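(* Consider the ODE $z'=\tilde f(z,\alpha,\varepsilon)$, $\alpha'=\varepsilon\tilde g(z,\alpha,\varepsilon)$, with $(z,\alpha)\in\mathbb R^n\times\mathbb R$, $0<\varepsilon\ll1$ and $C^{r\ge1}$-smooth right-hand side. Assume that the family of ODEs $z'=\tilde f(z,\alpha,0)$ has a hyperbolic limit cycle $\Gamma_{\alpha_\ast}$ of period $T_{\alpha_\ast}$ passing through $z=z_\ast$ for $\alpha=\alpha_\ast$. Let $\Delta$ be a non-degenerate cross-section, $\mathcal P_\Delta:\Delta\to\Delta$ the induced Poincaré map, and $S_\Delta=\Delta\cap\mathcal M$, where $\mathcal M$ is the manifold of limit cycles for $\varepsilon=0$ (all as defined in the context). Then $\mathcal P_\Delta$ is a fast-slow map satisfying Assumptions 1 and 2 stated in the context, with normally hyperbolic critical manifold $S_\Delta$.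
   Context: Limit cycle manifold: by hyperbolicity, there is a sufficiently small open interval $V_\alpha\ni\alpha_\ast$ such that for each $\alpha\in V_\alpha$ the layer problem $z'=\tilde f(z,\alpha,0)$, $\alpha'=0$ has a hyperbolic limit cycle $\Gamma_\alpha$ of period $T_\alpha$ continuing $\Gamma_{\alpha_\ast}$; $\mathcal M=\{\Gamma_\alpha:\alpha\in V_\alpha\}\subset\mathbb R^n\times V_\alpha$ is a 2-dimensional manifold. A limit cycle is hyperbolic if its $n-1$ characteristic (non-trivial Floquet) multipliers have modulus different from $1$. Cross-section: $\Delta$ is a fixed codimension-1 section such that $S_\Delta=\Delta\cap\mathcal M$ is a 1-dimensional submanifold of $\mathbb R^n\times V_\alpha$ and the paper's transversality condition $T_p\mathcal M\oplus T_p\Delta=T_p\mathbb R^{n+1}$ holds at each $p\in S_\Delta$ (i.e. $\mathcal M$ and $\Delta$ are transverse; the flow crosses $\Delta$ transversally). Coordinates $z=(x,y)\in\mathbb R^{n-1}\times\mathbb R$ are chosen so that $\Delta=\{(x,Y(x,\alpha),\alpha):x\in V_x,\alpha\in V_\alpha\}$ with $Y$ a $C^r$ function and $V_x$ a small neighbourhood of $x_\ast$, $z_\ast=(x_\ast,y_\ast)$; $(x,\alpha)$ are coordinates on $\Delta$. $\mathcal P_\Delta$ is the first-return (Poincaré) map on $\Delta$ induced by the flow of the full ODE, with return time close to $T_\alpha$. Fast-slow map: a map on $\mathbb R^{n}\ni Z=(x,\alpha)$ of the form $Z\mapsto Z+N(Z)f(Z)+\varepsilon G(Z,\varepsilon)$,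 with $N(Z)$ an $n\times(n-k)$ matrix and $f(Z)\in\mathbb R^{n-k}$ (here $k=1$), such that: (Assumption 1) $\{Nf=0\}$ contains a connected $k$-dimensional regularly embedded submanifold $S$, $1\le k<n$; (Assumption 2) $N$ has full column rank on $S$, $S=\{f=0\}$ (the critical manifold), and zeros of $Nf$ outside $S$ are isolated. $S$ is normally hyperbolic if at each point of $S$ the $n-k$ eigenvalues of $I_n+N\,Df$ other than the $k$ eigenvalues $1$ belonging to $TS$ have modulus different from $1$. *)

theory Defs
  imports
    "HOL-Analysis.Analysis"
    "HOL-Computational_Algebra.Computational_Algebra"
    "Jordan_Normal_Form.Char_Poly"
begin

section \<open>Smoothness\<close>

primrec Ck_open ::
  "nat \<Rightarrow> ('a::euclidean_space \<Rightarrow> 'b::real_normed_vector) \<Rightarrow> 'a set \<Rightarrow> bool" where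
  "Ck_open 0 h W \<longleftrightarrow> continuous_on W h"
| "Ck_open (Suc k) h W \<longleftrightarrow>
     (\<forall>x\<in>W. h differentiable (at x)) \<and>
     (\<forall>v. Ck_open k (\<lambda>x. frechet_derivative h (at x) v) W)"

text \<open>On a set that is not open, such as \<open>U \<times> [0, \<epsilon>\<^sub>0)\<close>, a map is \<open>C\<^sup>k\<close> if it
  extends to a \<open>C\<^sup>k\<close> map on an open neighbourhood of the set.\<close>

definition Ck_on ::
  "nat \<Rightarrow> ('a::euclidean_space \<Rightarrow> 'b::real_normed_vector) \<Rightarrow> 'a set \<Rightarrow> bool" where
  "Ck_on k h A \<longleftrightarrow>
     (\<exists>W h'. open W \<and> A \<subseteq> W \<and> Ck_open k h' W \<and> (\<forall>x\<in>A. h' x = h x))"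

definition embedded_submanifold :: "nat \<Rightarrow> nat \<Rightarrow> 'z::euclidean_space set \<Rightarrow> bool" where
  "embedded_submanifold r k S \<longleftrightarrow>
     (\<forall>p\<in>S. \<exists>W (W' :: 'z set) \<psi> \<psi>' L. open W \<and> p \<in> W \<and> open W' \<and> homeomorphism W W' \<psi> \<psi>' \<and>
        Ck_on r \<psi> W \<and> Ck_on r \<psi>' W' \<and> subspace L \<and> dim L = k \<and> \<psi> ` (S \<inter> W) = L \<inter> W')"

text \<open>Velocities at \<open>p\<close> of curves running in \<open>S\<close>; for a submanifold this is the tangent space.\<close>

definition tangent_vectors :: "'z::real_normed_vector set \<Rightarrow> 'z \<Rightarrow> 'z set" where
  "tangent_vectors S p =
     {v. \<exists>c d. 0 < d \<and> c 0 = p \<and> (\<forall>t. \<bar>t\<bar> < d \<longrightarrow> c t \<in> S) \<and>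
               (c has_vector_derivative v) (at (0::real))}"

section \<open>Eigenvalues of endomorphisms, with algebraic multiplicity\<close>

definition complex_matrix_of :: "('z::euclidean_space \<Rightarrow> 'z) \<Rightarrow> complex mat" where
  "complex_matrix_of A = Matrix.mat DIM('z) DIM('z)
     (\<lambda>(i, j). complex_of_real
        (inner (from_nat_into Basis i) (A (from_nat_into Basis j))))"

definition eigenvalue_mset :: "('z::euclidean_space \<Rightarrow> 'z) \<Rightarrow> complex multiset" where
  "eigenvalue_mset A = proots (char_poly (complex_matrix_of A))"

text \<open>The multiset difference leaves the eigenvalues other than \<open>k\<close> copies of the trivial
  eigenvalue \<open>1\<close>.  In particular a further eigenvalue \<open>1\<close> violates the condition.\<close>

definition hyperbolic_apart_from_ones :: "nat \<Rightarrow> ('z::euclidean_space \<Rightarrow> 'z) \<Rightarrow> bool" where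
  "hyperbolic_apart_from_ones k A \<longleftrightarrow>
     (\<forall>\<mu>. \<mu> \<in># eigenvalue_mset A - replicate_mset k 1 \<longrightarrow> cmod \<mu> \<noteq> 1)"

section \<open>Solutions, limit cycles and first returns\<close>

definition solves_ode_on ::
  "('z::real_normed_vector \<Rightarrow> 'z) \<Rightarrow> (real \<Rightarrow> 'z) \<Rightarrow> real set \<Rightarrow> bool" where
  "solves_ode_on F \<phi> I \<longleftrightarrow> (\<forall>t\<in>I. (\<phi> has_vector_derivative F (\<phi> t)) (at t within I))"

text \<open>\<open>T\<close> is the minimal period, which excludes equilibria.\<close>

definition periodic_solution ::
  "('z::real_normed_vector \<Rightarrow> 'z) \<Rightarrow> real \<Rightarrow> (real \<Rightarrow> 'z) \<Rightarrow> bool" where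
  "periodic_solution F T \<gamma> \<longleftrightarrow>
     0 < T \<and> solves_ode_on F \<gamma> UNIV \<and> (\<forall>t. \<gamma> (t + T) = \<gamma> t) \<and>
     (\<forall>s. 0 < s \<and> s < T \<longrightarrow> \<gamma> s \<noteq> \<gamma> 0)"

definition principal_variational_solution ::
  "('z::real_normed_vector \<Rightarrow> 'z) \<Rightarrow> (real \<Rightarrow> 'z) \<Rightarrow> real \<Rightarrow> (real \<Rightarrow> 'z \<Rightarrow> 'z) \<Rightarrow> bool" where
  "principal_variational_solution F \<gamma> T X \<longleftrightarrow>
     (\<forall>v. X 0 v = v \<and>
       (\<forall>t\<in>{0..T}. ((\<lambda>s. X s v) has_vector_derivative
            frechet_derivative F (at (\<gamma> t)) (X t v)) (at t within {0..T})))"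

text \<open>\<open>X T\<close> is the monodromy map; its eigenvalues are the characteristic multipliers, one of
  them being the trivial multiplier \<open>1\<close>.  A periodic orbit all of whose nontrivial multipliers
  lie off the unit circle is isolated, so that it is a limit cycle.\<close>

definition hyperbolic_limit_cycle ::
  "('z::euclidean_space \<Rightarrow> 'z) \<Rightarrow> real \<Rightarrow> 'z set \<Rightarrow> bool" where
  "hyperbolic_limit_cycle F T \<Gamma> \<longleftrightarrow>
     (\<exists>\<gamma> X. periodic_solution F T \<gamma> \<and> \<Gamma> = range \<gamma> \<and>
            principal_variational_solution F \<gamma> T X \<and> hyperbolic_apart_from_ones 1 (X T))"

definition first_return ::
  "('z::real_normed_vector \<Rightarrow> 'z) \<Rightarrow> 'z set \<Rightarrow> 'z \<Rightarrow> real \<Rightarrow> 'z \<Rightarrow> bool" where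
  "first_return F \<Delta> p t q \<longleftrightarrow>
     0 < t \<and> q \<in> \<Delta> \<and>
     (\<exists>\<phi>. solves_ode_on F \<phi> {0..t} \<and> \<phi> 0 = p \<and> \<phi> t = q \<and>
          (\<forall>s. 0 < s \<and> s < t \<longrightarrow> \<phi> s \<notin> \<Delta>))"

section \<open>The manifold of limit cycles and cross-sections\<close>

definition full_field ::
  "('z \<Rightarrow> real \<Rightarrow> real \<Rightarrow> 'z) \<Rightarrow> ('z \<Rightarrow> real \<Rightarrow> real \<Rightarrow> real) \<Rightarrow> real \<Rightarrow> 'z \<times> real \<Rightarrow> 'z \<times> real" where
  "full_field f g \<epsilon> = (\<lambda>(z, \<alpha>). (f z \<alpha> \<epsilon>, \<epsilon> * g z \<alpha> \<epsilon>))"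

text \<open>That the cycles \<open>\<Gamma> \<alpha>\<close> continue the given one means that a point on the cycle and its
  period can be followed continuously in \<open>\<alpha>\<close>.\<close>

definition limit_cycle_continuation ::
  "('z::euclidean_space \<Rightarrow> real \<Rightarrow> real \<Rightarrow> 'z) \<Rightarrow> real \<Rightarrow> real \<Rightarrow> 'z set \<Rightarrow>
   real set \<Rightarrow> (real \<Rightarrow> real) \<Rightarrow> (real \<Rightarrow> 'z set) \<Rightarrow> bool" where
  "limit_cycle_continuation f \<alpha>\<^sub>0 T\<^sub>0 \<Gamma>\<^sub>0 V T \<Gamma> \<longleftrightarrow>
     open V \<and> is_interval V \<and> \<alpha>\<^sub>0 \<in> V \<and> \<Gamma> \<alpha>\<^sub>0 = \<Gamma>\<^sub>0 \<and> T \<alpha>\<^sub>0 = T\<^sub>0 \<and>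
     (\<forall>\<alpha>\<in>V. hyperbolic_limit_cycle (\<lambda>z. f z \<alpha> 0) (T \<alpha>) (\<Gamma> \<alpha>)) \<and>
     continuous_on V T \<and> (\<exists>p. continuous_on V p \<and> (\<forall>\<alpha>\<in>V. p \<alpha> \<in> \<Gamma> \<alpha>))"

definition cycle_manifold :: "real set \<Rightarrow> (real \<Rightarrow> 'z set) \<Rightarrow> ('z \<times> real) set" where
  "cycle_manifold V \<Gamma> = {(z, \<alpha>). \<alpha> \<in> V \<and> z \<in> \<Gamma> \<alpha>}"

text \<open>Phase space is \<open>\<real>\<^sup>n = 'a \<times> \<real>\<close> with \<open>DIM('a) = n - 1\<close>, and \<open>(x, \<alpha>)\<close> are the coordinates
  on the graph of \<open>Y\<close>.\<close>

definition section_point ::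
  "('a \<Rightarrow> real \<Rightarrow> real) \<Rightarrow> 'a \<times> real \<Rightarrow> ('a \<times> real) \<times> real" where
  "section_point Y = (\<lambda>(x, \<alpha>). ((x, Y x \<alpha>), \<alpha>))"

definition cross_section ::
  "('a \<Rightarrow> real \<Rightarrow> real) \<Rightarrow> 'a set \<Rightarrow> real set \<Rightarrow> (('a \<times> real) \<times> real) set" where
  "cross_section Y Vx V = section_point Y ` (Vx \<times> V)"

text \<open>Transversality of the two manifolds alone would still allow the section to be tangent to
  the flow, provided the other tangent direction of \<open>M\<close> crosses it; hence the separate clause
  on the flow.\<close>

definition nondegenerate_section ::
  "nat \<Rightarrow> ('a::euclidean_space \<times> real \<Rightarrow> real \<Rightarrow> real \<Rightarrow> 'a \<times> real) \<Rightarrow>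
   (('a \<times> real) \<times> real) set \<Rightarrow> ('a \<times> real) \<Rightarrow> real \<Rightarrow>
   'a set \<Rightarrow> real set \<Rightarrow> ('a \<Rightarrow> real \<Rightarrow> real) \<Rightarrow> bool" where
  "nondegenerate_section r f M z\<^sub>0 \<alpha>\<^sub>0 Vx V Y \<longleftrightarrow>
     open Vx \<and> fst z\<^sub>0 \<in> Vx \<and> Y (fst z\<^sub>0) \<alpha>\<^sub>0 = snd z\<^sub>0 \<and>
     Ck_on r (\<lambda>(x, \<alpha>). Y x \<alpha>) (Vx \<times> V) \<and>
     (let \<Delta> = cross_section Y Vx V in
       \<forall>(z, \<alpha>) \<in> \<Delta> \<inter> M.
         span (tangent_vectors M (z, \<alpha>) \<union> tangent_vectors \<Delta> (z, \<alpha>)) = UNIV \<and>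
         (f z \<alpha> 0, 0) \<notin> tangent_vectors \<Delta> (z, \<alpha>))"

text \<open>\<open>P\<close> is the first-return map, with return time \<open>\<tau>\<close>, on a domain \<open>U\<close> which need not be
  invariant: the return point lies in the section over \<open>Vx \<times> V\<close>.\<close>

definition poincare_map ::
  "('a::euclidean_space \<times> real \<Rightarrow> real \<Rightarrow> real \<Rightarrow> 'a \<times> real) \<Rightarrow>
   ('a \<times> real \<Rightarrow> real \<Rightarrow> real \<Rightarrow> real) \<Rightarrow>
   ('a \<Rightarrow> real \<Rightarrow> real) \<Rightarrow> 'a set \<Rightarrow> real set \<Rightarrow> ('a \<times> real) set \<Rightarrow> real \<Rightarrow>
   ('a \<times> real \<Rightarrow> real \<Rightarrow> real) \<Rightarrow> ('a \<times> real \<Rightarrow> real \<Rightarrow> 'a \<times> real) \<Rightarrow> bool" where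
  "poincare_map f g Y Vx V U \<epsilon>\<^sub>0 \<tau> P \<longleftrightarrow>
     U \<subseteq> Vx \<times> V \<and>
     (\<forall>Z\<in>U. \<forall>\<epsilon>\<in>{0..<\<epsilon>\<^sub>0}. first_return (full_field f g \<epsilon>) (cross_section Y Vx V)
        (section_point Y Z) (\<tau> Z \<epsilon>) (section_point Y (P Z \<epsilon>)))"

section \<open>Fast-slow maps\<close>

text \<open>An \<open>n \<times> (n - k)\<close> matrix is a linear map from \<open>'u\<close>, of dimension \<open>n - k\<close>, to \<open>'z\<close>, of
  dimension \<open>n\<close>.  Dividing \<open>H Z \<epsilon> - H Z 0\<close> by \<open>\<epsilon>\<close> costs one derivative, so \<open>G\<close> is only
  required to be \<open>C\<^sup>r\<^sup>-\<^sup>1\<close> up to \<open>\<epsilon> = 0\<close>.\<close>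

definition fast_slow_map ::
  "nat \<Rightarrow> 'z::euclidean_space set \<Rightarrow> real \<Rightarrow> ('z \<Rightarrow> real \<Rightarrow> 'z) \<Rightarrow>
   ('z \<Rightarrow> 'u::euclidean_space \<Rightarrow>\<^sub>L 'z) \<Rightarrow> ('z \<Rightarrow> 'u) \<Rightarrow> ('z \<Rightarrow> real \<Rightarrow> 'z) \<Rightarrow> bool" where
  "fast_slow_map r U \<epsilon>\<^sub>0 H N h G \<longleftrightarrow>
     open U \<and> 0 < \<epsilon>\<^sub>0 \<and>
     Ck_on r (\<lambda>(Z, \<epsilon>). H Z \<epsilon>) (U \<times> {0..<\<epsilon>\<^sub>0}) \<and> Ck_on r N U \<and> Ck_on r h U \<and>
     Ck_on (r - 1) (\<lambda>(Z, \<epsilon>). G Z \<epsilon>) (U \<times> {0..<\<epsilon>\<^sub>0}) \<and>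
     (\<forall>Z\<in>U. \<forall>\<epsilon>\<in>{0..<\<epsilon>\<^sub>0}. H Z \<epsilon> = Z + blinfun_apply (N Z) (h Z) + \<epsilon> *\<^sub>R G Z \<epsilon>)"

definition fast_slow_assumption1 ::
  "nat \<Rightarrow> nat \<Rightarrow> 'z::euclidean_space set \<Rightarrow>
   ('z \<Rightarrow> 'u::euclidean_space \<Rightarrow>\<^sub>L 'z) \<Rightarrow> ('z \<Rightarrow> 'u) \<Rightarrow> 'z set \<Rightarrow> bool" where
  "fast_slow_assumption1 r k U N h S \<longleftrightarrow>
     1 \<le> k \<and> DIM('u) + k = DIM('z) \<and>
     S \<subseteq> {Z\<in>U. blinfun_apply (N Z) (h Z) = 0} \<and>
     connected S \<and> S \<noteq> {} \<and> embedded_submanifold r k S"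

definition fast_slow_assumption2 ::
  "'z::euclidean_space set \<Rightarrow> ('z \<Rightarrow> 'u::euclidean_space \<Rightarrow>\<^sub>L 'z) \<Rightarrow> ('z \<Rightarrow> 'u) \<Rightarrow>
   'z set \<Rightarrow> bool" where
  "fast_slow_assumption2 U N h S \<longleftrightarrow>
     (\<forall>Z\<in>S. inj (blinfun_apply (N Z))) \<and> S = {Z\<in>U. h Z = 0} \<and>
     (\<forall>Z. Z \<in> U - S \<and> blinfun_apply (N Z) (h Z) = 0 \<longrightarrow>
          Z isolated_in {Z\<in>U. blinfun_apply (N Z) (h Z) = 0})"

definition normally_hyperbolic ::
  "nat \<Rightarrow> ('z::euclidean_space \<Rightarrow> 'u::euclidean_space \<Rightarrow>\<^sub>L 'z) \<Rightarrow> ('z \<Rightarrow> 'u) \<Rightarrow> 'z set \<Rightarrow> bool" where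
  "normally_hyperbolic k N h S \<longleftrightarrow>
     (\<forall>Z\<in>S. hyperbolic_apart_from_ones k
        (\<lambda>v. v + blinfun_apply (N Z) (frechet_derivative h (at Z) v)))"

end

theory Submission
  imports Defs
begin

text \<open>With \<open>\<epsilon>\<close> adjoined to the state as a constant of motion, the system becomes a single autonomous
  equation whose flow is \<open>C\<^sup>r\<close>, including across \<open>\<epsilon> = 0\<close>.  The implicit function theorem gives the
  time of return to the section and, because hyperbolicity makes \<open>D\<^sub>xP - 1\<close> invertible, a curve
  of fixed points \<open>x = \<xi>(\<alpha>)\<close>.  Any other continuation of the cycle runs through the same points,
  so this curve is the critical manifold.  For \<open>\<epsilon> = 0\<close> the return map fixes \<open>\<alpha>\<close>, so that
  \<open>N\<close> is the inclusion of the \<open>x\<close>-space and \<open>f\<close> the displacement \<open>P - x\<close>; the remainder is divisible by \<open>\<epsilon>\<close> by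
  Hadamard's lemma.  Flow direction and section split the monodromy map into blocks, hence its
  characteristic polynomial is \<open>X - 1\<close> times that of \<open>D\<^sub>xP\<close>, and so is that of \<open>DP\<close>, which gives
  normal hyperbolicity.\<close>

text \<open>Every regularity proof is an induction on the order of smoothness, and no single type
  holds the k-th derivative for variable k. \<open>Ck_open\<close> therefore differentiates along
  fixed vectors, so that derivatives keep the type of the map; in return each equation has to be
  arranged so that its derivative is an equation of the same kind. Extending the fields to both
  sides of \<epsilon> = 0 makes all domains open, as these inductions require. Two more obstacles
  shape the proof. The prescribed section may meet an orbit several times within a period, far from
  \<open>z\<^sub>0\<close>, so the first return has to be taken to a smaller section, and the domain
  of the map is chosen after it. And a continuation is given by sets with a continuous choice of
  points and periods, where the points need not lie on the section; the flow has to carry them there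
  before local uniqueness can identify them with \<xi>(\<alpha>). Multipliers are treated through
  characteristic polynomials because multiplicity counts: a second eigenvalue 1 must be
  excluded.\<close>

no_notation scalar_prod (infix "\<bullet>" 70)

section \<open>Calculus of \<open>C\<^sup>k\<close> maps\<close>

lemma Ck_open_differentiable: "Ck_open (Suc k) h W \<Longrightarrow> x \<in> W \<Longrightarrow> h differentiable (at x)"
  by simp

lemma Ck_open_has_derivative:
  "Ck_open (Suc k) h W \<Longrightarrow> x \<in> W \<Longrightarrow> (h has_derivative frechet_derivative h (at x)) (at x)"
  using frechet_derivative_works by auto

lemma frechet_derivative_eq:
  "(h has_derivative D) (at x) \<Longrightarrow> frechet_derivative h (at x) = D"
  using frechet_derivative_at by metis

lemma Ck_open_continuous: "Ck_open k h W \<Longrightarrow> continuous_on W h"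
  by (cases k) (auto intro!: continuous_at_imp_continuous_on differentiable_imp_continuous_within)

lemma Ck_open_subset: "Ck_open k h W \<Longrightarrow> W' \<subseteq> W \<Longrightarrow> Ck_open k h W'"
  by (induction k arbitrary: h) (auto intro: continuous_on_subset)

text \<open>A derivative at a point of the open set \<open>W\<close> depends only on values nearby,
  so equality on \<open>W\<close> passes to all directional derivatives.\<close>

lemma Ck_open_cong_imp:
  assumes "open W" "\<And>x. x \<in> W \<Longrightarrow> f x = g x" "Ck_open k f W"
  shows "Ck_open k g W"
  using assms(2,3)
proof (induction k arbitrary: f g)
  case 0
  then show ?case by (auto cong: continuous_on_cong)
next
  case (Suc k)
  have d: "(g has_derivative frechet_derivative f (at x)) (at x)" if "x \<in> W" for x
    using has_derivative_transform_within_open[OF Ck_open_has_derivative[OF Suc.prems(2) that] assms(1) that]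
      Suc.prems(1) by blast
  have eq: "frechet_derivative g (at x) = frechet_derivative f (at x)" if "x \<in> W" for x
    using frechet_derivative_eq[OF d[OF that]] .
  have "Ck_open k (\<lambda>x. frechet_derivative g (at x) v) W" for v
    by (rule Suc.IH[of "\<lambda>x. frechet_derivative f (at x) v"]) (use eq Suc.prems(2) in auto)
  then show ?case using d by (auto simp: differentiable_def)
qed

text \<open>\<open>frechet_derivative\<close> is a choice operator; this rule lets a proof supply an
  explicit derivative \<open>D\<close> instead.\<close>

lemma Ck_open_SucI:
  assumes "open W" "\<And>x. x \<in> W \<Longrightarrow> (h has_derivative D x) (at x)"
    "\<And>v. Ck_open k (\<lambda>x. D x v) W"
  shows "Ck_open (Suc k) h W"
proof -
  have "Ck_open k (\<lambda>x. frechet_derivative h (at x) v) W" for v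
    by (rule Ck_open_cong_imp[OF assms(1) _ assms(3)[of v]])
      (simp add: frechet_derivative_eq[OF assms(2)])
  then show ?thesis using assms(2) by (auto simp: differentiable_def)
qed

lemma Ck_open_frechet: "Ck_open (Suc k) h W \<Longrightarrow> Ck_open k (\<lambda>x. frechet_derivative h (at x) v) W"
  unfolding Ck_open.simps(2) by (elim conjE allE)

lemma Ck_open_SucD: "Ck_open (Suc k) h W \<Longrightarrow> Ck_open k h W"
proof (induction k arbitrary: h)
  case 0
  then show ?case using Ck_open_continuous[OF 0] unfolding Ck_open.simps(1) by blast
next
  case (Suc k)
  have "h differentiable (at x)" if "x \<in> W" for x
    using Ck_open_differentiable[OF Suc.prems that] .
  moreover have "Ck_open k (\<lambda>x. frechet_derivative h (at x) v) W" for v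
    by (rule Suc.IH[OF Ck_open_frechet[OF Suc.prems]])
  ultimately show ?case unfolding Ck_open.simps(2)[of k] by (intro conjI ballI allI)
qed

text \<open>Used where the construction at each point works only after shrinking, as for flows on
  smaller time intervals.\<close>

lemma Ck_open_local:
  assumes "\<And>x. x \<in> W \<Longrightarrow> \<exists>U. open U \<and> x \<in> U \<and> Ck_open k h U"
  shows "Ck_open k h W"
  using assms
proof (induction k arbitrary: h)
  case 0
  show ?case
    using 0 by (simp, meson continuous_on_eq_continuous_at continuous_at_imp_continuous_on)
next
  case (Suc k)
  have "\<exists>U. open U \<and> x \<in> U \<and> Ck_open k (\<lambda>x. frechet_derivative h (at x) v) U" if "x \<in> W" for x v
    using Suc.prems[OF that] by auto
  then have "Ck_open k (\<lambda>x. frechet_derivative h (at x) v) W" for v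
    using Suc.IH[of "\<lambda>x. frechet_derivative h (at x) v"] by blast
  moreover have "h differentiable (at x)" if "x \<in> W" for x
    using Suc.prems[OF that] by auto
  ultimately show ?case by simp
qed

lemma Ck_open_const: "open W \<Longrightarrow> Ck_open k (\<lambda>x. c) W"
proof (induction k arbitrary: c)
  case (Suc k)
  show ?case by (rule Ck_open_SucI[where D = "\<lambda>x v. 0"]) (use Suc in auto)
qed simp

lemma Ck_open_bounded_linear:
  assumes "open W" "bounded_linear L"
  shows "Ck_open k L W"
proof (cases k)
  case 0
  then show ?thesis using assms(2) by (simp add: linear_continuous_on)
next
  case (Suc j)
  show ?thesis unfolding Suc
    by (rule Ck_open_SucI[where D = "\<lambda>x. L"])
      (use assms in \<open>auto intro: bounded_linear_imp_has_derivative Ck_open_const\<close>)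
qed

lemma Ck_open_add:
  assumes W: "open W" and "Ck_open k f W" "Ck_open k g W"
  shows "Ck_open k (\<lambda>x. f x + g x) W"
  using assms(2,3)
proof (induction k arbitrary: f g)
  case 0
  then show ?case by (auto intro: continuous_intros)
next
  case (Suc k)
  show ?case
    by (rule Ck_open_SucI[OF W has_derivative_add[OF Ck_open_has_derivative[OF Suc.prems(1)]
          Ck_open_has_derivative[OF Suc.prems(2)]]])
      (use Suc.IH Ck_open_frechet Suc.prems in blast)+
qed

text \<open>The product rule yields two terms of the same shape, each with one factor differentiated
  and the other one only lowered by an order, so the induction closes.\<close>

lemma Ck_open_bilinear:
  assumes W: "open W" and B: "bounded_bilinear B" and "Ck_open k f W" "Ck_open k g W"
  shows "Ck_open k (\<lambda>x. B (f x) (g x)) W"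
  using assms(3,4)
proof (induction k arbitrary: f g)
  case 0
  then show ?case using bounded_bilinear.continuous_on[OF B] by auto
next
  case (Suc k)
  show ?case
    by (rule Ck_open_SucI[OF W bounded_bilinear.FDERIV[OF B Ck_open_has_derivative[OF Suc.prems(1)]
          Ck_open_has_derivative[OF Suc.prems(2)]]])
      (intro Ck_open_add[OF W] Suc.IH Ck_open_frechet[OF Suc.prems(1)] Ck_open_frechet[OF Suc.prems(2)]
        Ck_open_SucD[OF Suc.prems(1)] Ck_open_SucD[OF Suc.prems(2)] | assumption)+
qed

lemma Ck_open_sum:
  assumes "open W" "\<And>i. i \<in> I \<Longrightarrow> Ck_open k (f i) W"
  shows "Ck_open k (\<lambda>x. \<Sum>i\<in>I. f i x) W"
  using assms(2)
  by (induction I rule: infinite_finite_induct)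
     (auto intro!: Ck_open_add Ck_open_const assms(1))

lemma Ck_open_linear_comp:
  assumes W: "open W" and L: "bounded_linear L" and f: "Ck_open k f W"
  shows "Ck_open k (\<lambda>x. L (f x)) W"
  using f
proof (induction k arbitrary: f)
  case 0
  then show ?case using bounded_linear.continuous_on[OF L] by auto
next
  case (Suc k)
  show ?case
    by (rule Ck_open_SucI[OF W bounded_linear.has_derivative[OF L Ck_open_has_derivative[OF Suc.prems]]])
      (use Suc.IH Ck_open_frechet Suc.prems in blast)+
qed

text \<open>\<open>Ck_open\<close> controls derivatives along constant directions only. Expansion in
  the basis reduces a direction that varies with the point to finitely many constant ones.\<close>

lemma frechet_derivative_basis_sum:
  fixes h :: "'a::euclidean_space \<Rightarrow> 'b::real_normed_vector"
  assumes "h differentiable (at x)"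
  shows "frechet_derivative h (at x) v = (\<Sum>b\<in>Basis. (v \<bullet> b) *\<^sub>R frechet_derivative h (at x) b)"
proof -
  have l: "linear (frechet_derivative h (at x))"
    using linear_frechet_derivative[OF assms] .
  show ?thesis
    by (subst euclidean_representation[of v, symmetric])
      (simp only: linear_sum[OF l] linear_cmul[OF l])
qed

text \<open>In the chain rule the outer derivative is taken along a direction that moves with
  \<open>x\<close>; after expansion in the basis it becomes a sum of products, to which the
  induction hypothesis applies.\<close>

lemma Ck_open_compose:
  fixes f :: "'a::euclidean_space \<Rightarrow> 'b::euclidean_space" and g :: "'b \<Rightarrow> 'c::real_normed_vector"
  assumes W: "open W" and "Ck_open k f W" "Ck_open k g V" "\<And>x. x \<in> W \<Longrightarrow> f x \<in> V"
  shows "Ck_open k (\<lambda>x. g (f x)) W"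
  using assms(2,3)
proof (induction k arbitrary: g)
  case 0
  then show ?case using assms(4) by (auto intro: continuous_on_compose2)
next
  case (Suc k)
  let ?D = "\<lambda>x v. \<Sum>b\<in>Basis. (frechet_derivative f (at x) v \<bullet> b) *\<^sub>R frechet_derivative g (at (f x)) b"
  show ?case
  proof (rule Ck_open_SucI[where D = ?D])
    show "((\<lambda>x. g (f x)) has_derivative ?D x) (at x)" if x: "x \<in> W" for x
    proof -
      have dg: "g differentiable (at (f x))" using Suc.prems(2) assms(4)[OF x] by auto
      show ?thesis
        using has_derivative_compose[OF Ck_open_has_derivative[OF Suc.prems(1) x]
            Ck_open_has_derivative[OF Suc.prems(2) assms(4)[OF x]]]
        by (subst (asm) frechet_derivative_basis_sum[OF dg])
    qed
    show "Ck_open k (\<lambda>x. ?D x v) W" for v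
    proof (intro Ck_open_sum W Ck_open_bilinear[OF W bounded_bilinear_scaleR])
      fix b :: 'b assume "b \<in> Basis"
      show "Ck_open k (\<lambda>x. frechet_derivative f (at x) v \<bullet> b) W"
        by (rule Ck_open_linear_comp[OF W bounded_linear_inner_left]) (use Suc.prems in auto)
      show "Ck_open k (\<lambda>x. frechet_derivative g (at (f x)) b) W"
        by (rule Suc.IH) (use Suc.prems Ck_open_SucD in \<open>blast, auto\<close>)
    qed
  qed (rule W)
qed

lemma Ck_open_Pair:
  assumes W: "open W" and "Ck_open k f W" "Ck_open k g W"
  shows "Ck_open k (\<lambda>x. (f x, g x)) W"
proof -
  have "Ck_open k (\<lambda>x. (f x, 0) + (0, g x)) W"
    by (intro Ck_open_add W Ck_open_linear_comp[OF W _ assms(2), of "\<lambda>y. (y, 0)"]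
        Ck_open_linear_comp[OF W _ assms(3), of "\<lambda>y. (0, y)"])
      (auto intro!: bounded_linear_Pair bounded_linear_ident bounded_linear_zero)
  then show ?thesis by simp
qed

lemma Ck_open_diff:
  assumes "open W" "Ck_open k f W" "Ck_open k g W"
  shows "Ck_open k (\<lambda>x. f x - g x) W"
  using Ck_open_add[OF assms(1,2) Ck_open_linear_comp[OF assms(1) bounded_linear_minus[OF bounded_linear_ident] assms(3)]]
  by simp

lemma Ck_open_fst: "open W \<Longrightarrow> Ck_open k f W \<Longrightarrow> Ck_open k (\<lambda>x. fst (f x)) W"
  and Ck_open_snd: "open W \<Longrightarrow> Ck_open k f W \<Longrightarrow> Ck_open k (\<lambda>x. snd (f x)) W"
  by (rule Ck_open_linear_comp[OF _ bounded_linear_fst] Ck_open_linear_comp[OF _ bounded_linear_snd]; assumption)+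

lemma Ck_open_id: "open W \<Longrightarrow> Ck_open k (\<lambda>x. x) W"
  by (rule Ck_open_bounded_linear[OF _ bounded_linear_ident])

lemma Ck_open_scaleR:
  "open W \<Longrightarrow> Ck_open k f W \<Longrightarrow> Ck_open k g W \<Longrightarrow> Ck_open k (\<lambda>x. f x *\<^sub>R g x) W"
  by (rule Ck_open_bilinear[OF _ bounded_bilinear_scaleR])

lemma Ck_open_mult:
  fixes f g :: "_ \<Rightarrow> real"
  shows "open W \<Longrightarrow> Ck_open k f W \<Longrightarrow> Ck_open k g W \<Longrightarrow> Ck_open k (\<lambda>x. f x * g x) W"
  using Ck_open_scaleR[of W k f g] by simp

lemmas Ck_open_intros = Ck_open_const Ck_open_id Ck_open_add Ck_open_diff Ck_open_fst Ck_open_snd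
  Ck_open_Pair Ck_open_scaleR Ck_open_mult

text \<open>Base point and direction both vary; one order is lost to the derivative. Linearised
  equations enter the inductions through this form.\<close>

lemma Ck_open_frechet_derivative:
  fixes H :: "'b::euclidean_space \<Rightarrow> 'c::real_normed_vector"
  assumes W: "open W" and H: "Ck_open (Suc k) H V" and "Ck_open k f W" "Ck_open k v W"
    and sub: "\<And>x. x \<in> W \<Longrightarrow> f x \<in> V"
  shows "Ck_open k (\<lambda>x. frechet_derivative H (at (f x)) (v x)) W"
proof (rule Ck_open_cong_imp[OF W])
  show "(\<Sum>b\<in>Basis. (v x \<bullet> b) *\<^sub>R frechet_derivative H (at (f x)) b) = frechet_derivative H (at (f x)) (v x)"
    if "x \<in> W" for x
    by (rule frechet_derivative_basis_sum[symmetric]) (use H sub[OF that] in auto)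
  show "Ck_open k (\<lambda>x. \<Sum>b\<in>Basis. (v x \<bullet> b) *\<^sub>R frechet_derivative H (at (f x)) b) W"
  proof (intro Ck_open_sum W Ck_open_scaleR)
    fix b :: 'b assume "b \<in> Basis"
    show "Ck_open k (\<lambda>x. v x \<bullet> b) W"
      by (rule Ck_open_linear_comp[OF W bounded_linear_inner_left assms(4)])
    show "Ck_open k (\<lambda>x. frechet_derivative H (at (f x)) b) W"
      by (rule Ck_open_compose[OF W assms(3) _ sub]) (use H in auto)
  qed
qed

lemma continuous_on_frechet_derivative:
  fixes H :: "'b::euclidean_space \<Rightarrow> 'c::real_normed_vector"
  assumes H: "Ck_open (Suc k) H V" and "continuous_on S f" "continuous_on S v"
    and sub: "\<And>x. x \<in> S \<Longrightarrow> f x \<in> V"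
  shows "continuous_on S (\<lambda>x. frechet_derivative H (at (f x)) (v x))"
proof -
  have c: "continuous_on V (\<lambda>x. frechet_derivative H (at x) b)" for b
    by (rule Ck_open_continuous[OF Ck_open_frechet[OF H]])
  have "continuous_on S (\<lambda>x. \<Sum>b\<in>Basis. (v x \<bullet> b) *\<^sub>R frechet_derivative H (at (f x)) b)"
    by (intro continuous_intros assms(3) continuous_on_compose2[OF c assms(2)]) (use sub in auto)
  moreover have "(\<Sum>b\<in>Basis. (v x \<bullet> b) *\<^sub>R frechet_derivative H (at (f x)) b) = frechet_derivative H (at (f x)) (v x)"
    if "x \<in> S" for x
    by (rule frechet_derivative_basis_sum[symmetric]) (use H sub[OF that] in auto)
  ultimately show ?thesis by (simp cong: continuous_on_cong)
qed

text \<open>The bridge to operator norms, which the inverse function theorem and the uniform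
  estimates use; in finite dimension continuity along basis vectors is enough. \<open>L\<close>
  serves to restrict to a partial derivative, and the second fact is needed because
  \<open>Blinfun\<close> is meaningful only on bounded linear maps.\<close>

lemma continuous_on_blinfun_frechet_derivative:
  fixes H :: "'b::euclidean_space \<Rightarrow> 'c::real_normed_vector" and L :: "'d::euclidean_space \<Rightarrow> 'b"
  assumes H: "Ck_open (Suc k) H V" and L: "bounded_linear L"
  shows "continuous_on V (\<lambda>x. Blinfun (\<lambda>v. frechet_derivative H (at x) (L v)))"
    and "x \<in> V \<Longrightarrow> blinfun_apply (Blinfun (\<lambda>v. frechet_derivative H (at x) (L v)))
       = (\<lambda>v. frechet_derivative H (at x) (L v))"
proof -
  show b: "blinfun_apply (Blinfun (\<lambda>v. frechet_derivative H (at x) (L v))) = (\<lambda>v. frechet_derivative H (at x) (L v))"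
    if "x \<in> V" for x
  proof (rule bounded_linear_Blinfun_apply)
    have "bounded_linear (frechet_derivative H (at x))"
      using Ck_open_has_derivative[OF H that] by (rule has_derivative_bounded_linear)
    then show "bounded_linear (\<lambda>v. frechet_derivative H (at x) (L v))"
      using L by (rule bounded_linear_compose)
  qed
  show "continuous_on V (\<lambda>x. Blinfun (\<lambda>v. frechet_derivative H (at x) (L v)))"
  proof (rule continuous_on_blinfun_componentwise)
    fix i :: 'd assume "i \<in> Basis"
    show "continuous_on V (\<lambda>x. blinfun_apply (Blinfun (\<lambda>v. frechet_derivative H (at x) (L v))) i)"
      using continuous_on_frechet_derivative[OF H continuous_on_id continuous_on_const[of V "L i"]]
      by (simp add: b cong: continuous_on_cong)
  qed
qed

lemma Ck_on_open_iff:
  assumes "open W"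
  shows "Ck_on k h W \<longleftrightarrow> Ck_open k h W"
proof
  assume "Ck_on k h W"
  then obtain W' h' where *: "open W'" "W \<subseteq> W'" "Ck_open k h' W'" "\<And>x. x \<in> W \<Longrightarrow> h' x = h x"
    unfolding Ck_on_def by auto
  show "Ck_open k h W"
    by (rule Ck_open_cong_imp[OF assms *(4) Ck_open_subset[OF *(3,2)]])
next
  assume "Ck_open k h W"
  then show "Ck_on k h W" unfolding Ck_on_def using assms by blast
qed

text \<open>Orders of smoothness are symbolic from here on; unfolding \<open>Suc k\<close> would
  expose derivatives where the closure rules are wanted.\<close>

declare Ck_open.simps(2) [simp del]

section \<open>The implicit function theorem for \<open>C\<^sup>k\<close> maps\<close>

text \<open>The map is block triangular with the identity as first block, so only the partial
  derivative in the second variable matters.\<close>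

lemma inj_partial_imp_inj:
  fixes D :: "'p::real_vector \<times> 'u::real_vector \<Rightarrow> 'u"
  assumes "linear D" "\<And>y. D (0, y) = 0 \<Longrightarrow> y = 0"
  shows "linear (\<lambda>v. (fst v, D v))" "inj (\<lambda>v. (fst v, D v))"
proof -
  show l: "linear (\<lambda>v. (fst v, D v))"
    by (intro linearI) (simp_all add: linear_add[OF assms(1)] linear_scale[OF assms(1)])
  show "inj (\<lambda>v. (fst v, D v))"
    using assms(2) unfolding linear_injective_0[OF l] by (auto simp: zero_prod_def)
qed

text \<open>The inverse function theorem for \<open>(p, u)\<close> mapped to
  \<open>(p, F (p, u))\<close>. Since it gives bijective derivatives on all of \<open>U\<close>, the
  partial derivative stays injective there. Mere differentiability of \<open>g\<close> suffices, as
  higher smoothness is recovered afterwards from the implicit equation itself.\<close>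

lemma implicit_local_diffeo:
  fixes F :: "'p::euclidean_space \<times> 'u::euclidean_space \<Rightarrow> 'u"
  assumes \<Omega>: "open \<Omega>" and F: "Ck_open (Suc k) F \<Omega>" and q: "q \<in> \<Omega>"
    and inj: "\<And>y. frechet_derivative F (at q) (0, y) = 0 \<Longrightarrow> y = 0"
  obtains U V g where "open U" "U \<subseteq> \<Omega>" "q \<in> U" "open V" "(fst q, F q) \<in> V"
    "homeomorphism U V (\<lambda>z. (fst z, F z)) g" "\<forall>y\<in>V. g differentiable (at y)"
    "\<forall>z\<in>U. \<forall>y. frechet_derivative F (at z) (0, y) = 0 \<longrightarrow> y = 0"
proof -
  define \<Psi> where "\<Psi> = (\<lambda>z. (fst z, F z))"
  have CP: "Ck_open (Suc k) \<Psi> \<Omega>"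
    unfolding \<Psi>_def by (intro Ck_open_intros \<Omega> F)
  have dF: "(F has_derivative frechet_derivative F (at z)) (at z)" if "z \<in> \<Omega>" for z
    using Ck_open_has_derivative[OF F that] .
  have D: "frechet_derivative \<Psi> (at z) = (\<lambda>v. (fst v, frechet_derivative F (at z) v))" if "z \<in> \<Omega>" for z
    unfolding \<Psi>_def
    by (intro frechet_derivative_eq has_derivative_Pair dF[OF that] has_derivative_fst has_derivative_ident)
  define \<Psi>' where "\<Psi>' = (\<lambda>z. Blinfun (\<lambda>v. frechet_derivative \<Psi> (at z) v))"
  have cont: "continuous_on \<Omega> \<Psi>'"
    unfolding \<Psi>'_def by (rule continuous_on_blinfun_frechet_derivative[OF CP bounded_linear_ident])
  have ap: "blinfun_apply (\<Psi>' z) = frechet_derivative \<Psi> (at z)" if "z \<in> \<Omega>" for z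
    unfolding \<Psi>'_def by (rule continuous_on_blinfun_frechet_derivative(2)[OF CP bounded_linear_ident that])
  have der: "(\<Psi> has_derivative blinfun_apply (\<Psi>' z)) (at z)" if "z \<in> \<Omega>" for z
    unfolding ap[OF that] by (rule Ck_open_has_derivative[OF CP that])
  have lin: "linear (frechet_derivative F (at q))"
    using dF[OF q] has_derivative_linear by blast
  obtain h where h: "linear h" "h \<circ> frechet_derivative \<Psi> (at q) = id"
    unfolding D[OF q]
    using linear_injective_left_inverse[OF inj_partial_imp_inj[OF lin inj]] by blast
  have "Blinfun h o\<^sub>L \<Psi>' q = id_blinfun"
  proof (rule blinfun_eqI)
    fix v
    have "blinfun_apply (Blinfun h) = h"
      by (rule bounded_linear_Blinfun_apply) (use h linear_conv_bounded_linear in blast)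
    then show "blinfun_apply (Blinfun h o\<^sub>L \<Psi>' q) v = blinfun_apply id_blinfun v"
      using fun_cong[OF h(2), of v] ap[OF q] by simp
  qed
  note inv0 = this
  obtain U V g g' where *: "open U" "U \<subseteq> \<Omega>" "q \<in> U" "open V" "\<Psi> q \<in> V" "homeomorphism U V \<Psi> g"
    "\<And>y. y \<in> V \<Longrightarrow> (g has_derivative (g' y)) (at y)"
    "\<And>y. y \<in> V \<Longrightarrow> bij (blinfun_apply (\<Psi>' (g y)))"
  proof (rule inverse_function_theorem[OF \<Omega> der cont q inv0])
    fix U V g g'
    assume "open U" "U \<subseteq> \<Omega>" "q \<in> U" "open V" "\<Psi> q \<in> V" "homeomorphism U V \<Psi> g"
      "\<And>y. y \<in> V \<Longrightarrow> (g has_derivative (g' y)) (at y)"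
      "\<And>y. y \<in> V \<Longrightarrow> bij (blinfun_apply (\<Psi>' (g y)))"
    then show thesis by (rule that)
  qed
  show thesis
  proof
    show "homeomorphism U V (\<lambda>z. (fst z, F z)) g" using *(6) unfolding \<Psi>_def .
    show "(fst q, F q) \<in> V" using *(5) unfolding \<Psi>_def .
    show "\<forall>y\<in>V. g differentiable (at y)" using *(7) by (auto simp: differentiable_def)
    have "y = 0" if z: "z \<in> U" and y: "frechet_derivative F (at z) (0, y) = 0" for z y
    proof -
      have "g (\<Psi> z) = z" "\<Psi> z \<in> V" using *(6) z by (auto simp: homeomorphism_def)
      then have "inj (frechet_derivative \<Psi> (at z))"
        using *(8)[of "\<Psi> z"] ap[of z] *(2) z by (auto simp: bij_def)
      moreover have "frechet_derivative \<Psi> (at z) (0, y) = 0" "frechet_derivative \<Psi> (at z) 0 = 0"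
        using D[of z] y z *(2) linear_0[OF has_derivative_linear[OF dF[of z]]] by (auto simp: zero_prod_def)
      ultimately show ?thesis by (metis injD prod.inject zero_prod_def)
    qed
    then show "\<forall>z\<in>U. \<forall>y. frechet_derivative F (at z) (0, y) = 0 \<longrightarrow> y = 0" by blast
  qed (use * in auto)
qed

text \<open>Injectivity of \<open>A q\<close> gives a lower bound \<open>e * norm x\<close>.
  Operators closer than \<open>e / 2\<close> keep the bound with \<open>e / 2\<close>, so the
  distance of the solutions is controlled by the residual \<open>c p - A p (y q)\<close>, which
  tends to 0.\<close>

lemma continuous_on_linear_solution:
  fixes A :: "'p::metric_space \<Rightarrow> 'u::euclidean_space \<Rightarrow> 'v::euclidean_space" and c :: "'p \<Rightarrow> 'v"
  assumes A: "continuous_on B (\<lambda>p. Blinfun (A p))" and bl: "\<And>p. p \<in> B \<Longrightarrow> bounded_linear (A p)"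
    and inj: "\<And>p y. p \<in> B \<Longrightarrow> A p y = 0 \<Longrightarrow> y = 0"
    and c: "continuous_on B c" and sol: "\<And>p. p \<in> B \<Longrightarrow> A p (y p) = c p"
  shows "continuous_on B y"
  unfolding continuous_on_def
proof
  fix q assume q: "q \<in> B"
  have ap: "blinfun_apply (Blinfun (A p)) = A p" if "p \<in> B" for p
    by (rule bounded_linear_Blinfun_apply[OF bl[OF that]])
  have "linear (A q)" using bl[OF q] by (rule bounded_linear.linear)
  moreover from this have "inj (A q)" using inj[OF q] by (auto simp: linear_injective_0)
  ultimately obtain e where e: "e > 0" "\<And>x. e * norm x \<le> norm (A q x)"
    using linear_inj_bounded_below_pos by blast
  have "((\<lambda>p. Blinfun (A p)) \<longlongrightarrow> Blinfun (A q)) (at q within B)"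
    using A q by (auto simp: continuous_on_def)
  then have ev: "\<forall>\<^sub>F p in at q within B. dist (Blinfun (A p)) (Blinfun (A q)) < e / 2"
    using e(1) by (auto dest!: tendstoD[where e = "e/2"])
  have inB: "\<forall>\<^sub>F p in at q within B. p \<in> B" by (simp add: eventually_at_filter)
  have bd: "\<forall>\<^sub>F p in at q within B. norm (y p - y q) \<le> norm (c p - A p (y q)) * (2 / e)"
    using ev inB
  proof eventually_elim
    case (elim p)
    let ?d = "y p - y q"
    have "norm (A p ?d - A q ?d) \<le> norm (Blinfun (A p) - Blinfun (A q)) * norm ?d"
      using norm_blinfun[of "Blinfun (A p) - Blinfun (A q)" ?d] ap[OF elim(2)] ap[OF q]
      by (simp add: blinfun.diff_left)
    also have "\<dots> \<le> (e / 2) * norm ?d"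
      using elim(1) by (intro mult_right_mono) (auto simp: dist_norm)
    finally have "(e / 2) * norm ?d \<le> norm (A p ?d)"
      using e(2)[of ?d] norm_triangle_ineq2[of "A q ?d" "A q ?d - A p ?d"]
      by (auto simp: norm_minus_commute field_simps)
    moreover have "A p ?d = c p - A p (y q)"
      using sol[OF elim(2)] linear_diff[OF bounded_linear.linear[OF bl[OF elim(2)]]] by simp
    ultimately show ?case using e(1) by (simp add: field_simps)
  qed
  have "((\<lambda>p. c p - A p (y q)) \<longlongrightarrow> c q - A q (y q)) (at q within B)"
  proof (intro tendsto_diff)
    show "(c \<longlongrightarrow> c q) (at q within B)" using c q by (auto simp: continuous_on_def)
    have "((\<lambda>p. blinfun_apply (Blinfun (A p)) (y q)) \<longlongrightarrow> blinfun_apply (Blinfun (A q)) (y q)) (at q within B)"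
      using A q by (intro tendsto_intros) (auto simp: continuous_on_def)
    then have "((\<lambda>p. blinfun_apply (Blinfun (A p)) (y q)) \<longlongrightarrow> A q (y q)) (at q within B)"
      using ap[OF q] by simp
    then show "((\<lambda>p. A p (y q)) \<longlongrightarrow> A q (y q)) (at q within B)"
      by (rule Lim_transform_eventually) (use inB in \<open>eventually_elim, simp add: ap\<close>)
  qed
  then have "((\<lambda>p. norm (c p - A p (y q)) * (2 / e)) \<longlongrightarrow> 0) (at q within B)"
    using sol[OF q] tendsto_mult_left_zero[OF tendsto_norm_zero, of "\<lambda>p. c p - A p (y q)" _ "2 / e"] by simp
  then have "((\<lambda>p. y p - y q) \<longlongrightarrow> 0) (at q within B)"
    by (rule Lim_null_comparison[OF bd])
  then show "(y \<longlongrightarrow> y q) (at q within B)" using Lim_null by blast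
qed

text \<open>Continuity of \<open>u\<close> keeps its graph inside the chart near \<open>p\<close>;
  there it must coincide with the second component of the local inverse at \<open>(x, 0)\<close>,
  which is differentiable. The second claim differentiates the identity
  \<open>F (x, u x) = 0\<close>.\<close>

lemma implicit_function_differentiable:
  fixes F :: "'p::euclidean_space \<times> 'u::euclidean_space \<Rightarrow> 'u"
  assumes B: "open B" and \<Omega>: "open \<Omega>" and F: "Ck_open (Suc k) F \<Omega>" and u: "continuous_on B u"
    and sol: "\<And>p. p \<in> B \<Longrightarrow> (p, u p) \<in> \<Omega> \<and> F (p, u p) = 0"
    and inj: "\<And>p y. p \<in> B \<Longrightarrow> frechet_derivative F (at (p, u p)) (0, y) = 0 \<Longrightarrow> y = 0"
    and p: "p \<in> B"
  shows "u differentiable (at p)"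
    and "frechet_derivative F (at (p, u p)) (w, frechet_derivative u (at p) w) = 0"
proof -
  obtain U V g where g: "open U" "U \<subseteq> \<Omega>" "(p, u p) \<in> U" "open V" "(fst (p, u p), F (p, u p)) \<in> V"
    "homeomorphism U V (\<lambda>z. (fst z, F z)) g" "\<forall>y\<in>V. g differentiable (at y)"
    "\<forall>z\<in>U. \<forall>y. frechet_derivative F (at z) (0, y) = 0 \<longrightarrow> y = 0"
    by (rule implicit_local_diffeo[OF \<Omega> F conjunct1[OF sol[OF p]] inj[OF p]])
  have V: "(p, 0) \<in> V" using g(5) sol[OF p] by simp
  define N where "N = {x\<in>B. (x, u x) \<in> U}"
  have "open N"
    unfolding N_def
    using continuous_open_preimage[OF continuous_on_Pair[OF continuous_on_id u] B g(1)]
    by (simp add: vimage_def Int_def)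
  moreover have "p \<in> N" using p g(3) by (simp add: N_def)
  moreover have "snd (g (x, 0)) = u x" if "x \<in> N" for x
    using homeomorphism_apply1[OF g(6), of "(x, u x)"] sol[of x] that by (simp add: N_def)
  moreover have "(\<lambda>x. snd (g (x, 0))) differentiable (at p)"
  proof -
    have "((\<lambda>x. (x, 0)) has_derivative (\<lambda>x. (x, 0))) (at p)" by (auto intro!: derivative_eq_intros)
    then have "((\<lambda>x. snd (g (x, 0))) has_derivative (\<lambda>v. snd (frechet_derivative g (at (p, 0)) (v, 0)))) (at p)"
      using bspec[OF g(7) V] unfolding frechet_derivative_works
      by (intro has_derivative_snd has_derivative_compose[of "\<lambda>x. (x, 0)" _ p UNIV g])
    then show ?thesis by (auto simp: differentiable_def)
  qed
  ultimately show d: "u differentiable (at p)"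
    unfolding differentiable_def using has_derivative_transform_within_open[of "\<lambda>x. snd (g (x, 0))" _ p UNIV N u] by metis
  then have "(u has_derivative frechet_derivative u (at p)) (at p)"
    using frechet_derivative_works by blast
  then have "((\<lambda>x. (x, u x)) has_derivative (\<lambda>w. (w, frechet_derivative u (at p) w))) (at p)"
    by (intro has_derivative_Pair has_derivative_ident)
  from has_derivative_compose[OF this Ck_open_has_derivative[OF F]] sol[OF p]
  have "((\<lambda>x. F (x, u x)) has_derivative (\<lambda>w. frechet_derivative F (at (p, u p)) (w, frechet_derivative u (at p) w))) (at p)"
    by auto
  from has_derivative_transform_within_open[OF this B p, of "\<lambda>x. 0"]
  have "((\<lambda>x. 0) has_derivative (\<lambda>w. frechet_derivative F (at (p, u p)) (w, frechet_derivative u (at p) w))) (at p)"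
    using sol by auto
  from has_derivative_unique[OF this has_derivative_const]
  show "frechet_derivative F (at (p, u p)) (w, frechet_derivative u (at p) w) = 0"
    by (rule fun_cong)
qed

text \<open>The derivative of an implicitly defined map solves a linear implicit equation with values in
  the same space, so the order of smoothness can be raised by induction without changing types.\<close>

theorem implicit_function_Ck:
  fixes F :: "'p::euclidean_space \<times> 'u::euclidean_space \<Rightarrow> 'u"
  assumes B: "open B" and "open \<Omega>" and "Ck_open k F \<Omega>" and "continuous_on B u"
    and "\<And>p. p \<in> B \<Longrightarrow> (p, u p) \<in> \<Omega> \<and> F (p, u p) = 0"
    and "\<And>p y. 0 < k \<Longrightarrow> p \<in> B \<Longrightarrow> frechet_derivative F (at (p, u p)) (0, y) = 0 \<Longrightarrow> y = 0"
  shows "Ck_open k u B"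
  using assms(2-)
proof (induction k arbitrary: F \<Omega> u)
  case 0
  then show ?case by simp
next
  case (Suc k)
  note F = Suc.prems(2) and sol = Suc.prems(4) and inj = Suc.prems(5)[OF zero_less_Suc]
  have uk: "Ck_open k u B"
    by (rule Suc.IH[OF Suc.prems(1) Ck_open_SucD[OF F] Suc.prems(3) sol inj])
  have diff1: "u differentiable (at p)" if "p \<in> B" for p
    by (rule implicit_function_differentiable(1)[OF B Suc.prems(1-4) inj that])
  have diff2: "frechet_derivative F (at (p, u p)) (w, frechet_derivative u (at p) w) = 0" if "p \<in> B" for p w
    by (rule implicit_function_differentiable(2)[OF B Suc.prems(1-4) inj that])
  show ?case
  proof (rule Ck_open_SucI[OF B])
    show "(u has_derivative frechet_derivative u (at p)) (at p)" if "p \<in> B" for p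
      using diff1[OF that] frechet_derivative_works by blast
    fix w
    let ?y = "\<lambda>p. frechet_derivative u (at p) w"
    \<comment> \<open>The linear equation solved by the derivative of \<open>u\<close> along
      \<open>w\<close>. Only \<open>snd z\<close> is unknown; \<open>u\<close> enters as a
      coefficient that is \<open>C^k\<close> by the induction hypothesis.\<close>
    let ?F2 = "\<lambda>z. frechet_derivative F (at (fst z, u (fst z))) (w, snd z)"
    let ?\<Omega> = "B \<times> (UNIV :: 'u set)"
    have lin: "linear (frechet_derivative F (at (p, u p)))" if "p \<in> B" for p
      using has_derivative_linear[OF Ck_open_has_derivative[OF F]] sol[OF that] by blast
    have split: "frechet_derivative F (at (p, u p)) (w, y)
        = frechet_derivative F (at (p, u p)) (w, 0) + frechet_derivative F (at (p, u p)) (0, y)"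
      if "p \<in> B" for p y
      using linear_add[OF lin[OF that], of "(w, 0)" "(0, y)"] by simp
    have op: "open ?\<Omega>" using B by (simp add: open_Times)
    have F2: "Ck_open k ?F2 ?\<Omega>"
      by (rule Ck_open_frechet_derivative[OF op F])
        (use sol in \<open>auto intro!: Ck_open_intros op Ck_open_compose[OF op _ uk]\<close>)
    have yc: "continuous_on B ?y"
    proof (rule continuous_on_linear_solution)
      let ?L = "\<lambda>y :: 'u. (0 :: 'p, y)"
      have L: "bounded_linear ?L" by (intro bounded_linear_Pair bounded_linear_zero bounded_linear_ident)
      have cu: "continuous_on B (\<lambda>p. (p, u p))" by (intro continuous_intros Suc.prems(3))
      show "continuous_on B (\<lambda>p. Blinfun (\<lambda>y. frechet_derivative F (at (p, u p)) (0, y)))"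
        by (rule continuous_on_compose2[OF continuous_on_blinfun_frechet_derivative(1)[OF F L] cu]) (use sol in auto)
      show "bounded_linear (\<lambda>y. frechet_derivative F (at (p, u p)) (0, y))" if "p \<in> B" for p
        using bounded_linear_compose[OF has_derivative_bounded_linear[OF Ck_open_has_derivative[OF F]] L] sol[OF that] by auto
      show "continuous_on B (\<lambda>p. - frechet_derivative F (at (p, u p)) (w, 0))"
        by (intro continuous_intros continuous_on_frechet_derivative[OF F cu]) (use sol in auto)
      show "frechet_derivative F (at (p, u p)) (0, ?y p) = - frechet_derivative F (at (p, u p)) (w, 0)" if "p \<in> B" for p
        using trans[OF split[OF that, symmetric] diff2[OF that]] by (rule minus_unique[symmetric])
    qed (rule inj)
    show "Ck_open k ?y B"
    proof (rule Suc.IH[OF op F2 yc])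
      show "(p, ?y p) \<in> ?\<Omega> \<and> ?F2 (p, ?y p) = 0" if "p \<in> B" for p
        using diff2[OF that] that by auto
      \<comment> \<open>\<open>?F2\<close> is affine in its second argument, so its partial
        derivative is that of \<open>F\<close> and inherits injectivity. For \<open>k = 0\<close>
        the map \<open>?F2\<close> is only known to be continuous, hence the guard.\<close>
      show "y = 0" if k: "0 < k" and p: "p \<in> B"
        and y: "frechet_derivative ?F2 (at (p, ?y p)) (0, y) = 0" for p y
      proof -
        obtain j where j: "k = Suc j" using k gr0_implies_Suc by blast
        have "((\<lambda>v. (p, v)) has_derivative (\<lambda>v. (0, v))) (at (?y p))"
          by (intro has_derivative_Pair has_derivative_const has_derivative_ident)
        from has_derivative_compose[OF this Ck_open_has_derivative[OF F2[unfolded j]]]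
        have "((\<lambda>v. frechet_derivative F (at (p, u p)) (w, v)) has_derivative
            (\<lambda>v. frechet_derivative ?F2 (at (p, ?y p)) (0, v))) (at (?y p))"
          using p by simp
        moreover have "((\<lambda>v. frechet_derivative F (at (p, u p)) (w, v)) has_derivative
            (\<lambda>v. frechet_derivative F (at (p, u p)) (0, v))) (at (?y p))"
          by (rule has_derivative_eq_rhs[OF has_derivative_compose[OF has_derivative_Pair[OF has_derivative_const
                has_derivative_ident] linear_imp_has_derivative[OF lin[OF p]]]]) simp
        ultimately have "frechet_derivative ?F2 (at (p, ?y p)) (0, y) = frechet_derivative F (at (p, u p)) (0, y)"
          using has_derivative_unique by (metis (no_types, lifting))
        then show ?thesis using inj[OF p] y by simp
      qed
    qed
  qed
qed

text \<open>\<open>u\<close> is read off from the local inverse at \<open>(p, 0)\<close>. The last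
  clause, uniqueness within the fixed set \<open>N\<close>, comes from injectivity of the chart and
  is what later identifies points on different continuations of the cycle.\<close>

theorem implicit_function_exists:
  fixes F :: "'p::euclidean_space \<times> 'u::euclidean_space \<Rightarrow> 'u"
  assumes \<Omega>: "open \<Omega>" and F: "Ck_open k F \<Omega>" and k: "0 < k" and q: "(p\<^sub>0, u\<^sub>0) \<in> \<Omega>" and F0: "F (p\<^sub>0, u\<^sub>0) = 0"
    and inj: "\<And>y. frechet_derivative F (at (p\<^sub>0, u\<^sub>0)) (0, y) = 0 \<Longrightarrow> y = 0"
  obtains B N u where "open B" "p\<^sub>0 \<in> B" "open N" "u\<^sub>0 \<in> N" "Ck_open k u B" "u p\<^sub>0 = u\<^sub>0" "B \<times> N \<subseteq> \<Omega>"
    "\<forall>p\<in>B. u p \<in> N \<and> F (p, u p) = 0" "\<forall>p\<in>B. \<forall>v\<in>N. F (p, v) = 0 \<longrightarrow> v = u p"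
proof -
  obtain j where j: "k = Suc j" using k gr0_implies_Suc by blast
  obtain U V g where g: "open U" "U \<subseteq> \<Omega>" "(p\<^sub>0, u\<^sub>0) \<in> U" "open V" "(fst (p\<^sub>0, u\<^sub>0), F (p\<^sub>0, u\<^sub>0)) \<in> V"
    "homeomorphism U V (\<lambda>z. (fst z, F z)) g" "\<forall>y\<in>V. g differentiable (at y)"
    "\<forall>z\<in>U. \<forall>y. frechet_derivative F (at z) (0, y) = 0 \<longrightarrow> y = 0"
    by (rule implicit_local_diffeo[OF \<Omega> F[unfolded j] q inj])
  have V: "(p\<^sub>0, 0) \<in> V" using g(5) F0 by simp
  obtain B0 N where BN: "open B0" "open N" "p\<^sub>0 \<in> B0" "u\<^sub>0 \<in> N" "B0 \<times> N \<subseteq> U"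
    using open_prod_elim[OF g(1,3)] by (metis mem_Sigma_iff)
  define u where "u = (\<lambda>p. snd (g (p, 0)))"
  define B1 where "B1 = {p \<in> B0. (p, 0) \<in> V}"
  have "open B1"
    using continuous_open_preimage[OF continuous_on_Pair[OF continuous_on_id continuous_on_const] BN(1) g(4)]
    by (simp add: B1_def vimage_def Int_def)
  have cu: "continuous_on B1 u"
    unfolding u_def
    by (intro continuous_on_snd continuous_on_compose2[OF homeomorphism_cont2[OF g(6)]] continuous_intros)
      (auto simp: B1_def)
  define B where "B = {p \<in> B1. u p \<in> N}"
  have B: "open B"
    using continuous_open_preimage[OF cu \<open>open B1\<close> BN(2)] by (simp add: B_def vimage_def Int_def)
  have gu: "g (p, 0) = (p, u p)" "F (p, u p) = 0" if "p \<in> B" for p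
    using homeomorphism_apply2[OF g(6), of "(p, 0)"] that unfolding B_def B1_def u_def
    by (metis (mono_tags, lifting) mem_Collect_eq prod.collapse prod.inject)+
  have uniq: "v = u p" if "p \<in> B" "v \<in> N" "F (p, v) = 0" for p v
  proof -
    have "(p, v) \<in> U" using that BN(5) by (auto simp: B_def B1_def)
    from homeomorphism_apply1[OF g(6) this] show ?thesis using that by (simp add: u_def)
  qed
  have u0: "u p\<^sub>0 = u\<^sub>0"
    using homeomorphism_apply1[OF g(6) g(3)] F0 by (simp add: u_def)
  have BU: "B \<times> N \<subseteq> U" using BN(5) by (auto simp: B_def B1_def)
  have "Ck_open k u B"
  proof (rule implicit_function_Ck[OF B \<Omega> F])
    show "continuous_on B u" using cu by (rule continuous_on_subset) (auto simp: B_def)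
    show "(p, u p) \<in> \<Omega> \<and> F (p, u p) = 0" if "p \<in> B" for p
      using gu[OF that] BU g(2) that by (auto simp: B_def)
    show "y = 0" if "0 < k" "p \<in> B" "frechet_derivative F (at (p, u p)) (0, y) = 0" for p y
    proof -
      have "(p, u p) \<in> U" using BU that by (auto simp: B_def)
      then show ?thesis using g(8) that(3) by blast
    qed
  qed
  moreover have "p\<^sub>0 \<in> B" using BN V u0 by (auto simp: B_def B1_def)
  moreover have "B \<times> N \<subseteq> \<Omega>" using BU g(2) by blast
  ultimately show thesis
    using that[of B N u] B BN(2,4) u0 gu(2) uniq unfolding B_def by blast
qed

section \<open>Ordinary differential equations\<close>

text \<open>The squared norm is differentiable also where \<open>d\<close> vanishes. In
  \<open>K = 2 * L + 1\<close> the part \<open>2 * L\<close> absorbs the Lipschitz term; the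
  remaining 1 and \<open>\<eta>\<^sup>2\<close> come from \<open>2 * norm (d s) * \<eta> \<le> (norm
  (d s))\<^sup>2 + \<eta>\<^sup>2\<close>. With these constants the auxiliary function \<phi> has
  nonpositive derivative.\<close>

lemma gronwall_forward:
  fixes d :: "real \<Rightarrow> 'u::real_inner"
  assumes d: "\<And>t. t \<in> {a..b} \<Longrightarrow> (d has_vector_derivative d' t) (at t within {a..b})"
    and le: "\<And>t. t \<in> {a..b} \<Longrightarrow> norm (d' t) \<le> L * norm (d t) + \<eta>"
    and L: "0 \<le> L" and t: "t \<in> {a..b}"
  shows "(norm (d t))\<^sup>2 \<le> ((norm (d a))\<^sup>2 + \<eta>\<^sup>2 * (b - a)) * exp ((2 * L + 1) * (b - a))"
proof -
  define K where "K = 2 * L + 1"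
  define \<phi> where "\<phi> = (\<lambda>s. exp (- (K * (s - a))) * (d s \<bullet> d s) - \<eta>\<^sup>2 * (s - a))"
  define \<phi>' where "\<phi>' = (\<lambda>s. exp (- (K * (s - a))) * (2 * (d s \<bullet> d' s)) - K * exp (- (K * (s - a))) * (d s \<bullet> d s) - \<eta>\<^sup>2)"
  have "(\<phi> has_derivative (\<lambda>h. \<phi>' s * h)) (at s within {a..t})" if "a \<le> s" "s \<le> t" for s
  proof -
    have "(d has_derivative (\<lambda>h. h *\<^sub>R d' s)) (at s within {a..t})"
      using has_vector_derivative_within_subset[OF d[of s], of "{a..t}"] that t
      by (auto simp: has_vector_derivative_def)
    then have i: "((\<lambda>s. d s \<bullet> d s) has_derivative (\<lambda>h. d s \<bullet> (h *\<^sub>R d' s) + (h *\<^sub>R d' s) \<bullet> d s)) (at s within {a..t})"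
      by (intro has_derivative_inner)
    have e: "((\<lambda>s. exp (- (K * (s - a)))) has_derivative (\<lambda>h. - (K * exp (- (K * (s - a)))) * h)) (at s within {a..t})"
      by (auto intro!: derivative_eq_intros)
    have l: "((\<lambda>s. \<eta>\<^sup>2 * (s - a)) has_derivative (\<lambda>h. \<eta>\<^sup>2 * h)) (at s within {a..t})"
      by (auto intro!: derivative_eq_intros)
    show ?thesis
      unfolding \<phi>_def
      by (rule has_derivative_eq_rhs[OF has_derivative_diff[OF has_derivative_mult[OF e i] l]])
        (simp add: \<phi>'_def fun_eq_iff inner_commute[of "d' s" "d s"] algebra_simps)
  qed
  then obtain s where s: "s \<in> {a..t}" "\<phi> t - \<phi> a = \<phi>' s * (t - a)"
    using mvt_very_simple[of a t \<phi> "\<lambda>s h. \<phi>' s * h"] t by auto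
  have "2 * (d s \<bullet> d' s) \<le> K * (d s \<bullet> d s) + \<eta>\<^sup>2"
  proof -
    have "2 * (d s \<bullet> d' s) \<le> 2 * (norm (d s) * norm (d' s))"
      using norm_cauchy_schwarz[of "d s" "d' s"] by simp
    also have "\<dots> \<le> 2 * (norm (d s) * (L * norm (d s) + \<eta>))"
      using le[of s] s t by (intro mult_left_mono) auto
    also have "\<dots> \<le> K * (norm (d s))\<^sup>2 + \<eta>\<^sup>2"
      using zero_le_power2[of "norm (d s) - \<eta>"] by (simp add: K_def power2_eq_square algebra_simps)
    finally show ?thesis by (simp add: power2_norm_eq_inner)
  qed
  then have "exp (- (K * (s - a))) * (2 * (d s \<bullet> d' s)) \<le> exp (- (K * (s - a))) * (K * (d s \<bullet> d s) + \<eta>\<^sup>2)"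
    by (intro mult_left_mono) auto
  moreover have "exp (- (K * (s - a))) * \<eta>\<^sup>2 \<le> 1 * \<eta>\<^sup>2"
    using s L by (intro mult_right_mono) (auto simp: K_def)
  ultimately have "\<phi>' s \<le> 0"
    unfolding \<phi>'_def by (simp add: algebra_simps)
  then have "\<phi> t \<le> \<phi> a"
    using s t mult_nonpos_nonneg[of "\<phi>' s" "t - a"] by auto
  then have "exp (- (K * (t - a))) * (d t \<bullet> d t) \<le> d a \<bullet> d a + \<eta>\<^sup>2 * (t - a)"
    by (simp add: \<phi>_def)
  then have "exp (K * (t - a)) * (exp (- (K * (t - a))) * (d t \<bullet> d t)) \<le> exp (K * (t - a)) * (d a \<bullet> d a + \<eta>\<^sup>2 * (t - a))"
    by (intro mult_left_mono) auto
  moreover have "exp (K * (t - a)) * exp (- (K * (t - a))) = 1" by (rule exp_minus_inverse)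
  ultimately have "d t \<bullet> d t \<le> exp (K * (t - a)) * (d a \<bullet> d a + \<eta>\<^sup>2 * (t - a))"
    by (simp only: mult.assoc[symmetric] mult_1)
  then have "d t \<bullet> d t \<le> (d a \<bullet> d a + \<eta>\<^sup>2 * (t - a)) * exp (K * (t - a))"
    by (simp only: mult.commute)
  also have "\<dots> \<le> (d a \<bullet> d a + \<eta>\<^sup>2 * (b - a)) * exp (K * (b - a))"
  proof (rule mult_mono)
    show "d a \<bullet> d a + \<eta>\<^sup>2 * (t - a) \<le> d a \<bullet> d a + \<eta>\<^sup>2 * (b - a)"
      using t by (intro add_left_mono mult_left_mono) auto
    have "0 \<le> K" using L by (simp add: K_def)
    then show "exp (K * (t - a)) \<le> exp (K * (b - a))" using t by (simp add: mult_left_mono)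
    show "0 \<le> d a \<bullet> d a + \<eta>\<^sup>2 * (b - a)" using t by simp
  qed simp
  finally show ?thesis by (simp add: power2_norm_eq_inner K_def)
qed

lemma has_vector_derivative_reflect:
  assumes "(u has_vector_derivative v) (at (- t) within {- b..- a})"
  shows "((\<lambda>s. u (- s)) has_vector_derivative - v) (at t within {a..b::real})"
proof -
  have "((\<lambda>s. - s) has_vector_derivative (- 1 :: real)) (at t within {a..b})"
    by (auto intro!: derivative_eq_intros)
  moreover have "uminus ` {a..b} = {- b..- a}" by simp
  ultimately show ?thesis
    using vector_diff_chain_within[of uminus "- 1" t "{a..b}" u v] assms by (simp add: o_def)
qed

text \<open>The reference time \<open>c\<close> may lie anywhere in the interval, because flows are
  followed in both directions from time 0 and variational equations are also solved backwards. Times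
  before \<open>c\<close> are treated by reversing time.\<close>

lemma gronwall:
  fixes d :: "real \<Rightarrow> 'u::real_inner"
  assumes d: "\<And>t. t \<in> {a..b} \<Longrightarrow> (d has_vector_derivative d' t) (at t within {a..b})"
    and le: "\<And>t. t \<in> {a..b} \<Longrightarrow> norm (d' t) \<le> L * norm (d t) + \<eta>"
    and L: "0 \<le> L" and c: "c \<in> {a..b}" and t: "t \<in> {a..b}"
  shows "(norm (d t))\<^sup>2 \<le> ((norm (d c))\<^sup>2 + \<eta>\<^sup>2 * (b - a)) * exp ((2 * L + 1) * (b - a))"
proof -
  have mono: "((norm (d c))\<^sup>2 + \<eta>\<^sup>2 * l) * exp ((2 * L + 1) * l) \<le> ((norm (d c))\<^sup>2 + \<eta>\<^sup>2 * (b - a)) * exp ((2 * L + 1) * (b - a))"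
    if "0 \<le> l" "l \<le> b - a" for l
  proof (rule mult_mono)
    show "(norm (d c))\<^sup>2 + \<eta>\<^sup>2 * l \<le> (norm (d c))\<^sup>2 + \<eta>\<^sup>2 * (b - a)"
      using that by (intro add_left_mono mult_left_mono) auto
    show "exp ((2 * L + 1) * l) \<le> exp ((2 * L + 1) * (b - a))" using that L by (simp add: mult_left_mono)
    show "0 \<le> (norm (d c))\<^sup>2 + \<eta>\<^sup>2 * (b - a)" using that by simp
  qed simp
  show ?thesis
  proof (cases "c \<le> t")
    case True
    have "(norm (d t))\<^sup>2 \<le> ((norm (d c))\<^sup>2 + \<eta>\<^sup>2 * (b - c)) * exp ((2 * L + 1) * (b - c))"
    proof (rule gronwall_forward[where d' = d'])
      show "(d has_vector_derivative d' s) (at s within {c..b})" if "s \<in> {c..b}" for s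
        by (rule has_vector_derivative_within_subset[OF d]) (use that c in auto)
      show "norm (d' s) \<le> L * norm (d s) + \<eta>" if "s \<in> {c..b}" for s
        by (rule le) (use that c in auto)
      show "t \<in> {c..b}" using t True by simp
    qed (rule L)
    also note mono[of "b - c"]
    finally show ?thesis using c by auto
  next
    case False
    have "(norm (d (- (- t))))\<^sup>2 \<le> ((norm (d (- (- c))))\<^sup>2 + \<eta>\<^sup>2 * (- a - (- c))) * exp ((2 * L + 1) * (- a - (- c)))"
    proof (rule gronwall_forward[where d = "\<lambda>s. d (- s)" and d' = "\<lambda>s. - d' (- s)"])
      show "((\<lambda>s. d (- s)) has_vector_derivative - d' (- s)) (at s within {- c..- a})" if "s \<in> {- c..- a}" for s
      proof (rule has_vector_derivative_reflect)
        show "(d has_vector_derivative d' (- s)) (at (- s) within {- (- a)..- (- c)})"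
          by (rule has_vector_derivative_within_subset[OF d]) (use that c in auto)
      qed
      show "norm (- d' (- s)) \<le> L * norm (d (- s)) + \<eta>" if "s \<in> {- c..- a}" for s
        using le[of "- s"] that c by auto
    qed (use False t L in auto)
    then have "(norm (d t))\<^sup>2 \<le> ((norm (d c))\<^sup>2 + \<eta>\<^sup>2 * (c - a)) * exp ((2 * L + 1) * (c - a))" by simp
    also note mono[of "c - a"]
    finally show ?thesis using c by auto
  qed
qed

lemma has_vector_derivative_glue:
  assumes u: "\<And>t. t \<in> {a..c} \<Longrightarrow> (u has_vector_derivative u' t) (at t within {a..c})"
    and v: "\<And>t. t \<in> {c..b} \<Longrightarrow> (v has_vector_derivative v' t) (at t within {c..b})"
    and eq: "u c = v c" "u' c = v' c" and c: "a \<le> c" "c \<le> b" and t: "t \<in> {a..b::real}"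
  shows "((\<lambda>t. if t \<in> {a..c} then u t else v t) has_vector_derivative (if t \<in> {a..c} then u' t else v' t)) (at t within {a..b})"
proof (rule has_vector_derivative_If_within_closures)
  show "t \<in> {a..c} \<union> {c..b}" "{a..b} = {a..c} \<union> {c..b}" using t c by auto
  have [simp]: "closure {a..c} = {a..c}" "closure {c..b} = {c..b}" by auto
  have un: "{a..c} \<union> {a..c} \<inter> {c..b} = {a..c}" "{c..b} \<union> {a..c} \<inter> {c..b} = {c..b}" using c by auto
  show "(u has_vector_derivative u' t) (at t within {a..c} \<union> closure {a..c} \<inter> closure {c..b})"
    if "t \<in> {a..c} \<union> closure {a..c} \<inter> closure {c..b}" using u[of t] that unfolding closure_closed[OF closed_real_atLeastAtMost] un by blast
  show "(v has_vector_derivative v' t) (at t within {c..b} \<union> closure {a..c} \<inter> closure {c..b})"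
    if "t \<in> {c..b} \<union> closure {a..c} \<inter> closure {c..b}" using v[of t] that unfolding closure_closed[OF closed_real_atLeastAtMost] un by blast
qed (use eq in auto)

text \<open>With a global Lipschitz constant the integral operator is a contraction on the whole
  interval at once, provided the supremum norm carries an exponential weight; no step-by-step
  continuation of solutions is needed.\<close>

lemma picard_forward:
  fixes G :: "real \<Rightarrow> 'u::euclidean_space \<Rightarrow> 'u"
  assumes ab: "a \<le> b" and c: "continuous_on ({a..b} \<times> UNIV) (\<lambda>(t, x). G t x)"
    and L: "0 \<le> L" "\<And>t x y. t \<in> {a..b} \<Longrightarrow> norm (G t x - G t y) \<le> L * norm (x - y)"
  obtains u where "u a = x0" "\<forall>t\<in>{a..b}. (u has_vector_derivative G t (u t)) (at t within {a..b})"
proof -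
  \<comment> \<open>Integrating the weight produces a factor \<open>1 / K\<close>, so the
    contraction constant is \<open>L / K \<le> 1 / 2\<close>; the summand 1 keeps \<open>K\<close>
    positive for \<open>L = 0\<close>.\<close>
  define K where "K = 2 * L + 1"
  define w where "w = (\<lambda>t. exp (K * (t - a)))"
  \<comment> \<open>Elements of the complete space \<open>bcontfun\<close> live on the whole real
    line; clamping the time extends a function on \<open>{a..b}\<close> to a bounded continuous
    one.\<close>
  define cl where "cl = (\<lambda>t. max a (min b t))"
  have K: "0 < K" and wpos: "0 < w t" for t using L by (auto simp: K_def w_def)
  have cl: "cl t \<in> {a..b}" for t using ab by (auto simp: cl_def)
  have clc: "continuous_on UNIV cl" unfolding cl_def by (intro continuous_intros)
  define g where "g = (\<lambda>v::real \<Rightarrow>\<^sub>C 'u. \<lambda>r. G r (w r *\<^sub>R v r))"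
  have gc: "continuous_on {a..b} (g v)" for v
  proof -
    have "continuous_on {a..b} (\<lambda>r. (r, w r *\<^sub>R v r))"
      unfolding w_def by (intro continuous_intros continuous_on_apply_bcontfun)
    then have "continuous_on {a..b} (\<lambda>r. (\<lambda>(t, x). G t x) (r, w r *\<^sub>R v r))"
      by (rule continuous_on_compose2[OF c]) auto
    then show ?thesis by (simp add: g_def)
  qed
  have gi: "g v integrable_on {a..s}" if "s \<in> {a..b}" for v s
    by (rule integrable_continuous_real, rule continuous_on_subset[OF gc]) (use that in auto)
  define q where "q = (\<lambda>v s. x0 + integral {a..s} (g v))"
  have qc: "continuous_on {a..b} (q v)" for v
    unfolding q_def by (intro continuous_intros indefinite_integral_continuous_1 gi) (use ab in auto)
  \<comment> \<open>The unknown is the solution divided by the weight, so a fixed point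
    \<open>v\<close> gives the solution \<open>w s *\<^sub>R v s = q v s\<close>.\<close>
  define Q where "Q = (\<lambda>v t. inverse (w (cl t)) *\<^sub>R q v (cl t))"
  have wq: "continuous_on {a..b} (\<lambda>s. inverse (w s) *\<^sub>R q v s)" for v
    using wpos by (intro continuous_intros qc) (auto simp: w_def intro!: continuous_intros)
  have Qb: "Q v \<in> bcontfun" for v
  proof -
    have "continuous_on UNIV (Q v)"
      unfolding Q_def by (rule continuous_on_compose2[OF wq clc]) (use cl in auto)
    moreover have "bounded (range (Q v))"
    proof (rule bounded_subset)
      show "bounded ((\<lambda>s. inverse (w s) *\<^sub>R q v s) ` {a..b})"
        by (intro compact_imp_bounded compact_continuous_image wq) auto
    qed (use cl in \<open>auto simp: Q_def\<close>)
    ultimately show ?thesis by (auto simp: bcontfun_def)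
  qed
  define QQ where "QQ = (\<lambda>v. Bcontfun (Q v))"
  have QQ: "apply_bcontfun (QQ v) = Q v" for v
    unfolding QQ_def by (rule Bcontfun_inverse[OF Qb])
  have contr: "dist (QQ v) (QQ v') \<le> (1 / 2) * dist v v'" for v v'
  proof (rule dist_bound)
    fix t
    let ?s = "cl t" and ?D = "dist v v'"
    have s: "?s \<in> {a..b}" by (rule cl)
    have int: "((\<lambda>r. L * ?D * w r) has_integral L * ?D * (w ?s / K) - L * ?D * (w a / K)) {a..?s}"
    proof (rule fundamental_theorem_of_calculus)
      show "((\<lambda>r. L * ?D * (w r / K)) has_vector_derivative L * ?D * w r) (at r within {a..?s})" for r
        using K unfolding w_def by (auto intro!: derivative_eq_intros simp: has_real_derivative_iff_has_vector_derivative[symmetric])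
    qed (use s in auto)
    have "norm (integral {a..?s} (\<lambda>r. g v r - g v' r)) \<le> integral {a..?s} (\<lambda>r. L * ?D * w r)"
    proof (rule Henstock_Kurzweil_Integration.integral_norm_bound_integral)
      show "(\<lambda>r. g v r - g v' r) integrable_on {a..?s}" by (intro integrable_diff gi s)
      show "(\<lambda>r. L * ?D * w r) integrable_on {a..?s}" using int by blast
      show "norm (g v r - g v' r) \<le> L * ?D * w r" if "r \<in> {a..?s}" for r
      proof -
        have "norm (g v r - g v' r) \<le> L * norm (w r *\<^sub>R v r - w r *\<^sub>R v' r)"
          unfolding g_def by (rule L(2)) (use that s in auto)
        also have "\<dots> = L * (w r * dist (v r) (v' r))"
          using wpos[of r] by (simp add: dist_norm flip: scaleR_diff_right)
        also have "\<dots> \<le> L * (w r * ?D)"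
          using L(1) wpos[of r] by (intro mult_left_mono dist_bounded) auto
        finally show ?thesis by (simp add: ac_simps)
      qed
    qed
    also have "\<dots> = L * ?D * (w ?s / K) - L * ?D * (w a / K)" using int by (rule integral_unique)
    also have "\<dots> \<le> L * ?D * (w ?s / K)" using L(1) wpos[of a] K by simp
    also have "\<dots> \<le> w ?s * ((1 / 2) * ?D)"
    proof -
      have "L / K \<le> 1 / 2" using K by (simp add: K_def field_simps)
      then have "(L / K) * (?D * w ?s) \<le> (1 / 2) * (?D * w ?s)"
        using wpos[of ?s] by (intro mult_right_mono) auto
      then show ?thesis by (simp add: ac_simps)
    qed
    finally have le: "norm (integral {a..?s} (\<lambda>r. g v r - g v' r)) \<le> w ?s * ((1 / 2) * ?D)" .
    have "dist (QQ v t) (QQ v' t) = norm (inverse (w ?s) *\<^sub>R (q v ?s - q v' ?s))"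
      by (simp add: QQ Q_def dist_norm scaleR_diff_right)
    also have "q v ?s - q v' ?s = integral {a..?s} (\<lambda>r. g v r - g v' r)"
      unfolding q_def
      using Henstock_Kurzweil_Integration.integral_diff[OF gi[OF s, of v] gi[OF s, of v']] by simp
    also have "norm (inverse (w ?s) *\<^sub>R integral {a..?s} (\<lambda>r. g v r - g v' r)) \<le> (1 / 2) * ?D"
      using le wpos[of ?s] by (simp add: field_simps)
    finally show "dist (QQ v t) (QQ v' t) \<le> (1 / 2) * ?D" .
  qed
  then obtain v where v: "QQ v = v"
    using banach_fix_type[of "1 / 2" QQ] by auto
  have u: "w s *\<^sub>R v s = q v s" if "s \<in> {a..b}" for s
  proof -
    have "v s = Q v s" using QQ[of v] v by simp
    moreover have "cl s = s" using that by (auto simp: cl_def)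
    ultimately show ?thesis using wpos[of s] by (simp add: Q_def)
  qed
  show thesis
  proof
    show "q v a = x0" by (simp add: q_def)
    show "\<forall>t\<in>{a..b}. (q v has_vector_derivative G t (q v t)) (at t within {a..b})"
    proof
      fix t assume t: "t \<in> {a..b}"
      have "((\<lambda>s. integral {a..s} (g v)) has_vector_derivative g v t) (at t within {a..b})"
        by (rule integral_has_vector_derivative[OF gc t])
      then have "((\<lambda>s. x0 + integral {a..s} (g v)) has_vector_derivative 0 + g v t) (at t within {a..b})"
        by (intro has_vector_derivative_add has_vector_derivative_const)
      moreover have "g v t = G t (q v t)" using u[OF t] by (simp add: g_def)
      ultimately show "(q v has_vector_derivative G t (q v t)) (at t within {a..b})" unfolding q_def by simp
    qed
  qed
qed

lemma picard:
  fixes G :: "real \<Rightarrow> 'u::euclidean_space \<Rightarrow> 'u"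
  assumes c: "t0 \<in> {a..b}" and cG: "continuous_on ({a..b} \<times> UNIV) (\<lambda>(t, x). G t x)"
    and L: "0 \<le> L" "\<And>t x y. t \<in> {a..b} \<Longrightarrow> norm (G t x - G t y) \<le> L * norm (x - y)"
  obtains u where "u t0 = x0" "\<forall>t\<in>{a..b}. (u has_vector_derivative G t (u t)) (at t within {a..b})"
proof -
  have cG1: "continuous_on ({t0..b} \<times> UNIV) (\<lambda>(t, x). G t x)"
    by (rule continuous_on_subset[OF cG]) (use c in auto)
  obtain u1 where u1: "u1 t0 = x0" "\<forall>t\<in>{t0..b}. (u1 has_vector_derivative G t (u1 t)) (at t within {t0..b})"
  proof (rule picard_forward[OF _ cG1 L(1)])
    show "norm (G t x - G t y) \<le> L * norm (x - y)" if "t \<in> {t0..b}" for t x y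
      by (rule L(2)) (use that c in auto)
  qed (use c in auto)
  have cG': "continuous_on ({- t0..- a} \<times> UNIV) (\<lambda>(t, x). - G (- t) x)"
  proof -
    have "continuous_on ({- t0..- a} \<times> UNIV) (\<lambda>p. (- fst p, snd p))" by (intro continuous_intros)
    then have "continuous_on ({- t0..- a} \<times> UNIV) (\<lambda>p. (\<lambda>(t, x). G t x) (- fst p, snd p))"
      by (rule continuous_on_compose2[OF cG]) (use c in auto)
    then show ?thesis by (auto simp: case_prod_unfold intro: continuous_on_minus)
  qed
  obtain u2 where u2: "u2 (- t0) = x0"
    "\<forall>t\<in>{- t0..- a}. (u2 has_vector_derivative - G (- t) (u2 t)) (at t within {- t0..- a})"
  proof (rule picard_forward[OF _ cG' L(1)])
    show "norm (- G (- t) x - - G (- t) y) \<le> L * norm (x - y)" if "t \<in> {- t0..- a}" for t x y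
      using L(2)[of "- t" x y] that c by (auto simp: norm_minus_commute)
  qed (use c in auto)
  have u2': "((\<lambda>s. u2 (- s)) has_vector_derivative G t (u2 (- t))) (at t within {a..t0})" if "t \<in> {a..t0}" for t
    using has_vector_derivative_reflect[OF bspec[OF u2(2), of "- t"]] that by simp
  let ?u = "\<lambda>t. if t \<in> {a..t0} then u2 (- t) else u1 t"
  show thesis
  proof (rule that[of ?u])
    show "?u t0 = x0" using u1(1) u2(1) by simp
    show "\<forall>t\<in>{a..b}. (?u has_vector_derivative G t (?u t)) (at t within {a..b})"
    proof
      fix t assume t: "t \<in> {a..b}"
      have "(?u has_vector_derivative (if t \<in> {a..t0} then G t (u2 (- t)) else G t (u1 t))) (at t within {a..b})"
        by (rule has_vector_derivative_glue[OF u2' bspec[OF u1(2)]]) (use u1(1) u2(1) c t in auto)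
      then show "(?u has_vector_derivative G t (?u t)) (at t within {a..b})"
        unfolding if_distrib[of "G t"] .
    qed
  qed
qed

lemma C1_lipschitz_on_compact:
  fixes F :: "'u::euclidean_space \<Rightarrow> 'u"
  assumes W: "open W" and F: "Ck_open (Suc k) F W" and K: "compact K" "K \<subseteq> W"
  obtains L where "0 \<le> L" "\<forall>x\<in>K. \<forall>y\<in>K. norm (F x - F y) \<le> L * norm (x - y)"
proof -
  let ?D = "\<lambda>x. Blinfun (\<lambda>v. frechet_derivative F (at x) v)"
  note D = continuous_on_blinfun_frechet_derivative[OF F bounded_linear_ident]
  have "local_lipschitz (UNIV :: real set) W (\<lambda>t. F)"
  proof (rule c1_implies_local_lipschitz[where f' = "\<lambda>(t, x). ?D x"])
    show "(F has_derivative blinfun_apply (case (t, x) of (t, x) \<Rightarrow> ?D x)) (at x)" if "x \<in> W" for t :: real and x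
      using Ck_open_has_derivative[OF F that] D(2)[OF that] by simp
    show "continuous_on (UNIV \<times> W) (\<lambda>(t :: real, x). ?D x)"
      unfolding case_prod_unfold by (rule continuous_on_compose2[OF D(1)]) (auto intro: continuous_intros)
  qed (use W in auto)
  then have "local_lipschitz {0 :: real} K (\<lambda>t. F)"
    by (rule local_lipschitz_subset) (use K in auto)
  then obtain L where "L-lipschitz_on K F"
    by (rule local_lipschitz_compact_implies_lipschitz[OF _ K(1)]) auto
  then show thesis
    using that[of L] by (auto simp: lipschitz_on_def dist_norm)
qed

lemma solves_ode_continuous: "solves_ode_on F \<phi> I \<Longrightarrow> continuous_on I \<phi>"
  unfolding solves_ode_on_def
  by (intro continuous_on_vector_derivative) auto

lemma solves_ode_subset: "solves_ode_on F \<phi> I \<Longrightarrow> J \<subseteq> I \<Longrightarrow> solves_ode_on F \<phi> J"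
  unfolding solves_ode_on_def by (auto intro: has_vector_derivative_within_subset)

text \<open>The two trajectories together form a compact set, on which \<open>F\<close> is
  Lipschitz; Gronwall's inequality with zero defect does the rest, forwards and backwards from
  \<open>c\<close>.\<close>

theorem ode_unique:
  fixes F :: "'u::euclidean_space \<Rightarrow> 'u"
  assumes W: "open W" and F: "Ck_open (Suc k) F W"
    and sol: "solves_ode_on F \<phi> {a..b}" "solves_ode_on F \<psi> {a..b}"
    and sub: "\<And>t. t \<in> {a..b} \<Longrightarrow> \<phi> t \<in> W" "\<And>t. t \<in> {a..b} \<Longrightarrow> \<psi> t \<in> W"
    and c: "c \<in> {a..b}" "\<phi> c = \<psi> c" and t: "t \<in> {a..b}"
  shows "\<phi> t = \<psi> t"
proof -
  have "compact (\<phi> ` {a..b} \<union> \<psi> ` {a..b})"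
    by (intro compact_Un compact_continuous_image solves_ode_continuous[OF sol(1)] solves_ode_continuous[OF sol(2)]) auto
  moreover have "\<phi> ` {a..b} \<union> \<psi> ` {a..b} \<subseteq> W" using sub by auto
  ultimately obtain L where L: "0 \<le> L" "\<forall>x\<in>\<phi> ` {a..b} \<union> \<psi> ` {a..b}. \<forall>y\<in>\<phi> ` {a..b} \<union> \<psi> ` {a..b}. norm (F x - F y) \<le> L * norm (x - y)"
    by (rule C1_lipschitz_on_compact[OF W F])
  have "(norm (\<phi> t - \<psi> t))\<^sup>2 \<le> ((norm (\<phi> c - \<psi> c))\<^sup>2 + 0\<^sup>2 * (b - a)) * exp ((2 * L + 1) * (b - a))"
  proof (rule gronwall[where d' = "\<lambda>t. F (\<phi> t) - F (\<psi> t)", OF _ _ L(1) c(1) t])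
    show "((\<lambda>t. \<phi> t - \<psi> t) has_vector_derivative F (\<phi> s) - F (\<psi> s)) (at s within {a..b})" if "s \<in> {a..b}" for s
      using sol that unfolding solves_ode_on_def by (intro has_vector_derivative_diff) simp_all
    show "norm (F (\<phi> s) - F (\<psi> s)) \<le> L * norm (\<phi> s - \<psi> s) + 0" if "s \<in> {a..b}" for s
      using L(2) that by auto
  qed
  then show ?thesis using c(2) by simp
qed

text \<open>Separate continuity becomes joint continuity as soon as the estimate in \<open>p\<close>
  is uniform in \<open>t\<close>, which is the form that Gronwall's inequality provides.\<close>

lemma continuous_on_equicontinuous:
  fixes u :: "real \<Rightarrow> 'p::metric_space \<Rightarrow> 'u::metric_space"
  assumes c: "\<And>p. p \<in> B \<Longrightarrow> continuous_on J (\<lambda>t. u t p)"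
    and eq: "\<And>p e. p \<in> B \<Longrightarrow> 0 < e \<Longrightarrow> \<exists>\<delta>>0. \<forall>p'\<in>B. dist p' p < \<delta> \<longrightarrow> (\<forall>t\<in>J. dist (u t p') (u t p) < e)"
  shows "continuous_on (J \<times> B) (\<lambda>(t, p). u t p)"
  unfolding continuous_on_iff
proof (safe, goal_cases)
  case (1 t p e)
  obtain \<delta> where \<delta>: "\<delta> > 0" "\<And>p' t. p' \<in> B \<Longrightarrow> dist p' p < \<delta> \<Longrightarrow> t \<in> J \<Longrightarrow> dist (u t p') (u t p) < e / 2"
    using eq[OF 1(2), of "e / 2"] 1(3) by auto
  obtain \<delta>' where \<delta>': "\<delta>' > 0" "\<And>s. s \<in> J \<Longrightarrow> dist s t < \<delta>' \<Longrightarrow> dist (u s p) (u t p) < e / 2"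
    using c[OF 1(2), unfolded continuous_on_iff, rule_format, OF 1(1), of "e / 2"] 1(3) by auto
  show ?case
  proof (intro exI[of _ "min \<delta> \<delta>'"] conjI ballI impI)
    fix x assume x: "x \<in> J \<times> B" "dist x (t, p) < min \<delta> \<delta>'"
    obtain s p' where sp: "x = (s, p')" by (cases x)
    have "dist s t < \<delta>'" "dist p' p < \<delta>"
      using x(2) dist_fst_le[of x "(t, p)"] dist_snd_le[of x "(t, p)"] sp by auto
    then have "dist (u s p') (u s p) < e / 2" "dist (u s p) (u t p) < e / 2"
      using \<delta>(2)[of p' s] \<delta>'(2)[of s] x(1) sp by auto
    then show "dist (case x of (t, p) \<Rightarrow> u t p) (u t p) < e"
      using dist_triangle[of "u s p'" "u t p" "u s p"] sp by simp
  qed (use \<delta>(1) \<delta>'(1) in auto)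
qed

text \<open>Truncating \<open>F\<close> outside a tube around the given solution produces a globally
  Lipschitz field, whose solutions exist on all of \<open>{a..b}\<close>. By Gronwall's inequality
  those that start close enough never leave the tube, where the field was not changed.\<close>

theorem continuous_local_flow:
  fixes F :: "'u::euclidean_space \<Rightarrow> 'u"
  assumes W: "open W" and F: "Ck_open (Suc k) F W" and ab: "0 \<in> {a..b}"
    and \<phi>: "solves_ode_on F \<phi> {a..b}" "\<And>t. t \<in> {a..b} \<Longrightarrow> \<phi> t \<in> W"
  obtains B \<Phi> where "open B" "\<phi> 0 \<in> B" "\<forall>w\<in>B. \<Phi> 0 w = w"
    "\<forall>w\<in>B. solves_ode_on F (\<lambda>t. \<Phi> t w) {a..b}" "\<forall>w\<in>B. \<forall>t\<in>{a..b}. \<Phi> t w \<in> W"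
    "continuous_on ({a..b} \<times> B) (\<lambda>(t, w). \<Phi> t w)"
proof -
  have \<phi>c: "continuous_on {a..b} \<phi>" by (rule solves_ode_continuous[OF \<phi>(1)])
  have K0: "compact (\<phi> ` {a..b})" by (intro compact_continuous_image \<phi>c) auto
  obtain \<rho> where \<rho>: "\<rho> > 0" "(\<Union>x\<in>\<phi> ` {a..b}. cball x \<rho>) \<subseteq> W"
    using compact_subset_open_imp_cball_epsilon_subset[OF K0 W] \<phi>(2) by blast
  define K where "K = {x + y | x y. x \<in> \<phi> ` {a..b} \<and> y \<in> cball 0 \<rho>}"
  have "compact K" unfolding K_def by (intro compact_sums K0 compact_cball)
  moreover have KW: "K \<subseteq> W"
  proof
    fix z assume "z \<in> K"
    then obtain x y where "z = x + y" "x \<in> \<phi> ` {a..b}" "norm y \<le> \<rho>" by (auto simp: K_def)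
    then have "z \<in> cball x \<rho>" by (simp add: dist_norm)
    then show "z \<in> W" using \<rho>(2) \<open>x \<in> \<phi> ` {a..b}\<close> by blast
  qed
  ultimately obtain L where L: "0 \<le> L" "\<forall>x\<in>K. \<forall>y\<in>K. norm (F x - F y) \<le> L * norm (x - y)"
    by (rule C1_lipschitz_on_compact[OF W F])
  \<comment> \<open>Projection onto a ball is nonexpansive, so inserting it extends the field from
    the tube to all states with the same Lipschitz constant.\<close>
  define clip where "clip = closest_point (cball (0::'u) \<rho>)"
  have clip_in: "clip x \<in> cball 0 \<rho>" for x
    unfolding clip_def by (rule closest_point_in_set) (use \<rho>(1) in auto)
  have clip_id: "clip x = x" if "norm x \<le> \<rho>" for x
    unfolding clip_def by (rule closest_point_self) (use that in auto)
  have clip_lip: "norm (clip x - clip y) \<le> norm (x - y)" for x y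
    using closest_point_lipschitz[of "cball (0::'u) \<rho>" x y] \<rho>(1) by (simp add: clip_def dist_norm)
  have clip_c: "continuous_on UNIV clip"
    unfolding clip_def by (rule continuous_on_closest_point) (use \<rho>(1) in auto)
  define G where "G = (\<lambda>t x. F (\<phi> t + clip (x - \<phi> t)))"
  have inK: "\<phi> t + clip z \<in> K" if "t \<in> {a..b}" for t z
    using clip_in[of z] that unfolding K_def by blast
  have Gc: "continuous_on ({a..b} \<times> UNIV) (\<lambda>(t, x). G t x)"
  proof -
    have "continuous_on ({a..b} \<times> UNIV) (\<lambda>p. \<phi> (fst p))"
      by (rule continuous_on_compose2[OF \<phi>c]) (auto intro: continuous_intros)
    then have "continuous_on ({a..b} \<times> UNIV) (\<lambda>p. \<phi> (fst p) + clip (snd p - \<phi> (fst p)))"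
      by (intro continuous_intros continuous_on_compose2[OF clip_c]) auto
    then have "continuous_on ({a..b} \<times> UNIV) (\<lambda>p. F (\<phi> (fst p) + clip (snd p - \<phi> (fst p))))"
      by (rule continuous_on_compose2[OF Ck_open_continuous[OF F]]) (use inK KW in auto)
    then show ?thesis by (simp add: G_def case_prod_unfold)
  qed
  have GL: "norm (G t x - G t y) \<le> L * norm (x - y)" if "t \<in> {a..b}" for t x y
  proof -
    have "norm (G t x - G t y) \<le> L * norm (clip (x - \<phi> t) - clip (y - \<phi> t))"
      using bspec[OF bspec[OF L(2) inK[OF that, of "x - \<phi> t"]] inK[OF that, of "y - \<phi> t"]] by (simp add: G_def)
    also have "\<dots> \<le> L * norm (x - y)"
      using clip_lip[of "x - \<phi> t" "y - \<phi> t"] L(1) by (intro mult_left_mono) auto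
    finally show ?thesis .
  qed
  have "\<forall>w. \<exists>u. u 0 = w \<and> (\<forall>t\<in>{a..b}. (u has_vector_derivative G t (u t)) (at t within {a..b}))"
  proof
    fix w
    obtain u where "u 0 = w" "\<forall>t\<in>{a..b}. (u has_vector_derivative G t (u t)) (at t within {a..b})"
      by (rule picard[OF ab Gc L(1) GL, of w])
    then show "\<exists>u. u 0 = w \<and> (\<forall>t\<in>{a..b}. (u has_vector_derivative G t (u t)) (at t within {a..b}))"
      by blast
  qed
  from choice[OF this] obtain \<Psi> where
    \<Psi>0: "\<forall>w. \<Psi> w 0 = w \<and> (\<forall>t\<in>{a..b}. (\<Psi> w has_vector_derivative G t (\<Psi> w t)) (at t within {a..b}))" ..
  have \<Psi>: "\<Psi> w 0 = w" "t \<in> {a..b} \<Longrightarrow> (\<Psi> w has_vector_derivative G t (\<Psi> w t)) (at t within {a..b})" for w t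
    using \<Psi>0 by simp_all
  define C where "C = exp ((2 * L + 1) * (b - a))"
  have C: "0 < C" by (simp add: C_def)
  have est: "(norm (\<Psi> w t - \<Psi> w' t))\<^sup>2 \<le> (norm (w - w'))\<^sup>2 * C" if "t \<in> {a..b}" for w w' t
  proof -
    have "(norm (\<Psi> w t - \<Psi> w' t))\<^sup>2 \<le> ((norm (\<Psi> w 0 - \<Psi> w' 0))\<^sup>2 + 0\<^sup>2 * (b - a)) * exp ((2 * L + 1) * (b - a))"
    proof (rule gronwall[OF _ _ L(1) ab that])
      show "((\<lambda>t. \<Psi> w t - \<Psi> w' t) has_vector_derivative G s (\<Psi> w s) - G s (\<Psi> w' s)) (at s within {a..b})"
        if "s \<in> {a..b}" for s
        by (intro has_vector_derivative_diff \<Psi>(2) that)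
      show "norm (G s (\<Psi> w s) - G s (\<Psi> w' s)) \<le> L * norm (\<Psi> w s - \<Psi> w' s) + 0" if "s \<in> {a..b}" for s
        using GL[OF that] by simp
    qed
    then show ?thesis by (simp add: C_def \<Psi>(1))
  qed
  have G\<phi>: "G t (\<phi> t) = F (\<phi> t)" for t using clip_id[of 0] \<rho>(1) by (simp add: G_def)
  have est\<phi>: "(norm (\<Psi> w t - \<phi> t))\<^sup>2 \<le> (norm (w - \<phi> 0))\<^sup>2 * C" if "t \<in> {a..b}" for w t
  proof -
    have d: "(\<phi> has_vector_derivative G t (\<phi> t)) (at t within {a..b})" if "t \<in> {a..b}" for t
      using \<phi>(1) that by (simp add: solves_ode_on_def G\<phi>)
    have "(norm (\<Psi> w t - \<phi> t))\<^sup>2 \<le> ((norm (\<Psi> w 0 - \<phi> 0))\<^sup>2 + 0\<^sup>2 * (b - a)) * exp ((2 * L + 1) * (b - a))"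
    proof (rule gronwall[OF _ _ L(1) ab that])
      show "((\<lambda>t. \<Psi> w t - \<phi> t) has_vector_derivative G s (\<Psi> w s) - G s (\<phi> s)) (at s within {a..b})"
        if "s \<in> {a..b}" for s
        by (intro has_vector_derivative_diff \<Psi>(2) d that)
      show "norm (G s (\<Psi> w s) - G s (\<phi> s)) \<le> L * norm (\<Psi> w s - \<phi> s) + 0" if "s \<in> {a..b}" for s
        using GL[OF that] by simp
    qed
    then show ?thesis by (simp add: C_def \<Psi>(1))
  qed
  \<comment> \<open>\<open>C\<close> bounds the growth of squared distances, so
    \<open>\<rho> / sqrt C\<close> is the initial distance that cannot exceed \<open>\<rho>\<close>
    up to the end.\<close>
  define B where "B = ball (\<phi> 0) (\<rho> / sqrt C)"
  have near: "norm (\<Psi> w t - \<phi> t) \<le> \<rho>" if "w \<in> B" "t \<in> {a..b}" for w t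
  proof -
    have "norm (w - \<phi> 0) \<le> \<rho> / sqrt C" using that by (simp add: B_def dist_norm norm_minus_commute)
    then have "(norm (w - \<phi> 0))\<^sup>2 * C \<le> (\<rho> / sqrt C)\<^sup>2 * C"
      using C by (intro mult_right_mono power_mono) auto
    also have "\<dots> = \<rho>\<^sup>2" using C by (simp add: power_divide)
    finally show ?thesis
      using power2_le_imp_le[OF order_trans[OF est\<phi>[OF that(2)]]] \<rho>(1) by simp
  qed
  have GF: "G t (\<Psi> w t) = F (\<Psi> w t)" "\<Psi> w t \<in> W" if "w \<in> B" "t \<in> {a..b}" for w t
    using clip_id[OF near[OF that]] inK[OF that(2), of "\<Psi> w t - \<phi> t"] KW by (auto simp: G_def)
  show thesis
  proof (rule that[of B "\<lambda>t w. \<Psi> w t"])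
    show "open B" "\<phi> 0 \<in> B" using \<rho>(1) C by (auto simp: B_def)
    show "\<forall>w\<in>B. \<Psi> w 0 = w" using \<Psi>(1) by simp
    show "\<forall>w\<in>B. solves_ode_on F (\<lambda>t. \<Psi> w t) {a..b}"
      unfolding solves_ode_on_def
    proof (intro ballI)
      fix w t assume w: "w \<in> B" "t \<in> {a..b}"
      show "(\<Psi> w has_vector_derivative F (\<Psi> w t)) (at t within {a..b})"
        using \<Psi>(2)[OF w(2), of w] GF(1)[OF w] by simp
    qed
    show "\<forall>w\<in>B. \<forall>t\<in>{a..b}. \<Psi> w t \<in> W" using GF(2) by blast
    show "continuous_on ({a..b} \<times> B) (\<lambda>(t, w). \<Psi> w t)"
    proof (rule continuous_on_equicontinuous)
      show "continuous_on {a..b} (\<lambda>t. \<Psi> w t)" for w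
        by (rule continuous_on_vector_derivative) (rule \<Psi>(2))
      fix w e assume "w \<in> B" "(0::real) < e"
      show "\<exists>\<delta>>0. \<forall>w'\<in>B. dist w' w < \<delta> \<longrightarrow> (\<forall>t\<in>{a..b}. dist (\<Psi> w' t) (\<Psi> w t) < e)"
      proof (intro exI[of _ "e / sqrt C"] conjI ballI impI)
        fix w' t assume "dist w' w < e / sqrt C" and t: "t \<in> {a..b}"
        then have "norm (w' - w) < e / sqrt C" by (simp add: dist_norm)
        then have "(norm (w' - w))\<^sup>2 * C < (e / sqrt C)\<^sup>2 * C"
          using C by (intro mult_strict_right_mono power_strict_mono) auto
        also have "\<dots> = e\<^sup>2" using C by (simp add: power_divide)
        finally show "dist (\<Psi> w' t) (\<Psi> w t) < e"
          using power2_less_imp_less[OF order_le_less_trans[OF est[OF t]]] \<open>0 < e\<close> unfolding dist_norm by simp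
      qed (use \<open>0 < e\<close> C in auto)
    qed
  qed
qed

section \<open>Smooth dependence on parameters\<close>

lemma frechet_derivative_bounded_on_compact:
  fixes H :: "'b::euclidean_space \<Rightarrow> 'c::real_normed_vector"
  assumes H: "Ck_open (Suc k) H \<Omega>" and K: "compact K" "K \<subseteq> \<Omega>"
  obtains L where "0 \<le> L" "\<forall>q\<in>K. \<forall>v. norm (frechet_derivative H (at q) v) \<le> L * norm v"
proof -
  note D = continuous_on_blinfun_frechet_derivative[OF H bounded_linear_ident]
  have "compact ((\<lambda>x. Blinfun (\<lambda>v. frechet_derivative H (at x) v)) ` K)"
    by (intro compact_continuous_image continuous_on_subset[OF D(1)] K)
  then obtain L where L: "0 < L" "\<And>x. x \<in> K \<Longrightarrow> norm (Blinfun (\<lambda>v. frechet_derivative H (at x) v)) \<le> L"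
    by (auto dest!: compact_imp_bounded simp: bounded_pos)
  have "norm (frechet_derivative H (at q) v) \<le> L * norm v" if "q \<in> K" for q v
  proof -
    have "norm (frechet_derivative H (at q) v) \<le> norm (Blinfun (\<lambda>v. frechet_derivative H (at q) v)) * norm v"
      using norm_blinfun[of "Blinfun (\<lambda>v. frechet_derivative H (at q) v)" v] D(2)[of q] that K by auto
    also have "\<dots> \<le> L * norm v" using L(2)[OF that] by (intro mult_right_mono) auto
    finally show ?thesis .
  qed
  then show thesis using that[of L] L(1) by auto
qed

text \<open>The derivative is uniformly continuous on the compact enlargement \<open>K'\<close>,
  which contains each short segment starting in \<open>K\<close>. The mean value inequality on the
  segment then gives a remainder estimate with one radius for all base points.\<close>

lemma uniformly_differentiable_on_compact:
  fixes H :: "'b::euclidean_space \<Rightarrow> 'c::real_normed_vector"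
  assumes \<Omega>: "open \<Omega>" and H: "Ck_open (Suc k) H \<Omega>" and K: "compact K" "K \<subseteq> \<Omega>" and e: "0 < e"
  obtains \<rho> where "0 < \<rho>"
    "\<forall>q\<in>K. \<forall>v. norm v < \<rho> \<longrightarrow> norm (H (q + v) - H q - frechet_derivative H (at q) v) \<le> e * norm v"
proof -
  let ?D = "\<lambda>x. Blinfun (\<lambda>v. frechet_derivative H (at x) v)"
  note D = continuous_on_blinfun_frechet_derivative[OF H bounded_linear_ident]
  obtain r where r: "r > 0" "(\<Union>x\<in>K. cball x r) \<subseteq> \<Omega>"
    using compact_subset_open_imp_cball_epsilon_subset[OF K(1) \<Omega> K(2)] by blast
  define K' where "K' = {x + y | x y. x \<in> K \<and> y \<in> cball 0 r}"
  have K': "compact K'" unfolding K'_def by (intro compact_sums K compact_cball)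
  have "K' \<subseteq> \<Omega>"
  proof
    fix z assume "z \<in> K'"
    then obtain x y where "z = x + y" "x \<in> K" "norm y \<le> r" by (auto simp: K'_def)
    then have "z \<in> cball x r" by (simp add: dist_norm)
    then show "z \<in> \<Omega>" using r(2) \<open>x \<in> K\<close> by blast
  qed
  then have "uniformly_continuous_on K' ?D"
    by (intro compact_uniformly_continuous K' continuous_on_subset[OF D(1)])
  then obtain \<rho> where \<rho>: "0 < \<rho>" "\<And>x y. x \<in> K' \<Longrightarrow> y \<in> K' \<Longrightarrow> dist y x < \<rho> \<Longrightarrow> dist (?D y) (?D x) < e"
    using e unfolding uniformly_continuous_on_def by metis
  show thesis
  proof (rule that[of "min \<rho> r"], goal_cases)
    case 1
    then show ?case using \<rho>(1) r(1) by simp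
  next
    case 2
    show ?case
    proof (intro ballI allI impI)
      fix q v :: 'b assume q: "q \<in> K" and v: "norm v < min \<rho> r"
      have S: "q + t *\<^sub>R v \<in> K' \<and> dist (q + t *\<^sub>R v) q < \<rho>" if "t \<in> {0..1}" for t
      proof -
        have "norm (t *\<^sub>R v) \<le> norm v" using that by (simp add: mult_left_le_one_le)
        then have "norm (t *\<^sub>R v) \<le> r" "norm (t *\<^sub>R v) < \<rho>" using v by auto
        moreover from this q have "q + t *\<^sub>R v \<in> K'"
          unfolding K'_def by (intro CollectI exI[of _ q] exI[of _ "t *\<^sub>R v"]) auto
        ultimately show ?thesis by (simp add: dist_norm)
      qed
      let ?S = "(\<lambda>t. q + t *\<^sub>R v) ` {0..1}"
      have q': "q \<in> ?S" by (rule image_eqI[of _ _ 0]) auto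
      have "norm (H (q + v) - H q - frechet_derivative H (at q) (q + v - q)) \<le> norm (q + v - q) * e"
      proof (rule differentiable_bound_linearization[where S = ?S and f' = "\<lambda>x. frechet_derivative H (at x)"])
        show "q + t *\<^sub>R (q + v - q) \<in> ?S" if "t \<in> {0..1}" for t using that by auto
        show "(H has_derivative frechet_derivative H (at x)) (at x within ?S)" if "x \<in> ?S" for x
          using that S \<open>K' \<subseteq> \<Omega>\<close> by (auto intro!: has_derivative_at_withinI Ck_open_has_derivative[OF H])
        show "onorm (frechet_derivative H (at x) - frechet_derivative H (at q)) \<le> e" if xS: "x \<in> ?S" for x
        proof -
          obtain t where "t \<in> {0..1}" "x = q + t *\<^sub>R v" using xS by blast
          then have x: "x \<in> K'" "dist x q < \<rho>" using S[of t] by auto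
          have q: "q \<in> K'" using S[of 0] by simp
          have "onorm (blinfun_apply (?D x - ?D q)) \<le> e"
            using \<rho>(2)[OF q x(1) x(2)] by (simp add: dist_norm norm_blinfun.rep_eq)
          moreover have "x \<in> \<Omega>" "q \<in> \<Omega>" using x q \<open>K' \<subseteq> \<Omega>\<close> by auto
          then have "blinfun_apply (?D x - ?D q) = frechet_derivative H (at x) - frechet_derivative H (at q)"
            by (simp add: fun_eq_iff blinfun.diff_left D(2)[unfolded fun_eq_iff, rule_format])
          ultimately show ?thesis by simp
        qed
      qed (rule q')
      then show "norm (H (q + v) - H q - frechet_derivative H (at q) v) \<le> e * norm v"
        by (simp add: mult.commute)
    qed
  qed
qed

text \<open>A closed ball around \<open>p\<close> makes the product with the time interval compact,
  so the estimate holds for all times with a single radius.\<close>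

lemma uniform_continuity_in_parameter:
  fixes f :: "real \<Rightarrow> 'p::euclidean_space \<Rightarrow> 'c::metric_space"
  assumes f: "continuous_on ({a..b} \<times> B) (\<lambda>(t, p). f t p)" and B: "open B" "p \<in> B" and e: "0 < e"
  obtains \<delta> where "0 < \<delta>" "ball p \<delta> \<subseteq> B" "\<forall>p'\<in>ball p \<delta>. \<forall>t\<in>{a..b}. dist (f t p') (f t p) < e"
proof -
  obtain r where r: "0 < r" "cball p r \<subseteq> B" using B open_contains_cball by blast
  have "uniformly_continuous_on ({a..b} \<times> cball p r) (\<lambda>(t, p). f t p)"
    by (intro compact_uniformly_continuous compact_Times continuous_on_subset[OF f]) (use r in auto)
  then obtain \<delta> where \<delta>: "0 < \<delta>" "\<And>x y. x \<in> {a..b} \<times> cball p r \<Longrightarrow> y \<in> {a..b} \<times> cball p r \<Longrightarrow> dist y x < \<delta> \<Longrightarrow>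
      dist (case y of (t, p) \<Rightarrow> f t p) (case x of (t, p) \<Rightarrow> f t p) < e"
    using e unfolding uniformly_continuous_on_def by metis
  show thesis
  proof (rule that[of "min \<delta> r"])
    show "ball p (min \<delta> r) \<subseteq> B" using r(2) by auto
    show "\<forall>p'\<in>ball p (min \<delta> r). \<forall>t\<in>{a..b}. dist (f t p') (f t p) < e"
    proof (intro ballI)
      fix p' t assume "p' \<in> ball p (min \<delta> r)" "t \<in> {a..b}"
      then show "dist (f t p') (f t p) < e"
        using \<delta>(2)[of "(t, p)" "(t, p')"] r(1) by (simp add: dist_Pair_Pair dist_commute)
    qed
  qed (use \<delta>(1) r(1) in auto)
qed

text \<open>The derivative in the parameters is constructed as the solution \<open>y w\<close> of the linear variational
  equation; two applications of Gronwall's inequality show that it is continuous and that it is the derivative.\<close>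

lemma ode_parameter_derivative:
  fixes H :: "real \<times> 'p::euclidean_space \<times> 'u::euclidean_space \<Rightarrow> 'u" and u :: "real \<Rightarrow> 'p \<Rightarrow> 'u"
  assumes B: "open B" and \<Omega>: "open \<Omega>" and H: "Ck_open (Suc k) H \<Omega>" and ab: "0 \<in> {a..b}"
    and u: "continuous_on ({a..b} \<times> B) (\<lambda>(t, p). u t p)"
    and graph: "\<And>t p. t \<in> {a..b} \<Longrightarrow> p \<in> B \<Longrightarrow> (t, p, u t p) \<in> \<Omega>"
    and sol: "\<And>t p. t \<in> {a..b} \<Longrightarrow> p \<in> B \<Longrightarrow>
      ((\<lambda>s. u s p) has_vector_derivative H (t, p, u t p)) (at t within {a..b})"
    and init: "Ck_open (Suc j) (u 0) B"
  obtains y :: "'p \<Rightarrow> real \<Rightarrow> 'p \<Rightarrow> 'u" where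
    "\<forall>w. continuous_on ({a..b} \<times> B) (\<lambda>(t, p). y w t p)"
    "\<forall>p\<in>B. \<forall>t\<in>{a..b}. (u t has_derivative (\<lambda>w. y w t p)) (at p)"
    "\<forall>w. \<forall>p\<in>B. \<forall>t\<in>{a..b}. ((\<lambda>s. y w s p) has_vector_derivative
       frechet_derivative H (at (t, p, u t p)) (0, w, y w t p)) (at t within {a..b})"
    "\<forall>w. \<forall>p\<in>B. y w 0 p = frechet_derivative (u 0) (at p) w"
proof -
  \<comment> \<open>The linearised right-hand side, without variation of time. It is linear in
    \<open>(w, z)\<close> jointly, hence affine in \<open>z\<close> for fixed
    \<open>w\<close>.\<close>
  define A where "A = (\<lambda>t p w z. frechet_derivative H (at (t, p, u t p)) (0, w, z))"
  have lin: "linear (frechet_derivative H (at (t, p, u t p)))" if "t \<in> {a..b}" "p \<in> B" for t p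
    using has_derivative_linear[OF Ck_open_has_derivative[OF H graph[OF that]]] .
  have A_add: "A t p (w + w') (z + z') = A t p w z + A t p w' z'" if "t \<in> {a..b}" "p \<in> B" for t p w w' z z'
    using linear_add[OF lin[OF that], of "(0, w, z)" "(0, w', z')"] by (simp add: A_def)
  have A_scale: "A t p (c *\<^sub>R w) (c *\<^sub>R z) = c *\<^sub>R A t p w z" if "t \<in> {a..b}" "p \<in> B" for t p c w z
    using linear_scale[OF lin[OF that], of c "(0, w, z)"] by (simp add: A_def)
  have A_diff: "A t p w z - A t p w z' = A t p 0 (z - z')" if "t \<in> {a..b}" "p \<in> B" for t p w z z'
    using linear_diff[OF lin[OF that], of "(0, w, z)" "(0, w, z')"] by (simp add: A_def)
  have ugc: "continuous_on ({a..b} \<times> B) (\<lambda>(t, p). (t, p, u t p))"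
    using u unfolding case_prod_unfold by (intro continuous_intros)
  have A_cont: "continuous_on S (\<lambda>x. A (t x) (p x) w (z x))"
    if "continuous_on S t" "continuous_on S p" "continuous_on S z" "\<And>x. x \<in> S \<Longrightarrow> t x \<in> {a..b} \<and> p x \<in> B"
    for S :: "'q::topological_space set" and t p w z
  proof -
    have "continuous_on S (\<lambda>x. (\<lambda>(t, p). (t, p, u t p)) (t x, p x))"
      by (rule continuous_on_compose2[OF ugc]) (use that in \<open>auto intro!: continuous_intros\<close>)
    then have "continuous_on S (\<lambda>x. (t x, p x, u (t x) (p x)))" by simp
    then show ?thesis
      unfolding A_def
      by (rule continuous_on_frechet_derivative[OF H]) (use that graph in \<open>auto intro!: continuous_intros\<close>)
  qed
  have bound: "\<exists>L\<ge>0. \<forall>p'\<in>C. \<forall>t\<in>{a..b}. \<forall>w z. norm (A t p' w z) \<le> L * norm (w, z)"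
    if C: "compact C" "C \<subseteq> B" for C
  proof -
    have "compact ((\<lambda>(t, p). (t, p, u t p)) ` ({a..b} \<times> C))"
      by (intro compact_continuous_image compact_Times C continuous_on_subset[OF ugc]) (use C in auto)
    moreover have "(\<lambda>(t, p). (t, p, u t p)) ` ({a..b} \<times> C) \<subseteq> \<Omega>" using graph C by auto
    ultimately obtain L where L: "0 \<le> L"
      "\<forall>q\<in>(\<lambda>(t, p). (t, p, u t p)) ` ({a..b} \<times> C). \<forall>v. norm (frechet_derivative H (at q) v) \<le> L * norm v"
      by (rule frechet_derivative_bounded_on_compact[OF H])
    have "norm (A t p' w z) \<le> L * norm (w, z)" if "p' \<in> C" "t \<in> {a..b}" for t p' w z
    proof -
      have "(t, p', u t p') \<in> (\<lambda>(t, p). (t, p, u t p)) ` ({a..b} \<times> C)" using that by (intro image_eqI[of _ _ "(t, p')"]) auto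
      from bspec[OF L(2) this] have "norm (A t p' w z) \<le> L * norm (0 :: real, w, z)" unfolding A_def by blast
      then show ?thesis by (simp add: norm_Pair)
    qed
    then show ?thesis using L(1) by blast
  qed
  have "\<forall>wp. snd wp \<in> B \<longrightarrow> (\<exists>y. y 0 = frechet_derivative (u 0) (at (snd wp)) (fst wp) \<and>
      (\<forall>t\<in>{a..b}. (y has_vector_derivative A t (snd wp) (fst wp) (y t)) (at t within {a..b})))"
  proof (intro allI impI)
    fix wp :: "'p \<times> 'p" assume p: "snd wp \<in> B"
    obtain L where L: "0 \<le> L" "\<forall>p'\<in>{snd wp}. \<forall>t\<in>{a..b}. \<forall>w z. norm (A t p' w z) \<le> L * norm (w, z)"
      using bound[of "{snd wp}"] p by auto
    obtain y where "y 0 = frechet_derivative (u 0) (at (snd wp)) (fst wp)"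
      "\<forall>t\<in>{a..b}. (y has_vector_derivative A t (snd wp) (fst wp) (y t)) (at t within {a..b})"
    proof (rule picard[OF ab _ L(1), of "\<lambda>t z. A t (snd wp) (fst wp) z" "frechet_derivative (u 0) (at (snd wp)) (fst wp)"])
      show "continuous_on ({a..b} \<times> UNIV) (\<lambda>(t, z). A t (snd wp) (fst wp) z)"
        unfolding case_prod_unfold by (rule A_cont) (use p in \<open>auto intro!: continuous_intros\<close>)
      show "norm (A t (snd wp) (fst wp) x - A t (snd wp) (fst wp) z) \<le> L * norm (x - z)" if "t \<in> {a..b}" for t x z
        unfolding A_diff[OF that p] using L(2) that by (auto simp: norm_Pair dest!: bspec[of _ _ t] spec[of _ 0] spec[of _ "x - z"])
    qed
    then show "\<exists>y. y 0 = frechet_derivative (u 0) (at (snd wp)) (fst wp) \<and>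
      (\<forall>t\<in>{a..b}. (y has_vector_derivative A t (snd wp) (fst wp) (y t)) (at t within {a..b}))" by blast
  qed
  then have "\<forall>wp. \<exists>y. snd wp \<in> B \<longrightarrow> (y 0 = frechet_derivative (u 0) (at (snd wp)) (fst wp) \<and>
      (\<forall>t\<in>{a..b}. (y has_vector_derivative A t (snd wp) (fst wp) (y t)) (at t within {a..b})))" by blast
  from choice[OF this] obtain y' where y': "\<forall>wp. snd wp \<in> B \<longrightarrow> (y' wp 0 = frechet_derivative (u 0) (at (snd wp)) (fst wp) \<and>
      (\<forall>t\<in>{a..b}. (y' wp has_vector_derivative A t (snd wp) (fst wp) (y' wp t)) (at t within {a..b})))" ..
  define y where "y = (\<lambda>w t p. y' (w, p) t)"
  have y0: "y w 0 p = frechet_derivative (u 0) (at p) w" if "p \<in> B" for w p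
    using y' that by (auto simp: y_def)
  have y: "((\<lambda>t. y w t p) has_vector_derivative A t p w (y w t p)) (at t within {a..b})"
    if "p \<in> B" "t \<in> {a..b}" for w p t
    using y' that unfolding y_def by fastforce
  have yc: "continuous_on {a..b} (\<lambda>t. y w t p)" if "p \<in> B" for w p
    by (rule continuous_on_vector_derivative) (rule y[OF that])
  have xi: "(u 0 has_derivative frechet_derivative (u 0) (at p)) (at p)" if "p \<in> B" for p
    by (rule Ck_open_has_derivative[OF init that])
  have cont: "continuous_on ({a..b} \<times> B) (\<lambda>(t, p). y w t p)" for w
  proof (rule continuous_on_equicontinuous)
    fix p e assume p: "p \<in> B" and e: "(0::real) < e"
    obtain r where r: "0 < r" "cball p r \<subseteq> B" using B p open_contains_cball by blast
    obtain L where L: "0 \<le> L" "\<forall>p'\<in>cball p r. \<forall>t\<in>{a..b}. \<forall>w z. norm (A t p' w z) \<le> L * norm (w, z)"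
      using bound[OF compact_cball r(2)] by blast
    define C where "C = exp ((2 * L + 1) * (b - a))"
    \<comment> \<open>With initial deviation and defect both at most \<eta>, Gronwall's bound is
      \<open>\<eta>\<^sup>2 * X\<close>; the choice of \<eta> below turns it into a quarter of
      \<open>e\<^sup>2\<close>.\<close>
    define X where "X = (1 + (b - a)) * C"
    define \<eta> where "\<eta> = e / (2 * sqrt X)"
    have pos: "0 < X" using ab by (auto simp: C_def X_def)
    then have \<eta>: "0 < \<eta>" using e by (simp add: \<eta>_def)
    have \<eta>e: "(\<eta>\<^sup>2 + \<eta>\<^sup>2 * (b - a)) * C < e\<^sup>2"
    proof -
      have "(\<eta>\<^sup>2 + \<eta>\<^sup>2 * (b - a)) * C = \<eta>\<^sup>2 * X" by (simp add: X_def algebra_simps)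
      also have "\<dots> = e\<^sup>2 / 4" using pos by (simp add: \<eta>_def power_divide power_mult_distrib)
      also have "\<dots> < e\<^sup>2" using e by simp
      finally show ?thesis .
    qed
    have "continuous_on ({a..b} \<times> B) (\<lambda>(t, p'). A t p' w (y w t p))"
      unfolding case_prod_unfold
      by (rule A_cont) (auto intro!: continuous_intros continuous_on_compose2[OF yc[OF p]])
    then obtain \<delta>1 where \<delta>1: "0 < \<delta>1" "ball p \<delta>1 \<subseteq> B"
      "\<forall>p'\<in>ball p \<delta>1. \<forall>t\<in>{a..b}. dist (A t p' w (y w t p)) (A t p w (y w t p)) < \<eta>"
      using uniform_continuity_in_parameter[OF _ B p \<eta>, of a b "\<lambda>t p'. A t p' w (y w t p)"] by blast
    have "continuous_on B (\<lambda>p. frechet_derivative (u 0) (at p) w)"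
      by (rule Ck_open_continuous[OF Ck_open_frechet[OF init]])
    then obtain \<delta>2 where \<delta>2: "0 < \<delta>2" "\<forall>p'\<in>B. dist p' p < \<delta>2 \<longrightarrow>
        dist (frechet_derivative (u 0) (at p') w) (frechet_derivative (u 0) (at p) w) < \<eta>"
      unfolding continuous_on_iff using p \<eta> by blast
    show "\<exists>\<delta>>0. \<forall>p'\<in>B. dist p' p < \<delta> \<longrightarrow> (\<forall>t\<in>{a..b}. dist (y w t p') (y w t p) < e)"
    proof (intro exI[of _ "min r (min \<delta>1 \<delta>2)"] conjI ballI impI)
      show "0 < min r (min \<delta>1 \<delta>2)" using r \<delta>1 \<delta>2 by simp
      fix p' t assume p': "p' \<in> B" "dist p' p < min r (min \<delta>1 \<delta>2)" and t: "t \<in> {a..b}"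
      have p'r: "p' \<in> cball p r" "p' \<in> ball p \<delta>1" using p'(2) by (auto simp: dist_commute)
      have "(norm (y w t p' - y w t p))\<^sup>2 \<le> ((norm (y w 0 p' - y w 0 p))\<^sup>2 + \<eta>\<^sup>2 * (b - a)) * exp ((2 * L + 1) * (b - a))"
      proof (rule gronwall[OF _ _ L(1) ab t])
        show "((\<lambda>s. y w s p' - y w s p) has_vector_derivative (A s p' w (y w s p') - A s p w (y w s p))) (at s within {a..b})"
          if "s \<in> {a..b}" for s
          by (intro has_vector_derivative_diff y p p' that)
        show "norm (A s p' w (y w s p') - A s p w (y w s p)) \<le> L * norm (y w s p' - y w s p) + \<eta>" if s: "s \<in> {a..b}" for s
        proof -
          have "A s p' w (y w s p') - A s p w (y w s p) = A s p' 0 (y w s p' - y w s p) + (A s p' w (y w s p) - A s p w (y w s p))"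
            using A_diff[OF s p'(1), of w "y w s p'" "y w s p"] by (simp add: algebra_simps)
          also have "norm \<dots> \<le> norm (A s p' 0 (y w s p' - y w s p)) + norm (A s p' w (y w s p) - A s p w (y w s p))"
            by (rule norm_triangle_ineq)
          also have "norm (A s p' 0 (y w s p' - y w s p)) \<le> L * norm (0 :: 'p, y w s p' - y w s p)"
            using L(2) p'r(1) s by blast
          also have "norm (0 :: 'p, y w s p' - y w s p) = norm (y w s p' - y w s p)" by (simp add: norm_Pair)
          also have "norm (A s p' w (y w s p) - A s p w (y w s p)) \<le> \<eta>"
            using \<delta>1(3) p'r(2) s by (auto simp: dist_norm less_imp_le)
          finally show ?thesis by simp
        qed
      qed
      also have "\<dots> \<le> (\<eta>\<^sup>2 + \<eta>\<^sup>2 * (b - a)) * C"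
      proof -
        have "norm (y w 0 p' - y w 0 p) \<le> \<eta>"
          using \<delta>2(2) p' y0[OF p] y0[OF p'(1)] by (auto simp: dist_norm less_imp_le)
        then have "(norm (y w 0 p' - y w 0 p))\<^sup>2 \<le> \<eta>\<^sup>2" by (intro power_mono) auto
        then show ?thesis by (auto simp: C_def intro!: mult_right_mono)
      qed
      also note \<eta>e
      finally show "dist (y w t p') (y w t p) < e"
        unfolding dist_norm by (rule power2_less_imp_less) (use e in simp)
    qed
  qed (rule yc)
  \<comment> \<open>The solutions \<open>y w\<close> were obtained by choice, separately for each
    \<open>w\<close>. Their linearity in \<open>w\<close> follows from uniqueness for the
    homogeneous equation.\<close>
  have unique0: "d t = 0" if pB: "p \<in> B" and t: "t \<in> {a..b}" and d0: "d 0 = 0"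
    and d: "\<And>t. t \<in> {a..b} \<Longrightarrow> (d has_vector_derivative A t p 0 (d t)) (at t within {a..b})" for d p t
  proof -
    obtain L where L: "0 \<le> L" "\<forall>p'\<in>{p}. \<forall>t\<in>{a..b}. \<forall>w z. norm (A t p' w z) \<le> L * norm (w, z)"
      using bound[of "{p}"] pB by auto
    have "(norm (d t))\<^sup>2 \<le> ((norm (d 0))\<^sup>2 + 0\<^sup>2 * (b - a)) * exp ((2 * L + 1) * (b - a))"
    proof (rule gronwall[OF d _ L(1) ab t])
      fix s assume s: "s \<in> {a..b}"
      have "norm (A s p 0 (d s)) \<le> L * norm (0 :: 'p, d s)" using L(2) s by blast
      then show "norm (A s p 0 (d s)) \<le> L * norm (d s) + 0" by (simp add: norm_Pair)
    qed
    then show ?thesis using d0 by simp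
  qed
  have ylin: "bounded_linear (\<lambda>w. y w t p)" if p: "p \<in> B" and t: "t \<in> {a..b}" for t p
  proof -
    have l0: "linear (frechet_derivative (u 0) (at p))" by (rule has_derivative_linear[OF xi[OF p]])
    have "y (w + w') t p - (y w t p + y w' t p) = 0" for w w'
    proof (rule unique0[OF p t])
      show "y (w + w') 0 p - (y w 0 p + y w' 0 p) = 0" using y0[OF p] linear_add[OF l0] by simp
      show "((\<lambda>t. y (w + w') t p - (y w t p + y w' t p)) has_vector_derivative
          A s p 0 (y (w + w') s p - (y w s p + y w' s p))) (at s within {a..b})" if s: "s \<in> {a..b}" for s
        using has_vector_derivative_diff[OF y[OF p s] has_vector_derivative_add[OF y[OF p s] y[OF p s]], of "w + w'" w w']
        unfolding A_add[OF s p, symmetric] A_diff[OF s p] .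
    qed
    moreover have "y (c *\<^sub>R w) t p - c *\<^sub>R y w t p = 0" for c w
    proof (rule unique0[OF p t])
      show "y (c *\<^sub>R w) 0 p - c *\<^sub>R y w 0 p = 0" using y0[OF p] linear_scale[OF l0] by simp
      show "((\<lambda>t. y (c *\<^sub>R w) t p - c *\<^sub>R y w t p) has_vector_derivative
          A s p 0 (y (c *\<^sub>R w) s p - c *\<^sub>R y w s p)) (at s within {a..b})" if s: "s \<in> {a..b}" for s
        using has_vector_derivative_diff[OF y[OF p s] has_vector_derivative_scaleR[OF DERIV_const y[OF p s]], of "c *\<^sub>R w" c w]
        unfolding scale_zero_left add_0_right A_scale[OF s p, symmetric] A_diff[OF s p] .
    qed
    ultimately have "linear (\<lambda>w. y w t p)" by (intro linearI) auto
    then show ?thesis by (simp add: linear_conv_bounded_linear)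
  qed
  have deriv: "(u t has_derivative (\<lambda>w. y w t p)) (at p)" if p: "p \<in> B" and t: "t \<in> {a..b}" for p t
  proof -
    obtain L where L: "0 \<le> L" "\<forall>p'\<in>{p}. \<forall>t\<in>{a..b}. \<forall>w z. norm (A t p' w z) \<le> L * norm (w, z)"
      using bound[of "{p}"] p by auto
    have "\<exists>M\<ge>0. \<forall>s\<in>{a..b}. \<forall>w. norm (y w s p) \<le> M * norm w"
    proof -
      have "\<exists>M. \<forall>s\<in>{a..b}. norm (y i s p) \<le> M" for i
        using compact_imp_bounded[OF compact_continuous_image[OF yc[OF p, of i] compact_Icc]]
        by (auto simp: bounded_iff)
      then obtain M where M: "\<And>i s. s \<in> {a..b} \<Longrightarrow> norm (y i s p) \<le> M i" by metis
      have M0: "0 \<le> M i" for i using order_trans[OF norm_ge_zero M[OF ab, of i]] .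
      have "norm (y w s p) \<le> (\<Sum>i\<in>Basis. M i) * norm w" if s: "s \<in> {a..b}" for s w
      proof -
        have l: "linear (\<lambda>w. y w s p)" using ylin[OF p s] by (rule bounded_linear.linear)
        have "y w s p = y (\<Sum>i\<in>Basis. (w \<bullet> i) *\<^sub>R i) s p" by (simp add: euclidean_representation)
        also have "\<dots> = (\<Sum>i\<in>Basis. (w \<bullet> i) *\<^sub>R y i s p)"
          by (simp only: linear_sum[OF l] linear_cmul[OF l])
        also have "norm \<dots> \<le> (\<Sum>i\<in>Basis. norm w * M i)"
        proof (rule order_trans[OF norm_sum sum_mono])
          fix i :: 'p assume "i \<in> Basis"
          then show "norm ((w \<bullet> i) *\<^sub>R y i s p) \<le> norm w * M i"
            using Basis_le_norm[of i w] M[OF s, of i] by (auto intro!: mult_mono)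
        qed
        finally show ?thesis by (simp add: sum_distrib_left mult.commute)
      qed
      then show ?thesis using M0 by (intro exI[of _ "\<Sum>i\<in>Basis. M i"]) (auto intro: sum_nonneg)
    qed
    then obtain M where M: "0 \<le> M" "\<And>s w. s \<in> {a..b} \<Longrightarrow> norm (y w s p) \<le> M * norm w" by blast
    \<comment> \<open>The Gronwall factor for the error \<open>d\<close> below: Lipschitz constant
      \<open>L + 1\<close>, since the part \<open>\<epsilon> * norm (d s)\<close> of the remainder
      is absorbed by \<open>\<epsilon> \<le> 1\<close>, and defect
      \<open>\<epsilon> * (1 + M) * norm h\<close>. The choice of \<epsilon> makes
      \<open>\<epsilon>\<^sup>2 * C \<le> e\<^sup>2\<close>.\<close>
    define C where "C = (1 + (1 + M)\<^sup>2 * (b - a)) * exp ((2 * (L + 1) + 1) * (b - a))"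
    have C: "0 < C" unfolding C_def using ab by (intro mult_pos_pos add_pos_nonneg mult_nonneg_nonneg) auto
    have main: "\<exists>\<delta>>0. \<forall>p'. norm (p' - p) < \<delta> \<longrightarrow> norm (u t p' - u t p - y (p' - p) t p) \<le> e * norm (p' - p)"
      if e: "0 < e" for e
    proof -
      define \<epsilon> where "\<epsilon> = min 1 (e / sqrt C)"
      have \<epsilon>: "0 < \<epsilon>" "\<epsilon> \<le> 1" "\<epsilon>\<^sup>2 * C \<le> e\<^sup>2"
      proof -
        show "0 < \<epsilon>" "\<epsilon> \<le> 1" using e C by (auto simp: \<epsilon>_def)
        have "\<epsilon>\<^sup>2 \<le> (e / sqrt C)\<^sup>2" using e C by (intro power_mono) (auto simp: \<epsilon>_def)
        then have "\<epsilon>\<^sup>2 * C \<le> (e / sqrt C)\<^sup>2 * C" using C by (intro mult_right_mono) auto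
        then show "\<epsilon>\<^sup>2 * C \<le> e\<^sup>2" using C by (simp add: power_divide)
      qed
      have "compact ((\<lambda>t. (t, p, u t p)) ` {a..b})"
      proof (intro compact_continuous_image compact_Icc)
        have "continuous_on {a..b} (\<lambda>t. (\<lambda>(t, p). (t, p, u t p)) (t, p))"
          by (rule continuous_on_compose2[OF ugc]) (use p in \<open>auto intro!: continuous_intros\<close>)
        then show "continuous_on {a..b} (\<lambda>t. (t, p, u t p))" by simp
      qed
      moreover have "(\<lambda>t. (t, p, u t p)) ` {a..b} \<subseteq> \<Omega>" using graph p by auto
      ultimately obtain \<rho> where \<rho>: "0 < \<rho>" "\<forall>q\<in>(\<lambda>t. (t, p, u t p)) ` {a..b}. \<forall>v. norm v < \<rho> \<longrightarrow>
          norm (H (q + v) - H q - frechet_derivative H (at q) v) \<le> \<epsilon> * norm v"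
        by (rule uniformly_differentiable_on_compact[OF \<Omega> H _ _ \<epsilon>(1)])
      obtain \<delta>1 where \<delta>1: "0 < \<delta>1" "ball p \<delta>1 \<subseteq> B" "\<forall>p'\<in>ball p \<delta>1. \<forall>t\<in>{a..b}. dist (u t p') (u t p) < \<rho> / 2"
        by (rule uniform_continuity_in_parameter[OF u B p half_gt_zero[OF \<rho>(1)]])
      obtain \<delta>2 where \<delta>2: "0 < \<delta>2" "\<And>p'. norm (p' - p) < \<delta>2 \<Longrightarrow>
          norm (u 0 p' - u 0 p - frechet_derivative (u 0) (at p) (p' - p)) \<le> \<epsilon> * norm (p' - p)"
        using xi[OF p] \<epsilon>(1) unfolding has_derivative_at_alt by blast
      show ?thesis
      proof (intro exI[of _ "min (\<rho> / 2) (min \<delta>1 \<delta>2)"] conjI allI impI)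
        show "0 < min (\<rho> / 2) (min \<delta>1 \<delta>2)" using \<rho> \<delta>1 \<delta>2 by simp
        fix p' assume p': "norm (p' - p) < min (\<rho> / 2) (min \<delta>1 \<delta>2)"
        define h where "h = p' - p"
        have p'B: "p' \<in> ball p \<delta>1" using p' by (simp add: dist_norm norm_minus_commute)
        then have pB: "p' \<in> B" using \<delta>1(2) by blast
        define d where "d = (\<lambda>s. u s p' - u s p - y h s p)"
        have "(norm (d t))\<^sup>2 \<le> ((norm (d 0))\<^sup>2 + (\<epsilon> * (1 + M) * norm h)\<^sup>2 * (b - a)) * exp ((2 * (L + 1) + 1) * (b - a))"
        proof (rule gronwall[OF _ _ _ ab t])
          show "(d has_vector_derivative H (s, p', u s p') - H (s, p, u s p) - A s p h (y h s p)) (at s within {a..b})"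
            if "s \<in> {a..b}" for s
            unfolding d_def by (intro has_vector_derivative_diff sol y p pB that)
          show "0 \<le> L + 1" using L(1) by simp
          fix s assume s: "s \<in> {a..b}"
          define z where "z = u s p' - u s p"
          \<comment> \<open>The Taylor remainder of \<open>H\<close> at \<open>(s, p, u s p)\<close>
            for the increment \<open>(0, h, z)\<close>; uniform differentiability bounds it by a
            single constant along the whole trajectory.\<close>
          define R where "R = H (s, p', u s p') - H (s, p, u s p) - A s p h z"
          have nz: "norm (h, z) \<le> norm h + norm z" by (rule norm_Pair_le)
          have "norm z < \<rho> / 2" using \<delta>1(3) p'B s by (auto simp: z_def dist_norm)
          moreover have "norm h < \<rho> / 2" using p' by (simp add: h_def)
          ultimately have "norm (0::real, h, z) < \<rho>" using nz by (simp add: norm_Pair)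
          moreover have "(s, p, u s p) + (0, h, z) = (s, p', u s p')" by (simp add: h_def z_def)
          ultimately have "norm R \<le> \<epsilon> * norm (0::real, h, z)"
            using bspec[OF \<rho>(2) imageI[OF s]] unfolding R_def A_def by metis
          also have "\<dots> \<le> \<epsilon> * (norm h + norm z)" using nz \<epsilon>(1) by (intro mult_left_mono) (auto simp: norm_Pair)
          also have "\<dots> \<le> \<epsilon> * (norm h + (norm (d s) + M * norm h))"
            using norm_triangle_ineq[of "d s" "y h s p"] M(2)[OF s, of h] \<epsilon>(1)
            by (intro mult_left_mono add_left_mono) (auto simp: d_def z_def)
          finally have R: "norm R \<le> \<epsilon> * norm (d s) + \<epsilon> * (1 + M) * norm h"
            using \<epsilon>(1) by (simp add: algebra_simps)
          have "H (s, p', u s p') - H (s, p, u s p) - A s p h (y h s p) = A s p 0 (d s) + R"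
            using A_diff[OF s p, of h z "y h s p"] by (simp add: R_def d_def z_def algebra_simps)
          also have "norm \<dots> \<le> norm (A s p 0 (d s)) + norm R" by (rule norm_triangle_ineq)
          also have "norm (A s p 0 (d s)) \<le> L * norm (0 :: 'p, d s)" using L(2) s by blast
          also have "L * norm (0 :: 'p, d s) = L * norm (d s)" by (simp add: norm_Pair)
          finally have "norm (H (s, p', u s p') - H (s, p, u s p) - A s p h (y h s p)) \<le> L * norm (d s) + norm R" by simp
          moreover have "\<epsilon> * norm (d s) \<le> 1 * norm (d s)" using \<epsilon> by (intro mult_right_mono) auto
          ultimately show "norm (H (s, p', u s p') - H (s, p, u s p) - A s p h (y h s p)) \<le> (L + 1) * norm (d s) + \<epsilon> * (1 + M) * norm h"
            using R by (simp add: algebra_simps)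
        qed
        also have "\<dots> \<le> ((\<epsilon> * norm h)\<^sup>2 + (\<epsilon> * (1 + M) * norm h)\<^sup>2 * (b - a)) * exp ((2 * (L + 1) + 1) * (b - a))"
        proof -
          have "norm (d 0) \<le> \<epsilon> * norm h"
            using \<delta>2(2)[of p'] p' y0[OF p] by (simp add: d_def h_def)
          then have "(norm (d 0))\<^sup>2 \<le> (\<epsilon> * norm h)\<^sup>2" by (intro power_mono) auto
          then show ?thesis by (intro mult_right_mono add_right_mono) auto
        qed
        also have "\<dots> = (\<epsilon>\<^sup>2 * C) * (norm h)\<^sup>2"
        proof -
          have "((\<epsilon> * n)\<^sup>2 + (\<epsilon> * z * n)\<^sup>2 * l) * E = (\<epsilon>\<^sup>2 * ((1 + z\<^sup>2 * l) * E)) * n\<^sup>2" for z l E n :: real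
            by (simp add: power_mult_distrib algebra_simps)
          then show ?thesis unfolding C_def .
        qed
        also have "\<dots> \<le> e\<^sup>2 * (norm h)\<^sup>2" using \<epsilon>(3) by (intro mult_right_mono) auto
        also have "\<dots> = (e * norm h)\<^sup>2" by (simp add: power_mult_distrib)
        finally show "norm (u t p' - u t p - y (p' - p) t p) \<le> e * norm (p' - p)"
          using power2_le_imp_le[of "norm (d t)" "e * norm h"] e by (simp add: d_def h_def)
      qed
    qed
    show ?thesis
      unfolding has_derivative_at_alt using ylin[OF p t] main by blast
  qed
  show thesis
    by (rule that[of y]) (use cont deriv y y0 in \<open>auto simp: A_def\<close>)
qed

text \<open>As for implicit functions, the derivatives solve an equation of the same kind, with the same
  types of state and parameter, which makes the induction on \<open>k\<close> possible.\<close>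

theorem ode_parameter_Ck:
  fixes H :: "real \<times> 'p::euclidean_space \<times> 'u::euclidean_space \<Rightarrow> 'u" and u :: "real \<Rightarrow> 'p \<Rightarrow> 'u"
  assumes B: "open B" and ab: "a < 0" "0 < b"
    and "open \<Omega>" and "Ck_open k H \<Omega>"
    and "continuous_on ({a<..<b} \<times> B) (\<lambda>(t, p). u t p)"
    and "\<And>t p. t \<in> {a<..<b} \<Longrightarrow> p \<in> B \<Longrightarrow> (t, p, u t p) \<in> \<Omega>"
    and "\<And>t p. t \<in> {a<..<b} \<Longrightarrow> p \<in> B \<Longrightarrow> ((\<lambda>s. u s p) has_vector_derivative H (t, p, u t p)) (at t)"
    and "Ck_open k (u 0) B"
  shows "Ck_open k (\<lambda>(t, p). u t p) ({a<..<b} \<times> B)"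
  using assms(2-)
proof (induction k arbitrary: H \<Omega> u a b)
  case 0
  then show ?case by simp
next
  case (Suc k)
  note ab = Suc.prems(1,2) and \<Omega> = Suc.prems(3) and H = Suc.prems(4) and cont = Suc.prems(5)
    and graph = Suc.prems(6) and sol = Suc.prems(7) and init = Suc.prems(8)
  have op: "open ({a<..<b} \<times> B)" using B by (simp add: open_Times)
  have uk: "Ck_open k (\<lambda>(t, p). u t p) ({a<..<b} \<times> B)"
    by (rule Suc.IH[OF ab \<Omega> Ck_open_SucD[OF H] cont graph sol Ck_open_SucD[OF init]])
  \<comment> \<open>Derivatives in the parameters were constructed on compact time intervals, so the
    claim is proved on smaller intervals and then localised.\<close>
  have step: "Ck_open (Suc k) (\<lambda>(t, p). u t p) ({a'<..<b'} \<times> B)"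
    if a': "a < a'" "a' < 0" and b': "0 < b'" "b' < b" for a' b'
  proof -
    have sub: "{a'..b'} \<subseteq> {a<..<b}" using a' b' by auto
    have ab': "0 \<in> {a'..b'}" using a' b' by auto
    have cont': "continuous_on ({a'..b'} \<times> B) (\<lambda>(t, p). u t p)"
      by (rule continuous_on_subset[OF cont]) (use sub in auto)
    have graph': "(t, p, u t p) \<in> \<Omega>" if "t \<in> {a'..b'}" "p \<in> B" for t p
      by (rule graph) (use that sub in auto)
    have sol': "((\<lambda>s. u s p) has_vector_derivative H (t, p, u t p)) (at t within {a'..b'})"
      if "t \<in> {a'..b'}" "p \<in> B" for t p
      by (rule has_vector_derivative_at_within[OF sol]) (use that sub in auto)
    obtain y where y: "\<forall>w. continuous_on ({a'..b'} \<times> B) (\<lambda>(t, p). y w t p)"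
      "\<forall>p\<in>B. \<forall>t\<in>{a'..b'}. (u t has_derivative (\<lambda>w. y w t p)) (at p)"
      "\<forall>w. \<forall>p\<in>B. \<forall>t\<in>{a'..b'}. ((\<lambda>s. y w s p) has_vector_derivative
         frechet_derivative H (at (t, p, u t p)) (0, w, y w t p)) (at t within {a'..b'})"
      "\<forall>w. \<forall>p\<in>B. y w 0 p = frechet_derivative (u 0) (at p) w"
      by (rule ode_parameter_derivative[OF B \<Omega> H ab' cont' graph' sol' init])
    have op': "open ({a'<..<b'} \<times> B)" using B by (simp add: open_Times)
    have uk': "Ck_open k (\<lambda>(t, p). u t p) ({a'<..<b'} \<times> B)"
      by (rule Ck_open_subset[OF uk]) (use a' b' in auto)
    have yk: "Ck_open k (\<lambda>(t, p). y w t p) ({a'<..<b'} \<times> B)" for w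
    proof -
      \<comment> \<open>The variational equation for a fixed direction \<open>w\<close>, with
        unknown \<open>snd (snd q)\<close>. The solution \<open>u\<close> is now a coefficient, of
        class \<open>C^k\<close> by the induction hypothesis.\<close>
      let ?H2 = "\<lambda>q. frechet_derivative H (at (fst q, fst (snd q), (\<lambda>(t, p). u t p) (fst q, fst (snd q)))) (0, w, snd (snd q))"
      let ?\<Omega>2 = "{a'<..<b'} \<times> B \<times> (UNIV :: 'u set)"
      have op2: "open ?\<Omega>2" using B by (simp add: open_Times)
      have H2: "Ck_open k ?H2 ?\<Omega>2"
      proof (rule Ck_open_frechet_derivative[OF op2 H])
        have 1: "Ck_open k (\<lambda>q. (\<lambda>(t, p). u t p) (fst q, fst (snd q))) ?\<Omega>2"
          by (rule Ck_open_compose[OF op2 _ uk'])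
            (intro Ck_open_Pair Ck_open_fst Ck_open_snd Ck_open_id op2, auto)
        show "Ck_open k (\<lambda>q. (fst q, fst (snd q), (\<lambda>(t, p). u t p) (fst q, fst (snd q)))) ?\<Omega>2"
          by (intro Ck_open_Pair op2 1 Ck_open_fst Ck_open_snd Ck_open_id)
        show "Ck_open k (\<lambda>q. (0, w, snd (snd q))) ?\<Omega>2"
          by (intro Ck_open_Pair op2 Ck_open_const Ck_open_snd Ck_open_id)
        show "(fst q, fst (snd q), (\<lambda>(t, p). u t p) (fst q, fst (snd q))) \<in> \<Omega>" if "q \<in> ?\<Omega>2" for q
          using that graph'[of "fst q" "fst (snd q)"] by (cases q) auto
      qed
      show ?thesis
      proof (rule Suc.IH[OF a'(2) b'(1) op2 H2])
        show "continuous_on ({a'<..<b'} \<times> B) (\<lambda>(t, p). y w t p)"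
          by (rule continuous_on_subset[OF spec[OF y(1)]]) auto
        show "(t, p, y w t p) \<in> ?\<Omega>2" if "t \<in> {a'<..<b'}" "p \<in> B" for t p using that by simp
        show "((\<lambda>s. y w s p) has_vector_derivative ?H2 (t, p, y w t p)) (at t)"
          if t: "t \<in> {a'<..<b'}" and p: "p \<in> B" for t p
        proof -
          have "((\<lambda>s. y w s p) has_vector_derivative
            frechet_derivative H (at (t, p, u t p)) (0, w, y w t p)) (at t within {a'..b'})"
            by (rule y(3)[rule_format, OF p]) (use t in simp)
          moreover have "at t within {a'..b'} = at t" using t by (intro at_within_interior) auto
          ultimately show ?thesis by simp
        qed
        show "Ck_open k (y w 0) B"
          by (rule Ck_open_cong_imp[OF B _ Ck_open_frechet[OF init, of w]]) (use y(4) in simp)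
      qed
    qed
    \<comment> \<open>The time derivative is given by the equation and the parameter derivative by
      \<open>y\<close>. Continuity of the latter in both variables makes the total derivative
      exist.\<close>
    let ?D = "\<lambda>(t, p) (dt, dp). dt *\<^sub>R H (t, p, u t p) + y dp t p"
    show ?thesis
    proof (rule Ck_open_SucI[OF op', where D = ?D])
      show "((\<lambda>(t, p). u t p) has_derivative ?D x) (at x)" if x: "x \<in> {a'<..<b'} \<times> B" for x
      proof -
        obtain t p where tp: "x = (t, p)" "t \<in> {a'<..<b'}" "p \<in> B" using x by (cases x) auto
        obtain r where r: "0 < r" "ball p r \<subseteq> B" using B tp(3) open_contains_ball by blast
        have bl: "blinfun_apply (Blinfun (\<lambda>w. y w s q)) = (\<lambda>w. y w s q)" if "s \<in> {a'<..<b'}" "q \<in> B" for s q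
        proof (rule bounded_linear_Blinfun_apply)
          have "(u s has_derivative (\<lambda>w. y w s q)) (at q)"
            by (rule y(2)[rule_format, OF that(2)]) (use that in simp)
          then show "bounded_linear (\<lambda>w. y w s q)" by (rule has_derivative_bounded_linear)
        qed
        have "continuous_on ({a'<..<b'} \<times> B) (\<lambda>x. Blinfun (\<lambda>w. y w (fst x) (snd x)))"
        proof (rule continuous_on_blinfun_componentwise)
          fix i :: 'p assume "i \<in> Basis"
          have "continuous_on ({a'<..<b'} \<times> B) (\<lambda>x. y i (fst x) (snd x))"
            using spec[OF y(1), of i] unfolding case_prod_unfold by (rule continuous_on_subset) auto
          then show "continuous_on ({a'<..<b'} \<times> B) (\<lambda>x. blinfun_apply (Blinfun (\<lambda>w. y w (fst x) (snd x))) i)"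
          proof (rule continuous_on_eq)
            fix x assume "x \<in> {a'<..<b'} \<times> B"
            then show "y i (fst x) (snd x) = blinfun_apply (Blinfun (\<lambda>w. y w (fst x) (snd x))) i"
              using bl[of "fst x" "snd x"] by (cases x) simp
          qed
        qed
        then have "continuous_on ({a'<..<b'} \<times> ball p r) (\<lambda>(s, q). Blinfun (\<lambda>w. y w s q))"
          unfolding case_prod_unfold by (rule continuous_on_subset) (use r in auto)
        then have fyc: "continuous (at (t, p) within {a'<..<b'} \<times> ball p r) (\<lambda>(s, q). Blinfun (\<lambda>w. y w s q))"
          using tp r by (auto simp: continuous_on_eq_continuous_within)
        have "((\<lambda>(s, q). u s q) has_derivative (\<lambda>(dt, dp). dt *\<^sub>R H (t, p, u t p) + blinfun_apply (Blinfun (\<lambda>w. y w t p)) dp))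
            (at (t, p) within {a'<..<b'} \<times> ball p r)"
        proof (rule has_derivative_partialsI[OF _ _ fyc])
          show "((\<lambda>s. u s p) has_derivative (\<lambda>dt. dt *\<^sub>R H (t, p, u t p))) (at t within {a'<..<b'})"
            unfolding has_vector_derivative_def[symmetric]
            by (rule has_vector_derivative_at_within[OF sol]) (use a' b' tp in auto)
          show "(u s has_derivative blinfun_apply (Blinfun (\<lambda>w. y w s q))) (at q within ball p r)"
            if "s \<in> {a'<..<b'}" "q \<in> ball p r" for s q
          proof -
            have q: "q \<in> B" using that r by auto
            show ?thesis
              unfolding bl[OF that(1) q]
              by (rule has_derivative_at_withinI[OF y(2)[rule_format, OF q]]) (use that in simp)
          qed
        qed (use r in auto)
        moreover have "at (t, p) within {a'<..<b'} \<times> ball p r = at (t, p)"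
          by (rule at_within_open) (use tp r in \<open>auto intro: open_Times\<close>)
        ultimately show ?thesis
          using bl[OF tp(2,3)] tp(1) by simp
      qed
      fix v :: "real \<times> 'p"
      have Hu: "Ck_open k (\<lambda>x. H (fst x, snd x, (\<lambda>(t, p). u t p) x)) ({a'<..<b'} \<times> B)"
      proof (rule Ck_open_compose[OF op' _ Ck_open_SucD[OF H]])
        show "Ck_open k (\<lambda>x. (fst x, snd x, (\<lambda>(t, p). u t p) x)) ({a'<..<b'} \<times> B)"
          by (intro Ck_open_Pair Ck_open_fst Ck_open_snd Ck_open_id op' uk')
        show "(fst x, snd x, (\<lambda>(t, p). u t p) x) \<in> \<Omega>" if "x \<in> {a'<..<b'} \<times> B" for x
          using graph'[of "fst x" "snd x"] that by (cases x) auto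
      qed
      have "Ck_open k (\<lambda>x. fst v *\<^sub>R H (fst x, snd x, (\<lambda>(t, p). u t p) x) + (\<lambda>(t, p). y (snd v) t p) x) ({a'<..<b'} \<times> B)"
        by (intro Ck_open_add Ck_open_scaleR Ck_open_const op' Hu yk)
      then show "Ck_open k (\<lambda>x. ?D x v) ({a'<..<b'} \<times> B)"
        by (simp add: case_prod_unfold)
    qed
  qed
  show ?case
  proof (rule Ck_open_local)
    fix x assume "x \<in> {a<..<b} \<times> B"
    then obtain t p where x: "x = (t, p)" "a < t" "t < b" "p \<in> B" by (cases x) auto
    \<comment> \<open>Both bounds have to leave room for \<open>t\<close> and for the initial time
      0.\<close>
    define a' b' where "a' = min ((a + t) / 2) (a / 2)" and "b' = max ((t + b) / 2) (b / 2)"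
    have "a < a'" "a' < 0" "0 < b'" "b' < b" "a' < t" "t < b'"
      using ab x by (auto simp: a'_def b'_def min_def max_def)
    then show "\<exists>U. open U \<and> x \<in> U \<and> Ck_open (Suc k) (\<lambda>(t, p). u t p) U"
      using step[of a' b'] x B by (intro exI[of _ "{a'<..<b'} \<times> B"]) (auto simp: open_Times)
  qed
qed

text \<open>Smooth dependence on initial values is dependence on a parameter that enters only
  through the initial condition. The right-hand side is independent of that parameter, so the
  linearised equation reduces to the variational equation of \<open>F\<close>. The times are
  required to be positive and negative so that the flow is smooth on an open set around time
  0.\<close>

theorem smooth_local_flow:
  fixes F :: "'u::euclidean_space \<Rightarrow> 'u"
  assumes W: "open W" and F: "Ck_open k F W" "0 < k" and ab: "a < 0" "0 < b"
    and \<phi>: "solves_ode_on F \<phi> {a..b}" "\<And>t. t \<in> {a..b} \<Longrightarrow> \<phi> t \<in> W"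
  obtains B \<Phi> where "open B" "\<phi> 0 \<in> B" "\<forall>w\<in>B. \<Phi> 0 w = w"
    "\<forall>w\<in>B. solves_ode_on F (\<lambda>t. \<Phi> t w) {a..b}" "\<forall>w\<in>B. \<forall>t\<in>{a..b}. \<Phi> t w \<in> W"
    "\<forall>t\<in>{a..b}. \<Phi> t (\<phi> 0) = \<phi> t"
    "Ck_open k (\<lambda>(t, w). \<Phi> t w) ({a<..<b} \<times> B)"
    "\<forall>w\<in>B. \<forall>t\<in>{a<..<b}. \<forall>v. ((\<lambda>s. frechet_derivative (\<Phi> s) (at w) v) has_vector_derivative
       frechet_derivative F (at (\<Phi> t w)) (frechet_derivative (\<Phi> t) (at w) v)) (at t)"
    "\<forall>w\<in>B. \<forall>t\<in>{a<..<b}. \<Phi> t differentiable (at w)"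
proof -
  obtain j where k: "k = Suc j" using F(2) gr0_implies_Suc by blast
  note F' = F(1)[unfolded k]
  have ab0: "0 \<in> {a..b}" using ab by simp
  obtain B \<Phi> where B: "open B" "\<phi> 0 \<in> B" "\<forall>w\<in>B. \<Phi> 0 w = w"
    "\<forall>w\<in>B. solves_ode_on F (\<lambda>t. \<Phi> t w) {a..b}" "\<forall>w\<in>B. \<forall>t\<in>{a..b}. \<Phi> t w \<in> W"
    "continuous_on ({a..b} \<times> B) (\<lambda>(t, w). \<Phi> t w)"
    by (rule continuous_local_flow[OF W F' ab0 \<phi>])
  have \<Phi>\<phi>: "\<Phi> t (\<phi> 0) = \<phi> t" if "t \<in> {a..b}" for t
    by (rule ode_unique[OF W F' _ \<phi>(1) _ \<phi>(2) ab0 _ that]) (use B in auto)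
  have init: "Ck_open i (\<Phi> 0) B" for i
    by (rule Ck_open_cong_imp[OF B(1) _ Ck_open_id[OF B(1)]]) (use B(3) in simp)
  let ?H = "\<lambda>q :: real \<times> 'u \<times> 'u. F (snd (snd q))"
  let ?\<Omega> = "(UNIV :: real set) \<times> (UNIV :: 'u set) \<times> W"
  have op: "open ?\<Omega>" using W by (simp add: open_Times)
  have H: "Ck_open k ?H ?\<Omega>"
    by (rule Ck_open_compose[OF op _ F(1)]) (intro Ck_open_snd Ck_open_id op, auto)
  have sol: "((\<lambda>s. \<Phi> s w) has_vector_derivative F (\<Phi> t w)) (at t within {a..b})" if "t \<in> {a..b}" "w \<in> B" for t w
    using B(4) that by (auto simp: solves_ode_on_def)
  have int: "at t within {a..b} = at t" if "t \<in> {a<..<b}" for t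
    using that by (intro at_within_interior) auto
  have Ck: "Ck_open k (\<lambda>(t, w). \<Phi> t w) ({a<..<b} \<times> B)"
  proof (rule ode_parameter_Ck[OF B(1) ab op H])
    show "continuous_on ({a<..<b} \<times> B) (\<lambda>(t, w). \<Phi> t w)" by (rule continuous_on_subset[OF B(6)]) auto
    show "((\<lambda>s. \<Phi> s w) has_vector_derivative ?H (t, w, \<Phi> t w)) (at t)" if "t \<in> {a<..<b}" "w \<in> B" for t w
      using sol[of t w] int[OF that(1)] that by simp
  qed (use B(5) init in auto)
  obtain y where y: "\<forall>v. continuous_on ({a..b} \<times> B) (\<lambda>(t, w). y v t w)"
      "\<forall>w\<in>B. \<forall>t\<in>{a..b}. (\<Phi> t has_derivative (\<lambda>v. y v t w)) (at w)"
      "\<forall>v. \<forall>w\<in>B. \<forall>t\<in>{a..b}. ((\<lambda>s. y v s w) has_vector_derivative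
         frechet_derivative ?H (at (t, w, \<Phi> t w)) (0, v, y v t w)) (at t within {a..b})"
      "\<forall>v. \<forall>w\<in>B. y v 0 w = frechet_derivative (\<Phi> 0) (at w) v"
    by (rule ode_parameter_derivative[OF B(1) op H[unfolded k] ab0 B(6) _ _ init[of "Suc 0"]]) (use B(5) sol in auto)
  have fy: "frechet_derivative (\<Phi> t) (at w) = (\<lambda>v. y v t w)" if "t \<in> {a..b}" "w \<in> B" for t w
    by (rule frechet_derivative_eq) (use y(2) that in auto)
  have FH: "frechet_derivative ?H (at (t, w, x)) (0, v, z) = frechet_derivative F (at x) z" if "x \<in> W" for t w x v z
  proof -
    have "((\<lambda>q :: real \<times> 'u \<times> 'u. snd (snd q)) has_derivative (\<lambda>q. snd (snd q))) (at (t, w, x))"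
      by (intro has_derivative_snd has_derivative_ident)
    from has_derivative_compose[OF this, of F "frechet_derivative F (at x)"]
    have "(?H has_derivative (\<lambda>q. frechet_derivative F (at x) (snd (snd q)))) (at (t, w, x))"
      using Ck_open_has_derivative[OF F' that] by simp
    from frechet_derivative_eq[OF this] show ?thesis by simp
  qed
  have var: "((\<lambda>s. frechet_derivative (\<Phi> s) (at w) v) has_vector_derivative
       frechet_derivative F (at (\<Phi> t w)) (frechet_derivative (\<Phi> t) (at w) v)) (at t)"
    if w: "w \<in> B" and t: "t \<in> {a<..<b}" for w t v
  proof -
    have "((\<lambda>s. y v s w) has_vector_derivative frechet_derivative ?H (at (t, w, \<Phi> t w)) (0, v, y v t w)) (at t)"
      unfolding int[OF t, symmetric] by (rule y(3)[rule_format, OF w]) (use t in simp)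
    then have "((\<lambda>s. y v s w) has_vector_derivative frechet_derivative F (at (\<Phi> t w)) (y v t w)) (at t)"
      using FH[of "\<Phi> t w"] B(5) w t by simp
    then have "((\<lambda>s. frechet_derivative (\<Phi> s) (at w) v) has_vector_derivative frechet_derivative F (at (\<Phi> t w)) (y v t w)) (at t)"
      by (rule has_vector_derivative_transform_within_open[OF _ open_greaterThanLessThan t]) (use fy w in auto)
    then show ?thesis using fy[of t w] w t by simp
  qed
  have "\<Phi> t differentiable (at w)" if "w \<in> B" "t \<in> {a<..<b}" for t w
    unfolding differentiable_def by (rule exI, rule y(2)[rule_format, OF that(1)]) (use that in simp)
  then show thesis
    by (intro that[OF B(1-5) _ Ck] ballI allI \<Phi>\<phi> var)
qed

section \<open>Characteristic polynomials of endomorphisms\<close>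

text \<open>The enumeration behind \<open>complex_matrix_of\<close> is fixed by choice, so its order
  on a product type is unknown. Allowing every enumeration makes it possible to pass to one in which
  matrices have block form.\<close>

definition basis_enum :: "(nat \<Rightarrow> 'z::euclidean_space) \<Rightarrow> bool" where
  "basis_enum b \<longleftrightarrow> bij_betw b {..<DIM('z)} Basis"

definition rep_mat :: "(nat \<Rightarrow> 'z::euclidean_space) \<Rightarrow> (nat \<Rightarrow> 'y::euclidean_space) \<Rightarrow> ('y \<Rightarrow> 'z) \<Rightarrow> complex mat" where
  "rep_mat b b' L = Matrix.mat DIM('z) DIM('y) (\<lambda>(i, j). complex_of_real (b i \<bullet> L (b' j)))"

lemma rep_mat_carrier [simp]:
  "rep_mat (b :: nat \<Rightarrow> 'z::euclidean_space) (b' :: nat \<Rightarrow> 'y::euclidean_space) L \<in> carrier_mat DIM('z) DIM('y)"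
  by (simp add: rep_mat_def)

lemma basis_enum_from_nat_into: "basis_enum (from_nat_into (Basis :: 'z::euclidean_space set))"
  unfolding basis_enum_def by (rule bij_betw_from_nat_into_finite) simp

lemma complex_matrix_of_rep_mat:
  "complex_matrix_of A = rep_mat (from_nat_into Basis) (from_nat_into Basis) A"
  by (simp add: complex_matrix_of_def rep_mat_def)

lemma basis_enum_inner:
  assumes "basis_enum (b :: nat \<Rightarrow> 'z::euclidean_space)" "i < DIM('z)" "j < DIM('z)"
  shows "b i \<bullet> b j = (if i = j then 1 else 0)"
proof -
  have "b i \<in> Basis" "b j \<in> Basis" "b i = b j \<longleftrightarrow> i = j"
    using assms unfolding basis_enum_def bij_betw_def inj_on_def by auto
  then show ?thesis by (simp add: inner_Basis)
qed

lemma basis_enum_sum: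
  assumes "basis_enum (b :: nat \<Rightarrow> 'z::euclidean_space)"
  shows "(\<Sum>k<DIM('z). (b k \<bullet> v) *\<^sub>R b k) = v"
proof -
  have "(\<Sum>k<DIM('z). (b k \<bullet> v) *\<^sub>R b k) = (\<Sum>i\<in>Basis. (i \<bullet> v) *\<^sub>R i)"
    by (rule sum.reindex_bij_betw) (use assms in \<open>simp add: basis_enum_def\<close>)
  then show ?thesis by (simp add: inner_commute[of _ v] euclidean_representation)
qed

lemma rep_mat_mult:
  fixes b :: "nat \<Rightarrow> 'x::euclidean_space" and b' :: "nat \<Rightarrow> 'y::euclidean_space" and b'' :: "nat \<Rightarrow> 'z::euclidean_space"
  assumes b': "basis_enum b'" and L: "linear L"
  shows "rep_mat b b' L * rep_mat b' b'' K = rep_mat b b'' (\<lambda>v. L (K v))"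
proof (rule eq_matI)
  fix i j assume "i < dim_row (rep_mat b b'' (\<lambda>v. L (K v)))" "j < dim_col (rep_mat b b'' (\<lambda>v. L (K v)))"
  then have ij: "i < DIM('x)" "j < DIM('z)" by (auto simp: rep_mat_def)
  have "(rep_mat b b' L * rep_mat b' b'' K) $$ (i, j)
      = (\<Sum>k<DIM('y). complex_of_real ((b i \<bullet> L (b' k)) * (b' k \<bullet> K (b'' j))))"
    using ij by (simp add: rep_mat_def scalar_prod_def lessThan_atLeast0)
  also have "\<dots> = complex_of_real (b i \<bullet> L (\<Sum>k<DIM('y). (b' k \<bullet> K (b'' j)) *\<^sub>R b' k))"
    by (simp add: linear_sum[OF L] linear_scale[OF L] inner_sum_right mult.commute)
  also have "\<dots> = rep_mat b b'' (\<lambda>v. L (K v)) $$ (i, j)"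
    using ij by (simp add: rep_mat_def basis_enum_sum[OF b'])
  finally show "(rep_mat b b' L * rep_mat b' b'' K) $$ (i, j) = rep_mat b b'' (\<lambda>v. L (K v)) $$ (i, j)" .
qed (auto simp: rep_mat_def)

lemma rep_mat_ident:
  assumes "basis_enum (b :: nat \<Rightarrow> 'z::euclidean_space)"
  shows "rep_mat b b (\<lambda>v. v) = 1\<^sub>m DIM('z)"
  by (rule eq_matI) (auto simp: rep_mat_def basis_enum_inner[OF assms])

text \<open>Covers a linear change of coordinates and, for \<open>L\<close> the identity, a change
  of enumeration.\<close>

lemma char_poly_rep_mat_conj:
  fixes b b' :: "nat \<Rightarrow> 'z::euclidean_space"
  assumes b: "basis_enum b" "basis_enum b'" and lin: "linear L" "linear L'" "linear M"
    and inv: "\<And>v. L (L' v) = v" "\<And>v. L' (L v) = v"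
  shows "char_poly (rep_mat b b M) = char_poly (rep_mat b' b' (\<lambda>v. L' (M (L v))))"
proof (rule char_poly_similar)
  have MoL: "linear (\<lambda>v. M (L v))" using linear_compose[OF lin(1,3)] by (simp add: o_def)
  have LML: "linear (\<lambda>v. L' (M (L v)))" using linear_compose[OF MoL lin(2)] by (simp add: o_def)
  have "rep_mat b b' L * rep_mat b' b' (\<lambda>v. L' (M (L v))) * rep_mat b' b L' = rep_mat b b M"
    unfolding rep_mat_mult[OF b(2) lin(1)] inv
    by (simp add: rep_mat_mult[OF b(2) MoL] inv)
  moreover have "rep_mat b b' L * rep_mat b' b L' = 1\<^sub>m DIM('z)" "rep_mat b' b L' * rep_mat b b' L = 1\<^sub>m DIM('z)"
    by (simp_all only: rep_mat_mult[OF b(2) lin(1)] rep_mat_mult[OF b(1) lin(2)] inv rep_mat_ident[OF b(1)] rep_mat_ident[OF b(2)])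
  ultimately have "similar_mat_wit (rep_mat b b M) (rep_mat b' b' (\<lambda>v. L' (M (L v)))) (rep_mat b b' L) (rep_mat b' b L')"
    unfolding similar_mat_wit_def Let_def by (auto simp: rep_mat_def)
  then show "similar_mat (rep_mat b b M) (rep_mat b' b' (\<lambda>v. L' (M (L v))))"
    unfolding similar_mat_def by blast
qed

definition cpoly :: "('z::euclidean_space \<Rightarrow> 'z) \<Rightarrow> complex poly" where
  "cpoly A = char_poly (complex_matrix_of A)"

lemma cpoly_rep_mat:
  assumes "basis_enum b" "linear A"
  shows "cpoly A = char_poly (rep_mat b b A)"
  unfolding cpoly_def complex_matrix_of_rep_mat
  using char_poly_rep_mat_conj[OF basis_enum_from_nat_into assms(1) linear_ident linear_ident assms(2)] by simp

lemma cpoly_conj: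
  fixes L L' M :: "'z::euclidean_space \<Rightarrow> 'z"
  assumes "linear L" "linear L'" "linear M" "\<And>v. L (L' v) = v" "\<And>v. L' (L v) = v"
  shows "cpoly M = cpoly (\<lambda>v. L' (M (L v)))"
  unfolding cpoly_def complex_matrix_of_rep_mat
  by (rule char_poly_rep_mat_conj[OF basis_enum_from_nat_into basis_enum_from_nat_into assms(1-3)])
    (rule assms(4,5))+

lemma cpoly_nonzero: "cpoly A \<noteq> 0"
proof -
  have "coeff (cpoly A) DIM('a) = 1" for A :: "'a::euclidean_space \<Rightarrow> 'a"
    unfolding cpoly_def complex_matrix_of_rep_mat using degree_monic_char_poly[OF rep_mat_carrier] by blast
  then show ?thesis by (metis coeff_0 zero_neq_one)
qed

lemma hyperbolic_cong_cpoly: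
  "cpoly A = cpoly B \<Longrightarrow> hyperbolic_apart_from_ones k A \<longleftrightarrow> hyperbolic_apart_from_ones k B"
  by (simp add: hyperbolic_apart_from_ones_def eigenvalue_mset_def cpoly_def)

text \<open>Deleting one copy of the trivial eigenvalue leaves exactly the roots of
  \<open>q\<close>, so that 1 itself is forbidden as a root of \<open>q\<close>.\<close>

lemma hyperbolic_iff_cofactor:
  assumes "cpoly M = [:- 1, 1:] * q"
  shows "hyperbolic_apart_from_ones 1 M \<longleftrightarrow> (\<forall>\<mu>. cmod \<mu> = 1 \<longrightarrow> poly q \<mu> \<noteq> 0)"
proof -
  have q: "q \<noteq> 0" using assms cpoly_nonzero[of M] by auto
  have "eigenvalue_mset M = {#1#} + proots q"
    using assms q by (simp add: eigenvalue_mset_def cpoly_def[symmetric] proots_mult del: mult_pCons_left)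
  then show ?thesis
    using q by (auto simp: hyperbolic_apart_from_ones_def)
qed

text \<open>The new basis vector comes first, which puts the one-dimensional block into the upper
  left corner.\<close>

definition adjoin :: "(nat \<Rightarrow> 'a::euclidean_space) \<Rightarrow> nat \<Rightarrow> 'a \<times> real" where
  "adjoin b i = (if i = 0 then (0, 1) else (b (i - 1), 0))"

lemma basis_enum_adjoin:
  assumes "basis_enum (b :: nat \<Rightarrow> 'a::euclidean_space)"
  shows "basis_enum (adjoin b)"
proof -
  have b: "inj_on b {..<DIM('a)}" "b ` {..<DIM('a)} = Basis"
    using assms by (auto simp: basis_enum_def bij_betw_def)
  have s: "{..<DIM('a \<times> real)} = insert 0 (Suc ` {..<DIM('a)})"
    by (auto simp: image_iff less_Suc_eq_0_disj)
  have "inj_on (adjoin b) {..<DIM('a \<times> real)}"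
  proof (rule inj_onI)
    fix i j assume ij: "i \<in> {..<DIM('a \<times> real)}" "j \<in> {..<DIM('a \<times> real)}" "adjoin b i = adjoin b j"
    show "i = j"
    proof (cases "i = 0 \<or> j = 0")
      case True
      then show ?thesis using ij(3) by (auto simp: adjoin_def split: if_splits)
    next
      case False
      then have "b (i - 1) = b (j - 1)" using ij(3) by (simp add: adjoin_def)
      then have "i - 1 = j - 1" by (rule inj_onD[OF b(1)]) (use ij False in auto)
      then show ?thesis using False by (cases i; cases j) simp_all
    qed
  qed
  moreover have "adjoin b 0 = (0, 1)" "adjoin b (Suc i) = (b i, 0)" for i by (simp_all add: adjoin_def)
  then have "adjoin b ` {..<DIM('a \<times> real)} = insert (0, 1) ((\<lambda>x. (x, 0)) ` (b ` {..<DIM('a)}))"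
    unfolding s image_insert image_image by simp
  then have "adjoin b ` {..<DIM('a \<times> real)} = Basis"
    unfolding b(2) by (auto simp: Basis_prod_def)
  ultimately show ?thesis by (simp add: basis_enum_def bij_betw_def)
qed

lemma char_poly_singleton_one: "char_poly (Matrix.mat 1 1 (\<lambda>_. 1 :: complex)) = [:- 1, 1:]"
  by (simp add: char_poly_defs det_def sign_def)

text \<open>The map fixes \<open>(0, 1)\<close>; in the basis that starts with this vector, the
  first column vanishes below the diagonal.\<close>

lemma cpoly_block_lower:
  fixes A :: "'a::euclidean_space \<Rightarrow> 'a" and l :: "'a \<Rightarrow> real"
  assumes A: "linear A" and l: "linear l"
  shows "cpoly (\<lambda>(v, s). (A v, l v + s)) = [:- 1, 1:] * cpoly A"
proof -
  define b where "b = from_nat_into (Basis :: 'a set)"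
  have b: "basis_enum b" unfolding b_def by (rule basis_enum_from_nat_into)
  let ?T = "\<lambda>(v, s). (A v, l v + s)"
  have T: "linear ?T"
    by (rule linearI) (auto simp: linear_add[OF A] linear_add[OF l] linear_scale[OF A] linear_scale[OF l] algebra_simps)
  let ?A1 = "Matrix.mat 1 1 (\<lambda>_. 1 :: complex)"
  let ?A2 = "Matrix.mat 1 DIM('a) (\<lambda>(i, j). complex_of_real (l (b j)))"
  have "rep_mat (adjoin b) (adjoin b) ?T = four_block_mat ?A1 ?A2 (0\<^sub>m DIM('a) 1) (rep_mat b b A)"
    by (rule eq_matI)
      (auto simp: rep_mat_def adjoin_def linear_0[OF A] linear_0[OF l])
  then have "cpoly ?T = char_poly ?A1 * char_poly (rep_mat b b A)"
    using char_poly_four_block_zeros_col[of ?A1 ?A2 "DIM('a)" "rep_mat b b A"]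
      cpoly_rep_mat[OF basis_enum_adjoin[OF b] T] by simp
  then show ?thesis
    using cpoly_rep_mat[OF b A] char_poly_singleton_one by simp
qed

text \<open>Here the coordinate \<open>s\<close> is preserved, so a row vanishes instead of a
  column; transposing leads back to a vanishing column.\<close>

lemma cpoly_block_upper:
  fixes A :: "'a::euclidean_space \<Rightarrow> 'a" and w :: 'a
  assumes A: "linear A"
  shows "cpoly (\<lambda>(v, s). (A v + s *\<^sub>R w, s)) = [:- 1, 1:] * cpoly A"
proof -
  define b where "b = from_nat_into (Basis :: 'a set)"
  have b: "basis_enum b" unfolding b_def by (rule basis_enum_from_nat_into)
  let ?T = "\<lambda>(v, s). (A v + s *\<^sub>R w, s)"
  have T: "linear ?T"
    by (rule linearI) (auto simp: linear_add[OF A] linear_scale[OF A] algebra_simps)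
  let ?A1 = "Matrix.mat 1 1 (\<lambda>_. 1 :: complex)"
  let ?A2 = "Matrix.mat 1 DIM('a) (\<lambda>(i, j). complex_of_real (b j \<bullet> w))"
  have "transpose_mat (rep_mat (adjoin b) (adjoin b) ?T)
      = four_block_mat ?A1 ?A2 (0\<^sub>m DIM('a) 1) (transpose_mat (rep_mat b b A))"
    by (rule eq_matI)
      (auto simp: rep_mat_def adjoin_def linear_0[OF A])
  then have "char_poly (transpose_mat (rep_mat (adjoin b) (adjoin b) ?T)) = char_poly ?A1 * char_poly (transpose_mat (rep_mat b b A))"
    using char_poly_four_block_zeros_col[of ?A1 ?A2 "DIM('a)" "transpose_mat (rep_mat b b A)"]
    by simp
  then have "cpoly ?T = char_poly ?A1 * char_poly (rep_mat b b A)"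
    unfolding cpoly_rep_mat[OF basis_enum_adjoin[OF b] T] char_poly_transpose_mat[OF rep_mat_carrier] .
  then show ?thesis
    using cpoly_rep_mat[OF b A] char_poly_singleton_one by simp
qed

text \<open>Applied in the contrapositive: if 1 is not a root, then \<open>A - 1\<close> is
  injective.\<close>

lemma cpoly_fixed_vector:
  fixes A :: "'a::euclidean_space \<Rightarrow> 'a"
  assumes A: "linear A" and w: "A w = w" "w \<noteq> 0"
  shows "poly (cpoly A) 1 = 0"
proof -
  define b where "b = from_nat_into (Basis :: 'a set)"
  have b: "basis_enum b" unfolding b_def by (rule basis_enum_from_nat_into)
  \<comment> \<open>The vector \<open>w\<close> is represented as the one-column matrix of this map,
    so that the product rule for \<open>rep_mat\<close> covers its image under \<open>A\<close> too;
    \<open>?o\<close> enumerates the basis of the reals.\<close>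
  let ?K = "\<lambda>t :: real. t *\<^sub>R w"
  let ?o = "\<lambda>_ :: nat. 1 :: real"
  let ?v = "col (rep_mat b ?o ?K) 0"
  have "rep_mat b b A * rep_mat b ?o ?K = rep_mat b ?o ?K"
    using rep_mat_mult[OF b A, of b ?o ?K] w(1) by (simp add: linear_scale[OF A])
  then have "col (rep_mat b b A * rep_mat b ?o ?K) 0 = ?v" by simp
  then have "rep_mat b b A *\<^sub>v ?v = ?v"
    using col_mult2[OF rep_mat_carrier rep_mat_carrier, of 0 b b A b ?o ?K] by simp
  moreover have "?v \<noteq> 0\<^sub>v DIM('a)"
  proof
    assume v: "?v = 0\<^sub>v DIM('a)"
    have "b i \<bullet> w = 0" if "i < DIM('a)" for i
    proof -
      have "vec_index ?v i = 0" unfolding v using that by simp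
      moreover have "vec_index ?v i = complex_of_real (b i \<bullet> w)" using that by (simp add: rep_mat_def)
      ultimately show ?thesis by simp
    qed
    then have "w = 0" using basis_enum_sum[OF b, of w] by simp
    then show False using w(2) by simp
  qed
  ultimately have "eigenvector (rep_mat b b A) ?v 1"
    unfolding eigenvector_def by (auto simp: rep_mat_def)
  then show ?thesis
    using eigenvalue_root_char_poly[OF rep_mat_carrier, of b b A 1] cpoly_rep_mat[OF b A]
    by (auto simp: eigenvalue_def)
qed

text \<open>By the Leibniz formula the value is a polynomial in the matrix entries and
  \<mu>.\<close>

lemma continuous_on_poly_cpoly:
  fixes A :: "'p::topological_space \<Rightarrow> 'a::euclidean_space \<Rightarrow> 'a"
  assumes "\<And>v. continuous_on B (\<lambda>p. A p v)"
  shows "continuous_on (B \<times> UNIV) (\<lambda>(p, \<mu>). poly (cpoly (A p)) \<mu>)"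
proof -
  let ?n = "DIM('a)"
  define b where "b = from_nat_into (Basis :: 'a set)"
  let ?e = "\<lambda>x i j. (if i = j then snd x else 0) - complex_of_real (b i \<bullet> A (fst x) (b j))"
  have "poly (cpoly (A p)) \<mu> = (\<Sum>\<pi> | \<pi> permutes {0..<?n}. signof \<pi> * (\<Prod>i=0..<?n. ?e (p, \<mu>) i (\<pi> i)))" for p \<mu>
  proof -
    have "poly (cpoly (A p)) \<mu> = det (- char_matrix (rep_mat b b (A p)) \<mu>)"
      unfolding cpoly_def complex_matrix_of_rep_mat b_def by (rule char_poly_matrix[OF rep_mat_carrier])
    also have "\<dots> = (\<Sum>\<pi> | \<pi> permutes {0..<?n}. signof \<pi> * (\<Prod>i=0..<?n. (- char_matrix (rep_mat b b (A p)) \<mu>) $$ (i, \<pi> i)))"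
      by (rule det_def') (auto simp: char_matrix_def rep_mat_def)
    also have "\<dots> = (\<Sum>\<pi> | \<pi> permutes {0..<?n}. signof \<pi> * (\<Prod>i=0..<?n. ?e (p, \<mu>) i (\<pi> i)))"
    proof (intro sum.cong refl arg_cong2[where f = "(*)"] prod.cong)
      fix \<pi> i assume "\<pi> \<in> {\<pi>. \<pi> permutes {0..<?n}}" "i \<in> {0..<?n}"
      then have "\<pi> i < ?n" "i < ?n" using permutes_in_image[of \<pi> "{0..<?n}" i] by auto
      then show "(- char_matrix (rep_mat b b (A p)) \<mu>) $$ (i, \<pi> i) = ?e (p, \<mu>) i (\<pi> i)"
        by (simp add: char_matrix_def rep_mat_def)
    qed
    finally show ?thesis .
  qed
  moreover have "continuous_on (B \<times> UNIV) (\<lambda>x. \<Sum>\<pi> | \<pi> permutes {0..<?n}. signof \<pi> * (\<Prod>i=0..<?n. ?e x i (\<pi> i)))"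
  proof (intro continuous_on_sum continuous_on_mult continuous_on_const continuous_on_prod continuous_on_diff
        continuous_on_of_real continuous_on_inner)
    show "continuous_on (B \<times> UNIV) (\<lambda>x. if i = j then snd x else 0)" for i j :: nat
      by (cases "i = j") (auto intro: continuous_intros)
    show "continuous_on (B \<times> UNIV) (\<lambda>x. A (fst x) v)" for v
      by (rule continuous_on_compose2[OF assms]) (auto intro: continuous_intros)
  qed
  ultimately show ?thesis by (simp add: case_prod_unfold cong: if_cong)
qed

text \<open>Here \<open>f\<close> plays the flow direction and the kernel of \<open>l\<close> the
  tangent space of a section. The kernel has the dimension of the horizontal hyperplane, hence is a
  linear copy of it, and transversality \<open>l f \<noteq> 0\<close> makes \<open>f\<close> a
  complement.\<close>

lemma adapted_coordinates:
  fixes f :: "'a::euclidean_space \<times> real" and l :: "'a \<times> real \<Rightarrow> real"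
  assumes l: "linear l" and f: "l f \<noteq> 0"
  obtains L L' :: "'a \<times> real \<Rightarrow> 'a \<times> real" where "linear L" "linear L'" "\<forall>v. L (L' v) = v" "\<forall>v. L' (L v) = v"
    "L (0, 1) = f" "\<forall>v. l (L (v, 0)) = 0"
proof -
  let ?S = "{v :: 'a \<times> real. snd v = 0}" and ?T = "{v. l v = 0}"
  define w where "w = adjoint l 1"
  have lw: "l v = w \<bullet> v" for v
    using adjoint_works[OF l, of v 1] by (simp add: w_def inner_commute)
  have w: "w \<noteq> 0" using f lw by auto
  have S: "subspace ?S" and T: "subspace ?T"
    by (auto simp: subspace_def linear_0[OF l] linear_add[OF l] linear_scale[OF l])
  have S': "?S = {v. ((0, 1) :: 'a \<times> real) \<bullet> v = 0}" by (auto simp: inner_prod_def)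
  have T': "?T = {v. w \<bullet> v = 0}" by (simp add: lw)
  have "dim ?S = dim ?T"
    unfolding S' T' using dim_hyperplane[of "(0, 1) :: 'a \<times> real"] dim_hyperplane[OF w] by (simp add: zero_prod_def)
  then obtain g g' where g: "linear g" "linear g'" "g ` ?S = ?T" "g' ` ?T = ?S"
    "\<And>x. x \<in> ?S \<Longrightarrow> g' (g x) = x" "\<And>x. x \<in> ?T \<Longrightarrow> g (g' x) = x"
    by (rule isometries_subspaces[OF S T]) blast
  define L where "L = (\<lambda>v. g (fst v, 0) + snd v *\<^sub>R f)"
  define c where "c = (\<lambda>v. l v / l f)"
  define L' where "L' = (\<lambda>v. (fst (g' (v - c v *\<^sub>R f)), c v))"
  have c: "c (u + v) = c u + c v" "c (r *\<^sub>R v) = r * c v" for u v r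
    by (simp_all add: c_def linear_add[OF l] linear_scale[OF l] add_divide_distrib)
  have gT: "l (g (v, 0)) = 0" for v using g(3) by auto
  have in_T: "v - c v *\<^sub>R f \<in> ?T" for v
    using f by (simp add: c_def linear_diff[OF l] linear_scale[OF l])
  show thesis
  proof (rule that[of L L'])
    show "linear L"
    proof (rule linearI)
      show "L (u + v) = L u + L v" for u v
        using linear_add[OF g(1), of "(fst u, 0)" "(fst v, 0)"] by (simp add: L_def algebra_simps)
      show "L (r *\<^sub>R v) = r *\<^sub>R L v" for r v
        using linear_scale[OF g(1), of r "(fst v, 0)"] by (simp add: L_def algebra_simps)
    qed
    show "linear L'"
    proof (rule linearI)
      show "L' (u + v) = L' u + L' v" for u v
        using linear_add[OF g(2), of "u - c u *\<^sub>R f" "v - c v *\<^sub>R f"] by (simp add: L'_def c algebra_simps)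
      show "L' (r *\<^sub>R v) = r *\<^sub>R L' v" for r v
        using linear_scale[OF g(2), of r "v - c v *\<^sub>R f"] by (simp add: L'_def c algebra_simps)
    qed
    show "\<forall>v. L (L' v) = v"
    proof
      fix v
      have "g' (v - c v *\<^sub>R f) \<in> ?S" using g(4) in_T by blast
      then have "(fst (g' (v - c v *\<^sub>R f)), 0) = g' (v - c v *\<^sub>R f)" by (simp add: prod_eq_iff)
      then show "L (L' v) = v" using g(6)[OF in_T] by (simp add: L_def L'_def)
    qed
    show "\<forall>v. L' (L v) = v"
    proof
      fix v :: "'a \<times> real"
      have "c (L v) = snd v"
        using f by (simp add: c_def L_def linear_add[OF l] linear_scale[OF l] gT)
      moreover have "L v - snd v *\<^sub>R f = g (fst v, 0)" by (simp add: L_def)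
      ultimately show "L' (L v) = v" using g(5)[of "(fst v, 0)"] by (simp add: L'_def)
    qed
    show "L (0, 1) = f" using linear_0[OF g(1)] by (simp add: L_def zero_prod_def)
    show "\<forall>v. l (L (v, 0)) = 0" by (simp add: L_def gT)
  qed
qed

text \<open>The conjugated map fixes \<open>(0, 1)\<close>, so the block formula applies. The
  remaining block is the map induced by \<open>M\<close> modulo the flow direction, that is, the
  linearised return map.\<close>

lemma cpoly_adapted:
  fixes M L L' :: "'a::euclidean_space \<times> real \<Rightarrow> 'a \<times> real"
  assumes lin: "linear L" "linear L'" "linear M" and inv: "\<forall>v. L (L' v) = v" "\<forall>v. L' (L v) = v"
    and f: "L (0, 1) = f" "M f = f"
  shows "cpoly M = [:- 1, 1:] * cpoly (\<lambda>v. fst (L' (M (L (v, 0)))))"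
    and "linear (\<lambda>v. fst (L' (M (L (v, 0)))))"
proof -
  define A where "A = (\<lambda>v. fst (L' (M (L (v, 0)))))"
  define l where "l = (\<lambda>v. snd (L' (M (L (v, 0)))))"
  have LML: "linear (\<lambda>v. L' (M (L v)))"
    using linear_compose[OF linear_compose[OF lin(1,3)] lin(2)] by (simp add: o_def)
  have emb: "linear (\<lambda>v :: 'a. (v, 0 :: real))" by (rule linearI) auto
  have A: "linear A"
    using linear_compose[OF linear_compose[OF emb LML] linear_fst] by (simp add: A_def o_def)
  have l: "linear l"
    using linear_compose[OF linear_compose[OF emb LML] linear_snd] by (simp add: l_def o_def)
  have "(\<lambda>v. L' (M (L v))) = (\<lambda>(v, s). (A v, l v + s))"
  proof
    fix x :: "'a \<times> real"
    obtain v s where x: "x = (v, s)" by (cases x)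
    have "L' (M (L (v, s))) = L' (M (L ((v, 0) + s *\<^sub>R (0, 1))))" by simp
    also have "\<dots> = L' (M (L (v, 0))) + s *\<^sub>R L' (M (L (0, 1)))"
      by (simp only: linear_add[OF LML] linear_scale[OF LML])
    also have "L' (M (L (0, 1))) = (0, 1)" using f inv(2) by metis
    finally show "L' (M (L x)) = (\<lambda>(v, s). (A v, l v + s)) x"
      by (simp add: x A_def l_def prod_eq_iff)
  qed
  then show "cpoly M = [:- 1, 1:] * cpoly (\<lambda>v. fst (L' (M (L (v, 0)))))"
    using cpoly_conj[OF lin inv[rule_format]] cpoly_block_lower[OF A l] unfolding A_def by simp
  show "linear (\<lambda>v. fst (L' (M (L (v, 0)))))" using A unfolding A_def .
qed

text \<open>The linear statement behind the implicit function theorem for closed orbits, with point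
  and period as unknowns. Such a \<open>v\<close> is tangent to the section and fixed modulo the
  flow direction; since 1 is not an eigenvalue of the quotient map, it vanishes.\<close>

lemma hyperbolic_transverse_injective:
  fixes M :: "'a::euclidean_space \<times> real \<Rightarrow> 'a \<times> real" and l :: "'a \<times> real \<Rightarrow> real"
  assumes M: "linear M" "M f = f" "hyperbolic_apart_from_ones 1 M"
    and l: "linear l" "l f \<noteq> 0" and v: "M v - v = c *\<^sub>R f" "l v = 0"
  shows "v = 0 \<and> c = 0"
proof -
  obtain L L' :: "'a \<times> real \<Rightarrow> 'a \<times> real" where L: "linear L" "linear L'" "\<forall>v. L (L' v) = v" "\<forall>v. L' (L v) = v"
    "L (0, 1) = f" "\<forall>v. l (L (v, 0)) = 0"
    by (rule adapted_coordinates[OF l])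
  note cp = cpoly_adapted[OF L(1,2) M(1) L(3,4,5) M(2)]
  define w where "w = fst (L' v)"
  have "v = L (w, snd (L' v))" unfolding w_def prod.collapse using L(3)[rule_format, of v] by (rule sym)
  also have "(w, snd (L' v)) = (w, 0) + snd (L' v) *\<^sub>R (0, 1)" by simp
  finally have "v = L (w, 0) + snd (L' v) *\<^sub>R f"
    using L(5) by (simp only: linear_add[OF L(1)] linear_scale[OF L(1)])
  moreover have "snd (L' v) = 0"
  proof -
    have "l (L (w, 0) + snd (L' v) *\<^sub>R f) = snd (L' v) * l f"
      using L(6) by (simp add: linear_add[OF l(1)] linear_scale[OF l(1)])
    then show ?thesis using v(2) l(2) \<open>v = L (w, 0) + snd (L' v) *\<^sub>R f\<close> by simp
  qed
  ultimately have vw: "v = L (w, 0)" by simp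
  have "fst (L' (M (L (w, 0)))) = w"
  proof -
    have "M (L (w, 0)) = L (w, 0) + c *\<^sub>R L (0, 1)" using v(1) vw L(5) by (simp add: algebra_simps)
    also have "\<dots> = L ((w, 0) + c *\<^sub>R (0, 1))" by (simp only: linear_add[OF L(1)] linear_scale[OF L(1)])
    finally show ?thesis using L(4) by simp
  qed
  moreover have "poly (cpoly (\<lambda>v. fst (L' (M (L (v, 0)))))) 1 \<noteq> 0"
    using hyperbolic_iff_cofactor[OF cp(1)] M(3) by auto
  ultimately have "w = 0" using cpoly_fixed_vector[OF cp(2), of w] by blast
  then have v0: "v = 0" using vw linear_0[OF L(1)] by (simp add: zero_prod_def)
  then have "c *\<^sub>R f = 0" using v(1) linear_0[OF M(1)] by simp
  moreover have "f \<noteq> 0" using l linear_0[OF l(1)] by auto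
  ultimately show ?thesis using v0 by simp
qed

text \<open>The quotient of \<open>M \<alpha>\<close> by \<open>f \<alpha>\<close> varies
  continuously in suitable coordinates, and having no eigenvalue on the compact unit circle is an
  open condition.\<close>

lemma hyperbolic_persists:
  fixes M :: "real \<Rightarrow> 'a::euclidean_space \<times> real \<Rightarrow> 'a \<times> real"
  assumes I: "open I" "\<alpha>\<^sub>0 \<in> I" and M: "\<And>\<alpha>. \<alpha> \<in> I \<Longrightarrow> linear (M \<alpha>)" "\<And>\<alpha>. \<alpha> \<in> I \<Longrightarrow> M \<alpha> (f \<alpha>) = f \<alpha>"
    and cont: "\<And>v. continuous_on I (\<lambda>\<alpha>. M \<alpha> v)" "continuous_on I f"
    and f: "f \<alpha>\<^sub>0 \<noteq> 0" and hyp: "hyperbolic_apart_from_ones 1 (M \<alpha>\<^sub>0)"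
  obtains \<delta> where "0 < \<delta>" "ball \<alpha>\<^sub>0 \<delta> \<subseteq> I" "\<forall>\<alpha>\<in>ball \<alpha>\<^sub>0 \<delta>. hyperbolic_apart_from_ones 1 (M \<alpha>)"
proof -
  have "linear (\<lambda>v. f \<alpha>\<^sub>0 \<bullet> v)" by (rule linearI) (auto simp: inner_add_right)
  moreover have "f \<alpha>\<^sub>0 \<bullet> f \<alpha>\<^sub>0 \<noteq> 0" using f by simp
  ultimately obtain L L' :: "'a \<times> real \<Rightarrow> 'a \<times> real" where L: "linear L" "linear L'" "\<forall>v. L (L' v) = v" "\<forall>v. L' (L v) = v"
    "L (0, 1) = f \<alpha>\<^sub>0" "\<forall>v. f \<alpha>\<^sub>0 \<bullet> L (v, 0) = 0"
    by (rule adapted_coordinates)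
  define k where "k = (\<lambda>\<alpha>. fst (L' (f \<alpha>)))"
  define m where "m = (\<lambda>\<alpha>. snd (L' (f \<alpha>)))"
  \<comment> \<open>The quotient map in coordinates frozen at \<open>\<alpha>\<^sub>0\<close>,
    corrected by a shear because \<open>f \<alpha>\<close> has moved from \<open>(0, 1)\<close> to
    \<open>(k \<alpha>, m \<alpha>)\<close>; the shear is invertible as long as
    \<open>m \<alpha> \<noteq> 0\<close>.\<close>
  define A where "A = (\<lambda>\<alpha> v. fst (L' (M \<alpha> (L (v, 0)))) - (snd (L' (M \<alpha> (L (v, 0)))) / m \<alpha>) *\<^sub>R k \<alpha>)"
  have cL': "continuous_on S L'" for S using L(2) by (simp add: linear_continuous_on linear_conv_bounded_linear)
  have cm: "continuous_on I m" and ck: "continuous_on I k"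
    unfolding m_def k_def
    using continuous_on_compose2[OF cL'[of UNIV] cont(2) subset_UNIV] by (auto intro: continuous_on_fst continuous_on_snd)
  have "L' (f \<alpha>\<^sub>0) = (0, 1)" using L(4)[rule_format, of "(0, 1)"] unfolding L(5) .
  then have m0: "m \<alpha>\<^sub>0 = 1" by (simp add: m_def)
  define J where "J = {\<alpha> \<in> I. m \<alpha> \<noteq> 0}"
  have J: "open J" "\<alpha>\<^sub>0 \<in> J" "J \<subseteq> I"
    using continuous_open_preimage[OF cm I(1), of "- {0}"] I(2) m0 by (auto simp: J_def vimage_def Int_def)
  have cp: "cpoly (M \<alpha>) = [:- 1, 1:] * cpoly (A \<alpha>)" if \<alpha>: "\<alpha> \<in> J" for \<alpha>
  proof -
    have m: "m \<alpha> \<noteq> 0" and \<alpha>I: "\<alpha> \<in> I" using \<alpha> by (auto simp: J_def)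
    define S where "S = (\<lambda>v. (fst v + snd v *\<^sub>R k \<alpha>, snd v * m \<alpha>))"
    define S' where "S' = (\<lambda>v. (fst v - (snd v / m \<alpha>) *\<^sub>R k \<alpha>, snd v / m \<alpha>))"
    have S: "linear S" by (rule linearI) (auto simp: S_def algebra_simps)
    have S': "linear S'" by (rule linearI) (auto simp: S'_def algebra_simps add_divide_distrib)
    have SS': "S (S' v) = v" "S' (S v) = v" for v using m by (auto simp: S_def S'_def)
    have l1: "linear (\<lambda>v. L (S v))" and l2: "linear (\<lambda>v. S' (L' v))"
      using linear_compose[OF S L(1)] linear_compose[OF L(2) S'] by (auto simp: o_def)
    have "L (S (0, 1)) = f \<alpha>" using L(3)[rule_format, of "f \<alpha>"] by (simp add: S_def k_def m_def)
    from cpoly_adapted(1)[OF l1 l2 M(1)[OF \<alpha>I] _ _ this M(2)[OF \<alpha>I]]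
    have "cpoly (M \<alpha>) = [:- 1, 1:] * cpoly (\<lambda>v. fst (S' (L' (M \<alpha> (L (S (v, 0)))))))"
      using SS' L(3,4) by simp
    also have "(\<lambda>v. fst (S' (L' (M \<alpha> (L (S (v, 0))))))) = A \<alpha>"
      by (simp add: fun_eq_iff A_def S_def S'_def)
    finally show ?thesis .
  qed
  have cA: "continuous_on J (\<lambda>\<alpha>. A \<alpha> v)" for v
  proof -
    have "continuous_on J (\<lambda>\<alpha>. L' (M \<alpha> (L (v, 0))))"
      by (rule continuous_on_compose2[OF cL'[of UNIV] continuous_on_subset[OF cont(1) J(3)] subset_UNIV])
    then show ?thesis
      unfolding A_def
      by (intro continuous_intros continuous_on_subset[OF cm J(3)] continuous_on_subset[OF ck J(3)]) (auto simp: J_def)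
  qed
  let ?h = "\<lambda>(\<alpha>, \<mu>). poly (cpoly (A \<alpha>)) \<mu>"
  have op: "open {x \<in> J \<times> UNIV. ?h x \<noteq> 0}"
    using continuous_open_preimage[OF continuous_on_poly_cpoly[of J A, OF cA], of "- {0}"] J(1)
    by (simp add: open_Times vimage_def Int_def open_Compl)
  have sub: "{\<alpha>\<^sub>0} \<times> sphere 0 1 \<subseteq> {x \<in> J \<times> UNIV. ?h x \<noteq> 0}"
    using hyperbolic_iff_cofactor[OF cp[OF J(2)]] hyp J(2) by auto
  \<comment> \<open>Compactness of the unit circle provides one neighbourhood of
    \<open>\<alpha>\<^sub>0\<close> that works for all \<mu> simultaneously.\<close>
  from Elementary_Topology.tube_lemma[OF compact_sphere op sub]
  obtain U where UV: "\<alpha>\<^sub>0 \<in> U" "open U" "U \<times> sphere 0 1 \<subseteq> {x \<in> J \<times> UNIV. ?h x \<noteq> 0}"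
    by (elim exE conjE)
  obtain \<delta> where \<delta>: "0 < \<delta>" "ball \<alpha>\<^sub>0 \<delta> \<subseteq> U \<inter> J"
    by (rule openE[OF open_Int[OF UV(2) J(1)] IntI[OF UV(1) J(2)]])
  show thesis
  proof (rule that[OF \<delta>(1)])
    show "ball \<alpha>\<^sub>0 \<delta> \<subseteq> I" using \<delta>(2) J(3) by blast
    show "\<forall>\<alpha>\<in>ball \<alpha>\<^sub>0 \<delta>. hyperbolic_apart_from_ones 1 (M \<alpha>)"
    proof
      fix \<alpha> assume "\<alpha> \<in> ball \<alpha>\<^sub>0 \<delta>"
      then have \<alpha>: "\<alpha> \<in> U" "\<alpha> \<in> J" using \<delta>(2) by auto
      show "hyperbolic_apart_from_ones 1 (M \<alpha>)"
        unfolding hyperbolic_iff_cofactor[OF cp[OF \<alpha>(2)]] 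
        using UV(3) \<alpha>(1) by (auto simp: subset_iff)
    qed
  qed
qed

section \<open>Variational equations and periodic orbits\<close>

text \<open>The common value may be prescribed at any time \<open>c\<close>. With \<open>c\<close>
  at the right end this yields invertibility of the derivative of the flow.\<close>

lemma variational_unique:
  fixes F :: "'u::euclidean_space \<Rightarrow> 'u"
  assumes F: "Ck_open (Suc k) F W" and \<phi>: "continuous_on {a..b} \<phi>" "\<And>t. t \<in> {a..b} \<Longrightarrow> \<phi> t \<in> W"
    and y: "\<And>t. t \<in> {a..b} \<Longrightarrow> (y has_vector_derivative frechet_derivative F (at (\<phi> t)) (y t)) (at t within {a..b})"
    and z: "\<And>t. t \<in> {a..b} \<Longrightarrow> (z has_vector_derivative frechet_derivative F (at (\<phi> t)) (z t)) (at t within {a..b})"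
    and c: "c \<in> {a..b}" "y c = z c" and t: "t \<in> {a..b}"
  shows "y t = z t"
proof -
  have "compact (\<phi> ` {a..b})" by (intro compact_continuous_image \<phi>(1)) auto
  moreover have "\<phi> ` {a..b} \<subseteq> W" using \<phi>(2) by auto
  ultimately obtain L where L: "0 \<le> L" "\<forall>q\<in>\<phi> ` {a..b}. \<forall>v. norm (frechet_derivative F (at q) v) \<le> L * norm v"
    by (rule frechet_derivative_bounded_on_compact[OF F])
  have "(norm (y t - z t))\<^sup>2 \<le> ((norm (y c - z c))\<^sup>2 + 0\<^sup>2 * (b - a)) * exp ((2 * L + 1) * (b - a))"
  proof (rule gronwall[OF _ _ L(1) c(1) t])
    fix s assume s: "s \<in> {a..b}"
    show "((\<lambda>t. y t - z t) has_vector_derivative frechet_derivative F (at (\<phi> s)) (y s) - frechet_derivative F (at (\<phi> s)) (z s)) (at s within {a..b})"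
      by (intro has_vector_derivative_diff y z s)
    have "linear (frechet_derivative F (at (\<phi> s)))"
      by (rule has_derivative_linear[OF Ck_open_has_derivative[OF F \<phi>(2)[OF s]]])
    then have "frechet_derivative F (at (\<phi> s)) (y s) - frechet_derivative F (at (\<phi> s)) (z s) = frechet_derivative F (at (\<phi> s)) (y s - z s)"
      by (rule linear_diff[symmetric])
    then show "norm (frechet_derivative F (at (\<phi> s)) (y s) - frechet_derivative F (at (\<phi> s)) (z s)) \<le> L * norm (y s - z s) + 0"
      using L(2) s by simp
  qed
  then show ?thesis using c(2) by simp
qed

text \<open>Differentiating the equation along its own solution shows that the velocity is a
  variational solution, the source of the trivial multiplier.\<close>

lemma variational_vector_field:
  fixes F :: "'u::euclidean_space \<Rightarrow> 'u"
  assumes F: "Ck_open (Suc k) F W" and \<phi>: "solves_ode_on F \<phi> I" "\<phi> t \<in> W" and t: "t \<in> I"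
  shows "((\<lambda>s. F (\<phi> s)) has_vector_derivative frechet_derivative F (at (\<phi> t)) (F (\<phi> t))) (at t within I)"
proof -
  have D: "(F has_derivative frechet_derivative F (at (\<phi> t))) (at (\<phi> t))"
    by (rule Ck_open_has_derivative[OF F \<phi>(2)])
  have "(\<phi> has_derivative (\<lambda>h. h *\<^sub>R F (\<phi> t))) (at t within I)"
    using \<phi>(1) t by (simp add: solves_ode_on_def has_vector_derivative_def)
  from has_derivative_compose[OF this D] show ?thesis
    unfolding has_vector_derivative_def by (simp add: linear_scale[OF has_derivative_linear[OF D]])
qed

lemma flow_total_derivative:
  fixes \<Phi> :: "real \<Rightarrow> 'w::euclidean_space \<Rightarrow> 'w"
  assumes \<Phi>: "Ck_open (Suc k) (\<lambda>(t, w). \<Phi> t w) Q" "(t, w) \<in> Q"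
    and dt: "((\<lambda>s. \<Phi> s w) has_vector_derivative u) (at t)"
  shows "frechet_derivative (\<lambda>(t, w). \<Phi> t w) (at (t, w)) (h, v) = h *\<^sub>R u + frechet_derivative (\<Phi> t) (at w) v"
    and "(\<Phi> t has_derivative frechet_derivative (\<Phi> t) (at w)) (at w)"
proof -
  let ?\<Phi> = "\<lambda>(t, w). \<Phi> t w"
  have D: "(?\<Phi> has_derivative frechet_derivative ?\<Phi> (at (t, w))) (at (t, w))"
    by (rule Ck_open_has_derivative[OF \<Phi>])
  note lin = has_derivative_linear[OF D]
  have "((\<lambda>s. (s, w)) has_derivative (\<lambda>h. (h, 0))) (at t)"
    by (intro has_derivative_Pair has_derivative_ident has_derivative_const)
  from has_derivative_compose[OF this, of ?\<Phi>] D
  have "((\<lambda>s. \<Phi> s w) has_derivative (\<lambda>h. frechet_derivative ?\<Phi> (at (t, w)) (h, 0))) (at t)" by simp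
  from has_derivative_unique[OF this dt[unfolded has_vector_derivative_def]]
  have 1: "frechet_derivative ?\<Phi> (at (t, w)) (h, 0) = h *\<^sub>R u" by (rule fun_cong)
  have "((\<lambda>w. (t, w)) has_derivative (\<lambda>v. (0, v))) (at w)"
    by (intro has_derivative_Pair has_derivative_ident has_derivative_const)
  from has_derivative_compose[OF this, of ?\<Phi>] D
  have 2: "(\<Phi> t has_derivative (\<lambda>v. frechet_derivative ?\<Phi> (at (t, w)) (0, v))) (at w)" by simp
  note 3 = frechet_derivative_eq[OF 2]
  show "(\<Phi> t has_derivative frechet_derivative (\<Phi> t) (at w)) (at w)" unfolding 3 by (rule 2)
  show "frechet_derivative ?\<Phi> (at (t, w)) (h, v) = h *\<^sub>R u + frechet_derivative (\<Phi> t) (at w) v"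
    using linear_add[OF lin, of "(h, 0)" "(0, v)"] 1 3 by simp
qed

lemma has_vector_derivative_union:
  assumes "(u has_vector_derivative v) (at t within A)" "(u has_vector_derivative v) (at t within B)"
  shows "(u has_vector_derivative v) (at t within A \<union> B)"
  using assms unfolding has_vector_derivative_def has_derivative_within
  by (auto intro: Lim_Un)

lemma periodic_int_mult:
  fixes \<gamma> :: "real \<Rightarrow> 'z"
  assumes "\<And>t. \<gamma> (t + T) = \<gamma> t"
  shows "\<gamma> (t + of_int n * T) = \<gamma> t"
proof (induction n rule: int_induct[where k = 0])
  case base
  then show ?case by simp
next
  case (step1 i)
  have "\<gamma> (t + of_int (i + 1) * T) = \<gamma> ((t + of_int i * T) + T)" by (simp add: algebra_simps)
  then show ?case using assms step1 by simp
next
  case (step2 i)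
  have "\<gamma> (t + of_int i * T) = \<gamma> ((t + of_int (i - 1) * T) + T)" by (simp add: algebra_simps)
  then show ?case using assms step2 by simp
qed

text \<open>A closed orbit comes from a flow on a bounded time interval, whereas
  \<open>periodic_solution\<close> asks for a solution for all times. At the seams the two one-sided
  derivatives agree because the equation is autonomous and
  \<open>\<phi> T = \<phi> 0\<close>.\<close>

lemma periodic_extension:
  fixes \<phi> :: "real \<Rightarrow> 'z::real_normed_vector"
  assumes \<phi>: "solves_ode_on F \<phi> {0..T}" and T: "0 < T" "\<phi> T = \<phi> 0"
  obtains \<gamma> where "solves_ode_on F \<gamma> UNIV" "\<forall>t. \<gamma> (t + T) = \<gamma> t" "\<forall>t\<in>{0..T}. \<gamma> t = \<phi> t"
proof -
  define \<gamma> where "\<gamma> = (\<lambda>t. \<phi> (t - T * of_int \<lfloor>t / T\<rfloor>))"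
  have per: "\<gamma> (t + T) = \<gamma> t" for t
  proof -
    have "\<lfloor>(t + T) / T\<rfloor> = \<lfloor>t / T\<rfloor> + 1" using T(1) by (simp add: add_divide_distrib)
    then show ?thesis by (simp add: \<gamma>_def algebra_simps)
  qed
  have eq: "\<gamma> t = \<phi> (t - T * of_int n)" if "t \<in> {T * of_int n..T * of_int n + T}" for t n
  proof (cases "t = T * of_int n + T")
    case True
    then have "t / T = of_int (n + 1)" using T(1) by (simp add: field_simps)
    then have "\<lfloor>t / T\<rfloor> = n + 1" by (metis floor_of_int)
    then show ?thesis using True T(2) by (simp add: \<gamma>_def algebra_simps)
  next
    case False
    then have "\<lfloor>t / T\<rfloor> = n" using that T(1) by (simp add: floor_eq_iff field_simps)
    then show ?thesis by (simp add: \<gamma>_def)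
  qed
  have piece: "(\<gamma> has_vector_derivative F (\<gamma> t)) (at t within {T * of_int n..T * of_int n + T})"
    if t: "t \<in> {T * of_int n..T * of_int n + T}" for t n
  proof (rule has_vector_derivative_transform[OF t])
    show "\<gamma> s = \<phi> (s - T * of_int n)" if "s \<in> {T * of_int n..T * of_int n + T}" for s by (rule eq[OF that])
    have "(\<phi> has_vector_derivative F (\<phi> (t - T * of_int n))) (at (t - T * of_int n) within {0..T})"
      using \<phi> t by (auto simp: solves_ode_on_def)
    moreover have "(\<lambda>s. s - T * of_int n) ` {T * of_int n..T * of_int n + T} = {0..T}"
      using image_add_atLeastAtMost'[of "- (T * of_int n)" "T * of_int n" "T * of_int n + T"] by simp
    moreover have "((\<lambda>s. s - T * of_int n) has_vector_derivative 1) (at t within {T * of_int n..T * of_int n + T})"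
      by (auto intro!: derivative_eq_intros)
    ultimately have "(\<phi> \<circ> (\<lambda>s. s - T * of_int n) has_vector_derivative 1 *\<^sub>R F (\<phi> (t - T * of_int n)))
        (at t within {T * of_int n..T * of_int n + T})"
      by (intro vector_diff_chain_within) auto
    then show "((\<lambda>s. \<phi> (s - T * of_int n)) has_vector_derivative F (\<gamma> t)) (at t within {T * of_int n..T * of_int n + T})"
      using eq[OF t] by (simp add: o_def)
  qed
  have "(\<gamma> has_vector_derivative F (\<gamma> t)) (at t)" for t
  proof -
    define n where "n = \<lfloor>t / T\<rfloor>"
    have n: "T * of_int n \<le> t" "t < T * of_int n + T"
    proof -
      have "of_int n \<le> t / T" "t / T < of_int n + 1" unfolding n_def by (rule of_int_floor_le real_of_int_floor_add_one_gt)+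
      then have "T * of_int n \<le> T * (t / T)" "T * (t / T) < T * (of_int n + 1)"
        using T(1) by (intro mult_left_mono mult_strict_left_mono; simp)+
      then show "T * of_int n \<le> t" "t < T * of_int n + T" using T(1) by (simp_all add: distrib_left)
    qed
    let ?I = "\<lambda>n. {T * of_int n..T * of_int n + T}"
    show ?thesis
    proof (cases "t = T * of_int n")
      case True
      have "(\<gamma> has_vector_derivative F (\<gamma> t)) (at t within ?I (n - 1) \<union> ?I n)"
        by (intro has_vector_derivative_union piece) (use True T(1) in \<open>auto simp: algebra_simps\<close>)
      moreover have "at t within ?I (n - 1) \<union> ?I n = at t"
      proof -
        have "{t - T<..<t + T} \<subseteq> ?I (n - 1) \<union> ?I n" using True by (auto simp: algebra_simps)
        then have "t \<in> interior (?I (n - 1) \<union> ?I n)"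
          using T(1) by (intro interiorI[of "{t - T<..<t + T}"]) auto
        then show ?thesis by (rule at_within_interior)
      qed
      ultimately show ?thesis by simp
    next
      case False
      then have "t \<in> interior (?I n)" using n by auto
      then show ?thesis using piece[of t n] n at_within_interior[of t "?I n"] by simp
    qed
  qed
  then have "solves_ode_on F \<gamma> UNIV" by (simp add: solves_ode_on_def)
  moreover have "\<forall>t\<in>{0..T}. \<gamma> t = \<phi> t" using eq[of _ 0] by simp
  ultimately show thesis using that per by blast
qed

lemma frechet_derivative_linear:
  "Ck_open (Suc k) h W \<Longrightarrow> x \<in> W \<Longrightarrow> linear (frechet_derivative h (at x))"
  by (rule has_derivative_linear[OF Ck_open_has_derivative])

text \<open>Moving the base point along the cycle conjugates the monodromy map by the derivative of the flow.\<close>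

lemma hyperbolic_limit_cycle_base_point:
  fixes F :: "'z::euclidean_space \<Rightarrow> 'z"
  assumes F: "Ck_open (Suc k) F UNIV" and hyp: "hyperbolic_limit_cycle F T \<Gamma>" and z: "z \<in> \<Gamma>"
  obtains \<gamma> X where "periodic_solution F T \<gamma>" "\<gamma> 0 = z" "\<Gamma> = range \<gamma>"
    "principal_variational_solution F \<gamma> T X" "hyperbolic_apart_from_ones 1 (X T)"
proof -
  obtain \<gamma> X where \<gamma>: "periodic_solution F T \<gamma>" "\<Gamma> = range \<gamma>"
    and X: "principal_variational_solution F \<gamma> T X" "hyperbolic_apart_from_ones 1 (X T)"
    using hyp unfolding hyperbolic_limit_cycle_def by blast
  have T: "0 < T" and sol: "solves_ode_on F \<gamma> UNIV" and per: "\<And>t. \<gamma> (t + T) = \<gamma> t"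
    and minimal: "\<And>s. 0 < s \<Longrightarrow> s < T \<Longrightarrow> \<gamma> s \<noteq> \<gamma> 0"
    using \<gamma>(1) by (auto simp: periodic_solution_def)
  obtain s0 where s0: "z = \<gamma> s0" using z \<gamma>(2) by blast
  \<comment> \<open>Reducing modulo the period gives a nonnegative time, so the flow from
    \<open>\<gamma> 0\<close> is only followed forwards.\<close>
  define s where "s = s0 - of_int \<lfloor>s0 / T\<rfloor> * T"
  have s: "0 \<le> s" "z = \<gamma> s"
  proof -
    have "of_int \<lfloor>s0 / T\<rfloor> * T \<le> s0 / T * T" using T by (intro mult_right_mono) auto
    then show "0 \<le> s" using T by (simp add: s_def)
    show "z = \<gamma> s" using periodic_int_mult[of \<gamma> T s "\<lfloor>s0 / T\<rfloor>"] per s0 by (simp add: s_def)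
  qed
  have W: "open (UNIV :: 'z set)" by simp
  have sol': "solves_ode_on F \<gamma> {- 1..s + T + 1}" by (rule solves_ode_subset[OF sol]) simp
  obtain B \<Psi> where \<Psi>: "open B" "\<gamma> 0 \<in> B" "\<forall>w\<in>B. \<Psi> 0 w = w"
    "\<forall>w\<in>B. solves_ode_on F (\<lambda>t. \<Psi> t w) {- 1..s + T + 1}" "\<forall>w\<in>B. \<forall>t\<in>{- 1..s + T + 1}. \<Psi> t w \<in> UNIV"
    "\<forall>t\<in>{- 1..s + T + 1}. \<Psi> t (\<gamma> 0) = \<gamma> t"
    "Ck_open (Suc k) (\<lambda>(t, w). \<Psi> t w) ({- 1<..<s + T + 1} \<times> B)"
    "\<forall>w\<in>B. \<forall>t\<in>{- 1<..<s + T + 1}. \<forall>v. ((\<lambda>s. frechet_derivative (\<Psi> s) (at w) v) has_vector_derivative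
       frechet_derivative F (at (\<Psi> t w)) (frechet_derivative (\<Psi> t) (at w) v)) (at t)"
    "\<forall>w\<in>B. \<forall>t\<in>{- 1<..<s + T + 1}. \<Psi> t differentiable (at w)"
    by (rule smooth_local_flow[OF W F zero_less_Suc _ _ sol']) (use s(1) T in auto)
  define D where "D = (\<lambda>t v. frechet_derivative (\<Psi> t) (at (\<gamma> 0)) v)"
  have D: "((\<lambda>t. D t v) has_vector_derivative frechet_derivative F (at (\<gamma> t)) (D t v)) (at t within I)"
    if "t \<in> {0..s + T}" for t v I
  proof -
    have t: "t \<in> {- 1<..<s + T + 1}" "t \<in> {- 1..s + T + 1}" using that by auto
    show ?thesis
      using has_vector_derivative_at_within[OF \<Psi>(8)[rule_format, OF \<Psi>(2) t(1), of v], of I] \<Psi>(6)[rule_format, OF t(2)]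
      by (simp add: D_def)
  qed
  have Dlin: "linear (D t)" if "t \<in> {0..s + T}" for t
  proof -
    have "\<Psi> t differentiable (at (\<gamma> 0))" by (rule \<Psi>(9)[rule_format, OF \<Psi>(2)]) (use that in auto)
    then show ?thesis unfolding D_def by (rule linear_frechet_derivative)
  qed
  have D0: "D 0 v = v" for v
  proof -
    have "(\<Psi> 0 has_derivative (\<lambda>v. v)) (at (\<gamma> 0))"
      by (rule has_derivative_transform_within_open[OF has_derivative_ident \<Psi>(1,2)]) (use \<Psi>(3) in auto)
    from frechet_derivative_eq[OF this] show ?thesis by (simp add: D_def)
  qed
  have \<gamma>c: "continuous_on S \<gamma>" for S
    using solves_ode_continuous[OF sol] by (rule continuous_on_subset) simp
  \<comment> \<open>Uniqueness is applied backwards from time \<open>s\<close>: a variational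
    solution that vanishes there vanishes at time 0.\<close>
  have Dinj: "v = 0" if v: "D s v = 0" for v
  proof -
    have "D 0 v = 0"
    proof (rule variational_unique[OF F \<gamma>c, of 0 s "\<lambda>t. D t v" "\<lambda>t. 0" s])
      show "((\<lambda>t. 0) has_vector_derivative frechet_derivative F (at (\<gamma> t)) 0) (at t within {0..s})" for t
        using linear_0[OF frechet_derivative_linear[OF F, of "\<gamma> t"]] by simp
    qed (use D s T v in auto)
    then show ?thesis by (simp add: D0)
  qed
  have sI: "s \<in> {0..s + T}" using s T by simp
  have injs: "inj (D s)" using Dinj by (simp add: linear_injective_0[OF Dlin[OF sI]])
  obtain L' where L': "linear L'" "\<And>v. L' (D s v) = v" "\<And>v. D s (L' v) = v"
    using linear_injective_isomorphism[OF Dlin[OF sI] injs refl] by (elim exE conjE) simp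
  have DT: "D T v = X T v" for v
  proof (rule variational_unique[OF F \<gamma>c, of 0 T "\<lambda>t. D t v" "\<lambda>t. X t v" 0])
    show "((\<lambda>t. X t v) has_vector_derivative frechet_derivative F (at (\<gamma> t)) (X t v)) (at t within {0..T})"
      if "t \<in> {0..T}" for t
      using X(1) that unfolding principal_variational_solution_def by blast
    show "D 0 v = X 0 v" using X(1) D0 by (simp add: principal_variational_solution_def)
  qed (use D s T in auto)
  have Dshift: "((\<lambda>t. D (t + c) v) has_vector_derivative frechet_derivative F (at (\<gamma> (t + c))) (D (t + c) v)) (at t within I)"
    if "t + c \<in> {0..s + T}" for t c v I
  proof -
    have "((\<lambda>t. t + c) has_vector_derivative 1) (at t within I)" by (auto intro!: derivative_eq_intros)
    from vector_diff_chain_within[OF this D[OF that]] show ?thesis by (simp add: o_def)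
  qed
  \<comment> \<open>Shifting time by a period changes neither the cycle nor the variational
    equation, so both sides solve it with the same initial value.\<close>
  have DsT: "D (s + T) v = D s (D T v)" for v
  proof (rule variational_unique[OF F \<gamma>c, of 0 s "\<lambda>t. D (t + T) v" "\<lambda>t. D t (D T v)" 0])
    show "((\<lambda>t. D (t + T) v) has_vector_derivative frechet_derivative F (at (\<gamma> t)) (D (t + T) v)) (at t within {0..s})"
      if "t \<in> {0..s}" for t
      using Dshift[of t T v "{0..s}"] that s T per by simp
  qed (use D D0 s T in auto)
  define \<gamma>' where "\<gamma>' = (\<lambda>t. \<gamma> (t + s))"
  define X' where "X' = (\<lambda>t v. D (t + s) (L' v))"
  have "periodic_solution F T \<gamma>'"
    unfolding periodic_solution_def
  proof (intro conjI allI impI T)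
    show "solves_ode_on F \<gamma>' UNIV"
      unfolding solves_ode_on_def
    proof
      fix t
      have "((\<lambda>t. t + s) has_vector_derivative 1) (at t)" by (auto intro!: derivative_eq_intros)
      moreover have "(\<gamma> has_vector_derivative F (\<gamma> (t + s))) (at (t + s))"
        using sol by (simp add: solves_ode_on_def)
      ultimately show "(\<gamma>' has_vector_derivative F (\<gamma>' t)) (at t)"
        using vector_diff_chain_at[of "\<lambda>t. t + s" 1 t \<gamma> "F (\<gamma> (t + s))"] by (simp add: o_def \<gamma>'_def)
    qed
    show "\<gamma>' (t + T) = \<gamma>' t" for t using per[of "t + s"] by (simp add: \<gamma>'_def algebra_simps)
    fix u assume u: "0 < u \<and> u < T"
    show "\<gamma>' u \<noteq> \<gamma>' 0"
    proof
      assume eq: "\<gamma>' u = \<gamma>' 0"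
      \<comment> \<open>A shorter period at the new base point is carried back along the orbit from
        time \<open>s\<close> to time 0.\<close>
      have "\<gamma> (0 + u) = \<gamma> 0"
      proof (rule ode_unique[OF W F, of "\<lambda>t. \<gamma> (t + u)" 0 s \<gamma> s 0])
        show "solves_ode_on F (\<lambda>t. \<gamma> (t + u)) {0..s}"
          unfolding solves_ode_on_def
        proof
          fix t
          have "((\<lambda>t. t + u) has_vector_derivative 1) (at t)" by (auto intro!: derivative_eq_intros)
          moreover have "(\<gamma> has_vector_derivative F (\<gamma> (t + u))) (at (t + u))"
            using sol by (simp add: solves_ode_on_def)
          ultimately have "((\<lambda>t. \<gamma> (t + u)) has_vector_derivative F (\<gamma> (t + u))) (at t)"
            using vector_diff_chain_at[of "\<lambda>t. t + u" 1 t \<gamma> "F (\<gamma> (t + u))"] by (simp add: o_def)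
          then show "((\<lambda>t. \<gamma> (t + u)) has_vector_derivative F (\<gamma> (t + u))) (at t within {0..s})"
            by (rule has_vector_derivative_at_within)
        qed
        show "solves_ode_on F \<gamma> {0..s}" by (rule solves_ode_subset[OF sol]) simp
        show "\<gamma> (s + u) = \<gamma> s" using eq by (simp add: \<gamma>'_def add.commute)
      qed (use s in auto)
      then show False using minimal[of u] u by simp
    qed
  qed
  moreover have "\<gamma>' 0 = z" using s by (simp add: \<gamma>'_def)
  moreover have "\<Gamma> = range \<gamma>'"
  proof -
    have "\<gamma> t \<in> range \<gamma>'" for t by (rule image_eqI[of _ _ "t - s"]) (simp_all add: \<gamma>'_def)
    moreover have "\<gamma>' t \<in> range \<gamma>" for t by (simp add: \<gamma>'_def)
    ultimately show ?thesis unfolding \<gamma>(2) by (intro equalityI image_subsetI)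
  qed
  moreover have "principal_variational_solution F \<gamma>' T X'"
    unfolding principal_variational_solution_def
  proof (intro allI conjI ballI)
    show "X' 0 v = v" for v by (simp add: X'_def L'(3))
    show "((\<lambda>s. X' s v) has_vector_derivative frechet_derivative F (at (\<gamma>' t)) (X' t v)) (at t within {0..T})"
      if "t \<in> {0..T}" for t v
      unfolding X'_def \<gamma>'_def by (rule Dshift) (use that s in auto)
  qed
  moreover have "hyperbolic_apart_from_ones 1 (X' T)"
  proof -
    have X'T: "X' T v = D s (X T (L' v))" for v
      using DsT[of "L' v"] DT[of "L' v"] by (simp add: X'_def add.commute)
    have "linear (X' T)"
      unfolding X'_def using linear_compose[OF L'(1) Dlin[of "T + s"]] s T by (simp add: o_def)
    from cpoly_conj[OF Dlin[OF sI] L'(1) this L'(3,2)]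
    have "cpoly (X' T) = cpoly (\<lambda>v. X T v)" by (simp add: X'T L'(2))
    then show ?thesis using X(2) hyperbolic_cong_cpoly by blast
  qed
  ultimately show thesis by (rule that)
qed

text \<open>The velocity along the orbit is a variational solution that returns to its initial value
  after a period; it is the eigenvector of the trivial multiplier.\<close>

lemma monodromy_fixes_vector_field:
  fixes F :: "'z::euclidean_space \<Rightarrow> 'z"
  assumes F: "Ck_open (Suc k) F UNIV" and \<gamma>: "solves_ode_on F \<gamma> {0..T}" "\<gamma> T = \<gamma> 0" "0 \<le> T"
    and X: "principal_variational_solution F \<gamma> T X"
  shows "X T (F (\<gamma> 0)) = F (\<gamma> 0)"
proof -
  have "X T (F (\<gamma> 0)) = F (\<gamma> T)"
  proof (rule variational_unique[OF F solves_ode_continuous[OF \<gamma>(1)], of "\<lambda>t. X t (F (\<gamma> 0))" "\<lambda>t. F (\<gamma> t)" 0])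
    show "((\<lambda>t. X t (F (\<gamma> 0))) has_vector_derivative frechet_derivative F (at (\<gamma> t)) (X t (F (\<gamma> 0)))) (at t within {0..T})"
      if "t \<in> {0..T}" for t
      using X that unfolding principal_variational_solution_def by blast
    show "((\<lambda>t. F (\<gamma> t)) has_vector_derivative frechet_derivative F (at (\<gamma> t)) (F (\<gamma> t))) (at t within {0..T})"
      if "t \<in> {0..T}" for t
      by (rule variational_vector_field[OF F \<gamma>(1) UNIV_I that])
  qed (use X \<gamma>(3) in \<open>auto simp: principal_variational_solution_def\<close>)
  then show ?thesis using \<gamma>(2) by simp
qed

text \<open>At an equilibrium uniqueness would make the solution constant, against minimality of the
  period.\<close>

lemma periodic_solution_nonzero_field:
  fixes F :: "'z::euclidean_space \<Rightarrow> 'z"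
  assumes F: "Ck_open (Suc k) F UNIV" and \<gamma>: "periodic_solution F T \<gamma>"
  shows "F (\<gamma> 0) \<noteq> 0"
proof
  assume 0: "F (\<gamma> 0) = 0"
  have T: "0 < T" and sol: "solves_ode_on F \<gamma> UNIV" using \<gamma> by (auto simp: periodic_solution_def)
  have "\<gamma> (T / 2) = \<gamma> 0"
  proof (rule ode_unique[OF open_UNIV F, of \<gamma> 0 T "\<lambda>t. \<gamma> 0" 0 "T / 2"])
    show "solves_ode_on F \<gamma> {0..T}" by (rule solves_ode_subset[OF sol]) simp
    show "solves_ode_on F (\<lambda>t. \<gamma> 0) {0..T}" by (simp add: solves_ode_on_def 0)
  qed (use T in auto)
  then show False using \<gamma> T by (auto simp: periodic_solution_def dest!: spec[of _ "T / 2"])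
qed

section \<open>Return times\<close>

text \<open>The number \<kappa> contributes only its sign, so that both directions of crossing are
  treated at once.\<close>

lemma strictly_monotone_crossing:
  fixes h :: "real \<Rightarrow> real"
  assumes d: "\<And>t. t \<in> {a<..<b} \<Longrightarrow> (h has_real_derivative h' t) (at t)"
    and pos: "\<And>t. t \<in> {a<..<b} \<Longrightarrow> 0 < h' t * \<kappa>"
    and s: "s \<in> {a<..<b}" "t \<in> {a<..<b}" "h s = h t"
  shows "s = t"
proof -
  have less: False if "s < t" "s \<in> {a<..<b}" "t \<in> {a<..<b}" "h s = h t" for s t
  proof -
    have "((\<lambda>x. h x) has_real_derivative h' x) (at x)" if "s \<le> x" "x \<le> t" for x
      using d[of x] that \<open>s \<in> _\<close> \<open>t \<in> _\<close> by auto
    then obtain x where x: "s < x" "x < t" "h t - h s = (t - s) * h' x"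
      using MVT2[OF \<open>s < t\<close>, of h h'] by blast
    have "h' x = 0" using x(3) that by simp
    moreover have "0 < h' x * \<kappa>" using pos[of x] x(1,2) that by auto
    ultimately show False by simp
  qed
  show ?thesis using less[of s t] less[of t s] s by (cases s t rule: linorder_cases) auto
qed

text \<open>For times near 0 and near \<open>T\<close> transversality makes \<sigma> strictly
  monotone along nearby orbits, so each window contains at most one crossing. In between, minimality
  of the period keeps the orbit away from its starting point. It may still meet the zero set of
  \<sigma> elsewhere, hence the last clause excludes early crossings only inside
  \<open>B\<close>.\<close>

theorem return_time:
  fixes F :: "'w::euclidean_space \<Rightarrow> 'w" and \<sigma> :: "'w \<Rightarrow> real"
  assumes W: "open W" and F: "Ck_open (Suc k) F W"
    and \<phi>: "solves_ode_on F \<phi> UNIV" "\<And>t. \<phi> t \<in> W" and T: "0 < T" "\<And>t. \<phi> (t + T) = \<phi> t"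
    and minimal: "\<And>s. 0 < s \<Longrightarrow> s < T \<Longrightarrow> \<phi> s \<noteq> \<phi> 0"
    and \<sigma>: "open Ws" "Ck_open (Suc k) \<sigma> Ws" "\<phi> 0 \<in> Ws" "\<sigma> (\<phi> 0) = 0"
    and transverse: "frechet_derivative \<sigma> (at (\<phi> 0)) (F (\<phi> 0)) \<noteq> 0"
  obtains B \<Phi> \<tau> \<delta> where "open B" "\<phi> 0 \<in> B" "B \<subseteq> Ws" "0 < \<delta>" "\<delta> < 1"
    "\<forall>w\<in>B. \<Phi> 0 w = w" "\<forall>w\<in>B. solves_ode_on F (\<lambda>t. \<Phi> t w) {- 1..T + 1}"
    "\<forall>w\<in>B. \<forall>t\<in>{- 1..T + 1}. \<Phi> t w \<in> W" "\<forall>t\<in>{- 1..T + 1}. \<Phi> t (\<phi> 0) = \<phi> t"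
    "Ck_open (Suc k) (\<lambda>(t, w). \<Phi> t w) ({- 1<..<T + 1} \<times> B)"
    "\<forall>w\<in>B. \<forall>t\<in>{- 1<..<T + 1}. \<forall>v. ((\<lambda>s. frechet_derivative (\<Phi> s) (at w) v) has_vector_derivative
       frechet_derivative F (at (\<Phi> t w)) (frechet_derivative (\<Phi> t) (at w) v)) (at t)"
    "Ck_open (Suc k) \<tau> B" "\<tau> (\<phi> 0) = T" "\<forall>w\<in>B. \<tau> w \<in> {T - \<delta><..<T + \<delta>} \<and> 0 < \<tau> w"
    "\<forall>w\<in>B. \<forall>s\<in>{T - \<delta><..<T + \<delta>}. \<Phi> s w \<in> Ws \<and> (\<sigma> (\<Phi> s w) = 0 \<longleftrightarrow> s = \<tau> w)"
    "\<forall>w\<in>B. \<sigma> w = 0 \<longrightarrow> (\<forall>s. 0 < s \<and> s < \<tau> w \<and> \<Phi> s w \<in> B \<longrightarrow> \<sigma> (\<Phi> s w) \<noteq> 0)"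
proof -
  let ?w0 = "\<phi> 0" and ?a = "- 1 :: real" and ?b = "T + 1"
  define \<kappa> where "\<kappa> = frechet_derivative \<sigma> (at ?w0) (F ?w0)"
  have \<phi>I: "solves_ode_on F \<phi> {?a..?b}" by (rule solves_ode_subset[OF \<phi>(1)]) simp
  obtain B0 \<Phi> where B0: "open B0" "?w0 \<in> B0" "\<forall>w\<in>B0. \<Phi> 0 w = w"
    "\<forall>w\<in>B0. solves_ode_on F (\<lambda>t. \<Phi> t w) {?a..?b}" "\<forall>w\<in>B0. \<forall>t\<in>{?a..?b}. \<Phi> t w \<in> W"
    "\<forall>t\<in>{?a..?b}. \<Phi> t ?w0 = \<phi> t"
    "Ck_open (Suc k) (\<lambda>(t, w). \<Phi> t w) ({?a<..<?b} \<times> B0)"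
    "\<forall>w\<in>B0. \<forall>t\<in>{?a<..<?b}. \<forall>v. ((\<lambda>s. frechet_derivative (\<Phi> s) (at w) v) has_vector_derivative
       frechet_derivative F (at (\<Phi> t w)) (frechet_derivative (\<Phi> t) (at w) v)) (at t)"
    "\<forall>w\<in>B0. \<forall>t\<in>{?a<..<?b}. \<Phi> t differentiable (at w)"
    by (rule smooth_local_flow[OF W F zero_less_Suc _ _ \<phi>I \<phi>(2)]) (use T(1) in auto)
  let ?Q = "{?a<..<?b} \<times> B0"
  have opQ: "open ?Q" using B0(1) by (simp add: open_Times)
  have \<Phi>c: "continuous_on ?Q (\<lambda>(t, w). \<Phi> t w)" by (rule Ck_open_continuous[OF B0(7)])
  \<comment> \<open>The states at which \<sigma> changes along \<open>F\<close> in the same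
    direction as at the base point.\<close>
  define Wp where "Wp = {w \<in> W \<inter> Ws. 0 < frechet_derivative \<sigma> (at w) (F w) * \<kappa>}"
  have "continuous_on (W \<inter> Ws) (\<lambda>w. frechet_derivative \<sigma> (at w) (F w) * \<kappa>)"
    by (intro continuous_intros continuous_on_frechet_derivative[OF \<sigma>(2)]
        continuous_on_subset[OF Ck_open_continuous[OF F]]) auto
  from continuous_open_preimage[OF this open_Int[OF W \<sigma>(1)] open_greaterThan[of 0]]
  have opWp: "open Wp" by (simp add: Wp_def vimage_def Int_def)
  have w0p: "?w0 \<in> Wp" using \<phi>(2) \<sigma>(3) transverse by (auto simp: Wp_def \<kappa>_def zero_less_mult_iff linorder_neq_iff)
  define R where "R = {x \<in> ?Q. (\<lambda>(t, w). \<Phi> t w) x \<in> Wp}"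
  have opR: "open R"
    using continuous_open_preimage[OF \<Phi>c opQ opWp] by (simp add: R_def vimage_def Int_def)
  have \<phi>T: "\<phi> T = ?w0" using T(2)[of 0] by simp
  have R0: "(0, ?w0) \<in> R" "(T, ?w0) \<in> R"
    using B0(2,6) T(1) w0p \<phi>T by (auto simp: R_def)
  obtain A1 C1 where AC1: "open A1" "open C1" "0 \<in> A1" "?w0 \<in> C1" "A1 \<times> C1 \<subseteq> R"
    using open_prod_elim[OF opR R0(1)] by (metis mem_Sigma_iff)
  obtain A2 C2 where AC2: "open A2" "open C2" "T \<in> A2" "?w0 \<in> C2" "A2 \<times> C2 \<subseteq> R"
    using open_prod_elim[OF opR R0(2)] by (metis mem_Sigma_iff)
  obtain d1 where d1: "0 < d1" "ball 0 d1 \<subseteq> A1" using openE[OF AC1(1,3)] by blast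
  obtain d2 where d2: "0 < d2" "ball T d2 \<subseteq> A2" using openE[OF AC2(1,3)] by blast
  \<comment> \<open>\<open>d1\<close> and \<open>d2\<close> keep both windows in the region of
    monotone \<sigma>, \<open>1 / 2\<close> keeps them inside the time range of the flow, and
    \<open>T / 3\<close> separates them and makes return times positive.\<close>
  define \<delta> where "\<delta> = min (min d1 d2) (min (1 / 2) (T / 3))"
  have \<delta>: "0 < \<delta>" "\<delta> < 1" "\<delta> \<le> d1" "\<delta> \<le> d2" "\<delta> < T" using d1(1) d2(1) T(1) by (auto simp: \<delta>_def)
  have inR: "(t, w) \<in> R" if "t \<in> {- \<delta><..<\<delta>} \<and> w \<in> C1 \<or> t \<in> {T - \<delta><..<T + \<delta>} \<and> w \<in> C2" for t w
    using that
  proof (elim disjE conjE)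
    assume t: "t \<in> {- \<delta><..<\<delta>}" "w \<in> C1"
    then have "t \<in> ball 0 d1" using \<delta>(3) by (auto simp: dist_real_def)
    then show ?thesis using d1(2) t(2) AC1(5) by blast
  next
    assume t: "t \<in> {T - \<delta><..<T + \<delta>}" "w \<in> C2"
    then have "t \<in> ball T d2" using \<delta>(4) by (auto simp: dist_real_def)
    then show ?thesis using d2(2) t(2) AC2(5) by blast
  qed
  have \<Phi>t: "((\<lambda>s. \<Phi> s w) has_vector_derivative F (\<Phi> t w)) (at t)" if "(t, w) \<in> ?Q" for t w
  proof -
    have "((\<lambda>s. \<Phi> s w) has_vector_derivative F (\<Phi> t w)) (at t within {?a..?b})"
      using B0(4) that by (auto simp: solves_ode_on_def)
    moreover have "at t within {?a..?b} = at t" by (rule at_within_interior) (use that in auto)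
    ultimately show ?thesis by simp
  qed
  have St: "((\<lambda>s. \<sigma> (\<Phi> s w)) has_real_derivative frechet_derivative \<sigma> (at (\<Phi> t w)) (F (\<Phi> t w))) (at t)"
    and Spos: "0 < frechet_derivative \<sigma> (at (\<Phi> t w)) (F (\<Phi> t w)) * \<kappa>" if "(t, w) \<in> R" for t w
  proof -
    have tw: "(t, w) \<in> ?Q" "\<Phi> t w \<in> Ws" using that by (auto simp: R_def Wp_def)
    have D: "(\<sigma> has_derivative frechet_derivative \<sigma> (at (\<Phi> t w))) (at (\<Phi> t w))"
      by (rule Ck_open_has_derivative[OF \<sigma>(2) tw(2)])
    from has_derivative_compose[OF \<Phi>t[OF tw(1), unfolded has_vector_derivative_def] D]
    show "((\<lambda>s. \<sigma> (\<Phi> s w)) has_real_derivative frechet_derivative \<sigma> (at (\<Phi> t w)) (F (\<Phi> t w))) (at t)"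
      by (simp add: has_field_derivative_def linear_scale[OF has_derivative_linear[OF D]] mult_commute_abs)
    show "0 < frechet_derivative \<sigma> (at (\<Phi> t w)) (F (\<Phi> t w)) * \<kappa>" using that by (simp add: R_def Wp_def)
  qed
  have near0: "s = t" if "w \<in> C1" "s \<in> {- \<delta><..<\<delta>}" "t \<in> {- \<delta><..<\<delta>}" "\<sigma> (\<Phi> s w) = \<sigma> (\<Phi> t w)" for s t w
    by (rule strictly_monotone_crossing[OF St Spos that(2-4)]) (use inR that(1) in blast)+
  have nearT: "s = t" if "w \<in> C2" "s \<in> {T - \<delta><..<T + \<delta>}" "t \<in> {T - \<delta><..<T + \<delta>}" "\<sigma> (\<Phi> s w) = \<sigma> (\<Phi> t w)" for s t w
    by (rule strictly_monotone_crossing[OF St Spos that(2-4)]) (use inR that(1) in blast)+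
  have "compact (\<phi> ` {\<delta>..T - \<delta>})"
    by (intro compact_continuous_image continuous_on_subset[OF solves_ode_continuous[OF \<phi>(1)]]) auto
  moreover have "?w0 \<notin> \<phi> ` {\<delta>..T - \<delta>}"
  proof
    assume "?w0 \<in> \<phi> ` {\<delta>..T - \<delta>}"
    then obtain s where "s \<in> {\<delta>..T - \<delta>}" "\<phi> s = ?w0" by (metis imageE)
    then show False using minimal[of s] \<delta>(1) by auto
  qed
  ultimately obtain c where c: "0 < c" "\<forall>x\<in>\<phi> ` {\<delta>..T - \<delta>}. c \<le> dist ?w0 x"
    using separate_point_closed[OF compact_imp_closed] by blast
  have "continuous_on ({\<delta>..T - \<delta>} \<times> B0) (\<lambda>(t, w). \<Phi> t w)"
    by (rule continuous_on_subset[OF \<Phi>c]) (use \<delta> in auto)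
  from uniform_continuity_in_parameter[OF this B0(1,2) half_gt_zero[OF c(1)]]
  obtain d3 where d3: "0 < d3" "ball ?w0 d3 \<subseteq> B0"
    "\<forall>w\<in>ball ?w0 d3. \<forall>t\<in>{\<delta>..T - \<delta>}. dist (\<Phi> t w) (\<Phi> t ?w0) < c / 2" by blast
  have middle: "\<Phi> s w \<notin> ball ?w0 (c / 2)" if "w \<in> ball ?w0 d3" "s \<in> {\<delta>..T - \<delta>}" for s w
  proof
    assume "\<Phi> s w \<in> ball ?w0 (c / 2)"
    then have "dist ?w0 (\<Phi> s w) < c / 2" by simp
    moreover have "dist (\<Phi> s w) (\<phi> s) < c / 2"
      using d3(3) that B0(6) \<delta> by auto
    moreover have "c \<le> dist ?w0 (\<phi> s)" using c(2) that(2) by blast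
    ultimately show False using dist_triangle[of ?w0 "\<phi> s" "\<Phi> s w"] by simp
  qed
  \<comment> \<open>Time is the unknown of the implicit function theorem, hence the swapped
    arguments.\<close>
  let ?F2 = "\<lambda>x. \<sigma> ((\<lambda>(t, w). \<Phi> t w) (snd x, fst x))"
  define \<Omega> where "\<Omega> = {x. (snd x, fst x) \<in> R}"
  have "open ((\<lambda>x :: 'w \<times> real. (snd x, fst x)) -` R)"
    by (rule open_vimage[OF opR]) (intro continuous_intros)
  then have op\<Omega>: "open \<Omega>" by (simp add: \<Omega>_def vimage_def)
  have F2: "Ck_open (Suc k) ?F2 \<Omega>"
  proof (rule Ck_open_compose[OF op\<Omega> _ \<sigma>(2)])
    show "Ck_open (Suc k) (\<lambda>x. (\<lambda>(t, w). \<Phi> t w) (snd x, fst x)) \<Omega>"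
    proof (rule Ck_open_compose[OF op\<Omega> _ B0(7)])
      show "Ck_open (Suc k) (\<lambda>x. (snd x, fst x)) \<Omega>"
        by (intro Ck_open_Pair Ck_open_fst Ck_open_snd Ck_open_id op\<Omega>)
    qed (auto simp: \<Omega>_def R_def)
  qed (auto simp: \<Omega>_def R_def Wp_def)
  have q: "(?w0, T) \<in> \<Omega>" using R0(2) by (simp add: \<Omega>_def)
  have F20: "?F2 (?w0, T) = 0" using B0(6) T(1) \<phi>T \<sigma>(4) by simp
  have inj: "y = 0" if y: "frechet_derivative ?F2 (at (?w0, T)) (0, y) = 0" for y
  proof -
    have D: "(?F2 has_derivative frechet_derivative ?F2 (at (?w0, T))) (at (?w0, T))"
      by (rule Ck_open_has_derivative[OF F2 q])
    have "((\<lambda>t. (?w0, t)) has_derivative (\<lambda>h. (0, h))) (at T)"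
      by (intro has_derivative_Pair has_derivative_ident has_derivative_const)
    from has_derivative_compose[OF this D]
    have "((\<lambda>t. \<sigma> (\<Phi> t ?w0)) has_derivative (\<lambda>h. frechet_derivative ?F2 (at (?w0, T)) (0, h))) (at T)" by simp
    from has_derivative_unique[OF this St[OF R0(2), unfolded has_field_derivative_def]]
    have "frechet_derivative ?F2 (at (?w0, T)) (0, y) = frechet_derivative \<sigma> (at (\<Phi> T ?w0)) (F (\<Phi> T ?w0)) * y"
      by (rule fun_cong)
    moreover have "\<Phi> T ?w0 = ?w0" using B0(6) T(1) \<phi>T by simp
    ultimately show ?thesis using y transverse by simp
  qed
  obtain B3 N \<tau> where \<tau>: "open B3" "?w0 \<in> B3" "open N" "T \<in> N" "Ck_open (Suc k) \<tau> B3" "\<tau> ?w0 = T" "B3 \<times> N \<subseteq> \<Omega>"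
    "\<forall>w\<in>B3. \<tau> w \<in> N \<and> ?F2 (w, \<tau> w) = 0" "\<forall>w\<in>B3. \<forall>t\<in>N. ?F2 (w, t) = 0 \<longrightarrow> t = \<tau> w"
    by (rule implicit_function_exists[OF op\<Omega> F2 zero_less_Suc q F20 inj])
  define B4 where "B4 = {w \<in> B3. \<tau> w \<in> {T - \<delta><..<T + \<delta>}}"
  have opB4: "open B4"
    using continuous_open_preimage[OF Ck_open_continuous[OF \<tau>(5)] \<tau>(1) open_greaterThanLessThan[of "T - \<delta>" "T + \<delta>"]]
    by (simp add: B4_def vimage_def Int_def)
  \<comment> \<open>Points of \<open>B\<close> are within \<open>c / 2\<close> of the base point,
    and at intermediate times orbits from \<open>B\<close> are within \<open>c / 2\<close> of an
    orbit that keeps distance \<open>c\<close>; so they are outside \<open>B\<close> then.\<close>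
  define B where "B = B4 \<inter> C1 \<inter> C2 \<inter> ball ?w0 d3 \<inter> ball ?w0 (c / 2) \<inter> B0 \<inter> Ws"
  have B: "open B" "?w0 \<in> B"
    unfolding B_def by (intro open_Int opB4 AC1 AC2 B0(1) \<sigma>(1) open_ball)
      (use AC1(4) AC2(4) B0(2) \<sigma>(3) \<tau>(2,6) \<delta>(1) d3(1) c(1) in \<open>auto simp: B4_def\<close>)
  have BB: "B \<subseteq> B0" "B \<subseteq> C1" "B \<subseteq> C2" "B \<subseteq> Ws" "B \<subseteq> B3" "B \<subseteq> ball ?w0 d3" "B \<subseteq> ball ?w0 (c / 2)"
    "\<And>w. w \<in> B \<Longrightarrow> \<tau> w \<in> {T - \<delta><..<T + \<delta>}"
    by (auto simp: B_def B4_def)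
  have \<tau>0: "\<sigma> (\<Phi> (\<tau> w) w) = 0" if "w \<in> B" for w using \<tau>(8) that BB(5) by auto
  have only: "\<Phi> s w \<in> Ws \<and> (\<sigma> (\<Phi> s w) = 0 \<longleftrightarrow> s = \<tau> w)" if w: "w \<in> B" and s: "s \<in> {T - \<delta><..<T + \<delta>}" for w s
  proof -
    have wC: "w \<in> C2" using w BB(3) by auto
    have "(s, w) \<in> R" by (rule inR) (use s wC in blast)
    then show ?thesis
      using nearT[OF wC s BB(8)[OF w]] \<tau>0[OF w] by (auto simp: R_def Wp_def)
  qed
  have first: "\<sigma> (\<Phi> s w) \<noteq> 0" if w: "w \<in> B" "\<sigma> w = 0" and s: "0 < s" "s < \<tau> w" "\<Phi> s w \<in> B" for w s
  proof
    assume 0: "\<sigma> (\<Phi> s w) = 0"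
    have \<tau>w: "\<tau> w < T + \<delta>" using BB(8)[OF w(1)] by simp
    consider "s < \<delta>" | "s \<in> {\<delta>..T - \<delta>}" | "T - \<delta> < s" by fastforce
    then show False
    proof cases
      case 1
      have "\<Phi> 0 w = w" using B0(3) w(1) BB(1) by blast
      then have "s = 0" using near0[of w s 0] w BB(2) s(1) 1 \<delta>(1) 0 by auto
      then show False using s by simp
    next
      case 2
      then show False using middle[of w s] w(1) s(3) BB(6,7) by blast
    next
      case 3
      then show False using only[OF w(1), of s] 0 s \<tau>w by auto
    qed
  qed
  show thesis
  proof (rule that[of B \<delta> \<Phi> \<tau>])
    show "Ck_open (Suc k) (\<lambda>(t, w). \<Phi> t w) ({?a<..<?b} \<times> B)"
      by (rule Ck_open_subset[OF B0(7)]) (use BB(1) in auto)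
    show "Ck_open (Suc k) \<tau> B" by (rule Ck_open_subset[OF \<tau>(5) BB(5)])
    show "\<forall>w\<in>B. \<tau> w \<in> {T - \<delta><..<T + \<delta>} \<and> 0 < \<tau> w"
    proof
      fix w assume "w \<in> B"
      from BB(8)[OF this] show "\<tau> w \<in> {T - \<delta><..<T + \<delta>} \<and> 0 < \<tau> w" using \<delta>(5) by simp
    qed
    show "\<forall>w\<in>B. \<forall>s\<in>{T - \<delta><..<T + \<delta>}. \<Phi> s w \<in> Ws \<and> (\<sigma> (\<Phi> s w) = 0 \<longleftrightarrow> s = \<tau> w)"
      by (intro ballI only)
    show "\<forall>w\<in>B. \<sigma> w = 0 \<longrightarrow> (\<forall>s. 0 < s \<and> s < \<tau> w \<and> \<Phi> s w \<in> B \<longrightarrow> \<sigma> (\<Phi> s w) \<noteq> 0)"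
      using first by blast
    show "\<forall>w\<in>B. \<Phi> 0 w = w" using B0(3) BB(1) by blast
    show "\<forall>w\<in>B. solves_ode_on F (\<lambda>t. \<Phi> t w) {?a..?b}" using B0(4) BB(1) by blast
    show "\<forall>w\<in>B. \<forall>t\<in>{?a..?b}. \<Phi> t w \<in> W" using B0(5) BB(1) by blast
    show "\<forall>w\<in>B. \<forall>t\<in>{?a<..<?b}. \<forall>v. ((\<lambda>s. frechet_derivative (\<Phi> s) (at w) v) has_vector_derivative
       frechet_derivative F (at (\<Phi> t w)) (frechet_derivative (\<Phi> t) (at w) v)) (at t)"
      using B0(8) BB(1) by blast
    show "\<tau> ?w0 = T" by (rule \<tau>(6))
    show "\<forall>t\<in>{?a..?b}. \<Phi> t ?w0 = \<phi> t" by (rule B0(6))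
  qed (use B BB(4) \<delta> in auto)
qed

section \<open>Difference quotients of smooth maps\<close>

text \<open>Differentiation under the integral sign replaces \<open>K\<close> by a directional
  derivative of \<open>K\<close>, so the induction hypothesis applies to the new integrand.
  \<open>\<Omega>\<close> is an open set around the compact fibres, as smoothness is a notion for
  open sets.\<close>

lemma Ck_open_parametric_integral:
  fixes K :: "'x::euclidean_space \<times> real \<Rightarrow> 'y::euclidean_space"
  assumes U: "open U" and \<Omega>: "open \<Omega>" "U \<times> {0..1} \<subseteq> \<Omega>" and K: "Ck_open k K \<Omega>"
  shows "Ck_open k (\<lambda>x. integral {0..1} (\<lambda>s. K (x, s))) U"
  using K
proof (induction k arbitrary: K)
  case 0
  have "continuous_on (U \<times> cbox 0 1) (\<lambda>(x, s). K (x, s))"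
    using 0 \<Omega>(2) by (auto simp: case_prod_unfold intro: continuous_on_subset)
  from integral_continuous_on_param[OF this] show ?case by (simp add: cbox_interval)
next
  case (Suc k)
  note K = Suc.prems
  define D where "D = (\<lambda>x s. Blinfun (\<lambda>v. frechet_derivative K (at (x, s)) (v, 0)))"
  have emb: "bounded_linear (\<lambda>v :: 'x. (v, 0 :: real))"
    by (intro bounded_linear_Pair bounded_linear_ident bounded_linear_zero)
  have Dc: "continuous_on \<Omega> (\<lambda>q. Blinfun (\<lambda>v. frechet_derivative K (at q) (v, 0)))"
    by (rule continuous_on_blinfun_frechet_derivative(1)[OF K emb])
  have D: "blinfun_apply (D x s) v = frechet_derivative K (at (x, s)) (v, 0)" if "x \<in> U" "s \<in> {0..1}" for x s v
    unfolding D_def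
    by (subst continuous_on_blinfun_frechet_derivative(2)[OF K emb]) (use that \<Omega>(2) in auto)
  have sec: "((\<lambda>x. K (x, s)) has_derivative blinfun_apply (D x s)) (at x)" if xs: "x \<in> U" "s \<in> {0..1}" for x s
  proof -
    have "((\<lambda>x. (x, s)) has_derivative (\<lambda>v. (v, 0))) (at x)"
      by (intro has_derivative_Pair has_derivative_ident has_derivative_const)
    moreover have "(x, s) \<in> \<Omega>" using xs \<Omega>(2) by auto
    from Ck_open_has_derivative[OF K this]
    have "(K has_derivative frechet_derivative K (at (x, s))) (at (x, s))" .
    ultimately have "((\<lambda>x. K (x, s)) has_derivative (\<lambda>v. frechet_derivative K (at (x, s)) (v, 0))) (at x)"
      by (rule has_derivative_compose)
    then show ?thesis by (rule has_derivative_eq_rhs) (simp add: fun_eq_iff D[OF xs])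
  qed
  have cK: "continuous_on {0..1} (\<lambda>s. K (x, s))" if "x \<in> U" for x
    by (rule continuous_on_compose2[OF Ck_open_continuous[OF K]]) (use that \<Omega>(2) in \<open>auto intro!: continuous_intros\<close>)
  have cD: "continuous_on {0..1} (D x)" if "x \<in> U" for x
    unfolding D_def
    by (rule continuous_on_compose2[OF Dc]) (use that \<Omega>(2) in \<open>auto intro!: continuous_intros\<close>)
  show ?case
  proof (rule Ck_open_SucI[OF U])
    fix x assume x: "x \<in> U"
    obtain e where e: "0 < e" "ball x e \<subseteq> U" by (rule openE[OF U x])
    have "((\<lambda>x. integral (cbox 0 1) (\<lambda>s. K (x, s))) has_derivative blinfun_apply (integral (cbox 0 1) (D x))) (at x within ball x e)"
    proof (rule leibniz_rule)
      show "((\<lambda>x. K (x, s)) has_derivative blinfun_apply (D y s)) (at y within ball x e)" if "y \<in> ball x e" "s \<in> cbox 0 1" for y s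
        by (rule has_derivative_at_withinI[OF sec]) (use that e(2) in \<open>auto simp: cbox_interval\<close>)
      show "(\<lambda>s. K (y, s)) integrable_on cbox 0 1" if "y \<in> ball x e" for y
        unfolding cbox_interval by (rule integrable_continuous_real[OF cK]) (use that e(2) in auto)
      show "continuous_on (ball x e \<times> cbox 0 1) (\<lambda>(x, s). D x s)"
        unfolding D_def case_prod_unfold prod.collapse
        by (rule continuous_on_subset[OF Dc]) (use e(2) \<Omega>(2) in \<open>auto simp: cbox_interval\<close>)
    qed (use e(1) in auto)
    moreover have "at x within ball x e = at x" using e(1) by (intro at_within_open) auto
    moreover have "blinfun_apply (integral {0..1} (D x)) = (\<lambda>v. integral {0..1} (\<lambda>s. frechet_derivative K (at (x, s)) (v, 0)))"
    proof
      fix v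
      have "blinfun_apply (integral {0..1} (D x)) v = integral {0..1} (\<lambda>s. blinfun_apply (D x s) v)"
        by (rule blinfun_apply_integral[OF integrable_continuous_real[OF cD[OF x]]])
      also have "\<dots> = integral {0..1} (\<lambda>s. frechet_derivative K (at (x, s)) (v, 0))"
        by (rule integral_cong) (simp add: D[OF x])
      finally show "blinfun_apply (integral {0..1} (D x)) v = integral {0..1} (\<lambda>s. frechet_derivative K (at (x, s)) (v, 0))" .
    qed
    ultimately show "((\<lambda>x. integral {0..1} (\<lambda>s. K (x, s))) has_derivative
        (\<lambda>v. integral {0..1} (\<lambda>s. frechet_derivative K (at (x, s)) (v, 0)))) (at x)"
      by (simp add: cbox_interval)
  next
    show "Ck_open k (\<lambda>x. integral {0..1} (\<lambda>s. frechet_derivative K (at (x, s)) (v, 0))) U" for v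
      by (rule Suc.IH[OF Ck_open_frechet[OF K]])
  qed
qed

text \<open>The quotient is the mean of the \<epsilon>-derivative over the segment from 0 to
  \<epsilon>, and this integral is as smooth as the derivative also at \<epsilon> = 0, where the
  quotient itself is not defined.\<close>

lemma Ck_open_difference_quotient:
  fixes P :: "'z::euclidean_space \<times> real \<Rightarrow> 'y::euclidean_space"
  assumes U: "open U" and P: "Ck_open (Suc k) P (U \<times> {- e<..<e})" and e: "0 < e"
  obtains G where "Ck_open k (\<lambda>(Z, \<epsilon>). G Z \<epsilon>) (U \<times> {- e<..<e})"
    "\<forall>Z\<in>U. \<forall>\<epsilon>\<in>{- e<..<e}. P (Z, \<epsilon>) = P (Z, 0) + \<epsilon> *\<^sub>R G Z \<epsilon>"
proof -
  let ?V = "U \<times> {- e<..<e}"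
  \<comment> \<open>Maps \<open>((Z, \<epsilon>), s)\<close> to \<open>(Z, s * \<epsilon>)\<close>.
    Its preimage \<open>\<Omega>\<close> is open and contains the parameter domain times
    \<open>{0..1}\<close>.\<close>
  let ?m = "\<lambda>q :: ('z \<times> real) \<times> real. (fst (fst q), snd q * snd (fst q))"
  define \<Omega> where "\<Omega> = ?m -` ?V"
  have opV: "open ?V" using U by (simp add: open_Times)
  have op: "open \<Omega>"
    unfolding \<Omega>_def by (rule open_vimage[OF opV]) (intro continuous_intros)
  have seg: "s * \<epsilon> \<in> {- e<..<e}" if "\<epsilon> \<in> {- e<..<e}" "s \<in> {0..1}" for s \<epsilon>
  proof -
    have "\<bar>s * \<epsilon>\<bar> \<le> 1 * \<bar>\<epsilon>\<bar>" unfolding abs_mult by (intro mult_right_mono) (use that in auto)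
    then show ?thesis using that(1) by auto
  qed
  have sub: "?V \<times> {0..1} \<subseteq> \<Omega>"
    using seg by (auto simp: \<Omega>_def)
  let ?K = "\<lambda>q. frechet_derivative P (at (?m q)) (0, 1)"
  have K: "Ck_open k ?K \<Omega>"
  proof (rule Ck_open_frechet_derivative[OF op P _ Ck_open_const[OF op]])
    show "Ck_open k ?m \<Omega>"
      by (intro Ck_open_Pair Ck_open_mult Ck_open_fst Ck_open_snd Ck_open_id op)
  qed (simp add: \<Omega>_def)
  define G where "G = (\<lambda>Z \<epsilon>. integral {0..1} (\<lambda>s. ?K ((Z, \<epsilon>), s)))"
  have "Ck_open k (\<lambda>x. integral {0..1} (\<lambda>s. ?K (x, s))) ?V"
    by (rule Ck_open_parametric_integral[OF opV op sub K])
  then have 1: "Ck_open k (\<lambda>(Z, \<epsilon>). G Z \<epsilon>) ?V"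
    unfolding G_def case_prod_unfold by simp
  have 2: "P (Z, \<epsilon>) = P (Z, 0) + \<epsilon> *\<^sub>R G Z \<epsilon>" if Z: "Z \<in> U" and \<epsilon>: "\<epsilon> \<in> {- e<..<e}" for Z \<epsilon>
  proof -
    have "((\<lambda>s. P (Z, s * \<epsilon>)) has_vector_derivative \<epsilon> *\<^sub>R ?K ((Z, \<epsilon>), s)) (at s within {0..1})" if s: "s \<in> {0..1}" for s
    proof -
      have D: "(P has_derivative frechet_derivative P (at (Z, s * \<epsilon>))) (at (Z, s * \<epsilon>))"
        by (rule Ck_open_has_derivative[OF P]) (use Z seg[OF \<epsilon> s] in auto)
      have "((\<lambda>s. (Z, s * \<epsilon>)) has_derivative (\<lambda>h. (0, h * \<epsilon>))) (at s within {0..1})"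
        by (auto intro!: derivative_eq_intros)
      from has_derivative_compose[OF this D]
      have "((\<lambda>s. P (Z, s * \<epsilon>)) has_derivative (\<lambda>h. frechet_derivative P (at (Z, s * \<epsilon>)) (0, h * \<epsilon>))) (at s within {0..1})" .
      moreover have "frechet_derivative P (at (Z, s * \<epsilon>)) (0, h * \<epsilon>) = h *\<^sub>R \<epsilon> *\<^sub>R ?K ((Z, \<epsilon>), s)" for h
        using linear_scale[OF has_derivative_linear[OF D], of "h * \<epsilon>" "(0, 1)"] by simp
      ultimately show ?thesis by (simp add: has_vector_derivative_def)
    qed
    from fundamental_theorem_of_calculus[OF _ this]
    have "((\<lambda>s. \<epsilon> *\<^sub>R ?K ((Z, \<epsilon>), s)) has_integral P (Z, \<epsilon>) - P (Z, 0)) {0..1}" by simp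
    then have "P (Z, \<epsilon>) - P (Z, 0) = integral {0..1} (\<lambda>s. \<epsilon> *\<^sub>R ?K ((Z, \<epsilon>), s))"
      by (rule integral_unique[symmetric])
    also have "\<dots> = \<epsilon> *\<^sub>R G Z \<epsilon>" unfolding G_def by (rule integral_cmul)
    finally show ?thesis by (simp add: algebra_simps)
  qed
  show thesis by (rule that[of G]) (use 1 2 in blast)+
qed

section \<open>The extended autonomous system\<close>

lemma vector_derivative_zero_constant:
  fixes h :: "real \<Rightarrow> 'z::real_normed_vector"
  assumes "\<And>t. t \<in> {a..b} \<Longrightarrow> (h has_vector_derivative 0) (at t within {a..b})" "s \<in> {a..b}" "t \<in> {a..b}"
  shows "h s = h t"
proof -
  have "\<exists>c. \<forall>x\<in>{a..b}. h x = c"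
    by (rule has_derivative_zero_constant) (use assms(1) in \<open>auto simp: has_vector_derivative_def\<close>)
  then show ?thesis using assms(2,3) by auto
qed

text \<open>State \<open>(z, \<alpha>, \<epsilon>)\<close>, with \<open>\<epsilon>\<close> as a constant of motion; \<open>F\<close> is defined on a neighbourhood \<open>W\<close>
  that also contains some negative values of \<open>\<epsilon>\<close>.\<close>

locale extended_system =
  fixes f :: "'a::euclidean_space \<times> real \<Rightarrow> real \<Rightarrow> real \<Rightarrow> 'a \<times> real"
    and g :: "'a \<times> real \<Rightarrow> real \<Rightarrow> real \<Rightarrow> real" and k :: nat and \<epsilon>\<^sub>1 :: real
    and W :: "(('a \<times> real) \<times> real \<times> real) set"
    and F :: "('a \<times> real) \<times> real \<times> real \<Rightarrow> ('a \<times> real) \<times> real \<times> real"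
  assumes eps: "0 < \<epsilon>\<^sub>1" and W: "open W" and domain: "UNIV \<times> UNIV \<times> {0..<\<epsilon>\<^sub>1} \<subseteq> W"
    and F: "Ck_open (Suc k) F W"
    and F_eq: "\<And>z \<alpha> \<epsilon>. \<epsilon> \<in> {0..<\<epsilon>\<^sub>1} \<Longrightarrow> F (z, \<alpha>, \<epsilon>) = (f z \<alpha> \<epsilon>, \<epsilon> * g z \<alpha> \<epsilon>, 0)"
    and F_eps: "\<And>w. w \<in> W \<Longrightarrow> snd (snd (F w)) = 0"

lemma (in extended_system) in_domain: "\<epsilon> \<in> {0..<\<epsilon>\<^sub>1} \<Longrightarrow> (z, \<alpha>, \<epsilon>) \<in> W"
  using domain by auto

lemma (in extended_system) in_domain0: "(z, \<alpha>, 0) \<in> W"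
  using eps by (intro in_domain) simp

lemma (in extended_system) F_eq0: "F (z, \<alpha>, 0) = (f z \<alpha> 0, 0, 0)"
  using eps F_eq[of 0 z \<alpha>] by simp

lemma (in extended_system) frozen_embedding_derivative: "((\<lambda>z. (z, \<alpha>, 0)) has_derivative (\<lambda>v. (v, 0, 0))) (at z)"
  by (auto intro!: derivative_eq_intros simp: zero_prod_def)

lemma (in extended_system) frozen_Ck: "Ck_open (Suc k) (\<lambda>z. f z \<alpha> 0) UNIV"
proof -
  have "Ck_open (Suc k) (\<lambda>z. fst (F (z, \<alpha>, 0))) UNIV"
    by (intro Ck_open_fst open_UNIV Ck_open_compose[OF open_UNIV _ F] Ck_open_Pair Ck_open_id Ck_open_const)
      (rule in_domain0)
  then show ?thesis by (simp add: F_eq0)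
qed

lemma (in extended_system) frozen_derivative:
  "frechet_derivative F (at (z, \<alpha>, 0)) (v, 0, 0) = (frechet_derivative (\<lambda>z. f z \<alpha> 0) (at z) v, 0, 0)"
proof -
  note D = Ck_open_has_derivative[OF F in_domain0]
  have "((\<lambda>z. F (z, \<alpha>, 0)) has_derivative (\<lambda>v. frechet_derivative F (at (z, \<alpha>, 0)) (v, 0, 0))) (at z)"
    by (rule has_derivative_compose[OF frozen_embedding_derivative D])
  moreover have "((\<lambda>z. F (z, \<alpha>, 0)) has_derivative (\<lambda>v. (frechet_derivative (\<lambda>z. f z \<alpha> 0) (at z) v, 0, 0))) (at z)"
    unfolding F_eq0
    by (intro has_derivative_Pair has_derivative_const Ck_open_has_derivative[OF frozen_Ck]) simp
  ultimately show ?thesis using has_derivative_unique by (metis (no_types, lifting))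
qed

lemma (in extended_system) lift_frozen:
  assumes "solves_ode_on (\<lambda>z. f z \<alpha> 0) \<phi> I"
  shows "solves_ode_on F (\<lambda>t. (\<phi> t, \<alpha>, 0)) I"
  unfolding solves_ode_on_def F_eq0
  using assms by (auto simp: solves_ode_on_def intro!: has_vector_derivative_Pair)

text \<open>The last component of \<open>F\<close> vanishes on all of \<open>W\<close>, also for
  unphysical \<epsilon>. Hence \<epsilon> is seen to be constant first, and only then is the
  explicit form of \<open>F\<close>, known for admissible \<epsilon>, inserted.\<close>

lemma (in extended_system) drop_full:
  assumes \<psi>: "solves_ode_on F \<psi> {a..b}" "\<And>t. t \<in> {a..b} \<Longrightarrow> \<psi> t \<in> W"
    and c: "c \<in> {a..b}" "snd (snd (\<psi> c)) = \<epsilon>" and \<epsilon>: "\<epsilon> \<in> {0..<\<epsilon>\<^sub>1}"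
  shows "t \<in> {a..b} \<Longrightarrow> snd (snd (\<psi> t)) = \<epsilon>"
    and "solves_ode_on (full_field f g \<epsilon>) (\<lambda>t. (fst (\<psi> t), fst (snd (\<psi> t)))) {a..b}"
proof -
  have d: "(\<psi> has_vector_derivative F (\<psi> t)) (at t within {a..b})" if "t \<in> {a..b}" for t
    using \<psi>(1) that by (simp add: solves_ode_on_def)
  have const: "snd (snd (\<psi> t)) = \<epsilon>" if t: "t \<in> {a..b}" for t
  proof -
    have "((\<lambda>t. snd (snd (\<psi> t))) has_vector_derivative 0) (at t within {a..b})" if "t \<in> {a..b}" for t
      using bounded_linear.has_vector_derivative[OF bounded_linear_snd
          bounded_linear.has_vector_derivative[OF bounded_linear_snd d[OF that]]]
        F_eps[OF \<psi>(2)[OF that]] by simp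
    from vector_derivative_zero_constant[OF this t c(1)] show ?thesis using c(2) by simp
  qed
  show "t \<in> {a..b} \<Longrightarrow> snd (snd (\<psi> t)) = \<epsilon>" by (rule const)
  show "solves_ode_on (full_field f g \<epsilon>) (\<lambda>t. (fst (\<psi> t), fst (snd (\<psi> t)))) {a..b}"
    unfolding solves_ode_on_def
  proof
    fix t assume t: "t \<in> {a..b}"
    have "\<psi> t = (fst (\<psi> t), fst (snd (\<psi> t)), \<epsilon>)" using const[OF t] by (simp add: prod_eq_iff)
    then have "F (\<psi> t) = (f (fst (\<psi> t)) (fst (snd (\<psi> t))) \<epsilon>, \<epsilon> * g (fst (\<psi> t)) (fst (snd (\<psi> t))) \<epsilon>, 0)"
      using F_eq[OF \<epsilon>] by metis
    moreover have "((\<lambda>t. (fst (\<psi> t), fst (snd (\<psi> t)))) has_vector_derivative (fst (F (\<psi> t)), fst (snd (F (\<psi> t))))) (at t within {a..b})"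
      by (intro has_vector_derivative_Pair bounded_linear.has_vector_derivative[OF bounded_linear_fst]
          bounded_linear.has_vector_derivative[OF bounded_linear_snd] d t)
    ultimately show "((\<lambda>t. (fst (\<psi> t), fst (snd (\<psi> t)))) has_vector_derivative
        full_field f g \<epsilon> (fst (\<psi> t), fst (snd (\<psi> t)))) (at t within {a..b})"
      by (simp add: full_field_def)
  qed
qed

lemma (in extended_system) drop_frozen:
  assumes \<psi>: "solves_ode_on F \<psi> {a..b}" "\<And>t. t \<in> {a..b} \<Longrightarrow> \<psi> t \<in> W"
    and c: "c \<in> {a..b}" "snd (\<psi> c) = (\<alpha>, 0)"
  shows "t \<in> {a..b} \<Longrightarrow> snd (\<psi> t) = (\<alpha>, 0)"
    and "solves_ode_on (\<lambda>z. f z \<alpha> 0) (\<lambda>t. fst (\<psi> t)) {a..b}"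
proof -
  have e0: "0 \<in> {0..<\<epsilon>\<^sub>1}" using eps by simp
  have c0: "snd (snd (\<psi> c)) = 0" using c(2) by simp
  note full = drop_full[OF \<psi> c(1) c0 e0]
  have d: "((\<lambda>t. (fst (\<psi> t), fst (snd (\<psi> t)))) has_vector_derivative (f (fst (\<psi> t)) (fst (snd (\<psi> t))) 0, 0)) (at t within {a..b})"
    if "t \<in> {a..b}" for t
    using full(2) that by (simp add: solves_ode_on_def full_field_def)
  have const: "fst (snd (\<psi> t)) = \<alpha>" if t: "t \<in> {a..b}" for t
  proof -
    have "((\<lambda>t. fst (snd (\<psi> t))) has_vector_derivative 0) (at t within {a..b})" if "t \<in> {a..b}" for t
      using bounded_linear.has_vector_derivative[OF bounded_linear_snd d[OF that]] by simp
    from vector_derivative_zero_constant[OF this t c(1)] show ?thesis using c(2) by simp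
  qed
  show "t \<in> {a..b} \<Longrightarrow> snd (\<psi> t) = (\<alpha>, 0)" using const full(1) by (simp add: prod_eq_iff)
  show "solves_ode_on (\<lambda>z. f z \<alpha> 0) (\<lambda>t. fst (\<psi> t)) {a..b}"
    unfolding solves_ode_on_def
  proof
    fix t assume t: "t \<in> {a..b}"
    show "((\<lambda>t. fst (\<psi> t)) has_vector_derivative f (fst (\<psi> t)) \<alpha> 0) (at t within {a..b})"
      using bounded_linear.has_vector_derivative[OF bounded_linear_fst d[OF t]] const[OF t] by simp
  qed
qed

lemma (in extended_system) flow_follows_cycle:
  assumes \<psi>: "solves_ode_on F \<psi> {0..b}" "\<And>t. t \<in> {0..b} \<Longrightarrow> \<psi> t \<in> W" "\<psi> 0 = (\<gamma> 0, \<alpha>, 0)"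
    and \<gamma>: "solves_ode_on (\<lambda>z. f z \<alpha> 0) \<gamma> UNIV" and t: "t \<in> {0..b}"
  shows "\<psi> t = (\<gamma> t, \<alpha>, 0)"
  by (rule ode_unique[OF W F \<psi>(1) lift_frozen[OF solves_ode_subset[OF \<gamma>]] \<psi>(2) _ _ \<psi>(3) t])
    (use t in \<open>auto intro: in_domain0\<close>)

lemma (in extended_system) monodromy_of_flow:
  assumes B: "w = (\<gamma> 0, \<alpha>, 0)" "0 < T"
    and \<Phi>: "\<And>t. t \<in> {0..T} \<Longrightarrow> \<Phi> t w = (\<gamma> t, \<alpha>, 0)"
    and var: "\<And>t v. t \<in> {0..T} \<Longrightarrow> ((\<lambda>s. frechet_derivative (\<Phi> s) (at w) v) has_vector_derivative
       frechet_derivative F (at (\<Phi> t w)) (frechet_derivative (\<Phi> t) (at w) v)) (at t)"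
    and init: "\<And>v. frechet_derivative (\<Phi> 0) (at w) v = v"
    and \<gamma>: "solves_ode_on (\<lambda>z. f z \<alpha> 0) \<gamma> UNIV"
    and X: "principal_variational_solution (\<lambda>z. f z \<alpha> 0) \<gamma> T X"
  shows "frechet_derivative (\<Phi> T) (at w) (v, 0, 0) = (X T v, 0, 0)"
proof (rule variational_unique[OF F, of 0 T "\<lambda>t. (\<gamma> t, \<alpha>, 0)" "\<lambda>t. frechet_derivative (\<Phi> t) (at w) (v, 0, 0)"
      "\<lambda>t. (X t v, 0, 0)" 0])
  show "continuous_on {0..T} (\<lambda>t. (\<gamma> t, \<alpha>, 0))"
    by (intro continuous_intros continuous_on_subset[OF solves_ode_continuous[OF \<gamma>]]) simp
  show "((\<lambda>t. frechet_derivative (\<Phi> t) (at w) (v, 0, 0)) has_vector_derivative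
      frechet_derivative F (at (\<gamma> t, \<alpha>, 0)) (frechet_derivative (\<Phi> t) (at w) (v, 0, 0))) (at t within {0..T})"
    if "t \<in> {0..T}" for t
    using has_vector_derivative_at_within[OF var[OF that]] \<Phi>[OF that] by simp
  show "((\<lambda>t. (X t v, 0, 0)) has_vector_derivative frechet_derivative F (at (\<gamma> t, \<alpha>, 0)) (X t v, 0, 0)) (at t within {0..T})"
    if "t \<in> {0..T}" for t
    unfolding frozen_derivative using X that unfolding principal_variational_solution_def
    by (intro has_vector_derivative_Pair has_vector_derivative_const) blast
  show "frechet_derivative (\<Phi> 0) (at w) (v, 0, 0) = (X 0 v, 0, 0)"
  proof -
    have "X 0 v = v" using X unfolding principal_variational_solution_def by blast
    then show ?thesis using init by simp
  qed
qed (use B in \<open>auto intro: in_domain0\<close>)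

text \<open>Smoothness up to \<epsilon> = 0 means by definition that smooth extensions exist; the
  field is built from these extensions on the intersection of their domains.\<close>

lemma extended_system_exists:
  fixes f :: "'a::euclidean_space \<times> real \<Rightarrow> real \<Rightarrow> real \<Rightarrow> 'a \<times> real" and g :: "'a \<times> real \<Rightarrow> real \<Rightarrow> real \<Rightarrow> real"
  assumes "0 < \<epsilon>\<^sub>1"
    and f: "Ck_on (Suc k) (\<lambda>(z, \<alpha>, \<epsilon>). f z \<alpha> \<epsilon>) (UNIV \<times> UNIV \<times> {0..<\<epsilon>\<^sub>1})"
    and g: "Ck_on (Suc k) (\<lambda>(z, \<alpha>, \<epsilon>). g z \<alpha> \<epsilon>) (UNIV \<times> UNIV \<times> {0..<\<epsilon>\<^sub>1})"
  obtains W F where "extended_system f g k \<epsilon>\<^sub>1 W F"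
proof -
  let ?A = "(UNIV :: ('a \<times> real) set) \<times> (UNIV :: real set) \<times> {0..<\<epsilon>\<^sub>1}"
  obtain Wf f' where f': "open Wf" "?A \<subseteq> Wf" "Ck_open (Suc k) f' Wf" "\<forall>x\<in>?A. f' x = (\<lambda>(z, \<alpha>, \<epsilon>). f z \<alpha> \<epsilon>) x"
    using f unfolding Ck_on_def by (elim exE conjE)
  obtain Wg g' where g': "open Wg" "?A \<subseteq> Wg" "Ck_open (Suc k) g' Wg" "\<forall>x\<in>?A. g' x = (\<lambda>(z, \<alpha>, \<epsilon>). g z \<alpha> \<epsilon>) x"
    using g unfolding Ck_on_def by (elim exE conjE)
  define W where "W = Wf \<inter> Wg"
  define F where "F = (\<lambda>w. (f' w, snd (snd w) * g' w, 0 :: real))"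
  have W: "open W" using f'(1) g'(1) by (simp add: W_def open_Int)
  have "extended_system f g k \<epsilon>\<^sub>1 W F"
  proof
    show "Ck_open (Suc k) F W"
      unfolding F_def
      by (intro Ck_open_Pair Ck_open_mult Ck_open_snd Ck_open_id Ck_open_const W
          Ck_open_subset[OF f'(3)] Ck_open_subset[OF g'(3)]) (simp_all add: W_def)
    show "F (z, \<alpha>, \<epsilon>) = (f z \<alpha> \<epsilon>, \<epsilon> * g z \<alpha> \<epsilon>, 0)" if "\<epsilon> \<in> {0..<\<epsilon>\<^sub>1}" for z \<alpha> \<epsilon>
      using f'(4)[rule_format, of "(z, \<alpha>, \<epsilon>)"] g'(4)[rule_format, of "(z, \<alpha>, \<epsilon>)"] that by (simp add: F_def)
    show "?A \<subseteq> W" using f'(2) g'(2) by (simp add: W_def)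
  qed (use assms(1) W in \<open>auto simp: F_def\<close>)
  then show thesis by (rule that)
qed

section \<open>Continuation of a hyperbolic cycle\<close>

text \<open>Bundles what is known about returns near a closed orbit in a form that survives
  shrinking \<open>B\<close>, since every application has to shrink it further.\<close>

definition return_structure ::
  "('w::euclidean_space \<Rightarrow> 'w) \<Rightarrow> 'w set \<Rightarrow> nat \<Rightarrow> ('w \<Rightarrow> real) \<Rightarrow> 'w set \<Rightarrow> real \<Rightarrow> 'w \<Rightarrow>
   'w set \<Rightarrow> (real \<Rightarrow> 'w \<Rightarrow> 'w) \<Rightarrow> ('w \<Rightarrow> real) \<Rightarrow> real \<Rightarrow> bool" where
  "return_structure F W k \<sigma> Ws T w\<^sub>0 B \<Phi> \<tau> \<delta> \<longleftrightarrow>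
     open B \<and> w\<^sub>0 \<in> B \<and> B \<subseteq> Ws \<and> 0 < \<delta> \<and> \<delta> < 1 \<and>
     (\<forall>w\<in>B. \<Phi> 0 w = w) \<and> (\<forall>w\<in>B. solves_ode_on F (\<lambda>t. \<Phi> t w) {- 1..T + 1}) \<and>
     (\<forall>w\<in>B. \<forall>t\<in>{- 1..T + 1}. \<Phi> t w \<in> W) \<and>
     Ck_open (Suc k) (\<lambda>(t, w). \<Phi> t w) ({- 1<..<T + 1} \<times> B) \<and>
     (\<forall>w\<in>B. \<forall>t\<in>{- 1<..<T + 1}. \<forall>v. ((\<lambda>s. frechet_derivative (\<Phi> s) (at w) v) has_vector_derivative
        frechet_derivative F (at (\<Phi> t w)) (frechet_derivative (\<Phi> t) (at w) v)) (at t)) \<and>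
     Ck_open (Suc k) \<tau> B \<and> \<tau> w\<^sub>0 = T \<and> (\<forall>w\<in>B. \<tau> w \<in> {T - \<delta><..<T + \<delta>} \<and> 0 < \<tau> w) \<and>
     (\<forall>w\<in>B. \<forall>s\<in>{T - \<delta><..<T + \<delta>}. \<Phi> s w \<in> Ws \<and> (\<sigma> (\<Phi> s w) = 0 \<longleftrightarrow> s = \<tau> w)) \<and>
     (\<forall>w\<in>B. \<sigma> w = 0 \<longrightarrow> (\<forall>s. 0 < s \<and> s < \<tau> w \<and> \<Phi> s w \<in> B \<longrightarrow> \<sigma> (\<Phi> s w) \<noteq> 0))"

lemma return_structureD:
  assumes "return_structure F W k \<sigma> Ws T w\<^sub>0 B \<Phi> \<tau> \<delta>"
  shows "open B" "w\<^sub>0 \<in> B" "B \<subseteq> Ws" "0 < \<delta>" "\<delta> < 1"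
    "w \<in> B \<Longrightarrow> \<Phi> 0 w = w" "w \<in> B \<Longrightarrow> solves_ode_on F (\<lambda>t. \<Phi> t w) {- 1..T + 1}"
    "w \<in> B \<Longrightarrow> t \<in> {- 1..T + 1} \<Longrightarrow> \<Phi> t w \<in> W"
    "Ck_open (Suc k) (\<lambda>(t, w). \<Phi> t w) ({- 1<..<T + 1} \<times> B)"
    "w \<in> B \<Longrightarrow> t \<in> {- 1<..<T + 1} \<Longrightarrow> ((\<lambda>s. frechet_derivative (\<Phi> s) (at w) v) has_vector_derivative
        frechet_derivative F (at (\<Phi> t w)) (frechet_derivative (\<Phi> t) (at w) v)) (at t)"
    "Ck_open (Suc k) \<tau> B" "\<tau> w\<^sub>0 = T" "w \<in> B \<Longrightarrow> \<tau> w \<in> {T - \<delta><..<T + \<delta>}" "w \<in> B \<Longrightarrow> 0 < \<tau> w"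
    "w \<in> B \<Longrightarrow> s \<in> {T - \<delta><..<T + \<delta>} \<Longrightarrow> \<Phi> s w \<in> Ws"
    "w \<in> B \<Longrightarrow> s \<in> {T - \<delta><..<T + \<delta>} \<Longrightarrow> \<sigma> (\<Phi> s w) = 0 \<longleftrightarrow> s = \<tau> w"
    "w \<in> B \<Longrightarrow> \<sigma> w = 0 \<Longrightarrow> 0 < s \<Longrightarrow> s < \<tau> w \<Longrightarrow> \<Phi> s w \<in> B \<Longrightarrow> \<sigma> (\<Phi> s w) \<noteq> 0"
  using assms unfolding return_structure_def by simp_all

text \<open>The ban on early crossings speaks of crossings inside the neighbourhood only, so it
  becomes weaker with it.\<close>

lemma return_structure_subset:
  assumes R: "return_structure F W k \<sigma> Ws T w\<^sub>0 B \<Phi> \<tau> \<delta>" and B': "open B'" "w\<^sub>0 \<in> B'" "B' \<subseteq> B"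
  shows "return_structure F W k \<sigma> Ws T w\<^sub>0 B' \<Phi> \<tau> \<delta>"
proof -
  note D = return_structureD[OF R]
  have m: "w \<in> B" if "w \<in> B'" for w using B'(3) that by blast
  show ?thesis
    unfolding return_structure_def
  proof (intro conjI ballI allI impI)
    show "B' \<subseteq> Ws" using B'(3) D(3) by blast
    show "Ck_open (Suc k) (\<lambda>(t, w). \<Phi> t w) ({- 1<..<T + 1} \<times> B')"
      by (rule Ck_open_subset[OF D(9)]) (use B'(3) in auto)
    show "Ck_open (Suc k) \<tau> B'" by (rule Ck_open_subset[OF D(11) B'(3)])
    show "\<sigma> (\<Phi> s w) \<noteq> 0" if "w \<in> B'" "\<sigma> w = 0" "0 < s \<and> s < \<tau> w \<and> \<Phi> s w \<in> B'" for w s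
      using D(17)[OF m[OF that(1)] that(2)] that(3) m by blast
  qed (use B' D(4,5,12) in simp, use B' D(4,5,12) in simp, (rule D; (rule m)?; assumption)+)
qed

lemma return_structure_flow_derivative:
  assumes R: "return_structure F W k \<sigma> Ws T w\<^sub>0 B \<Phi> \<tau> \<delta>" and w: "w \<in> B" and t: "t \<in> {- 1<..<T + 1}"
  shows "((\<lambda>s. \<Phi> s w) has_vector_derivative F (\<Phi> t w)) (at t)"
    and "((\<lambda>(t, w). \<Phi> t w) has_derivative (\<lambda>(h, v). h *\<^sub>R F (\<Phi> t w) + frechet_derivative (\<Phi> t) (at w) v)) (at (t, w))"
    and "linear (frechet_derivative (\<Phi> t) (at w))"
    and "frechet_derivative (\<Phi> 0) (at w) v = v"
proof -
  note D = return_structureD[OF R]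
  have "((\<lambda>s. \<Phi> s w) has_vector_derivative F (\<Phi> t w)) (at t within {- 1..T + 1})"
    using D(7)[OF w] t by (auto simp: solves_ode_on_def)
  moreover have "at t within {- 1..T + 1} = at t" by (rule at_within_interior) (use t in auto)
  ultimately show 1: "((\<lambda>s. \<Phi> s w) has_vector_derivative F (\<Phi> t w)) (at t)" by simp
  have q: "(t, w) \<in> {- 1<..<T + 1} \<times> B" using t w by simp
  show "((\<lambda>(t, w). \<Phi> t w) has_derivative (\<lambda>(h, v). h *\<^sub>R F (\<Phi> t w) + frechet_derivative (\<Phi> t) (at w) v)) (at (t, w))"
    by (rule has_derivative_eq_rhs[OF Ck_open_has_derivative[OF D(9) q]])
      (simp add: fun_eq_iff flow_total_derivative(1)[OF D(9) q 1])
  show "linear (frechet_derivative (\<Phi> t) (at w))"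
    by (rule has_derivative_linear[OF flow_total_derivative(2)[OF D(9) q 1]])
  have "(\<Phi> 0 has_derivative (\<lambda>v. v)) (at w)"
    by (rule has_derivative_transform_within_open[OF has_derivative_ident D(1) w]) (use D(6) in auto)
  from frechet_derivative_eq[OF this] show "frechet_derivative (\<Phi> 0) (at w) v = v" by simp
qed

text \<open>The implicit function theorem with parameter \<alpha> and unknowns point and time, for
  the equations "the orbit closes" and "the point lies on the section". Keeping the time as an
  unknown makes the linearisation \<open>X v - v = - s f\<close> together with tangency of
  \<open>v\<close>, which hyperbolicity and transversality reduce to zero.\<close>

lemma (in extended_system) cycle_family:
  assumes hyp: "hyperbolic_limit_cycle (\<lambda>z. f z \<alpha>\<^sub>0 0) T\<^sub>0 \<Gamma>\<^sub>0" and z0: "z\<^sub>0 \<in> \<Gamma>\<^sub>0"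
    and \<sigma>: "open Ws" "Ck_open (Suc k) \<sigma> Ws" "(z\<^sub>0, \<alpha>\<^sub>0, 0) \<in> Ws" "\<sigma> (z\<^sub>0, \<alpha>\<^sub>0, 0) = 0"
    and transverse: "frechet_derivative \<sigma> (at (z\<^sub>0, \<alpha>\<^sub>0, 0)) (f z\<^sub>0 \<alpha>\<^sub>0 0, 0, 0) \<noteq> 0"
  obtains B \<Phi> \<tau> \<delta> I \<zeta> where "return_structure F W k \<sigma> Ws T\<^sub>0 (z\<^sub>0, \<alpha>\<^sub>0, 0) B \<Phi> \<tau> \<delta>"
    "open I" "\<alpha>\<^sub>0 \<in> I" "Ck_open (Suc k) \<zeta> I" "\<zeta> \<alpha>\<^sub>0 = z\<^sub>0"
    "\<forall>\<alpha>\<in>I. (\<zeta> \<alpha>, \<alpha>, 0) \<in> B \<and> \<sigma> (\<zeta> \<alpha>, \<alpha>, 0) = 0 \<and> \<Phi> (\<tau> (\<zeta> \<alpha>, \<alpha>, 0)) (\<zeta> \<alpha>, \<alpha>, 0) = (\<zeta> \<alpha>, \<alpha>, 0)"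
    "\<forall>z \<alpha>. (z, \<alpha>, 0) \<in> B \<and> \<sigma> (z, \<alpha>, 0) = 0 \<and> \<Phi> (\<tau> (z, \<alpha>, 0)) (z, \<alpha>, 0) = (z, \<alpha>, 0) \<longrightarrow> \<alpha> \<in> I \<and> z = \<zeta> \<alpha>"
proof -
  let ?w0 = "(z\<^sub>0, \<alpha>\<^sub>0, 0 :: real)" and ?f0 = "f z\<^sub>0 \<alpha>\<^sub>0 0"
  obtain \<gamma> X where \<gamma>: "periodic_solution (\<lambda>z. f z \<alpha>\<^sub>0 0) T\<^sub>0 \<gamma>" "\<gamma> 0 = z\<^sub>0"
    and X: "principal_variational_solution (\<lambda>z. f z \<alpha>\<^sub>0 0) \<gamma> T\<^sub>0 X" "hyperbolic_apart_from_ones 1 (X T\<^sub>0)"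
    by (rule hyperbolic_limit_cycle_base_point[OF frozen_Ck hyp z0])
  have T0: "0 < T\<^sub>0" and sol: "solves_ode_on (\<lambda>z. f z \<alpha>\<^sub>0 0) \<gamma> UNIV" and per: "\<And>t. \<gamma> (t + T\<^sub>0) = \<gamma> t"
    and minimal: "\<And>s. 0 < s \<Longrightarrow> s < T\<^sub>0 \<Longrightarrow> \<gamma> s \<noteq> \<gamma> 0"
    using \<gamma>(1) by (auto simp: periodic_solution_def)
  have \<gamma>T: "\<gamma> T\<^sub>0 = z\<^sub>0" using per[of 0] \<gamma>(2) by simp
  define \<phi> where "\<phi> = (\<lambda>t. (\<gamma> t, \<alpha>\<^sub>0, 0 :: real))"
  have \<phi>0: "\<phi> 0 = ?w0" by (simp add: \<phi>_def \<gamma>(2))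
  have \<phi>1: "solves_ode_on F \<phi> UNIV" unfolding \<phi>_def by (rule lift_frozen[OF sol])
  have \<phi>2: "\<phi> t \<in> W" for t unfolding \<phi>_def by (rule in_domain0)
  have \<phi>3: "\<phi> (t + T\<^sub>0) = \<phi> t" for t by (simp add: \<phi>_def per)
  have \<phi>4: "\<phi> s \<noteq> \<phi> 0" if "0 < s" "s < T\<^sub>0" for s using minimal[OF that] by (simp add: \<phi>_def)
  have Fw0: "F ?w0 = (?f0, 0, 0)" by (rule F_eq0)
  have tr: "frechet_derivative \<sigma> (at (\<phi> 0)) (F (\<phi> 0)) \<noteq> 0" using transverse by (simp add: \<phi>0 Fw0)
  obtain B0 \<Phi> \<tau> \<delta> where R0: "return_structure F W k \<sigma> Ws T\<^sub>0 ?w0 B0 \<Phi> \<tau> \<delta>"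
    and \<Phi>\<phi>: "\<forall>t\<in>{- 1..T\<^sub>0 + 1}. \<Phi> t ?w0 = \<phi> t"
  proof (rule return_time[OF W F \<phi>1 \<phi>2 T0 \<phi>3 \<phi>4 \<sigma>(1,2) \<sigma>(3,4)[folded \<phi>0] tr])
    fix B \<delta> \<Phi> \<tau>
    assume "open B" "\<phi> 0 \<in> B" "B \<subseteq> Ws" "0 < \<delta>" "\<delta> < 1"
    "\<forall>w\<in>B. \<Phi> 0 w = w" "\<forall>w\<in>B. solves_ode_on F (\<lambda>t. \<Phi> t w) {- 1..T\<^sub>0 + 1}"
    "\<forall>w\<in>B. \<forall>t\<in>{- 1..T\<^sub>0 + 1}. \<Phi> t w \<in> W" and *: "\<forall>t\<in>{- 1..T\<^sub>0 + 1}. \<Phi> t (\<phi> 0) = \<phi> t"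
    and "Ck_open (Suc k) (\<lambda>(t, w). \<Phi> t w) ({- 1<..<T\<^sub>0 + 1} \<times> B)"
    "\<forall>w\<in>B. \<forall>t\<in>{- 1<..<T\<^sub>0 + 1}. \<forall>v. ((\<lambda>s. frechet_derivative (\<Phi> s) (at w) v) has_vector_derivative
       frechet_derivative F (at (\<Phi> t w)) (frechet_derivative (\<Phi> t) (at w) v)) (at t)"
    "Ck_open (Suc k) \<tau> B" "\<tau> (\<phi> 0) = T\<^sub>0" "\<forall>w\<in>B. \<tau> w \<in> {T\<^sub>0 - \<delta><..<T\<^sub>0 + \<delta>} \<and> 0 < \<tau> w"
    "\<forall>w\<in>B. \<forall>s\<in>{T\<^sub>0 - \<delta><..<T\<^sub>0 + \<delta>}. \<Phi> s w \<in> Ws \<and> (\<sigma> (\<Phi> s w) = 0 \<longleftrightarrow> s = \<tau> w)"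
    "\<forall>w\<in>B. \<sigma> w = 0 \<longrightarrow> (\<forall>s. 0 < s \<and> s < \<tau> w \<and> \<Phi> s w \<in> B \<longrightarrow> \<sigma> (\<Phi> s w) \<noteq> 0)"
    then have "return_structure F W k \<sigma> Ws T\<^sub>0 ?w0 B \<Phi> \<tau> \<delta>"
      unfolding return_structure_def \<phi>0 by (intro conjI)
    then show thesis using * unfolding \<phi>0 by (rule that)
  qed
  note D = return_structureD[OF R0]
  have T0I: "T\<^sub>0 \<in> {- 1<..<T\<^sub>0 + 1}" using T0 by simp
  have \<Phi>T: "\<Phi> T\<^sub>0 ?w0 = ?w0" using \<Phi>\<phi> T0 \<gamma>T by (simp add: \<phi>_def)
  have mono: "frechet_derivative (\<Phi> T\<^sub>0) (at ?w0) (v, 0, 0) = (X T\<^sub>0 v, 0, 0)" for v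
  proof (rule monodromy_of_flow[OF _ T0 _ _ _ sol X(1)])
    show "?w0 = (\<gamma> 0, \<alpha>\<^sub>0, 0)" by (simp add: \<gamma>(2))
    show "\<Phi> t ?w0 = (\<gamma> t, \<alpha>\<^sub>0, 0)" if "t \<in> {0..T\<^sub>0}" for t using \<Phi>\<phi> that by (simp add: \<phi>_def)
    show "((\<lambda>s. frechet_derivative (\<Phi> s) (at ?w0) v) has_vector_derivative
       frechet_derivative F (at (\<Phi> t ?w0)) (frechet_derivative (\<Phi> t) (at ?w0) v)) (at t)" if "t \<in> {0..T\<^sub>0}" for t v
      by (rule D(10)[OF D(2)]) (use that in auto)
    show "frechet_derivative (\<Phi> 0) (at ?w0) v = v" for v
      by (rule return_structure_flow_derivative(4)[OF R0 D(2) T0I])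
  qed
  have Xlin: "linear (X T\<^sub>0)"
  proof -
    have emb: "linear (\<lambda>v :: 'a \<times> real. (v, 0 :: real, 0 :: real))" by (rule linearI) auto
    have "linear (\<lambda>v. fst (frechet_derivative (\<Phi> T\<^sub>0) (at ?w0) (v, 0, 0)))"
      using linear_compose[OF linear_compose[OF emb return_structure_flow_derivative(3)[OF R0 D(2) T0I]] linear_fst]
      by (simp add: o_def)
    then show ?thesis by (simp add: mono)
  qed
  have Xf: "X T\<^sub>0 ?f0 = ?f0"
    using monodromy_fixes_vector_field[OF frozen_Ck solves_ode_subset[OF sol] _ _ X(1)] \<gamma>(2) \<gamma>T T0 by simp
  \<comment> \<open>Rearranges parameter and unknowns \<open>(\<alpha>, (z, t))\<close> into time
    and extended state \<open>(t, (z, \<alpha>, 0))\<close>.\<close>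
  define j where "j = (\<lambda>q :: real \<times> ('a \<times> real) \<times> real. (snd (snd q), (fst (snd q), fst q, 0 :: real)))"
  define FF where "FF = (\<lambda>q. (fst ((\<lambda>(t, w). \<Phi> t w) (j q)) - fst (snd q), \<sigma> (snd (j q))))"
  define \<Omega> where "\<Omega> = j -` ({- 1<..<T\<^sub>0 + 1} \<times> B0)"
  have op\<Omega>: "open \<Omega>"
    unfolding \<Omega>_def
    by (rule open_vimage[OF open_Times[OF open_greaterThanLessThan D(1)]]) (unfold j_def, intro continuous_intros)
  have jC: "Ck_open (Suc k) j \<Omega>"
    unfolding j_def by (intro Ck_open_Pair Ck_open_fst Ck_open_snd Ck_open_id Ck_open_const op\<Omega>)
  have FFC: "Ck_open (Suc k) FF \<Omega>"
    unfolding FF_def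
    by (intro Ck_open_Pair Ck_open_diff Ck_open_fst Ck_open_snd Ck_open_id op\<Omega>
        Ck_open_compose[OF op\<Omega> jC D(9)] Ck_open_compose[OF op\<Omega> Ck_open_snd[OF op\<Omega> jC] \<sigma>(2)])
      (use D(3) in \<open>auto simp: \<Omega>_def\<close>)
  let ?q0 = "(\<alpha>\<^sub>0, (z\<^sub>0, T\<^sub>0))"
  have jq: "j ?q0 = (T\<^sub>0, ?w0)" by (simp add: j_def)
  have q: "?q0 \<in> \<Omega>" using D(2) T0 by (simp add: \<Omega>_def jq)
  have FF0: "FF ?q0 = 0" by (simp add: FF_def jq \<Phi>T \<sigma>(4) zero_prod_def)
  have inj: "y = 0" if y: "frechet_derivative FF (at ?q0) (0, y) = 0" for y
  proof -
    obtain v s where vs: "y = (v, s)" by (cases y)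
    have dj: "(j has_derivative (\<lambda>d. (snd (snd d), (fst (snd d), fst d, 0)))) (at ?q0)"
      unfolding j_def by (intro has_derivative_Pair has_derivative_fst has_derivative_snd has_derivative_ident has_derivative_const)
    have d1: "((\<lambda>q. (\<lambda>(t, w). \<Phi> t w) (j q)) has_derivative
        (\<lambda>d. (\<lambda>(h, v). h *\<^sub>R F (\<Phi> T\<^sub>0 ?w0) + frechet_derivative (\<Phi> T\<^sub>0) (at ?w0) v) (snd (snd d), (fst (snd d), fst d, 0)))) (at ?q0)"
      by (rule has_derivative_compose[OF dj]) (unfold jq, rule return_structure_flow_derivative(2)[OF R0 D(2) T0I])
    have d2: "((\<lambda>q. \<sigma> (snd (j q))) has_derivative (\<lambda>d. frechet_derivative \<sigma> (at ?w0) (snd (snd (snd d), (fst (snd d), fst d, 0))))) (at ?q0)"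
      by (rule has_derivative_compose[OF has_derivative_snd[OF dj]])
        (unfold jq snd_conv, rule Ck_open_has_derivative[OF \<sigma>(2,3)])
    have "(FF has_derivative (\<lambda>d. (fst ((\<lambda>(h, v). h *\<^sub>R F (\<Phi> T\<^sub>0 ?w0) + frechet_derivative (\<Phi> T\<^sub>0) (at ?w0) v) (snd (snd d), (fst (snd d), fst d, 0))) - fst (snd d),
        frechet_derivative \<sigma> (at ?w0) (snd (snd (snd d), (fst (snd d), fst d, 0)))))) (at ?q0)"
      unfolding FF_def
      by (intro has_derivative_Pair has_derivative_diff has_derivative_fst[OF d1] d2 has_derivative_fst has_derivative_snd has_derivative_ident)
    from frechet_derivative_eq[OF this] y
    have 1: "fst (s *\<^sub>R F ?w0 + frechet_derivative (\<Phi> T\<^sub>0) (at ?w0) (v, 0, 0)) - v = 0"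
      and 2: "frechet_derivative \<sigma> (at ?w0) (v, 0, 0) = 0"
      by (simp_all add: vs zero_prod_def \<Phi>T)
    have 3: "X T\<^sub>0 v - v = (- s) *\<^sub>R ?f0" using 1 by (simp add: Fw0 mono algebra_simps)
    have emb: "linear (\<lambda>v :: 'a \<times> real. (v, 0 :: real, 0 :: real))" by (rule linearI) auto
    have l: "linear (\<lambda>v. frechet_derivative \<sigma> (at ?w0) (v, 0, 0))"
      using linear_compose[OF emb frechet_derivative_linear[OF \<sigma>(2,3)]] by (simp add: o_def)
    have "v = 0 \<and> - s = 0"
      by (rule hyperbolic_transverse_injective[OF Xlin Xf X(2) l transverse 3 2])
    then show ?thesis by (simp add: vs zero_prod_def)
  qed
  obtain I0 N u where u: "open I0" "\<alpha>\<^sub>0 \<in> I0" "open N" "(z\<^sub>0, T\<^sub>0) \<in> N" "Ck_open (Suc k) u I0" "u \<alpha>\<^sub>0 = (z\<^sub>0, T\<^sub>0)"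
    "I0 \<times> N \<subseteq> \<Omega>" "\<forall>\<alpha>\<in>I0. u \<alpha> \<in> N \<and> FF (\<alpha>, u \<alpha>) = 0" "\<forall>\<alpha>\<in>I0. \<forall>v\<in>N. FF (\<alpha>, v) = 0 \<longrightarrow> v = u \<alpha>"
    by (rule implicit_function_exists[OF op\<Omega> FFC zero_less_Suc q FF0 inj])
  \<comment> \<open>On this smaller set a point with its return time automatically lies where the
    implicit function theorem guarantees uniqueness, which yields the last claim.\<close>
  define B where "B = {w \<in> B0. (fst w, \<tau> w) \<in> N \<and> fst (snd w) \<in> I0}"
  have \<tau>c: "continuous_on B0 \<tau>" by (rule Ck_open_continuous[OF D(11)])
  have "continuous_on B0 (\<lambda>w. ((fst w, \<tau> w), fst (snd w)))" by (intro continuous_intros \<tau>c)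
  from continuous_open_preimage[OF this D(1) open_Times[OF u(3,1)]]
  have B: "open B" by (simp add: B_def vimage_def Int_def conj_assoc mem_Times_iff)
  have w0B: "?w0 \<in> B" using D(2,12) u(2,4) by (simp add: B_def)
  have R: "return_structure F W k \<sigma> Ws T\<^sub>0 ?w0 B \<Phi> \<tau> \<delta>"
    by (rule return_structure_subset[OF R0 B w0B]) (auto simp: B_def)
  define \<zeta> where "\<zeta> = (\<lambda>\<alpha>. fst (u \<alpha>))"
  have uc: "continuous_on I0 u" by (rule Ck_open_continuous[OF u(5)])
  \<comment> \<open>The time found by the implicit function theorem is kept in the window in which
    \<sigma> has a single zero along the orbit; this identifies it with \<tau>.\<close>
  define I1 where "I1 = {\<alpha> \<in> I0. snd (u \<alpha>) \<in> {T\<^sub>0 - \<delta><..<T\<^sub>0 + \<delta>} \<and> (\<zeta> \<alpha>, \<alpha>, 0) \<in> B}"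
  have "continuous_on I0 (\<lambda>\<alpha>. (snd (u \<alpha>), (\<zeta> \<alpha>, \<alpha>, 0)))" unfolding \<zeta>_def by (intro continuous_intros uc)
  from continuous_open_preimage[OF this u(1) open_Times[OF open_greaterThanLessThan B]]
  have I1: "open I1" by (simp add: I1_def vimage_def Int_def mem_Times_iff)
  have closed_orbit: "\<Phi> (snd (u \<alpha>)) (\<zeta> \<alpha>, \<alpha>, 0) = (\<zeta> \<alpha>, \<alpha>, 0)" "\<sigma> (\<zeta> \<alpha>, \<alpha>, 0) = 0" "snd (u \<alpha>) = \<tau> (\<zeta> \<alpha>, \<alpha>, 0)"
    if \<alpha>: "\<alpha> \<in> I1" for \<alpha>
  proof -
    let ?w = "(\<zeta> \<alpha>, \<alpha>, 0 :: real)" and ?t = "snd (u \<alpha>)"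
    have w: "?w \<in> B0" and t: "?t \<in> {T\<^sub>0 - \<delta><..<T\<^sub>0 + \<delta>}" and \<alpha>0: "\<alpha> \<in> I0" using \<alpha> by (auto simp: I1_def B_def)
    have "(\<alpha>, u \<alpha>) \<in> \<Omega>" using u(7,8) \<alpha>0 by blast
    then have t': "?t \<in> {- 1..T\<^sub>0 + 1}" by (auto simp: \<Omega>_def j_def)
    have "FF (\<alpha>, u \<alpha>) = 0" using u(8) \<alpha>0 by blast
    then have "fst (FF (\<alpha>, u \<alpha>)) = 0" "snd (FF (\<alpha>, u \<alpha>)) = 0" by simp_all
    then have z: "fst (\<Phi> ?t ?w) = \<zeta> \<alpha>" and s: "\<sigma> ?w = 0" by (simp_all add: FF_def j_def \<zeta>_def)
    have w1: "\<Phi> 0 ?w = ?w" by (rule D(6)[OF w])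
    \<comment> \<open>The equations only close the \<open>z\<close> component; \<alpha> and
      \<epsilon> return because they are constant.\<close>
    have "snd (\<Phi> ?t ?w) = (\<alpha>, 0)"
      by (rule drop_frozen(1)[OF D(7)[OF w] D(8)[OF w], of 0 \<alpha> ?t]) (use t' T0 w1 in auto)
    then show e: "\<Phi> ?t ?w = ?w" using z by (simp add: prod_eq_iff)
    show "\<sigma> ?w = 0" by (rule s)
    show "?t = \<tau> ?w" using D(16)[OF w t] e s by simp
  qed
  define I where "I = I1"
  show thesis
  proof (rule that[OF R, of I \<zeta>])
    show "open I" using I1 by (simp add: I_def)
    show "\<alpha>\<^sub>0 \<in> I" using u(2,6) D(4) w0B by (simp add: I_def I1_def \<zeta>_def)
    show "Ck_open (Suc k) \<zeta> I"
      unfolding \<zeta>_def I_def by (rule Ck_open_fst[OF I1 Ck_open_subset[OF u(5)]]) (auto simp: I1_def)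
    show "\<zeta> \<alpha>\<^sub>0 = z\<^sub>0" by (simp add: \<zeta>_def u(6))
    show "\<forall>\<alpha>\<in>I. (\<zeta> \<alpha>, \<alpha>, 0) \<in> B \<and> \<sigma> (\<zeta> \<alpha>, \<alpha>, 0) = 0 \<and> \<Phi> (\<tau> (\<zeta> \<alpha>, \<alpha>, 0)) (\<zeta> \<alpha>, \<alpha>, 0) = (\<zeta> \<alpha>, \<alpha>, 0)"
    proof
      fix \<alpha> assume "\<alpha> \<in> I"
      then have \<alpha>: "\<alpha> \<in> I1" by (simp add: I_def)
      show "(\<zeta> \<alpha>, \<alpha>, 0) \<in> B \<and> \<sigma> (\<zeta> \<alpha>, \<alpha>, 0) = 0 \<and> \<Phi> (\<tau> (\<zeta> \<alpha>, \<alpha>, 0)) (\<zeta> \<alpha>, \<alpha>, 0) = (\<zeta> \<alpha>, \<alpha>, 0)"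
        using closed_orbit(1,2)[OF \<alpha>] \<alpha> unfolding closed_orbit(3)[OF \<alpha>] I1_def by blast
    qed
    show "\<forall>z \<alpha>. (z, \<alpha>, 0) \<in> B \<and> \<sigma> (z, \<alpha>, 0) = 0 \<and> \<Phi> (\<tau> (z, \<alpha>, 0)) (z, \<alpha>, 0) = (z, \<alpha>, 0) \<longrightarrow> \<alpha> \<in> I \<and> z = \<zeta> \<alpha>"
    proof (intro allI impI)
      fix z \<alpha> assume *: "(z, \<alpha>, 0) \<in> B \<and> \<sigma> (z, \<alpha>, 0) = 0 \<and> \<Phi> (\<tau> (z, \<alpha>, 0)) (z, \<alpha>, 0) = (z, \<alpha>, 0)"
      let ?t = "\<tau> (z, \<alpha>, 0)"
      have w: "(z, \<alpha>, 0) \<in> B0" and N: "(z, ?t) \<in> N" and \<alpha>: "\<alpha> \<in> I0" using * by (auto simp: B_def)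
      have "FF (\<alpha>, (z, ?t)) = 0" using * by (simp add: FF_def j_def zero_prod_def)
      then have eq: "(z, ?t) = u \<alpha>" using u(9) \<alpha> N by blast
      have z: "z = \<zeta> \<alpha>" unfolding \<zeta>_def by (subst eq[symmetric]) simp
      moreover have "snd (u \<alpha>) = ?t" using arg_cong[where f = snd, OF eq] by simp
      ultimately show "\<alpha> \<in> I \<and> z = \<zeta> \<alpha>"
        using \<alpha> * D(13)[OF w] by (simp add: I_def I1_def)
    qed
  qed
qed

lemma (in extended_system) return_of_frozen_point:
  assumes R: "return_structure F W k \<sigma> Ws T\<^sub>0 w\<^sub>0 B \<Phi> \<tau> \<delta>" and w: "(z, \<alpha>, 0) \<in> B" and T0: "0 < T\<^sub>0"
  shows "t \<in> {- 1..T\<^sub>0 + 1} \<Longrightarrow> snd (\<Phi> t (z, \<alpha>, 0)) = (\<alpha>, 0)"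
    and "solves_ode_on (\<lambda>z. f z \<alpha> 0) (\<lambda>t. fst (\<Phi> t (z, \<alpha>, 0))) {- 1..T\<^sub>0 + 1}"
proof -
  note D = return_structureD[OF R]
  have 0: "0 \<in> {- 1..T\<^sub>0 + 1}" "snd (\<Phi> 0 (z, \<alpha>, 0)) = (\<alpha>, 0)" using T0 D(6)[OF w] by simp_all
  show "t \<in> {- 1..T\<^sub>0 + 1} \<Longrightarrow> snd (\<Phi> t (z, \<alpha>, 0)) = (\<alpha>, 0)"
    by (rule drop_frozen(1)[OF D(7)[OF w] D(8)[OF w] 0])
  show "solves_ode_on (\<lambda>z. f z \<alpha> 0) (\<lambda>t. fst (\<Phi> t (z, \<alpha>, 0))) {- 1..T\<^sub>0 + 1}"
    by (rule drop_frozen(2)[OF D(7)[OF w] D(8)[OF w] 0])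
qed

text \<open>A period inside the window is a zero of \<sigma> along the orbit, hence it is the return
  time; in particular it does not depend on the continuation from which the cycle came.\<close>

lemma (in extended_system) return_of_cycle:
  assumes R: "return_structure F W k \<sigma> Ws T\<^sub>0 w\<^sub>0 B \<Phi> \<tau> \<delta>" and T0: "0 < T\<^sub>0"
    and w: "(\<gamma> 0, \<alpha>, 0) \<in> B" "\<sigma> (\<gamma> 0, \<alpha>, 0) = 0"
    and \<gamma>: "periodic_solution (\<lambda>z. f z \<alpha> 0) T \<gamma>" and T: "T \<in> {T\<^sub>0 - \<delta><..<T\<^sub>0 + \<delta>}"
    and X: "principal_variational_solution (\<lambda>z. f z \<alpha> 0) \<gamma> T X"
  shows "\<tau> (\<gamma> 0, \<alpha>, 0) = T" and "\<Phi> T (\<gamma> 0, \<alpha>, 0) = (\<gamma> 0, \<alpha>, 0)"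
    and "frechet_derivative (\<Phi> T) (at (\<gamma> 0, \<alpha>, 0)) (v, 0, 0) = (X T v, 0, 0)"
    and "linear (X T)" and "X T (f (\<gamma> 0) \<alpha> 0) = f (\<gamma> 0) \<alpha> 0"
proof -
  let ?w = "(\<gamma> 0, \<alpha>, 0 :: real)"
  note D = return_structureD[OF R]
  have Tpos: "0 < T" and sol: "solves_ode_on (\<lambda>z. f z \<alpha> 0) \<gamma> UNIV" and per: "\<gamma> T = \<gamma> 0"
    using \<gamma> by (auto simp: periodic_solution_def dest: spec[of _ 0])
  have sub: "{0..T} \<subseteq> {- 1..T\<^sub>0 + 1}" using T D(5) by auto
  have \<Phi>: "\<Phi> t ?w = (\<gamma> t, \<alpha>, 0)" if "t \<in> {0..T}" for t
    by (rule flow_follows_cycle[OF solves_ode_subset[OF D(7)[OF w(1)] sub] D(8)[OF w(1)] D(6)[OF w(1)] sol that])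
      (use sub in auto)
  show \<Phi>T: "\<Phi> T ?w = ?w" using \<Phi>[of T] Tpos per by simp
  show "\<tau> ?w = T" using D(16)[OF w(1) T] \<Phi>T w(2) by simp
  have TI: "T \<in> {- 1<..<T\<^sub>0 + 1}" using T Tpos D(5) by simp
  show mono: "frechet_derivative (\<Phi> T) (at ?w) (v, 0, 0) = (X T v, 0, 0)" for v
  proof (rule monodromy_of_flow[OF _ Tpos _ _ _ sol X])
    show "?w = (\<gamma> 0, \<alpha>, 0)" ..
    show "\<Phi> t ?w = (\<gamma> t, \<alpha>, 0)" if "t \<in> {0..T}" for t by (rule \<Phi>[OF that])
    show "((\<lambda>s. frechet_derivative (\<Phi> s) (at ?w) v) has_vector_derivative
       frechet_derivative F (at (\<Phi> t ?w)) (frechet_derivative (\<Phi> t) (at ?w) v)) (at t)" if "t \<in> {0..T}" for t v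
      by (rule D(10)[OF w(1)]) (use that T D(5) in auto)
    show "frechet_derivative (\<Phi> 0) (at ?w) v = v" for v
      by (rule return_structure_flow_derivative(4)[OF R w(1) TI])
  qed
  have emb: "linear (\<lambda>v :: 'a \<times> real. (v, 0 :: real, 0 :: real))" by (rule linearI) auto
  have "linear (\<lambda>v. fst (frechet_derivative (\<Phi> T) (at ?w) (v, 0, 0)))"
    using linear_compose[OF linear_compose[OF emb return_structure_flow_derivative(3)[OF R w(1) TI]] linear_fst]
    by (simp add: o_def)
  then show "linear (X T)" by (simp add: mono)
  show "X T (f (\<gamma> 0) \<alpha> 0) = f (\<gamma> 0) \<alpha> 0"
    by (rule monodromy_fixes_vector_field[OF frozen_Ck solves_ode_subset[OF sol] per _ X]) (use Tpos in auto)
qed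

lemma principal_variational_solution_exists:
  fixes F :: "'z::euclidean_space \<Rightarrow> 'z"
  assumes F: "Ck_open (Suc k) F UNIV" and \<gamma>: "solves_ode_on F \<gamma> UNIV" and T: "0 < T"
  obtains X where "principal_variational_solution F \<gamma> T X"
proof -
  have \<gamma>I: "solves_ode_on F \<gamma> {- 1..T + 1}" by (rule solves_ode_subset[OF \<gamma>]) simp
  obtain B \<Psi> where \<Psi>: "open B" "\<gamma> 0 \<in> B" "\<forall>w\<in>B. \<Psi> 0 w = w"
    "\<forall>w\<in>B. solves_ode_on F (\<lambda>t. \<Psi> t w) {- 1..T + 1}" "\<forall>w\<in>B. \<forall>t\<in>{- 1..T + 1}. \<Psi> t w \<in> UNIV"
    "\<forall>t\<in>{- 1..T + 1}. \<Psi> t (\<gamma> 0) = \<gamma> t"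
    "Ck_open (Suc k) (\<lambda>(t, w). \<Psi> t w) ({- 1<..<T + 1} \<times> B)"
    "\<forall>w\<in>B. \<forall>t\<in>{- 1<..<T + 1}. \<forall>v. ((\<lambda>s. frechet_derivative (\<Psi> s) (at w) v) has_vector_derivative
       frechet_derivative F (at (\<Psi> t w)) (frechet_derivative (\<Psi> t) (at w) v)) (at t)"
    "\<forall>w\<in>B. \<forall>t\<in>{- 1<..<T + 1}. \<Psi> t differentiable (at w)"
    by (rule smooth_local_flow[OF open_UNIV F zero_less_Suc _ _ \<gamma>I]) (use T in auto)
  have "principal_variational_solution F \<gamma> T (\<lambda>t v. frechet_derivative (\<Psi> t) (at (\<gamma> 0)) v)"
    unfolding principal_variational_solution_def
  proof (intro allI conjI ballI)
    have "(\<Psi> 0 has_derivative (\<lambda>v. v)) (at (\<gamma> 0))"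
      by (rule has_derivative_transform_within_open[OF has_derivative_ident \<Psi>(1,2)]) (use \<Psi>(3) in auto)
    from frechet_derivative_eq[OF this] show "frechet_derivative (\<Psi> 0) (at (\<gamma> 0)) v = v" for v by simp
    fix v t assume t: "t \<in> {0..T}"
    have t': "t \<in> {- 1<..<T + 1}" "t \<in> {- 1..T + 1}" using t by auto
    show "((\<lambda>s. frechet_derivative (\<Psi> s) (at (\<gamma> 0)) v) has_vector_derivative
        frechet_derivative F (at (\<gamma> t)) (frechet_derivative (\<Psi> t) (at (\<gamma> 0)) v)) (at t within {0..T})"
      using has_vector_derivative_at_within[OF \<Psi>(8)[rule_format, OF \<Psi>(2) t'(1), of v], of "{0..T}"]
        \<Psi>(6)[rule_format, OF t'(2)] by simp
  qed
  then show thesis by (rule that)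
qed

text \<open>No section is prescribed here, so the hyperplane orthogonal to the flow at a point of
  the cycle serves. The family of closed orbits consists of hyperbolic cycles near
  \<open>\<alpha>\<^sub>0\<close> because the monodromy maps depend continuously on
  \<alpha>.\<close>

lemma (in extended_system) continuation_exists:
  assumes hyp: "hyperbolic_limit_cycle (\<lambda>z. f z \<alpha>\<^sub>0 0) T\<^sub>0 \<Gamma>\<^sub>0"
  shows "\<exists>V T \<Gamma>. limit_cycle_continuation f \<alpha>\<^sub>0 T\<^sub>0 \<Gamma>\<^sub>0 V T \<Gamma>"
proof -
  obtain \<gamma>' where \<gamma>': "periodic_solution (\<lambda>z. f z \<alpha>\<^sub>0 0) T\<^sub>0 \<gamma>'" "\<Gamma>\<^sub>0 = range \<gamma>'"
    using hyp unfolding hyperbolic_limit_cycle_def by blast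
  define z\<^sub>0 where "z\<^sub>0 = \<gamma>' 0"
  have z0: "z\<^sub>0 \<in> \<Gamma>\<^sub>0" by (simp add: z\<^sub>0_def \<gamma>'(2))
  have T0: "0 < T\<^sub>0" using \<gamma>'(1) by (simp add: periodic_solution_def)
  define f0 where "f0 = f z\<^sub>0 \<alpha>\<^sub>0 0"
  have f0: "f0 \<noteq> 0" unfolding f0_def z\<^sub>0_def by (rule periodic_solution_nonzero_field[OF frozen_Ck \<gamma>'(1)])
  define \<sigma> where "\<sigma> = (\<lambda>w :: ('a \<times> real) \<times> real \<times> real. (fst w - z\<^sub>0) \<bullet> f0)"
  have \<sigma>C: "Ck_open (Suc k) \<sigma> UNIV"
    unfolding \<sigma>_def
    by (rule Ck_open_linear_comp[OF open_UNIV bounded_linear_inner_left])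
      (intro Ck_open_diff Ck_open_fst Ck_open_id Ck_open_const open_UNIV)
  have "(\<sigma> has_derivative (\<lambda>v. fst v \<bullet> f0)) (at w)" for w
    unfolding \<sigma>_def by (auto intro!: derivative_eq_intros)
  from frechet_derivative_eq[OF this]
  have tr: "frechet_derivative \<sigma> (at (z\<^sub>0, \<alpha>\<^sub>0, 0)) (f z\<^sub>0 \<alpha>\<^sub>0 0, 0, 0) \<noteq> 0"
    using f0 by (simp add: f0_def)
  obtain B \<Phi> \<tau> \<delta> I \<zeta> where R: "return_structure F W k \<sigma> UNIV T\<^sub>0 (z\<^sub>0, \<alpha>\<^sub>0, 0) B \<Phi> \<tau> \<delta>"
    and I: "open I" "\<alpha>\<^sub>0 \<in> I" and \<zeta>: "Ck_open (Suc k) \<zeta> I" "\<zeta> \<alpha>\<^sub>0 = z\<^sub>0"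
    "\<forall>\<alpha>\<in>I. (\<zeta> \<alpha>, \<alpha>, 0) \<in> B \<and> \<sigma> (\<zeta> \<alpha>, \<alpha>, 0) = 0 \<and> \<Phi> (\<tau> (\<zeta> \<alpha>, \<alpha>, 0)) (\<zeta> \<alpha>, \<alpha>, 0) = (\<zeta> \<alpha>, \<alpha>, 0)"
    "\<forall>z \<alpha>. (z, \<alpha>, 0) \<in> B \<and> \<sigma> (z, \<alpha>, 0) = 0 \<and> \<Phi> (\<tau> (z, \<alpha>, 0)) (z, \<alpha>, 0) = (z, \<alpha>, 0) \<longrightarrow> \<alpha> \<in> I \<and> z = \<zeta> \<alpha>"
    by (rule cycle_family[OF hyp z0 open_UNIV \<sigma>C UNIV_I _ tr]) (simp_all add: \<sigma>_def)
  note D = return_structureD[OF R]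
  define w where "w = (\<lambda>\<alpha>. (\<zeta> \<alpha>, \<alpha>, 0 :: real))"
  define T where "T = (\<lambda>\<alpha>. \<tau> (w \<alpha>))"
  have wB: "w \<alpha> \<in> B" "\<sigma> (w \<alpha>) = 0" "\<Phi> (T \<alpha>) (w \<alpha>) = w \<alpha>" if "\<alpha> \<in> I" for \<alpha>
    using \<zeta>(3) that by (auto simp: w_def T_def)
  have TI: "T \<alpha> \<in> {T\<^sub>0 - \<delta><..<T\<^sub>0 + \<delta>}" "0 < T \<alpha>" "T \<alpha> \<in> {- 1<..<T\<^sub>0 + 1}" if "\<alpha> \<in> I" for \<alpha>
    using D(13,14)[OF wB(1)[OF that]] D(5) by (auto simp: T_def)
  have "\<exists>\<gamma> X. periodic_solution (\<lambda>z. f z \<alpha> 0) (T \<alpha>) \<gamma> \<and> \<gamma> 0 = \<zeta> \<alpha> \<and>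
      principal_variational_solution (\<lambda>z. f z \<alpha> 0) \<gamma> (T \<alpha>) X" if \<alpha>: "\<alpha> \<in> I" for \<alpha>
  proof -
    let ?\<phi> = "\<lambda>t. fst (\<Phi> t (w \<alpha>))"
    have w: "(\<zeta> \<alpha>, \<alpha>, 0) \<in> B" using wB(1)[OF \<alpha>] by (simp add: w_def)
    have \<phi>: "solves_ode_on (\<lambda>z. f z \<alpha> 0) ?\<phi> {0..T \<alpha>}"
      unfolding w_def by (rule solves_ode_subset[OF return_of_frozen_point(2)[OF R w T0]]) (use TI[OF \<alpha>] in auto)
    have \<phi>0: "?\<phi> 0 = \<zeta> \<alpha>" using D(6)[OF wB(1)[OF \<alpha>]] by (simp add: w_def)
    have \<phi>T: "?\<phi> (T \<alpha>) = ?\<phi> 0" using wB(3)[OF \<alpha>] D(6)[OF wB(1)[OF \<alpha>]] by simp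
    obtain \<gamma> where \<gamma>: "solves_ode_on (\<lambda>z. f z \<alpha> 0) \<gamma> UNIV" "\<forall>t. \<gamma> (t + T \<alpha>) = \<gamma> t" "\<forall>t\<in>{0..T \<alpha>}. \<gamma> t = ?\<phi> t"
      by (rule periodic_extension[OF \<phi> TI(2)[OF \<alpha>] \<phi>T])
    have \<gamma>0: "\<gamma> 0 = \<zeta> \<alpha>" using \<gamma>(3) TI(2)[OF \<alpha>] \<phi>0 by simp
    have "periodic_solution (\<lambda>z. f z \<alpha> 0) (T \<alpha>) \<gamma>"
      unfolding periodic_solution_def
    proof (intro conjI allI impI TI(2)[OF \<alpha>] \<gamma>(1))
      show "\<gamma> (t + T \<alpha>) = \<gamma> t" for t using \<gamma>(2) by blast
      fix s assume s: "0 < s \<and> s < T \<alpha>"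
      \<comment> \<open>A shorter period would bring the orbit back to its starting point in
        \<open>B\<close> before time \<tau>, an early crossing of the section.\<close>
      show "\<gamma> s \<noteq> \<gamma> 0"
      proof
        assume eq: "\<gamma> s = \<gamma> 0"
        have "fst (\<Phi> s (w \<alpha>)) = \<zeta> \<alpha>" using eq \<gamma>(3) \<gamma>0 s by simp
        moreover have "snd (\<Phi> s (w \<alpha>)) = (\<alpha>, 0)"
          unfolding w_def by (rule return_of_frozen_point(1)[OF R w T0]) (use s TI(3)[OF \<alpha>] in auto)
        ultimately have "\<Phi> s (w \<alpha>) = w \<alpha>" by (simp add: w_def prod_eq_iff)
        then show False using D(17)[OF wB(1,2)[OF \<alpha>], of s] s wB[OF \<alpha>] by (simp add: T_def)
      qed
    qed
    moreover obtain X where "principal_variational_solution (\<lambda>z. f z \<alpha> 0) \<gamma> (T \<alpha>) X"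
      by (rule principal_variational_solution_exists[OF frozen_Ck \<gamma>(1) TI(2)[OF \<alpha>]])
    ultimately show ?thesis using \<gamma>0 by blast
  qed
  then have "\<forall>\<alpha>. \<exists>\<gamma>X. \<alpha> \<in> I \<longrightarrow> periodic_solution (\<lambda>z. f z \<alpha> 0) (T \<alpha>) (fst \<gamma>X) \<and> fst \<gamma>X 0 = \<zeta> \<alpha> \<and>
      principal_variational_solution (\<lambda>z. f z \<alpha> 0) (fst \<gamma>X) (T \<alpha>) (snd \<gamma>X)" by fastforce
  from choice[OF this] obtain \<gamma>X where \<gamma>X: "\<forall>\<alpha>. \<alpha> \<in> I \<longrightarrow> periodic_solution (\<lambda>z. f z \<alpha> 0) (T \<alpha>) (fst (\<gamma>X \<alpha>)) \<and>
      fst (\<gamma>X \<alpha>) 0 = \<zeta> \<alpha> \<and> principal_variational_solution (\<lambda>z. f z \<alpha> 0) (fst (\<gamma>X \<alpha>)) (T \<alpha>) (snd (\<gamma>X \<alpha>))" ..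
  define \<gamma> where "\<gamma> = (\<lambda>\<alpha>. fst (\<gamma>X \<alpha>))"
  define X where "X = (\<lambda>\<alpha>. snd (\<gamma>X \<alpha>))"
  have \<gamma>: "periodic_solution (\<lambda>z. f z \<alpha> 0) (T \<alpha>) (\<gamma> \<alpha>)" "\<gamma> \<alpha> 0 = \<zeta> \<alpha>"
    and X: "principal_variational_solution (\<lambda>z. f z \<alpha> 0) (\<gamma> \<alpha>) (T \<alpha>) (X \<alpha>)" if "\<alpha> \<in> I" for \<alpha>
    using \<gamma>X that by (auto simp: \<gamma>_def X_def)
  define M where "M = (\<lambda>\<alpha>. X \<alpha> (T \<alpha>))"
  note cyc = return_of_cycle[OF R T0 _ _ \<gamma>(1) TI(1) X]
  have wB': "(\<gamma> \<alpha> 0, \<alpha>, 0) \<in> B" "\<sigma> (\<gamma> \<alpha> 0, \<alpha>, 0) = 0" if "\<alpha> \<in> I" for \<alpha>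
    using wB[OF that] \<gamma>(2)[OF that] by (simp_all add: w_def)
  have Mlin: "linear (M \<alpha>)" and Mf: "M \<alpha> (f (\<zeta> \<alpha>) \<alpha> 0) = f (\<zeta> \<alpha>) \<alpha> 0"
    and M: "frechet_derivative (\<Phi> (T \<alpha>)) (at (w \<alpha>)) (v, 0, 0) = (M \<alpha> v, 0, 0)" if \<alpha>: "\<alpha> \<in> I" for \<alpha> v
    using cyc(3,4,5)[OF wB'[OF \<alpha>] \<alpha> \<alpha> \<alpha>] \<gamma>(2)[OF \<alpha>] by (simp_all add: M_def w_def)
  have \<zeta>c: "continuous_on I \<zeta>" by (rule Ck_open_continuous[OF \<zeta>(1)])
  have wc: "continuous_on I w" unfolding w_def by (intro continuous_intros \<zeta>c)
  have Tc: "continuous_on I T"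
    unfolding T_def by (rule continuous_on_compose2[OF Ck_open_continuous[OF D(11)] wc]) (use wB in auto)
  have Mc: "continuous_on I (\<lambda>\<alpha>. M \<alpha> v)" for v
  proof -
    have "continuous_on I (\<lambda>\<alpha>. fst (frechet_derivative (\<lambda>(t, w). \<Phi> t w) (at (T \<alpha>, w \<alpha>)) (0, (v, 0, 0))))"
      by (intro continuous_on_fst continuous_on_frechet_derivative[OF D(9)] continuous_on_Pair Tc wc continuous_on_const)
        (use wB(1) TI(3) in blast)
    \<comment> \<open>Continuity of the monodromy maps is inherited from the joint derivative of the
      flow, of which they are the partial derivative in the state.\<close>
    then show ?thesis
    proof (rule continuous_on_eq)
      fix \<alpha> assume \<alpha>: "\<alpha> \<in> I"
      have "frechet_derivative (\<lambda>(t, w). \<Phi> t w) (at (T \<alpha>, w \<alpha>)) (0, (v, 0, 0))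
          = 0 *\<^sub>R F (\<Phi> (T \<alpha>) (w \<alpha>)) + frechet_derivative (\<Phi> (T \<alpha>)) (at (w \<alpha>)) (v, 0, 0)"
        by (rule flow_total_derivative(1)[OF D(9) _ return_structure_flow_derivative(1)[OF R wB(1)[OF \<alpha>] TI(3)[OF \<alpha>]]])
          (use wB(1)[OF \<alpha>] TI(3)[OF \<alpha>] in simp)
      then show "fst (frechet_derivative (\<lambda>(t, w). \<Phi> t w) (at (T \<alpha>, w \<alpha>)) (0, (v, 0, 0))) = M \<alpha> v"
        by (simp add: M[OF \<alpha>])
    qed
  qed
  have fc: "continuous_on I (\<lambda>\<alpha>. f (\<zeta> \<alpha>) \<alpha> 0)"
  proof -
    have "continuous_on I (\<lambda>\<alpha>. fst (F (w \<alpha>)))"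
      by (intro continuous_on_fst continuous_on_compose2[OF Ck_open_continuous[OF F] wc])
        (auto simp: w_def intro: in_domain0)
    then show ?thesis by (simp add: w_def F_eq0)
  qed
  have T\<alpha>0: "T \<alpha>\<^sub>0 = T\<^sub>0" using D(12) by (simp add: T_def w_def \<zeta>(2))
  have hyp0: "hyperbolic_apart_from_ones 1 (M \<alpha>\<^sub>0)"
  proof -
    obtain \<gamma>0 X0 where b: "periodic_solution (\<lambda>z. f z \<alpha>\<^sub>0 0) T\<^sub>0 \<gamma>0" "\<gamma>0 0 = z\<^sub>0"
      "principal_variational_solution (\<lambda>z. f z \<alpha>\<^sub>0 0) \<gamma>0 T\<^sub>0 X0" "hyperbolic_apart_from_ones 1 (X0 T\<^sub>0)"
      by (rule hyperbolic_limit_cycle_base_point[OF frozen_Ck hyp z0])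
    have wb: "(\<gamma>0 0, \<alpha>\<^sub>0, 0) \<in> B" "\<sigma> (\<gamma>0 0, \<alpha>\<^sub>0, 0) = 0" and Tb: "T\<^sub>0 \<in> {T\<^sub>0 - \<delta><..<T\<^sub>0 + \<delta>}"
      using wB[OF I(2)] \<zeta>(2) b(2) D(4) by (simp_all add: w_def)
    have "X0 T\<^sub>0 v = M \<alpha>\<^sub>0 v" for v
      using return_of_cycle(3)[OF R T0 wb b(1) Tb b(3), of v] M[OF I(2), of v] by (simp add: T\<alpha>0 w_def \<zeta>(2) b(2))
    then have "X0 T\<^sub>0 = M \<alpha>\<^sub>0" ..
    then show ?thesis using b(4) by simp
  qed
  obtain \<rho> where \<rho>: "0 < \<rho>" "ball \<alpha>\<^sub>0 \<rho> \<subseteq> I" "\<forall>\<alpha>\<in>ball \<alpha>\<^sub>0 \<rho>. hyperbolic_apart_from_ones 1 (M \<alpha>)"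
    by (rule hyperbolic_persists[OF I Mlin Mf Mc fc _ hyp0]) (use f0 in \<open>simp_all add: f0_def \<zeta>(2)\<close>)
  \<comment> \<open>A continuation has to give back the original cycle literally; separating this
    value avoids comparing two parametrisations of it.\<close>
  define \<Gamma> where "\<Gamma> = (\<lambda>\<alpha>. if \<alpha> = \<alpha>\<^sub>0 then \<Gamma>\<^sub>0 else range (\<gamma> \<alpha>))"
  have "limit_cycle_continuation f \<alpha>\<^sub>0 T\<^sub>0 \<Gamma>\<^sub>0 (ball \<alpha>\<^sub>0 \<rho>) T \<Gamma>"
    unfolding limit_cycle_continuation_def
  proof (intro conjI ballI exI[of _ \<zeta>])
    show "is_interval (ball \<alpha>\<^sub>0 \<rho>)" by (simp add: is_interval_convex_1)
    show "hyperbolic_limit_cycle (\<lambda>z. f z \<alpha> 0) (T \<alpha>) (\<Gamma> \<alpha>)" if \<alpha>: "\<alpha> \<in> ball \<alpha>\<^sub>0 \<rho>" for \<alpha>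
    proof (cases "\<alpha> = \<alpha>\<^sub>0")
      case True
      then show ?thesis using hyp by (simp add: \<Gamma>_def T\<alpha>0)
    next
      case False
      have \<alpha>I: "\<alpha> \<in> I" using \<alpha> \<rho>(2) by blast
      show ?thesis
        unfolding hyperbolic_limit_cycle_def
        by (intro exI[of _ "\<gamma> \<alpha>"] exI[of _ "X \<alpha>"] conjI \<gamma>(1)[OF \<alpha>I] X[OF \<alpha>I])
          (use False \<rho>(3) \<alpha> in \<open>simp_all add: \<Gamma>_def M_def\<close>)
    qed
    show "continuous_on (ball \<alpha>\<^sub>0 \<rho>) T" by (rule continuous_on_subset[OF Tc \<rho>(2)])
    show "continuous_on (ball \<alpha>\<^sub>0 \<rho>) \<zeta>" by (rule continuous_on_subset[OF \<zeta>c \<rho>(2)])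
    show "\<zeta> \<alpha> \<in> \<Gamma> \<alpha>" if "\<alpha> \<in> ball \<alpha>\<^sub>0 \<rho>" for \<alpha>
    proof (cases "\<alpha> = \<alpha>\<^sub>0")
      case True
      then show ?thesis using z0 by (simp add: \<Gamma>_def \<zeta>(2))
    next
      case False
      have "\<gamma> \<alpha> 0 = \<zeta> \<alpha>" using \<gamma>(2) that \<rho>(2) by blast
      then show ?thesis using False rangeI[of "\<gamma> \<alpha>" 0] by (simp add: \<Gamma>_def)
    qed
  qed (use \<rho>(1) T\<alpha>0 in \<open>auto simp: \<Gamma>_def\<close>)
  then show ?thesis by blast
qed

section \<open>The Poincare map\<close>

text \<open>The vectors \<open>(v, y v)\<close> span the tangent space of the section at fixed
  \<alpha>, and \<open>t\<close> is the derivative of the return time. So \<open>A\<close> is the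
  map induced by \<open>M\<close> modulo the flow direction, and both \<open>M\<close> and the
  derivative of the return map, with \<open>b\<close> its \<alpha>-part, have characteristic
  polynomial \<open>X - 1\<close> times that of \<open>A\<close>.\<close>

lemma block_hyperbolic:
  fixes M :: "'a::euclidean_space \<times> real \<Rightarrow> 'a \<times> real"
  assumes M: "linear M" "M f = f" "hyperbolic_apart_from_ones 1 M" and A: "linear A" and y: "linear y"
    and f: "snd f \<noteq> y (fst f)" and eq: "\<And>v. M (v, y v) = (A v, y (A v)) - t v *\<^sub>R f"
  shows "hyperbolic_apart_from_ones 1 (\<lambda>(v, s). (A v + s *\<^sub>R b, s))"
proof -
  define \<kappa> where "\<kappa> = snd f - y (fst f)"
  have \<kappa>: "\<kappa> \<noteq> 0" using f by (simp add: \<kappa>_def)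
  define L where "L = (\<lambda>u :: 'a \<times> real. (fst u, y (fst u)) + snd u *\<^sub>R f)"
  define c where "c = (\<lambda>u :: 'a \<times> real. (snd u - y (fst u)) / \<kappa>)"
  define L' where "L' = (\<lambda>u :: 'a \<times> real. (fst u - c u *\<^sub>R fst f, c u))"
  have cl: "c (u + v) = c u + c v" "c (r *\<^sub>R u) = r * c u" for u v r
    by (simp_all add: c_def linear_add[OF y] linear_scale[OF y] algebra_simps add_divide_distrib diff_divide_distrib)
  have L: "linear L"
    by (rule linearI) (simp_all add: L_def linear_add[OF y] linear_scale[OF y] algebra_simps)
  have L': "linear L'"
    by (rule linearI) (simp_all add: L'_def cl algebra_simps)
  have inv1: "L (L' u) = u" for u
  proof -
    have "y (fst u) + c u * \<kappa> = snd u" using \<kappa> by (simp add: c_def)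
    then show ?thesis
      by (simp add: L_def L'_def \<kappa>_def prod_eq_iff linear_diff[OF y] linear_scale[OF y] algebra_simps)
  qed
  have inv2: "L' (L u) = u" for u
  proof -
    have "snd (L u) - y (fst (L u)) = snd u * \<kappa>"
      by (simp add: L_def \<kappa>_def linear_add[OF y] linear_scale[OF y] algebra_simps)
    then have "c (L u) = snd u" using \<kappa> by (simp add: c_def)
    then show ?thesis by (simp add: L'_def) (simp add: L_def)
  qed
  have Lf: "L (0, 1) = f" by (simp add: L_def linear_0[OF y] zero_prod_def[symmetric])
  have "fst (L' (M (L (v, 0)))) = A v" for v
  proof -
    have "M (L (v, 0)) = L (A v, - t v)" using eq[of v] by (simp add: L_def)
    then show ?thesis by (simp add: inv2)
  qed
  then have "cpoly M = [:- 1, 1:] * cpoly A"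
    using cpoly_adapted(1)[OF L L' M(1) _ _ Lf M(2)] inv1 inv2 by simp
  then have "cpoly (\<lambda>(v, s). (A v + s *\<^sub>R b, s)) = cpoly M"
    using cpoly_block_upper[OF A, of b] by simp
  then show ?thesis using M(3) hyperbolic_cong_cpoly by blast
qed

text \<open>Translates the condition on velocities of curves into an inequality for derivatives. If
  equality held, the straight line through \<open>x\<close> along the flow, lifted to the section at
  fixed \<alpha>, would have the flow vector as its velocity.\<close>

lemma section_transverse:
  fixes Y :: "'a::euclidean_space \<Rightarrow> real \<Rightarrow> real"
  assumes nd: "nondegenerate_section r f M z\<^sub>0 \<alpha>\<^sub>0 Vx V Y" and r: "r = Suc k" and V: "open V"
    and x: "x \<in> Vx" "\<alpha> \<in> V" and M: "((x, Y x \<alpha>), \<alpha>) \<in> M"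
  shows "snd (f (x, Y x \<alpha>) \<alpha> 0) \<noteq> frechet_derivative (\<lambda>(x, \<alpha>). Y x \<alpha>) (at (x, \<alpha>)) (fst (f (x, Y x \<alpha>) \<alpha> 0), 0)"
proof
  let ?f = "f (x, Y x \<alpha>) \<alpha> 0" and ?Y = "\<lambda>(x, \<alpha>). Y x \<alpha>"
  assume eq: "snd ?f = frechet_derivative ?Y (at (x, \<alpha>)) (fst ?f, 0)"
  have Vx: "open Vx" and YC: "Ck_on (Suc k) ?Y (Vx \<times> V)"
    using nd r by (auto simp: nondegenerate_section_def Let_def)
  have opV: "open (Vx \<times> V)" using Vx V by (rule open_Times)
  have D: "(?Y has_derivative frechet_derivative ?Y (at (x, \<alpha>))) (at (x, \<alpha>))"
    by (rule Ck_open_has_derivative[OF YC[unfolded Ck_on_open_iff[OF opV]]]) (use x in auto)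
  define c where "c = (\<lambda>t. section_point Y (x + t *\<^sub>R fst ?f, \<alpha>))"
  obtain e where e: "0 < e" "ball x e \<subseteq> Vx" by (rule openE[OF Vx x(1)])
  \<comment> \<open>The summand 1 covers the case of a vanishing \<open>x\<close> component of the
    field.\<close>
  define d where "d = e / (norm (fst ?f) + 1)"
  have d: "0 < d" using e(1) by (simp add: d_def add_nonneg_pos)
  have cin: "c t \<in> cross_section Y Vx V" if "\<bar>t\<bar> < d" for t
  proof -
    have "\<bar>t\<bar> * norm (fst ?f) \<le> \<bar>t\<bar> * (norm (fst ?f) + 1)" by (intro mult_left_mono) auto
    also have "\<dots> < d * (norm (fst ?f) + 1)" by (intro mult_strict_right_mono that) (simp add: add_nonneg_pos)
    also have "\<dots> = e"
    proof -
      have "norm (fst ?f) + 1 \<noteq> 0" using norm_ge_zero[of "fst ?f"] by linarith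
      then show ?thesis by (simp add: d_def)
    qed
    finally have "x + t *\<^sub>R fst ?f \<in> ball x e" by (simp add: dist_norm)
    then show ?thesis using e(2) x(2) by (auto simp: c_def cross_section_def)
  qed
  have "((\<lambda>t. (x + t *\<^sub>R fst ?f, \<alpha>)) has_derivative (\<lambda>h. (h *\<^sub>R fst ?f, 0))) (at 0)"
    by (auto intro!: derivative_eq_intros)
  from has_derivative_compose[OF this, of ?Y] D
  have "((\<lambda>t. Y (x + t *\<^sub>R fst ?f) \<alpha>) has_derivative (\<lambda>h. frechet_derivative ?Y (at (x, \<alpha>)) (h *\<^sub>R fst ?f, 0))) (at 0)"
    by simp
  moreover have "frechet_derivative ?Y (at (x, \<alpha>)) (h *\<^sub>R fst ?f, 0) = h *\<^sub>R snd ?f" for h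
    using linear_scale[OF has_derivative_linear[OF D], of h "(fst ?f, 0)"] eq by simp
  ultimately have "((\<lambda>t. Y (x + t *\<^sub>R fst ?f) \<alpha>) has_vector_derivative snd ?f) (at 0)"
    by (simp add: has_vector_derivative_def)
  moreover have "((\<lambda>t. x + t *\<^sub>R fst ?f) has_vector_derivative fst ?f) (at 0)"
    by (auto intro!: derivative_eq_intros)
  ultimately have "((\<lambda>t. ((x + t *\<^sub>R fst ?f, Y (x + t *\<^sub>R fst ?f) \<alpha>), \<alpha>)) has_vector_derivative ((fst ?f, snd ?f), 0)) (at 0)"
    by (intro has_vector_derivative_Pair has_vector_derivative_const)
  then have "(c has_vector_derivative (?f, 0)) (at 0)"
    by (simp add: c_def section_point_def)
  moreover have c0: "c 0 = ((x, Y x \<alpha>), \<alpha>)" by (simp add: c_def section_point_def)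
  ultimately have "(?f, 0) \<in> tangent_vectors (cross_section Y Vx V) ((x, Y x \<alpha>), \<alpha>)"
    unfolding tangent_vectors_def using d cin by blast
  moreover have "((x, Y x \<alpha>), \<alpha>) \<in> cross_section Y Vx V \<inter> M"
    using cin[of 0] d c0 M by simp
  ultimately show False
    using nd unfolding nondegenerate_section_def Let_def by blast
qed

lemma open_box:
  fixes Q :: "(('a::topological_space \<times> real) \<times> real) set"
  assumes "open Q" "((x, \<alpha>), 0) \<in> Q"
  obtains Ux r e where "open Ux" "x \<in> Ux" "0 < r" "0 < e" "(Ux \<times> ball \<alpha> r) \<times> {- e<..<e} \<subseteq> Q"
proof -
  obtain A C where AC: "open A" "open C" "(x, \<alpha>) \<in> A" "0 \<in> C" "A \<times> C \<subseteq> Q"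
    using open_prod_elim[OF assms] by (metis mem_Sigma_iff)
  obtain Ux D where UD: "open Ux" "open D" "x \<in> Ux" "\<alpha> \<in> D" "Ux \<times> D \<subseteq> A"
    using open_prod_elim[OF AC(1,3)] by (metis mem_Sigma_iff)
  obtain r where r: "0 < r" "ball \<alpha> r \<subseteq> D" by (rule openE[OF UD(2,4)])
  obtain e where e: "0 < e" "ball 0 e \<subseteq> C" by (rule openE[OF AC(2,4)])
  have "{- e<..<e} = ball 0 e" by (auto simp: dist_real_def)
  then have "(Ux \<times> ball \<alpha> r) \<times> {- e<..<e} \<subseteq> Q"
    using UD(5) r(2) e(2) AC(5) by blast
  then show thesis by (rule that[OF UD(1,3) r(1) e(1)])
qed

text \<open>A limit cycle is given as a set; its parametrisation is first moved so that it starts at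
  the point on the section.\<close>

lemma (in extended_system) cycle_point_is_fixed:
  assumes R: "return_structure F W k \<sigma> Ws T\<^sub>0 w\<^sub>0 B \<Phi> \<tau> \<delta>" and T0: "0 < T\<^sub>0"
    and hyp: "hyperbolic_limit_cycle (\<lambda>z. f z \<alpha> 0) T \<Gamma>" and T: "T \<in> {T\<^sub>0 - \<delta><..<T\<^sub>0 + \<delta>}"
    and z: "z \<in> \<Gamma>" "(z, \<alpha>, 0) \<in> B" "\<sigma> (z, \<alpha>, 0) = 0"
  obtains M where "\<tau> (z, \<alpha>, 0) = T" "\<Phi> T (z, \<alpha>, 0) = (z, \<alpha>, 0)" "linear M" "M (f z \<alpha> 0) = f z \<alpha> 0"
    "hyperbolic_apart_from_ones 1 M" "\<forall>v. frechet_derivative (\<Phi> T) (at (z, \<alpha>, 0)) (v, 0, 0) = (M v, 0, 0)"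
proof -
  obtain \<gamma> X where \<gamma>: "periodic_solution (\<lambda>z. f z \<alpha> 0) T \<gamma>" "\<gamma> 0 = z" "\<Gamma> = range \<gamma>"
    and X: "principal_variational_solution (\<lambda>z. f z \<alpha> 0) \<gamma> T X" "hyperbolic_apart_from_ones 1 (X T)"
    by (rule hyperbolic_limit_cycle_base_point[OF frozen_Ck hyp z(1)])
  have w: "(\<gamma> 0, \<alpha>, 0) \<in> B" "\<sigma> (\<gamma> 0, \<alpha>, 0) = 0" using z by (simp_all add: \<gamma>(2))
  note cyc = return_of_cycle[OF R T0 w \<gamma>(1) T X(1), unfolded \<gamma>(2)]
  show thesis by (rule that[of "X T"]) (use cyc X(2) in blast)+
qed

text \<open>For \<alpha> near \<open>\<alpha>\<^sub>0\<close> the chosen point of the cycle is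
  transported by the flow close to \<open>z\<^sub>0\<close> and then by the return map onto the
  section. There it is a fixed point of the return map, and local uniqueness makes it
  \<open>\<zeta> \<alpha>\<close>.\<close>

lemma (in extended_system) family_is_continuation:
  assumes R: "return_structure F W k \<sigma> Ws T\<^sub>0 (z\<^sub>0, \<alpha>\<^sub>0, 0) B \<Phi> \<tau> \<delta>" and T0: "0 < T\<^sub>0"
    and I: "open I" "\<alpha>\<^sub>0 \<in> I"
    and uniq: "\<forall>z \<alpha>. (z, \<alpha>, 0) \<in> B \<and> \<sigma> (z, \<alpha>, 0) = 0 \<and> \<Phi> (\<tau> (z, \<alpha>, 0)) (z, \<alpha>, 0) = (z, \<alpha>, 0) \<longrightarrow> \<alpha> \<in> I \<and> z = \<zeta> \<alpha>"
    and \<sigma>0: "\<sigma> (z\<^sub>0, \<alpha>\<^sub>0, 0) = 0" and z0: "z\<^sub>0 \<in> \<Gamma>\<^sub>0"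
    and cont: "limit_cycle_continuation f \<alpha>\<^sub>0 T\<^sub>0 \<Gamma>\<^sub>0 V T \<Gamma>"
  obtains \<rho> where "0 < \<rho>" "ball \<alpha>\<^sub>0 \<rho> \<subseteq> V" "ball \<alpha>\<^sub>0 \<rho> \<subseteq> I"
    "\<forall>\<alpha>\<in>ball \<alpha>\<^sub>0 \<rho>. T \<alpha> \<in> {T\<^sub>0 - \<delta><..<T\<^sub>0 + \<delta>} \<and> \<zeta> \<alpha> \<in> \<Gamma> \<alpha>"
proof -
  note D = return_structureD[OF R]
  obtain p where V: "open V" "\<alpha>\<^sub>0 \<in> V" and \<Gamma>0: "\<Gamma> \<alpha>\<^sub>0 = \<Gamma>\<^sub>0" "T \<alpha>\<^sub>0 = T\<^sub>0"
    and hyp: "\<forall>\<alpha>\<in>V. hyperbolic_limit_cycle (\<lambda>z. f z \<alpha> 0) (T \<alpha>) (\<Gamma> \<alpha>)"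
    and Tc: "continuous_on V T" and p: "continuous_on V p" "\<forall>\<alpha>\<in>V. p \<alpha> \<in> \<Gamma> \<alpha>"
    using cont unfolding limit_cycle_continuation_def by blast
  have hyp0: "hyperbolic_limit_cycle (\<lambda>z. f z \<alpha>\<^sub>0 0) T\<^sub>0 \<Gamma>\<^sub>0" using hyp V(2) \<Gamma>0 by metis
  have p0: "p \<alpha>\<^sub>0 \<in> \<Gamma>\<^sub>0" using p(2) V(2) \<Gamma>0 by metis
  have T0w: "T\<^sub>0 \<in> {T\<^sub>0 - \<delta><..<T\<^sub>0 + \<delta>}" using D(4) by simp
  obtain M0 where "\<tau> (z\<^sub>0, \<alpha>\<^sub>0, 0) = T\<^sub>0" and \<Phi>T0: "\<Phi> T\<^sub>0 (z\<^sub>0, \<alpha>\<^sub>0, 0) = (z\<^sub>0, \<alpha>\<^sub>0, 0)"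
    and "linear M0" "M0 (f z\<^sub>0 \<alpha>\<^sub>0 0) = f z\<^sub>0 \<alpha>\<^sub>0 0" "hyperbolic_apart_from_ones 1 M0"
    "\<forall>v. frechet_derivative (\<Phi> T\<^sub>0) (at (z\<^sub>0, \<alpha>\<^sub>0, 0)) (v, 0, 0) = (M0 v, 0, 0)"
    by (rule cycle_point_is_fixed[OF R T0 hyp0 T0w z0 D(2) \<sigma>0])
  obtain \<gamma> X where \<gamma>: "periodic_solution (\<lambda>z. f z \<alpha>\<^sub>0 0) T\<^sub>0 \<gamma>" "\<gamma> 0 = p \<alpha>\<^sub>0" "\<Gamma>\<^sub>0 = range \<gamma>"
    and "principal_variational_solution (\<lambda>z. f z \<alpha>\<^sub>0 0) \<gamma> T\<^sub>0 X" "hyperbolic_apart_from_ones 1 (X T\<^sub>0)"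
    by (rule hyperbolic_limit_cycle_base_point[OF frozen_Ck hyp0 p0])
  have sol: "solves_ode_on (\<lambda>z. f z \<alpha>\<^sub>0 0) \<gamma> UNIV" and per: "\<And>t. \<gamma> (t + T\<^sub>0) = \<gamma> t"
    using \<gamma>(1) by (auto simp: periodic_solution_def)
  obtain s0 where s0: "z\<^sub>0 = \<gamma> s0" using z0 \<gamma>(3) by blast
  define s where "s = s0 - of_int \<lfloor>s0 / T\<^sub>0\<rfloor> * T\<^sub>0"
  have "of_int \<lfloor>s0 / T\<^sub>0\<rfloor> * T\<^sub>0 \<le> s0 / T\<^sub>0 * T\<^sub>0" using T0 by (intro mult_right_mono) auto
  then have s: "0 \<le> s" using T0 by (simp add: s_def)
  have zs: "\<gamma> s = z\<^sub>0" using periodic_int_mult[of \<gamma> T\<^sub>0 s "\<lfloor>s0 / T\<^sub>0\<rfloor>"] per s0 by (simp add: s_def)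
  define \<phi> where "\<phi> = (\<lambda>t. (\<gamma> t, \<alpha>\<^sub>0, 0 :: real))"
  have \<phi>: "solves_ode_on F \<phi> {- 1..s + 1}"
    unfolding \<phi>_def by (rule solves_ode_subset[OF lift_frozen[OF sol]]) simp
  obtain Bp \<Psi> where \<Psi>: "open Bp" "\<phi> 0 \<in> Bp" "\<forall>w\<in>Bp. \<Psi> 0 w = w"
    "\<forall>w\<in>Bp. solves_ode_on F (\<lambda>t. \<Psi> t w) {- 1..s + 1}" "\<forall>w\<in>Bp. \<forall>t\<in>{- 1..s + 1}. \<Psi> t w \<in> W"
    "\<forall>t\<in>{- 1..s + 1}. \<Psi> t (\<phi> 0) = \<phi> t"
    "Ck_open (Suc k) (\<lambda>(t, w). \<Psi> t w) ({- 1<..<s + 1} \<times> Bp)"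
    "\<forall>w\<in>Bp. \<forall>t\<in>{- 1<..<s + 1}. \<forall>v. ((\<lambda>s. frechet_derivative (\<Psi> s) (at w) v) has_vector_derivative
       frechet_derivative F (at (\<Psi> t w)) (frechet_derivative (\<Psi> t) (at w) v)) (at t)"
    "\<forall>w\<in>Bp. \<forall>t\<in>{- 1<..<s + 1}. \<Psi> t differentiable (at w)"
    by (rule smooth_local_flow[OF W F zero_less_Suc _ _ \<phi>]) (use s in \<open>auto simp: \<phi>_def intro: in_domain0\<close>)
  have pc: "continuous_on V (\<lambda>\<alpha>. (p \<alpha>, \<alpha>, 0 :: real))" by (intro continuous_intros p(1))
  define J where "J = {\<alpha> \<in> V. (p \<alpha>, \<alpha>, 0) \<in> Bp}"
  have J: "open J" using continuous_open_preimage[OF pc V(1) \<Psi>(1)] by (simp add: J_def vimage_def Int_def)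
  \<comment> \<open>\<open>s\<close> is the time that the unperturbed cycle needs from
    \<open>p \<alpha>\<^sub>0\<close> to \<open>z\<^sub>0\<close>; it is kept for all \<alpha>, so
    \<open>q \<alpha>\<close> is near \<open>z\<^sub>0\<close> but in general not on the
    section.\<close>
  define q where "q = (\<lambda>\<alpha>. \<Psi> s (p \<alpha>, \<alpha>, 0))"
  have qc: "continuous_on J q"
  proof -
    have "continuous_on J (\<lambda>\<alpha>. (s, (p \<alpha>, \<alpha>, 0 :: real)))"
      by (intro continuous_on_Pair continuous_on_const continuous_on_subset[OF p(1)] continuous_on_id) (auto simp: J_def)
    moreover have "(\<lambda>\<alpha>. (s, (p \<alpha>, \<alpha>, 0 :: real))) ` J \<subseteq> {- 1<..<s + 1} \<times> Bp"
      using s by (auto simp: J_def)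
    ultimately have "continuous_on J (\<lambda>\<alpha>. (\<lambda>(t, w). \<Psi> t w) (s, (p \<alpha>, \<alpha>, 0)))"
      by (rule continuous_on_compose2[OF Ck_open_continuous[OF \<Psi>(7)]])
    then show ?thesis by (simp add: q_def)
  qed
  define J2 where "J2 = {\<alpha> \<in> J. q \<alpha> \<in> B}"
  have J2: "open J2" using continuous_open_preimage[OF qc J D(1)] by (simp add: J2_def vimage_def Int_def)
  \<comment> \<open>One return puts the point on the section, since \<open>\<tau>\<close> is defined
    also for starting points off it.\<close>
  define R' where "R' = (\<lambda>\<alpha>. \<Phi> (\<tau> (q \<alpha>)) (q \<alpha>))"
  have \<tau>I: "\<tau> w \<in> {- 1<..<T\<^sub>0 + 1}" if "w \<in> B" for w using D(13)[OF that] D(14)[OF that] D(5) by simp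
  have R'c: "continuous_on J2 R'"
  proof -
    have q2: "continuous_on J2 q" by (rule continuous_on_subset[OF qc]) (auto simp: J2_def)
    have "continuous_on J2 (\<lambda>\<alpha>. \<tau> (q \<alpha>))"
      by (rule continuous_on_compose2[OF Ck_open_continuous[OF D(11)] q2]) (auto simp: J2_def)
    then have "continuous_on J2 (\<lambda>\<alpha>. (\<tau> (q \<alpha>), q \<alpha>))" using q2 by (rule continuous_on_Pair)
    moreover have "(\<lambda>\<alpha>. (\<tau> (q \<alpha>), q \<alpha>)) ` J2 \<subseteq> {- 1<..<T\<^sub>0 + 1} \<times> B"
    proof
      fix x assume "x \<in> (\<lambda>\<alpha>. (\<tau> (q \<alpha>), q \<alpha>)) ` J2"
      then obtain \<alpha> where "q \<alpha> \<in> B" "x = (\<tau> (q \<alpha>), q \<alpha>)" by (auto simp: J2_def)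
      then show "x \<in> {- 1<..<T\<^sub>0 + 1} \<times> B" using \<tau>I[of "q \<alpha>"] by blast
    qed
    ultimately have "continuous_on J2 (\<lambda>\<alpha>. (\<lambda>(t, w). \<Phi> t w) (\<tau> (q \<alpha>), q \<alpha>))"
      by (rule continuous_on_compose2[OF Ck_open_continuous[OF D(9)]])
    then show ?thesis by (simp add: R'_def)
  qed
  define J3 where "J3 = {\<alpha> \<in> J2. R' \<alpha> \<in> B \<and> T \<alpha> \<in> {T\<^sub>0 - \<delta><..<T\<^sub>0 + \<delta>}}"
  have "continuous_on J2 (\<lambda>\<alpha>. (R' \<alpha>, T \<alpha>))"
    by (intro continuous_on_Pair R'c continuous_on_subset[OF Tc]) (auto simp: J2_def J_def)
  from continuous_open_preimage[OF this J2 open_Times[OF D(1) open_greaterThanLessThan]]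
  have J3: "open J3" by (simp add: J3_def vimage_def Int_def mem_Times_iff)
  have \<phi>0: "\<phi> 0 = (p \<alpha>\<^sub>0, \<alpha>\<^sub>0, 0)" by (simp add: \<phi>_def \<gamma>(2))
  have sI: "s \<in> {- 1..s + 1}" using s by simp
  have q0: "q \<alpha>\<^sub>0 = (z\<^sub>0, \<alpha>\<^sub>0, 0)"
    using \<Psi>(6)[rule_format, OF sI] by (simp add: q_def \<phi>0[symmetric]) (simp add: \<phi>_def zs)
  have "\<alpha>\<^sub>0 \<in> J3 \<inter> I"
    using V(2) \<Psi>(2) D(2,4,12) I(2) by (simp add: J3_def J2_def J_def \<phi>0 R'_def q0 \<Phi>T0 \<Gamma>0(2))
  then obtain \<rho> where \<rho>: "0 < \<rho>" "ball \<alpha>\<^sub>0 \<rho> \<subseteq> J3 \<inter> I" by (rule openE[OF open_Int[OF J3 I(1)]])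
  have in\<Gamma>: "\<zeta> \<alpha> \<in> \<Gamma> \<alpha>" if \<alpha>: "\<alpha> \<in> J3" for \<alpha>
  proof -
    have \<alpha>V: "\<alpha> \<in> V" and pB: "(p \<alpha>, \<alpha>, 0) \<in> Bp" and qB: "q \<alpha> \<in> B" and RB: "R' \<alpha> \<in> B"
      and T\<alpha>: "T \<alpha> \<in> {T\<^sub>0 - \<delta><..<T\<^sub>0 + \<delta>}" using \<alpha> by (auto simp: J3_def J2_def J_def)
    note h\<alpha> = hyp[rule_format, OF \<alpha>V]
    obtain \<gamma>1 X1 where \<gamma>1: "periodic_solution (\<lambda>z. f z \<alpha> 0) (T \<alpha>) \<gamma>1" "\<gamma>1 0 = p \<alpha>" "\<Gamma> \<alpha> = range \<gamma>1"
      and "principal_variational_solution (\<lambda>z. f z \<alpha> 0) \<gamma>1 (T \<alpha>) X1" "hyperbolic_apart_from_ones 1 (X1 (T \<alpha>))"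
      by (rule hyperbolic_limit_cycle_base_point[OF frozen_Ck h\<alpha> p(2)[rule_format, OF \<alpha>V]])
    have sol1: "solves_ode_on (\<lambda>z. f z \<alpha> 0) \<gamma>1 UNIV" using \<gamma>1(1) by (simp add: periodic_solution_def)
    have sub: "{0..s} \<subseteq> {- 1..s + 1}" by auto
    have q1: "q \<alpha> = (\<gamma>1 s, \<alpha>, 0)"
      unfolding q_def
      by (rule flow_follows_cycle[OF solves_ode_subset[OF \<Psi>(4)[rule_format, OF pB] sub] _ _ sol1])
        (use \<Psi>(3,5) pB sub s \<gamma>1(2) in auto)
    have "\<gamma>1 s \<in> \<Gamma> \<alpha>" by (simp add: \<gamma>1(3))
    then obtain \<gamma>2 X2 where \<gamma>2: "periodic_solution (\<lambda>z. f z \<alpha> 0) (T \<alpha>) \<gamma>2" "\<gamma>2 0 = \<gamma>1 s" "\<Gamma> \<alpha> = range \<gamma>2"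
      and "principal_variational_solution (\<lambda>z. f z \<alpha> 0) \<gamma>2 (T \<alpha>) X2" "hyperbolic_apart_from_ones 1 (X2 (T \<alpha>))"
      by (rule hyperbolic_limit_cycle_base_point[OF frozen_Ck h\<alpha>])
    have sol2: "solves_ode_on (\<lambda>z. f z \<alpha> 0) \<gamma>2 UNIV" using \<gamma>2(1) by (simp add: periodic_solution_def)
    have sub2: "{0..\<tau> (q \<alpha>)} \<subseteq> {- 1..T\<^sub>0 + 1}" using \<tau>I[OF qB] by auto
    have R'1: "R' \<alpha> = (\<gamma>2 (\<tau> (q \<alpha>)), \<alpha>, 0)"
      unfolding R'_def
      by (rule flow_follows_cycle[OF solves_ode_subset[OF D(7)[OF qB] sub2] D(8)[OF qB] _ sol2])
        (use sub2 D(6)[OF qB] D(14)[OF qB] q1 \<gamma>2(2) in auto)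
    let ?z = "\<gamma>2 (\<tau> (q \<alpha>))"
    have z: "?z \<in> \<Gamma> \<alpha>" "(?z, \<alpha>, 0) \<in> B" using RB R'1 by (simp_all add: \<gamma>2(3))
    have \<sigma>z: "\<sigma> (?z, \<alpha>, 0) = 0" using D(16)[OF qB D(13)[OF qB]] R'1 by (simp add: R'_def)
    obtain M where "\<tau> (?z, \<alpha>, 0) = T \<alpha>" "\<Phi> (T \<alpha>) (?z, \<alpha>, 0) = (?z, \<alpha>, 0)" "linear M" "M (f ?z \<alpha> 0) = f ?z \<alpha> 0"
      "hyperbolic_apart_from_ones 1 M" "\<forall>v. frechet_derivative (\<Phi> (T \<alpha>)) (at (?z, \<alpha>, 0)) (v, 0, 0) = (M v, 0, 0)"
      by (rule cycle_point_is_fixed[OF R T0 h\<alpha> T\<alpha> z \<sigma>z])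
    then have "\<Phi> (\<tau> (?z, \<alpha>, 0)) (?z, \<alpha>, 0) = (?z, \<alpha>, 0)" by metis
    then have "?z = \<zeta> \<alpha>" using uniq z(2) \<sigma>z by blast
    then show ?thesis using z(1) by simp
  qed
  show thesis
    by (rule that[OF \<rho>(1)]) (use \<rho>(2) in\<Gamma> in \<open>auto simp: J3_def J2_def J_def\<close>)
qed

text \<open>Subtracting \<xi> flattens the graph; a single chart over all of \<open>I\<close> is
  enough.\<close>

lemma embedded_graph:
  fixes \<xi> :: "real \<Rightarrow> 'a::euclidean_space"
  assumes I: "open I" and \<xi>: "Ck_open r \<xi> I" and S: "S = (\<lambda>\<alpha>. (\<xi> \<alpha>, \<alpha>)) ` I"
  shows "embedded_submanifold r 1 S"
  unfolding embedded_submanifold_def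
proof
  fix p assume p: "p \<in> S"
  let ?W = "(UNIV :: 'a set) \<times> I" and ?L = "{0 :: 'a} \<times> (UNIV :: real set)"
  let ?\<psi> = "\<lambda>q :: 'a \<times> real. (fst q - \<xi> (snd q), snd q)" and ?\<psi>' = "\<lambda>q :: 'a \<times> real. (fst q + \<xi> (snd q), snd q)"
  have W: "open ?W" using I by (simp add: open_Times)
  have \<xi>W: "Ck_open r (\<lambda>q :: 'a \<times> real. \<xi> (snd q)) ?W"
    by (rule Ck_open_compose[OF W Ck_open_snd[OF W Ck_open_id[OF W]] \<xi>]) auto
  have C: "Ck_open r ?\<psi> ?W" "Ck_open r ?\<psi>' ?W"
    by (intro Ck_open_Pair Ck_open_diff Ck_open_add Ck_open_fst Ck_open_snd Ck_open_id \<xi>W W)+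
  have hom: "homeomorphism ?W ?W ?\<psi> ?\<psi>'"
    by (rule homeomorphismI[OF Ck_open_continuous[OF C(1)] Ck_open_continuous[OF C(2)]]) auto
  have L: "subspace ?L" unfolding subspace_def mem_Times_iff by (simp add: zero_prod_def)
  have "?L = span {(0, 1)}"
  proof
    show "?L \<subseteq> span {(0, 1)}"
    proof
      fix x assume "x \<in> ?L"
      then have "x = snd x *\<^sub>R (0, 1)" by (auto simp: prod_eq_iff)
      then show "x \<in> span {(0, 1)}" unfolding span_singleton by blast
    qed
    show "span {(0, 1)} \<subseteq> ?L" by (rule span_minimal[OF _ L]) simp
  qed
  then have "dim ?L = 1" by (simp add: dim_singleton zero_prod_def)
  moreover have "?\<psi> ` (S \<inter> ?W) = ?L \<inter> ?W"
  proof -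
    have "S \<inter> ?W = S" using S by auto
    moreover have "?\<psi> ` S = ?L \<inter> ?W" unfolding S by force
    ultimately show ?thesis by simp
  qed
  moreover have "p \<in> ?W" using p S by auto
  ultimately show "\<exists>W (W' :: ('a \<times> real) set) \<psi> \<psi>' L. open W \<and> p \<in> W \<and> open W' \<and> homeomorphism W W' \<psi> \<psi>' \<and>
        Ck_on r \<psi> W \<and> Ck_on r \<psi>' W' \<and> subspace L \<and> dim L = 1 \<and> \<psi> ` (S \<inter> W) = L \<inter> W'"
    using W hom C L unfolding Ck_on_open_iff[OF W, symmetric] by blast
qed

text \<open>Domains are shrunk twice. The section is restricted to the part over \<open>Wx\<close>
  and \<open>W\<close> whose points lie in the neighbourhood without early crossings; then
  \<open>U\<close> is chosen so small that returns from \<open>U\<close> land in this part.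
  \<open>U\<close> need not be invariant.\<close>

theorem (in extended_system) poincare_map_fast_slow:
  assumes hyp: "hyperbolic_limit_cycle (\<lambda>z. f z \<alpha>\<^sub>0 0) T\<^sub>0 \<Gamma>\<^sub>0" and z0: "z\<^sub>0 \<in> \<Gamma>\<^sub>0"
    and cont: "limit_cycle_continuation f \<alpha>\<^sub>0 T\<^sub>0 \<Gamma>\<^sub>0 V T \<Gamma>"
    and nd: "nondegenerate_section (Suc k) f (cycle_manifold V \<Gamma>) z\<^sub>0 \<alpha>\<^sub>0 Vx V Y"
  shows "\<exists>Wx W U \<epsilon>\<^sub>0 \<tau> P S.
          open Wx \<and> fst z\<^sub>0 \<in> Wx \<and> Wx \<subseteq> Vx \<and>
          open W \<and> is_interval W \<and> \<alpha>\<^sub>0 \<in> W \<and> W \<subseteq> V \<and>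
          open U \<and> (fst z\<^sub>0, \<alpha>\<^sub>0) \<in> U \<and> 0 < \<epsilon>\<^sub>0 \<and> \<epsilon>\<^sub>0 \<le> \<epsilon>\<^sub>1 \<and>
          S = {Z\<in>U. section_point Y Z \<in> cross_section Y Wx W \<inter> cycle_manifold V \<Gamma>} \<and>
          poincare_map f g Y Wx W U \<epsilon>\<^sub>0 \<tau> P \<and>
          continuous_on (U \<times> {0..<\<epsilon>\<^sub>0}) (\<lambda>(Z, \<epsilon>). \<tau> Z \<epsilon>) \<and>
          (\<forall>Z\<in>S. \<tau> Z 0 = T (snd Z)) \<and>
          (\<exists>(N :: 'a \<times> real \<Rightarrow> 'a \<Rightarrow>\<^sub>L ('a \<times> real)) h G.
             fast_slow_map (Suc k) U \<epsilon>\<^sub>0 P N h G \<and>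
             fast_slow_assumption1 (Suc k) 1 U N h S \<and>
             fast_slow_assumption2 U N h S \<and>
             normally_hyperbolic 1 N h S)"
proof -

  \<comment> \<open>The section as a zero set, and transversality of the flow\<close>
  define x\<^sub>0 where "x\<^sub>0 = fst z\<^sub>0"
  let ?Y = "\<lambda>(x, \<alpha>). Y x \<alpha>" and ?w0 = "(z\<^sub>0, \<alpha>\<^sub>0, 0 :: real)"
  have V: "open V" "\<alpha>\<^sub>0 \<in> V" and \<Gamma>0: "\<Gamma> \<alpha>\<^sub>0 = \<Gamma>\<^sub>0"
    and hypV: "\<And>\<alpha>. \<alpha> \<in> V \<Longrightarrow> hyperbolic_limit_cycle (\<lambda>z. f z \<alpha> 0) (T \<alpha>) (\<Gamma> \<alpha>)"
    using cont unfolding limit_cycle_continuation_def by blast+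
  have Vx: "open Vx" "x\<^sub>0 \<in> Vx" and Y0: "Y x\<^sub>0 \<alpha>\<^sub>0 = snd z\<^sub>0" and YC': "Ck_on (Suc k) ?Y (Vx \<times> V)"
    using nd by (auto simp: nondegenerate_section_def Let_def x\<^sub>0_def)
  have opV: "open (Vx \<times> V)" using Vx(1) V(1) by (rule open_Times)
  have YC: "Ck_open (Suc k) ?Y (Vx \<times> V)" using YC' unfolding Ck_on_open_iff[OF opV] .
  have z0': "z\<^sub>0 = (x\<^sub>0, Y x\<^sub>0 \<alpha>\<^sub>0)" by (simp add: x\<^sub>0_def Y0[unfolded x\<^sub>0_def])
  have T0: "0 < T\<^sub>0" using hyp by (auto simp: hyperbolic_limit_cycle_def periodic_solution_def)
  define pr where "pr = (\<lambda>w :: ('a \<times> real) \<times> real \<times> real. (fst (fst w), fst (snd w)))"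
  define \<sigma> where "\<sigma> = (\<lambda>w :: ('a \<times> real) \<times> real \<times> real. snd (fst w) - ?Y (pr w))"
  define Ws where "Ws = pr -` (Vx \<times> V)"
  have prc: "continuous_on A pr" for A unfolding pr_def by (intro continuous_intros)
  have Ws: "open Ws" unfolding Ws_def by (rule open_vimage[OF opV prc])
  have prC: "Ck_open j pr A" if "open A" for j A
    unfolding pr_def by (intro Ck_open_Pair Ck_open_fst Ck_open_snd Ck_open_id that)
  have \<sigma>C: "Ck_open (Suc k) \<sigma> Ws"
    unfolding \<sigma>_def
    by (intro Ck_open_diff Ck_open_fst Ck_open_snd Ck_open_id Ws Ck_open_compose[OF Ws prC[OF Ws] YC])
      (simp add: Ws_def)
  have \<sigma>_iff: "\<sigma> w = 0 \<longleftrightarrow> snd (fst w) = Y (fst (fst w)) (fst (snd w))" for w by (simp add: \<sigma>_def pr_def)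
  have w0s: "?w0 \<in> Ws" "\<sigma> ?w0 = 0" using Vx(2) V(2) by (simp_all add: Ws_def pr_def \<sigma>_iff z0')
  have tr: "snd (f (x, Y x \<alpha>) \<alpha> 0) \<noteq> frechet_derivative ?Y (at (x, \<alpha>)) (fst (f (x, Y x \<alpha>) \<alpha> 0), 0)"
    if "x \<in> Vx" "\<alpha> \<in> V" "(x, Y x \<alpha>) \<in> \<Gamma> \<alpha>" for x \<alpha>
    by (rule section_transverse[OF nd refl V(1) that(1,2)]) (use that in \<open>simp add: cycle_manifold_def\<close>)
  have dpr: "(pr has_derivative pr) (at w)" for w
    unfolding pr_def by (intro has_derivative_Pair has_derivative_fst has_derivative_snd has_derivative_ident)
  have "(\<sigma> has_derivative (\<lambda>v. snd (fst v) - frechet_derivative ?Y (at (x\<^sub>0, \<alpha>\<^sub>0)) (pr v))) (at ?w0)"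
    unfolding \<sigma>_def
  proof (intro has_derivative_diff has_derivative_snd has_derivative_fst has_derivative_ident has_derivative_compose[OF dpr])
    show "(?Y has_derivative frechet_derivative ?Y (at (x\<^sub>0, \<alpha>\<^sub>0))) (at (pr ?w0))"
      using Ck_open_has_derivative[OF YC, of "(x\<^sub>0, \<alpha>\<^sub>0)"] Vx(2) V(2) by (simp add: pr_def z0')
  qed
  from frechet_derivative_eq[OF this]
  have tr0: "frechet_derivative \<sigma> (at ?w0) (f z\<^sub>0 \<alpha>\<^sub>0 0, 0, 0) \<noteq> 0"
    using tr[of x\<^sub>0 \<alpha>\<^sub>0] Vx(2) V(2) z0 by (simp add: pr_def z0' \<Gamma>0)

  \<comment> \<open>Returns near the cycle, and the family of closed orbits\<close>
  obtain B \<Phi> \<tau> \<delta> I \<zeta> where R: "return_structure F W k \<sigma> Ws T\<^sub>0 ?w0 B \<Phi> \<tau> \<delta>"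
    and I: "open I" "\<alpha>\<^sub>0 \<in> I" and \<zeta>: "Ck_open (Suc k) \<zeta> I" "\<zeta> \<alpha>\<^sub>0 = z\<^sub>0"
    and fam: "\<forall>\<alpha>\<in>I. (\<zeta> \<alpha>, \<alpha>, 0) \<in> B \<and> \<sigma> (\<zeta> \<alpha>, \<alpha>, 0) = 0 \<and> \<Phi> (\<tau> (\<zeta> \<alpha>, \<alpha>, 0)) (\<zeta> \<alpha>, \<alpha>, 0) = (\<zeta> \<alpha>, \<alpha>, 0)"
    and uniq: "\<forall>z \<alpha>. (z, \<alpha>, 0) \<in> B \<and> \<sigma> (z, \<alpha>, 0) = 0 \<and> \<Phi> (\<tau> (z, \<alpha>, 0)) (z, \<alpha>, 0) = (z, \<alpha>, 0) \<longrightarrow> \<alpha> \<in> I \<and> z = \<zeta> \<alpha>"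
    by (rule cycle_family[OF hyp z0 Ws \<sigma>C w0s tr0])
  note D = return_structureD[OF R]
  obtain \<rho> where \<rho>: "0 < \<rho>" "ball \<alpha>\<^sub>0 \<rho> \<subseteq> V" "ball \<alpha>\<^sub>0 \<rho> \<subseteq> I"
    "\<forall>\<alpha>\<in>ball \<alpha>\<^sub>0 \<rho>. T \<alpha> \<in> {T\<^sub>0 - \<delta><..<T\<^sub>0 + \<delta>} \<and> \<zeta> \<alpha> \<in> \<Gamma> \<alpha>"
    by (rule family_is_continuation[OF R T0 I uniq w0s(2) z0 cont])
  have \<tau>I: "\<tau> w \<in> {- 1<..<T\<^sub>0 + 1}" if "w \<in> B" for w using D(13)[OF that] D(14)[OF that] D(5) by simp

  \<comment> \<open>The return map in section coordinates\<close>
  define \<iota> where "\<iota> = (\<lambda>q :: ('a \<times> real) \<times> real. ((fst (fst q), ?Y (fst q)), snd (fst q), snd q))"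
  have \<iota>\<sigma>: "\<sigma> (\<iota> q) = 0" for q by (simp add: \<sigma>_iff \<iota>_def case_prod_unfold)
  let ?E = "(Vx \<times> V) \<times> (UNIV :: real set)"
  have opE: "open ?E" using opV by (simp add: open_Times)
  have \<iota>CE: "Ck_open (Suc k) \<iota> ?E"
    unfolding \<iota>_def
    by (intro Ck_open_Pair Ck_open_fst Ck_open_snd Ck_open_id opE
        Ck_open_compose[OF opE Ck_open_fst[OF opE Ck_open_id[OF opE]] YC]) auto
  define Q where "Q = {q \<in> ?E. \<iota> q \<in> B}"
  have Q: "open Q"
    using continuous_open_preimage[OF Ck_open_continuous[OF \<iota>CE] opE D(1)] by (simp add: Q_def vimage_def Int_def)
  have \<iota>C: "Ck_open (Suc k) \<iota> Q" by (rule Ck_open_subset[OF \<iota>CE]) (auto simp: Q_def)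
  have \<iota>B: "\<iota> q \<in> B" if "q \<in> Q" for q using that by (simp add: Q_def)
  have \<tau>C: "Ck_open (Suc k) (\<lambda>q. \<tau> (\<iota> q)) Q" by (rule Ck_open_compose[OF Q \<iota>C D(11) \<iota>B])
  \<comment> \<open>The map still takes values in the extended state space, so that conservation of
    \<epsilon> and, for \<epsilon> = 0, of \<alpha> can be read off before projecting with
    \<open>pr\<close>.\<close>
  define Rm where "Rm = (\<lambda>q. (\<lambda>(t, w). \<Phi> t w) (\<tau> (\<iota> q), \<iota> q))"
  have RmC: "Ck_open (Suc k) Rm Q"
    unfolding Rm_def
    by (rule Ck_open_compose[OF Q Ck_open_Pair[OF Q \<tau>C \<iota>C] D(9)]) (use \<tau>I \<iota>B in blast)
  have \<iota>0: "\<iota> ((x\<^sub>0, \<alpha>\<^sub>0), 0) = ?w0" by (simp add: \<iota>_def z0')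
  have Q0: "((x\<^sub>0, \<alpha>\<^sub>0), 0) \<in> Q" using Vx(2) V(2) D(2) by (simp add: Q_def \<iota>0)
  have Rm_eps: "snd (snd (Rm q)) = snd q" if q: "q \<in> Q" "snd q \<in> {0..<\<epsilon>\<^sub>1}" for q
    unfolding Rm_def prod.case
  proof (rule drop_full(1)[OF D(7)[OF \<iota>B[OF q(1)]] D(8)[OF \<iota>B[OF q(1)]] _ _ q(2)])
    show "0 \<in> {- 1..T\<^sub>0 + 1}" using T0 by simp
    show "snd (snd (\<Phi> 0 (\<iota> q))) = snd q" using D(6)[OF \<iota>B[OF q(1)]] by (simp add: \<iota>_def)
    show "\<tau> (\<iota> q) \<in> {- 1..T\<^sub>0 + 1}" using \<tau>I[OF \<iota>B[OF q(1)]] by simp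
  qed
  have Rm_frozen: "snd (Rm (Z, 0)) = (snd Z, 0)" if q: "(Z, 0) \<in> Q" for Z
  proof -
    have "\<iota> (Z, 0) = ((fst Z, ?Y Z), snd Z, 0)" by (simp add: \<iota>_def)
    with \<iota>B[OF q] have w: "((fst Z, ?Y Z), snd Z, 0) \<in> B" by simp
    show ?thesis
      unfolding Rm_def prod.case \<open>\<iota> (Z, 0) = _\<close>
      by (rule return_of_frozen_point(1)[OF R w T0]) (use \<tau>I[OF w] in auto)
  qed
  have Rm_section: "snd (fst (Rm q)) = Y (fst (fst (Rm q))) (fst (snd (Rm q)))" if q: "q \<in> Q" for q
    using D(16)[OF \<iota>B[OF q] D(13)[OF \<iota>B[OF q]]] by (simp add: \<sigma>_iff Rm_def)
  have Rm_Ws: "pr (Rm q) \<in> Vx \<times> V" if q: "q \<in> Q" for q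
    using D(15)[OF \<iota>B[OF q] D(13)[OF \<iota>B[OF q]]] by (simp add: Ws_def Rm_def)
  have Rm0: "Rm ((x\<^sub>0, \<alpha>\<^sub>0), 0) = ?w0"
    using conjunct2[OF conjunct2[OF bspec[OF fam I(2)]]] by (simp only: Rm_def \<iota>0 \<zeta>(2) prod.case)

  \<comment> \<open>The smaller section and the domain of the map\<close>
  obtain Wx r1 e1 where Wx: "open Wx" "x\<^sub>0 \<in> Wx" "0 < r1" "0 < e1" "(Wx \<times> ball \<alpha>\<^sub>0 r1) \<times> {- e1<..<e1} \<subseteq> Q"
    by (rule open_box[OF Q Q0])
  define Wa where "Wa = ball \<alpha>\<^sub>0 (min r1 \<rho>)"
  have Wa: "open Wa" "\<alpha>\<^sub>0 \<in> Wa" "Wa \<subseteq> V" "Wa \<subseteq> ball \<alpha>\<^sub>0 \<rho>" "Wa \<subseteq> ball \<alpha>\<^sub>0 r1" "is_interval Wa"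
    using Wx(3) \<rho>(1,2) by (auto simp: Wa_def is_interval_convex_1)
  have WQ: "(Wx \<times> Wa) \<times> {- e1<..<e1} \<subseteq> Q" using Wx(5) Wa(5) by blast
  have WxVx: "Wx \<subseteq> Vx"
  proof
    fix x assume "x \<in> Wx"
    then have "((x, \<alpha>\<^sub>0), 0) \<in> Q" using WQ Wa(2) Wx(4) by auto
    then show "x \<in> Vx" by (simp add: Q_def)
  qed
  \<comment> \<open>Starting points whose return lies over the smaller section; openness leaves room
    for \<epsilon> of both signs.\<close>
  define Q2 where "Q2 = {q \<in> (Wx \<times> Wa) \<times> {- e1<..<e1}. pr (Rm q) \<in> Wx \<times> Wa}"
  have opW: "open ((Wx \<times> Wa) \<times> {- e1<..<e1})" by (intro open_Times Wx(1) Wa(1) open_greaterThanLessThan)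
  have "continuous_on ((Wx \<times> Wa) \<times> {- e1<..<e1}) (\<lambda>q. pr (Rm q))"
    by (rule continuous_on_compose2[OF prc[of UNIV] continuous_on_subset[OF Ck_open_continuous[OF RmC] WQ]]) simp
  from continuous_open_preimage[OF this opW open_Times[OF Wx(1) Wa(1)]]
  have Q2: "open Q2" by (simp add: Q2_def vimage_def Int_def)
  have Q20: "((x\<^sub>0, \<alpha>\<^sub>0), 0) \<in> Q2" using Wx(2,4) Wa(2) by (simp add: Q2_def Rm0 pr_def z0')
  obtain Ux r2 e2 where Ux: "open Ux" "x\<^sub>0 \<in> Ux" "0 < r2" "0 < e2" "(Ux \<times> ball \<alpha>\<^sub>0 r2) \<times> {- e2<..<e2} \<subseteq> Q2"
    by (rule open_box[OF Q2 Q20])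
  define \<xi> where "\<xi> = (\<lambda>\<alpha>. fst (\<zeta> \<alpha>))"
  have \<xi>C: "Ck_open (Suc k) \<xi> I" unfolding \<xi>_def by (rule Ck_open_fst[OF I(1) \<zeta>(1)])
  \<comment> \<open>Keeps \<xi> inside \<open>Ux\<close>, so that the critical manifold is a graph
    over the whole interval \<open>Ua\<close> and therefore connected.\<close>
  define J where "J = {\<alpha> \<in> I. \<xi> \<alpha> \<in> Ux}"
  have J: "open J"
    using continuous_open_preimage[OF Ck_open_continuous[OF \<xi>C] I(1) Ux(1)] by (simp add: J_def vimage_def Int_def)
  have "\<alpha>\<^sub>0 \<in> J" using I(2) Ux(2) by (simp add: J_def \<xi>_def \<zeta>(2) x\<^sub>0_def[symmetric])
  then obtain r3 where r3: "0 < r3" "ball \<alpha>\<^sub>0 r3 \<subseteq> J" by (rule openE[OF J])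
  define Ua where "Ua = ball \<alpha>\<^sub>0 (min r2 r3)"
  have Ua: "open Ua" "\<alpha>\<^sub>0 \<in> Ua" "Ua \<subseteq> ball \<alpha>\<^sub>0 r2" "Ua \<subseteq> J" "connected Ua"
    using Ux(3) r3 by (auto simp: Ua_def)
  define U where "U = Ux \<times> Ua"
  define \<epsilon>\<^sub>0 where "\<epsilon>\<^sub>0 = min e2 \<epsilon>\<^sub>1"
  have \<epsilon>0: "0 < \<epsilon>\<^sub>0" "\<epsilon>\<^sub>0 \<le> \<epsilon>\<^sub>1" "\<epsilon>\<^sub>0 \<le> e2" using Ux(4) eps by (auto simp: \<epsilon>\<^sub>0_def)
  have U: "open U" "(x\<^sub>0, \<alpha>\<^sub>0) \<in> U" using Ux(1,2) Ua(1,2) by (simp_all add: U_def open_Times)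
  let ?D = "U \<times> {- \<epsilon>\<^sub>0<..<\<epsilon>\<^sub>0}"
  have opD: "open ?D" using U(1) by (simp add: open_Times)
  have DQ2: "?D \<subseteq> Q2" using Ux(5) Ua(3) \<epsilon>0(3) by (auto simp: U_def)
  have DW: "?D \<subseteq> (Wx \<times> Wa) \<times> {- e1<..<e1}" using DQ2 by (auto simp: Q2_def)
  have DQ: "?D \<subseteq> Q" using DW WQ by blast
  have inD: "(Z, \<epsilon>) \<in> ?D" if "Z \<in> U" "\<epsilon> \<in> {0..<\<epsilon>\<^sub>0}" for Z \<epsilon> using that by auto
  have inD0: "(Z, 0) \<in> ?D" if "Z \<in> U" for Z using that \<epsilon>0(1) by simp
  have UW: "Z \<in> Wx \<times> Wa" if "Z \<in> U" for Z
    using subsetD[OF DW inD0[OF that]] unfolding mem_Times_iff by simp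
  have UWa: "fst Z \<in> Wx" "snd Z \<in> Wa" "snd Z \<in> V" if "Z \<in> U" for Z
    using UW[OF that] Wa(3) unfolding mem_Times_iff by blast+

  \<comment> \<open>The critical manifold as fixed point set and as graph\<close>
  define \<tau>' where "\<tau>' = (\<lambda>Z \<epsilon>. \<tau> (\<iota> (Z, \<epsilon>)))"
  define P where "P = (\<lambda>Z \<epsilon>. pr (Rm (Z, \<epsilon>)))"
  define S where "S = {Z\<in>U. section_point Y Z \<in> cross_section Y Wx Wa \<inter> cycle_manifold V \<Gamma>}"
  have S_iff: "Z \<in> S \<longleftrightarrow> Z \<in> U \<and> (fst Z, ?Y Z) \<in> \<Gamma> (snd Z)" for Z
  proof -
    have "section_point Y Z \<in> cross_section Y Wx Wa" if "Z \<in> U"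
      unfolding cross_section_def by (rule imageI[OF UW[OF that]])
    moreover have "section_point Y Z \<in> cycle_manifold V \<Gamma> \<longleftrightarrow> (fst Z, ?Y Z) \<in> \<Gamma> (snd Z)" if "Z \<in> U"
      using UWa(3)[OF that] by (simp add: section_point_def cycle_manifold_def case_prod_unfold)
    ultimately show ?thesis unfolding S_def by blast
  qed
  have U\<alpha>: "snd Z \<in> V" "snd Z \<in> I" "T (snd Z) \<in> {T\<^sub>0 - \<delta><..<T\<^sub>0 + \<delta>}" "\<zeta> (snd Z) \<in> \<Gamma> (snd Z)" if "Z \<in> U" for Z
  proof -
    have "snd Z \<in> ball \<alpha>\<^sub>0 \<rho>" using Wa(4) UWa(2)[OF that] by blast
    then show "snd Z \<in> V" "snd Z \<in> I" "T (snd Z) \<in> {T\<^sub>0 - \<delta><..<T\<^sub>0 + \<delta>}" "\<zeta> (snd Z) \<in> \<Gamma> (snd Z)"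
      using \<rho>(2,3,4) by auto
  qed
  have \<iota>Z: "\<iota> (Z, 0) = ((fst Z, ?Y Z), snd Z, 0)" for Z by (simp add: \<iota>_def)
  have wB: "((fst Z, ?Y Z), snd Z, 0) \<in> B" "\<sigma> ((fst Z, ?Y Z), snd Z, 0) = 0" if "Z \<in> U" for Z
  proof -
    have "(Z, 0) \<in> Q" using inD0[OF that] DQ by blast
    from \<iota>B[OF this] show "((fst Z, ?Y Z), snd Z, 0) \<in> B" by (simp add: \<iota>Z)
    show "\<sigma> ((fst Z, ?Y Z), snd Z, 0) = 0" using \<iota>\<sigma>[of "(Z, 0)"] by (simp add: \<iota>Z)
  qed
  have cyc: "\<tau>' Z 0 = T (snd Z)" "Rm (Z, 0) = ((fst Z, ?Y Z), snd Z, 0)" if Z: "Z \<in> S" for Z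
  proof -
    have ZU: "Z \<in> U" and Z\<Gamma>: "(fst Z, ?Y Z) \<in> \<Gamma> (snd Z)" using Z S_iff by auto
    obtain M where M: "\<tau> ((fst Z, ?Y Z), snd Z, 0) = T (snd Z)" "\<Phi> (T (snd Z)) ((fst Z, ?Y Z), snd Z, 0) = ((fst Z, ?Y Z), snd Z, 0)"
      "linear M" "M (f (fst Z, ?Y Z) (snd Z) 0) = f (fst Z, ?Y Z) (snd Z) 0" "hyperbolic_apart_from_ones 1 M"
      "\<forall>v. frechet_derivative (\<Phi> (T (snd Z))) (at ((fst Z, ?Y Z), snd Z, 0)) (v, 0, 0) = (M v, 0, 0)"
      by (rule cycle_point_is_fixed[OF R T0 hypV[OF U\<alpha>(1)[OF ZU]] U\<alpha>(3)[OF ZU] Z\<Gamma> wB[OF ZU]])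
    show "\<tau>' Z 0 = T (snd Z)" "Rm (Z, 0) = ((fst Z, ?Y Z), snd Z, 0)"
      using M(1,2) by (simp_all only: \<tau>'_def Rm_def \<iota>Z prod.case)
  qed
  have P_snd: "snd (P Z 0) = snd Z" if "Z \<in> U" for Z
    using Rm_frozen[OF subsetD[OF DQ inD0[OF that]]] by (simp add: P_def pr_def)
  have fixed: "fst Z = \<xi> (snd Z)" if Z: "Z \<in> U" and fx: "fst (P Z 0) = fst Z" for Z
  proof -
    have q: "(Z, 0) \<in> Q" using inD0[OF Z] DQ by blast
    have 1: "fst (fst (Rm (Z, 0))) = fst Z" using fx by (simp add: P_def pr_def)
    have 2: "snd (Rm (Z, 0)) = (snd Z, 0)" by (rule Rm_frozen[OF q])
    have 3: "snd (fst (Rm (Z, 0))) = ?Y Z" using Rm_section[OF q] 1 2 by (simp add: case_prod_unfold)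
    have "Rm (Z, 0) = ((fst Z, ?Y Z), snd Z, 0)" using 1 2 3 by (simp add: prod_eq_iff)
    then have "\<Phi> (\<tau> ((fst Z, ?Y Z), snd Z, 0)) ((fst Z, ?Y Z), snd Z, 0) = ((fst Z, ?Y Z), snd Z, 0)"
      unfolding Rm_def \<iota>Z prod.case .
    then have "(fst Z, ?Y Z) = \<zeta> (snd Z)" using uniq wB[OF Z] by blast
    from arg_cong[where f = fst, OF this] show ?thesis by (simp add: \<xi>_def)
  qed
  \<comment> \<open>This is where the given continuation enters: its cycles pass through the points
    of the constructed family.\<close>
  have on_family: "Z \<in> S" if Z: "Z \<in> U" and eq: "fst Z = \<xi> (snd Z)" for Z
  proof -
    have "\<sigma> (\<zeta> (snd Z), snd Z, 0) = 0" using fam U\<alpha>(2)[OF Z] by blast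
    then have "snd (\<zeta> (snd Z)) = ?Y Z" using eq by (simp add: \<sigma>_iff \<xi>_def case_prod_unfold)
    then have "\<zeta> (snd Z) = (fst Z, ?Y Z)" using eq by (simp add: \<xi>_def prod_eq_iff)
    then show ?thesis using U\<alpha>(4)[OF Z] Z by (simp add: S_iff)
  qed
  have S_fixed: "Z \<in> S \<longleftrightarrow> Z \<in> U \<and> fst (P Z 0) = fst Z" for Z
  proof
    assume Z: "Z \<in> S"
    then show "Z \<in> U \<and> fst (P Z 0) = fst Z" using cyc(2)[OF Z] S_iff[of Z] by (simp add: P_def pr_def)
  next
    assume "Z \<in> U \<and> fst (P Z 0) = fst Z"
    then show "Z \<in> S" using fixed on_family by blast
  qed
  have S_graph: "S = (\<lambda>\<alpha>. (\<xi> \<alpha>, \<alpha>)) ` Ua"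
  proof (intro equalityI subsetI)
    fix Z assume "Z \<in> S"
    then have Z: "Z \<in> U" "fst Z = \<xi> (snd Z)" using S_fixed fixed by blast+
    then show "Z \<in> (\<lambda>\<alpha>. (\<xi> \<alpha>, \<alpha>)) ` Ua"
      by (intro image_eqI[of _ _ "snd Z"]) (auto simp: prod_eq_iff U_def)
  next
    fix Z assume "Z \<in> (\<lambda>\<alpha>. (\<xi> \<alpha>, \<alpha>)) ` Ua"
    then obtain \<alpha> where \<alpha>: "\<alpha> \<in> Ua" "Z = (\<xi> \<alpha>, \<alpha>)" by blast
    have "\<xi> \<alpha> \<in> Ux" using \<alpha>(1) Ua(4) by (auto simp: J_def)
    then show "Z \<in> S" using \<alpha> on_family[of Z] by (simp add: U_def)
  qed
  have PC: "Ck_open (Suc k) (\<lambda>q. pr (Rm q)) ?D"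
    by (rule Ck_open_compose[OF opD Ck_open_subset[OF RmC DQ] prC[OF open_UNIV]]) simp

  \<comment> \<open>The fast-slow form and its assumptions\<close>
  obtain G where G: "Ck_open k (\<lambda>(Z, \<epsilon>). G Z \<epsilon>) ?D"
    "\<forall>Z\<in>U. \<forall>\<epsilon>\<in>{- \<epsilon>\<^sub>0<..<\<epsilon>\<^sub>0}. pr (Rm (Z, \<epsilon>)) = pr (Rm (Z, 0)) + \<epsilon> *\<^sub>R G Z \<epsilon>"
    by (rule Ck_open_difference_quotient[OF U(1) PC \<epsilon>0(1)])
  define N where "N = (\<lambda>Z :: 'a \<times> real. Blinfun (\<lambda>v :: 'a. (v, 0 :: real)))"
  have N: "blinfun_apply (N Z) v = (v, 0)" for Z v
    unfolding N_def
    by (subst bounded_linear_Blinfun_apply) (auto intro!: bounded_linear_Pair bounded_linear_ident bounded_linear_zero)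
  define h where "h = (\<lambda>Z. fst (P Z 0) - fst Z)"
  have emb0: "Ck_open (Suc k) (\<lambda>Z :: 'a \<times> real. (Z, 0 :: real)) U"
    by (intro Ck_open_Pair Ck_open_id Ck_open_const U(1))
  have P0C: "Ck_open (Suc k) (\<lambda>Z. P Z 0) U"
    unfolding P_def by (rule Ck_open_compose[OF U(1) emb0 PC]) (rule inD0)
  have hC: "Ck_open (Suc k) h U"
    unfolding h_def by (intro Ck_open_diff Ck_open_fst Ck_open_id U(1) P0C)
  have Ck_onI: "Ck_on j H (U \<times> {0..<\<epsilon>\<^sub>0})" if "Ck_open j H ?D" for j and H :: "('a \<times> real) \<times> real \<Rightarrow> 'a \<times> real"
    unfolding Ck_on_def by (intro exI[of _ ?D] exI[of _ H] conjI opD that) auto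
  have fs: "fast_slow_map (Suc k) U \<epsilon>\<^sub>0 P N h G"
    unfolding fast_slow_map_def
  proof (intro conjI ballI U(1) \<epsilon>0(1))
    show "Ck_on (Suc k) (\<lambda>(Z, \<epsilon>). P Z \<epsilon>) (U \<times> {0..<\<epsilon>\<^sub>0})"
      using Ck_onI[OF PC] by (simp only: P_def case_prod_unfold prod.collapse)
    show "Ck_on (Suc k) N U" unfolding Ck_on_open_iff[OF U(1)] N_def by (rule Ck_open_const[OF U(1)])
    show "Ck_on (Suc k) h U" unfolding Ck_on_open_iff[OF U(1)] by (rule hC)
    show "Ck_on (Suc k - 1) (\<lambda>(Z, \<epsilon>). G Z \<epsilon>) (U \<times> {0..<\<epsilon>\<^sub>0})" using Ck_onI[OF G(1)] by simp
    show "P Z \<epsilon> = Z + blinfun_apply (N Z) (h Z) + \<epsilon> *\<^sub>R G Z \<epsilon>" if Z: "Z \<in> U" and \<epsilon>: "\<epsilon> \<in> {0..<\<epsilon>\<^sub>0}" for Z \<epsilon>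
    proof -
      have "\<epsilon> \<in> {- \<epsilon>\<^sub>0<..<\<epsilon>\<^sub>0}" using \<epsilon> by auto
      then have "P Z \<epsilon> = P Z 0 + \<epsilon> *\<^sub>R G Z \<epsilon>"
        unfolding P_def by (rule G(2)[rule_format, OF Z])
      moreover have "Z + blinfun_apply (N Z) (h Z) = P Z 0"
        using P_snd[OF Z] by (simp add: N h_def prod_eq_iff)
      ultimately show ?thesis by simp
    qed
  qed
  have a1: "fast_slow_assumption1 (Suc k) 1 U N h S"
    unfolding fast_slow_assumption1_def
  proof (intro conjI)
    show "S \<subseteq> {Z \<in> U. blinfun_apply (N Z) (h Z) = 0}" by (rule subsetI) (simp add: S_fixed N h_def zero_prod_def)
    have \<xi>U: "Ck_open (Suc k) \<xi> Ua" by (rule Ck_open_subset[OF \<xi>C]) (use Ua(4) in \<open>auto simp: J_def\<close>)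
    show "connected S"
      unfolding S_graph
      by (intro connected_continuous_image continuous_on_Pair continuous_on_id Ck_open_continuous[OF \<xi>U] Ua(5))
    show "S \<noteq> {}" unfolding S_graph using Ua(2) by blast
    show "embedded_submanifold (Suc k) 1 S" by (rule embedded_graph[OF Ua(1) \<xi>U S_graph])
  qed auto
  have a2: "fast_slow_assumption2 U N h S"
    unfolding fast_slow_assumption2_def
  proof (intro conjI ballI allI impI)
    show "inj (blinfun_apply (N Z))" for Z by (rule injI) (simp add: N)
    show S0: "S = {Z \<in> U. h Z = 0}" unfolding set_eq_iff by (simp add: S_fixed h_def)
    fix Z assume "Z \<in> U - S \<and> blinfun_apply (N Z) (h Z) = 0"
    \<comment> \<open>\<open>N\<close> is injective at every point, so there is no zero of the
      product outside \<open>S\<close>.\<close>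
    then show "Z isolated_in {Z \<in> U. blinfun_apply (N Z) (h Z) = 0}" unfolding S0 by (auto simp: N zero_prod_def)
  qed

  \<comment> \<open>Normal hyperbolicity\<close>
  have nh: "normally_hyperbolic 1 N h S"
    unfolding normally_hyperbolic_def
  proof
    fix Z assume Z: "Z \<in> S"
    obtain x \<alpha> where xa: "Z = (x, \<alpha>)" by (cases Z)
    have ZU: "Z \<in> U" and Z\<Gamma>: "(x, Y x \<alpha>) \<in> \<Gamma> \<alpha>" using Z by (simp_all add: S_iff xa)
    have x\<alpha>: "x \<in> Vx" "\<alpha> \<in> V" using UWa[OF ZU] subsetD[OF WxVx] by (simp_all add: xa)
    let ?z = "(x, Y x \<alpha>)" and ?t = "T \<alpha>"
    let ?w = "(?z, \<alpha>, 0 :: real)"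
    have wB': "?w \<in> B" "\<sigma> ?w = 0" using wB[OF ZU] by (simp_all add: xa)
    have T\<alpha>: "?t \<in> {T\<^sub>0 - \<delta><..<T\<^sub>0 + \<delta>}" using U\<alpha>(3)[OF ZU] by (simp add: xa)
    obtain M where M: "\<tau> ?w = ?t" "\<Phi> ?t ?w = ?w" "linear M" "M (f ?z \<alpha> 0) = f ?z \<alpha> 0" "hyperbolic_apart_from_ones 1 M"
      "\<forall>v. frechet_derivative (\<Phi> ?t) (at ?w) (v, 0, 0) = (M v, 0, 0)"
      by (rule cycle_point_is_fixed[OF R T0 hypV[OF x\<alpha>(2)] T\<alpha> Z\<Gamma> wB'])
    have q: "(Z, 0) \<in> Q" using inD0[OF ZU] DQ by blast
    define y where "y = (\<lambda>v. frechet_derivative ?Y (at Z) (v, 0))"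
    have dY: "(?Y has_derivative frechet_derivative ?Y (at Z)) (at Z)"
      by (rule Ck_open_has_derivative[OF YC]) (use x\<alpha> xa in auto)
    have embl: "linear (\<lambda>v :: 'a. (v, 0 :: real))" by (rule linearI) auto
    have y: "linear y"
      using linear_compose[OF embl has_derivative_linear[OF dY]] by (simp add: y_def o_def)
    \<comment> \<open>The derivative of the embedding of the section at \<epsilon> = 0.\<close>
    define \<iota>' where "\<iota>' = (\<lambda>d :: 'a \<times> real. ((fst d, frechet_derivative ?Y (at Z) d), snd d, 0 :: real))"
    have d\<iota>: "((\<lambda>Z. \<iota> (Z, 0)) has_derivative \<iota>') (at Z)"
      unfolding \<iota>_def \<iota>'_def fst_conv snd_conv
      by (intro has_derivative_Pair has_derivative_fst has_derivative_snd has_derivative_ident has_derivative_const dY)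
    have \<iota>w: "\<iota> (Z, 0) = ?w" by (simp add: \<iota>_def xa)
    define t' where "t' = (\<lambda>d. frechet_derivative \<tau> (at ?w) (\<iota>' d))"
    have d\<tau>: "((\<lambda>Z. \<tau> (\<iota> (Z, 0))) has_derivative t') (at Z)"
      unfolding t'_def by (rule has_derivative_compose[OF d\<iota>]) (unfold \<iota>w, rule Ck_open_has_derivative[OF D(11) wB'(1)])
    \<comment> \<open>Chain rule for the flow at the return time: the variation of the return time
      moves the image along the field, the variation of the starting point is carried by the
      linearised flow.\<close>
    define R' where "R' = (\<lambda>d. t' d *\<^sub>R F ?w + frechet_derivative (\<Phi> ?t) (at ?w) (\<iota>' d))"
    have tI: "?t \<in> {- 1<..<T\<^sub>0 + 1}" using \<tau>I[OF wB'(1)] by (simp add: M(1))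
    have dR: "((\<lambda>Z. Rm (Z, 0)) has_derivative R') (at Z)"
    proof -
      have "((\<lambda>Z. (\<lambda>(t, w). \<Phi> t w) (\<tau> (\<iota> (Z, 0)), \<iota> (Z, 0))) has_derivative
          (\<lambda>d. (\<lambda>(h, v). h *\<^sub>R F (\<Phi> ?t ?w) + frechet_derivative (\<Phi> ?t) (at ?w) v) (t' d, \<iota>' d))) (at Z)"
        by (rule has_derivative_compose[OF has_derivative_Pair[OF d\<tau> d\<iota>]])
          (unfold \<iota>w M(1), rule return_structure_flow_derivative(2)[OF R wB'(1) tI])
      then show ?thesis by (simp add: Rm_def R'_def M(2))
    qed
    have R'v: "R' (v, 0) = (t' (v, 0) *\<^sub>R f ?z \<alpha> 0 + M (v, y v), 0, 0)" for v
      using M(6) by (simp add: R'_def F_eq0 \<iota>'_def y_def)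
    define a where "a = (\<lambda>d. fst (fst (R' d)))"
    have lR: "linear R'" by (rule has_derivative_linear[OF dR])
    have la: "linear a"
      using linear_compose[OF linear_compose[OF lR linear_fst] linear_fst] by (simp add: a_def o_def)
    define A where "A = (\<lambda>v. a (v, 0))"
    have A: "linear A" using linear_compose[OF embl la] by (simp add: A_def o_def)
    have R1: "Rm (Z, 0) = ?w" using cyc(2)[OF Z] by (simp add: xa)
    have dpR: "((\<lambda>Z. pr (Rm (Z, 0))) has_derivative (\<lambda>d. pr (R' d))) (at Z)"
      by (rule has_derivative_compose[OF dR dpr])
    have prw: "pr (Rm (Z, 0)) = Z" unfolding R1 by (simp add: pr_def xa)
    \<comment> \<open>Images lie on the section. Differentiating this relation in two ways shows
      that \<open>R'\<close> maps into its tangent space, which gives the missing component in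
      \<open>sec\<close>.\<close>
    have "((\<lambda>Z. ?Y (pr (Rm (Z, 0)))) has_derivative (\<lambda>d. frechet_derivative ?Y (at Z) (pr (R' d)))) (at Z)"
      by (rule has_derivative_compose[OF dpR]) (unfold prw, rule dY)
    moreover have "((\<lambda>Z. snd (fst (Rm (Z, 0)))) has_derivative (\<lambda>d. snd (fst (R' d)))) (at Z)"
      by (intro has_derivative_snd has_derivative_fst dR)
    then have "((\<lambda>Z. ?Y (pr (Rm (Z, 0)))) has_derivative (\<lambda>d. snd (fst (R' d)))) (at Z)"
    proof (rule has_derivative_transform_within_open[OF _ U(1) ZU])
      fix Z' assume "Z' \<in> U"
      then have "(Z', 0) \<in> Q" using inD0 DQ by blast
      from Rm_section[OF this] show "snd (fst (Rm (Z', 0))) = ?Y (pr (Rm (Z', 0)))" by (simp add: pr_def)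
    qed
    ultimately have "(\<lambda>d. frechet_derivative ?Y (at Z) (pr (R' d))) = (\<lambda>d. snd (fst (R' d)))"
      by (rule has_derivative_unique)
    then have "snd (fst (R' d)) = frechet_derivative ?Y (at Z) (pr (R' d))" for d by (rule fun_cong[symmetric])
    from this[of "(v, 0)" for v] have sec: "snd (t' (v, 0) *\<^sub>R f ?z \<alpha> 0 + M (v, y v)) = y (A v)" for v
      by (simp add: R'v pr_def A_def a_def y_def)
    have fstA: "A v = fst (t' (v, 0) *\<^sub>R f ?z \<alpha> 0 + M (v, y v))" for v by (simp add: A_def a_def R'v)
    \<comment> \<open>The monodromy map sends tangent vectors of the section back to such vectors,
      up to a multiple of the flow direction.\<close>
    have Mv: "M (v, y v) = (A v, y (A v)) - t' (v, 0) *\<^sub>R f ?z \<alpha> 0" for v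
      using fstA[of v] sec[of v] by (simp add: prod_eq_iff)
    have ftr: "snd (f ?z \<alpha> 0) \<noteq> y (fst (f ?z \<alpha> 0))"
      using tr[OF x\<alpha> Z\<Gamma>] by (simp add: y_def xa)
    have hyp1: "hyperbolic_apart_from_ones 1 (\<lambda>(v, s). (A v + s *\<^sub>R a (0, 1), s))"
      by (rule block_hyperbolic[OF M(3,4,5) A y ftr Mv])
    have "(h has_derivative (\<lambda>d. a d - fst d)) (at Z)"
      unfolding h_def P_def pr_def fst_conv a_def
      by (intro has_derivative_diff has_derivative_fst dR has_derivative_ident)
    note dh = frechet_derivative_eq[OF this]
    have "(\<lambda>v. v + blinfun_apply (N Z) (frechet_derivative h (at Z) v)) = (\<lambda>(v, s). (A v + s *\<^sub>R a (0, 1), s))"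
    proof
      fix d :: "'a \<times> real"
      have "a d = a ((fst d, 0) + snd d *\<^sub>R (0, 1))" by simp
      also have "\<dots> = A (fst d) + snd d *\<^sub>R a (0, 1)"
        by (simp only: linear_add[OF la] linear_scale[OF la] A_def)
      finally show "d + blinfun_apply (N Z) (frechet_derivative h (at Z) d) = (\<lambda>(v, s). (A v + s *\<^sub>R a (0, 1), s)) d"
        by (simp add: dh N prod_eq_iff case_prod_unfold)
    qed
    then show "hyperbolic_apart_from_ones 1 (\<lambda>v. v + blinfun_apply (N Z) (frechet_derivative h (at Z) v))"
      using hyp1 by simp
  qed

  \<comment> \<open>The map as a first return\<close>
  have pm: "poincare_map f g Y Wx Wa U \<epsilon>\<^sub>0 \<tau>' P"
    unfolding poincare_map_def
  proof (intro conjI ballI subsetI UW)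
    fix Z \<epsilon> assume Z: "Z \<in> U" and \<epsilon>: "\<epsilon> \<in> {0..<\<epsilon>\<^sub>0}"
    let ?q = "(Z, \<epsilon>)"
    have qD: "?q \<in> ?D" by (rule inD[OF Z \<epsilon>])
    then have q: "?q \<in> Q" using DQ by blast
    note wB = \<iota>B[OF q]
    have \<epsilon>1: "\<epsilon> \<in> {0..<\<epsilon>\<^sub>1}" using \<epsilon> \<epsilon>0(2) by auto
    let ?\<phi> = "\<lambda>s. (fst (\<Phi> s (\<iota> ?q)), fst (snd (\<Phi> s (\<iota> ?q))))"
    have 0: "0 \<in> {- 1..T\<^sub>0 + 1}" "snd (snd (\<Phi> 0 (\<iota> ?q))) = \<epsilon>"
      using T0 D(6)[OF wB] by (simp_all add: \<iota>_def)
    note full = drop_full[OF D(7)[OF wB] D(8)[OF wB] 0 \<epsilon>1]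
    have sub: "{0..\<tau>' Z \<epsilon>} \<subseteq> {- 1..T\<^sub>0 + 1}" using \<tau>I[OF wB] by (auto simp: \<tau>'_def)
    have PW: "P Z \<epsilon> \<in> Wx \<times> Wa" using subsetD[OF DQ2 qD] by (simp add: Q2_def P_def)
    show "first_return (full_field f g \<epsilon>) (cross_section Y Wx Wa) (section_point Y Z) (\<tau>' Z \<epsilon>) (section_point Y (P Z \<epsilon>))"
      unfolding first_return_def
    proof (intro conjI exI[of _ ?\<phi>] allI impI)
      show "0 < \<tau>' Z \<epsilon>" using D(14)[OF wB] by (simp add: \<tau>'_def)
      show "section_point Y (P Z \<epsilon>) \<in> cross_section Y Wx Wa" using PW by (simp add: cross_section_def)
      show "solves_ode_on (full_field f g \<epsilon>) ?\<phi> {0..\<tau>' Z \<epsilon>}" by (rule solves_ode_subset[OF full(2) sub])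
      show "?\<phi> 0 = section_point Y Z" using D(6)[OF wB] by (simp add: \<iota>_def section_point_def case_prod_unfold)
      show "?\<phi> (\<tau>' Z \<epsilon>) = section_point Y (P Z \<epsilon>)"
        using Rm_section[OF q] by (simp add: P_def pr_def section_point_def Rm_def \<tau>'_def prod_eq_iff)
      fix s assume s: "0 < s \<and> s < \<tau>' Z \<epsilon>"
      show "?\<phi> s \<notin> cross_section Y Wx Wa"
      proof
        \<comment> \<open>An earlier meeting with the smaller section would be a zero of \<sigma> at
          a point of \<open>B\<close>, because \<epsilon> has not changed and all points over
          \<open>Wx\<close> and \<open>Wa\<close> are embedded into \<open>B\<close>.\<close>
        assume "?\<phi> s \<in> cross_section Y Wx Wa"
        then obtain Z' where Z': "Z' \<in> Wx \<times> Wa" "?\<phi> s = section_point Y Z'" by (auto simp: cross_section_def)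
        have "s \<in> {- 1..T\<^sub>0 + 1}" using sub s by auto
        then have "snd (snd (\<Phi> s (\<iota> ?q))) = \<epsilon>" by - (rule full(1))
        then have eq: "\<Phi> s (\<iota> ?q) = \<iota> (Z', \<epsilon>)"
          using Z'(2) by (simp add: \<iota>_def section_point_def prod_eq_iff case_prod_unfold)
        have "\<epsilon> \<in> {- e1<..<e1}" using subsetD[OF DW qD] by simp
        then have "(Z', \<epsilon>) \<in> Q" using Z'(1) WQ by blast
        from \<iota>B[OF this] have "\<Phi> s (\<iota> ?q) \<in> B" by (simp only: eq)
        then have "\<sigma> (\<Phi> s (\<iota> ?q)) \<noteq> 0"
          using D(17)[OF wB \<iota>\<sigma>] s by (simp add: \<tau>'_def)
        then show False by (simp add: eq \<iota>\<sigma>)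
      qed
    qed
  qed
  have \<tau>c: "continuous_on (U \<times> {0..<\<epsilon>\<^sub>0}) (\<lambda>(Z, \<epsilon>). \<tau>' Z \<epsilon>)"
  proof -
    have "continuous_on (U \<times> {0..<\<epsilon>\<^sub>0}) (\<lambda>q. \<tau> (\<iota> q))"
      by (rule continuous_on_subset[OF Ck_open_continuous[OF \<tau>C]]) (use inD DQ in blast)
    then show ?thesis by (simp add: \<tau>'_def case_prod_unfold)
  qed
  show ?thesis
    unfolding x\<^sub>0_def[symmetric]
    by (intro exI[of _ Wx] exI[of _ Wa] exI[of _ U] exI[of _ \<epsilon>\<^sub>0] exI[of _ \<tau>'] exI[of _ P] exI[of _ S] conjI
        exI[of _ N] exI[of _ h] exI[of _ G] ballI Wx(1,2) WxVx Wa(1,6,2,3) U \<epsilon>0(1,2) S_def pm \<tau>c cyc(1) fs a1 a2 nh)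
qed

theorem lemma5p17:
  fixes f :: "'a::euclidean_space \<times> real \<Rightarrow> real \<Rightarrow> real \<Rightarrow> 'a \<times> real"
    and g :: "'a \<times> real \<Rightarrow> real \<Rightarrow> real \<Rightarrow> real"
    and r :: nat and \<epsilon>\<^sub>1 \<alpha>\<^sub>0 T\<^sub>0 :: real and z\<^sub>0 :: "'a \<times> real" and \<Gamma>\<^sub>0 :: "('a \<times> real) set"
  assumes "1 \<le> r" and "0 < \<epsilon>\<^sub>1"
    and "Ck_on r (\<lambda>(z, \<alpha>, \<epsilon>). f z \<alpha> \<epsilon>) (UNIV \<times> UNIV \<times> {0..<\<epsilon>\<^sub>1})"
    and "Ck_on r (\<lambda>(z, \<alpha>, \<epsilon>). g z \<alpha> \<epsilon>) (UNIV \<times> UNIV \<times> {0..<\<epsilon>\<^sub>1})"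
    and "hyperbolic_limit_cycle (\<lambda>z. f z \<alpha>\<^sub>0 0) T\<^sub>0 \<Gamma>\<^sub>0" and "z\<^sub>0 \<in> \<Gamma>\<^sub>0"
  shows "(\<exists>V T \<Gamma>. limit_cycle_continuation f \<alpha>\<^sub>0 T\<^sub>0 \<Gamma>\<^sub>0 V T \<Gamma>) \<and>
    (\<forall>V T \<Gamma> Vx Y.
       limit_cycle_continuation f \<alpha>\<^sub>0 T\<^sub>0 \<Gamma>\<^sub>0 V T \<Gamma> \<and>
       nondegenerate_section r f (cycle_manifold V \<Gamma>) z\<^sub>0 \<alpha>\<^sub>0 Vx V Y \<longrightarrow>
       (\<exists>Wx W U \<epsilon>\<^sub>0 \<tau> P S.
          open Wx \<and> fst z\<^sub>0 \<in> Wx \<and> Wx \<subseteq> Vx \<and>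
          open W \<and> is_interval W \<and> \<alpha>\<^sub>0 \<in> W \<and> W \<subseteq> V \<and>
          open U \<and> (fst z\<^sub>0, \<alpha>\<^sub>0) \<in> U \<and> 0 < \<epsilon>\<^sub>0 \<and> \<epsilon>\<^sub>0 \<le> \<epsilon>\<^sub>1 \<and>
          S = {Z\<in>U. section_point Y Z \<in> cross_section Y Wx W \<inter> cycle_manifold V \<Gamma>} \<and>
          poincare_map f g Y Wx W U \<epsilon>\<^sub>0 \<tau> P \<and>
          continuous_on (U \<times> {0..<\<epsilon>\<^sub>0}) (\<lambda>(Z, \<epsilon>). \<tau> Z \<epsilon>) \<and>
          (\<forall>Z\<in>S. \<tau> Z 0 = T (snd Z)) \<and>
          (\<exists>(N :: 'a \<times> real \<Rightarrow> 'a \<Rightarrow>\<^sub>L ('a \<times> real)) h G.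
             fast_slow_map r U \<epsilon>\<^sub>0 P N h G \<and>
             fast_slow_assumption1 r 1 U N h S \<and>
             fast_slow_assumption2 U N h S \<and>
             normally_hyperbolic 1 N h S)))"
proof -
  obtain k where r: "r = Suc k" using assms(1) by (cases r) auto
  obtain W F where "extended_system f g k \<epsilon>\<^sub>1 W F"
    by (rule extended_system_exists[OF assms(2) assms(3,4)[unfolded r]])
  then interpret extended_system f g k \<epsilon>\<^sub>1 W F .
  show ?thesis
    unfolding r
  proof (intro conjI allI impI, goal_cases)
    case 1
    show ?case by (rule continuation_exists[OF assms(5)])
  next
    case (2 V T \<Gamma> Vx Y)
    show ?case by (rule poincare_map_fast_slow[OF assms(5,6) conjunct1[OF 2] conjunct2[OF 2]])
  qed
qed

end
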